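(* Let $1<q<p<+\infty$, $N\ge 1$, and let $\Omega\subset\mathbb{R}^N$ be a bounded domain which, if $N\ge 2$, is $C^{1,\kappa}$-regular for some $\kappa\in(0,1)$. Let $l\in\mathbb{N}$ and let $\alpha,\beta\in\mathbb{R}$ satisfy $\alpha>\lambda_l(p)$ and $\beta<\beta_*(\alpha)$. Then $E_{\alpha,\beta}$ has at least $l$ distinct pairs $\{u,-u\}$ of critical points in $\{u\in W_0^{1,p}:E_{\alpha,\beta}(u)>0\}$; that is, the problem $-\Delta_p u-\Delta_q u=\alpha|u|^{p-2}u+\beta|u|^{q-2}u$ in $\Omega$, $u=0$ on $\partial\Omega$, has at least $l$ distinct pairs of (nontrivial) weak solutions with positive energy.
   Context: $\|\cdot\|_r$ is the norm of $L^r(\Omega)$; $W_0^{1,r}=W_0^{1,r}(\Omega)$ is equipped with the norm $\|\nabla u\|_r$. Put $H_\alpha(u)=\|\nabla u\|_p^p-\alpha\|u\|_p^p$, $G_\beta(u)=\|\nabla u\|_q^q-\beta\|u\|_q^q$ and $E_{\alpha,\beta}(u)=\frac1p H_\alpha(u)+\frac1q G_\beta(u)$ for $u\in W_0^{1,p}$. A weak solution of the problem is a critical point of $E_{\alpha,\beta}\in C^1(W_0^{1,p};\mathbb{R})$, and its energy is the value of $E_{\alpha,\beta}$ at it. Krasnoselskii genus: for symmetric $A=-A$, $\gamma(A)=\inf\{k\in\mathbb{N}:\exists\, h\in C(A,\mathbb{R}^k\setminus\{0\}),\ h \text{ odd}\}$, $\gamma(A)=+\infty$ if no such $h$ exists,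 $\gamma(\emptyset)=0$. For $r>1$ let $\Sigma_k(r)$ be the set of all symmetric $A\subset W_0^{1,r}\setminus\{0\}$ which are compact in $W_0^{1,r}$ and satisfy $\gamma(A)\ge k$, and define $\lambda_k(r)=\inf_{A\in\Sigma_k(r)}\max_{u\in A}\|\nabla u\|_r^r/\|u\|_r^r$; $\lambda_1(r)$ is the first eigenvalue of the Dirichlet $r$-Laplacian. $\beta_*(\alpha)=\inf\{\|\nabla u\|_q^q/\|u\|_q^q: u\in W_0^{1,p}\setminus\{0\},\ H_\alpha(u)\le 0\}$ for $\alpha\ge\lambda_1(p)$, and $\beta_*(\alpha)=+\infty$ for $\alpha<\lambda_1(p)$. *)

theory Defs
  imports "HOL-Analysis.Analysis"
begin

text \<open>Functions modulo equality almost everywhere. A class of functions on an open set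
  \<open>\<Omega>\<close> is represented by its extension by zero. No measurability is built into the
  type; since \<open>lebesgue\<close> is complete, measurability and integrability do not depend on the
  representative, and the function spaces below require integrability.\<close>

quotient_type (overloaded) 'a fun_ae = "'a::euclidean_space \<Rightarrow> real" /
  "\<lambda>f g. AE x in lebesgue. f x = g x"
proof (rule equivpI)
  show "reflp (\<lambda>f g :: 'a \<Rightarrow> real. AE x in lebesgue. f x = g x)"
    by (auto intro!: reflpI)
  show "symp (\<lambda>f g :: 'a \<Rightarrow> real. AE x in lebesgue. f x = g x)"
    by (auto intro!: sympI elim!: eventually_mono)
  show "transp (\<lambda>f g :: 'a \<Rightarrow> real. AE x in lebesgue. f x = g x)"
  proof (rule transpI)
    fix f g h :: "'a \<Rightarrow> real"
    assume "AE x in lebesgue. f x = g x" "AE x in lebesgue. g x = h x"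
    then show "AE x in lebesgue. f x = h x"
      by eventually_elim simp
  qed
qed

instantiation fun_ae :: (euclidean_space) real_vector
begin

lift_definition zero_fun_ae :: "'a fun_ae" is "\<lambda>_. 0" .

lift_definition plus_fun_ae :: "'a fun_ae \<Rightarrow> 'a fun_ae \<Rightarrow> 'a fun_ae" is "\<lambda>f g x. f x + g x"
  by (erule (1) eventually_elim2) simp

lift_definition minus_fun_ae :: "'a fun_ae \<Rightarrow> 'a fun_ae \<Rightarrow> 'a fun_ae" is "\<lambda>f g x. f x - g x"
  by (erule (1) eventually_elim2) simp

lift_definition uminus_fun_ae :: "'a fun_ae \<Rightarrow> 'a fun_ae" is "\<lambda>f x. - f x"
  by (erule eventually_mono) auto

lift_definition scaleR_fun_ae :: "real \<Rightarrow> 'a fun_ae \<Rightarrow> 'a fun_ae" is "\<lambda>c f x. c * f x"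
  by (erule eventually_mono) auto

instance
  by (standard; transfer) (simp_all add: algebra_simps)

end

section \<open>Domains\<close>

text \<open>Near every boundary point \<open>\<Omega>\<close> is the open epigraph, in the direction of a unit
  vector \<open>e\<close>, of a function \<open>\<psi>\<close> of the coordinates orthogonal to \<open>e\<close> (invariance along
  \<open>e\<close>) with Hoelder continuous gradient \<open>D\<close>. Only the values of \<open>\<psi>\<close> near the
  boundary point matter, so asking for \<open>\<psi>\<close> on the whole hyperplane is no restriction
  (cut-off).\<close>

definition C1_regular :: "real \<Rightarrow> 'a::euclidean_space set \<Rightarrow> bool" where
  "C1_regular \<kappa> \<Omega> \<longleftrightarrow>
    (\<forall>z\<in>frontier \<Omega>. \<exists>e \<psi> D C \<delta>. norm e = 1 \<and> \<delta> > 0 \<and>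
       (\<forall>x t. \<psi> (x + t *\<^sub>R e) = \<psi> x) \<and>
       (\<forall>x. (\<psi> has_derivative (\<lambda>v. D x \<bullet> v)) (at x)) \<and>
       (\<forall>x y. norm (D x - D y) \<le> C * norm (x - y) powr \<kappa>) \<and>
       \<Omega> \<inter> ball z \<delta> = {x \<in> ball z \<delta>. \<psi> x < x \<bullet> e})"

section \<open>Sobolev spaces\<close>

fun Ck :: "nat \<Rightarrow> ('a::euclidean_space \<Rightarrow> real) \<Rightarrow> bool" where
  "Ck 0 f \<longleftrightarrow> continuous_on UNIV f"
| "Ck (Suc k) f \<longleftrightarrow> (\<forall>x. f differentiable (at x)) \<and>
     (\<forall>i\<in>Basis. Ck k (\<lambda>x. frechet_derivative f (at x) i))"

definition test_functions :: "'a::euclidean_space set \<Rightarrow> ('a \<Rightarrow> real) set" where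
  "test_functions \<Omega> = {\<phi>. (\<forall>k. Ck k \<phi>) \<and> compact (closure {x. \<phi> x \<noteq> 0}) \<and>
     closure {x. \<phi> x \<noteq> 0} \<subseteq> \<Omega>}"

definition has_weak_gradient ::
    "'a::euclidean_space set \<Rightarrow> ('a \<Rightarrow> real) \<Rightarrow> ('a \<Rightarrow> 'a) \<Rightarrow> bool" where
  "has_weak_gradient \<Omega> f g \<longleftrightarrow>
    (\<forall>K. compact K \<and> K \<subseteq> \<Omega> \<longrightarrow> set_integrable lebesgue K f \<and> set_integrable lebesgue K g) \<and>
    (\<forall>\<phi>\<in>test_functions \<Omega>. \<forall>i\<in>Basis.
       (LINT x:\<Omega>|lebesgue. f x * frechet_derivative \<phi> (at x) i) =
       - (LINT x:\<Omega>|lebesgue. (g x \<bullet> i) * \<phi> x))"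

text \<open>Determined only almost everywhere in \<open>\<Omega>\<close>; it is only used under integrals over
  \<open>\<Omega>\<close>.\<close>

definition weak_gradient :: "'a::euclidean_space set \<Rightarrow> 'a fun_ae \<Rightarrow> 'a \<Rightarrow> 'a" where
  "weak_gradient \<Omega> u = (SOME g. has_weak_gradient \<Omega> (rep_fun_ae u) g)"

text \<open>Meaningful for functions in \<open>L\<^sup>r(\<Omega>)\<close> only: a non-integrable power would give 0.\<close>

definition Lr_norm ::
    "'a::euclidean_space set \<Rightarrow> real \<Rightarrow> ('a \<Rightarrow> 'b::real_normed_vector) \<Rightarrow> real" where
  "Lr_norm \<Omega> r f = (LINT x:\<Omega>|lebesgue. norm (f x) powr r) powr (1 / r)"

definition sobolev_space :: "'a::euclidean_space set \<Rightarrow> real \<Rightarrow> 'a fun_ae set" where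
  "sobolev_space \<Omega> r =
    {u. (AE x in lebesgue. x \<notin> \<Omega> \<longrightarrow> rep_fun_ae u x = 0) \<and>
        set_integrable lebesgue \<Omega> (\<lambda>x. norm (rep_fun_ae u x) powr r) \<and>
        (\<exists>g. has_weak_gradient \<Omega> (rep_fun_ae u) g \<and>
             set_integrable lebesgue \<Omega> (\<lambda>x. norm (g x) powr r))}"

definition norm_L :: "'a::euclidean_space set \<Rightarrow> real \<Rightarrow> 'a fun_ae \<Rightarrow> real" where
  "norm_L \<Omega> r u = Lr_norm \<Omega> r (rep_fun_ae u)"

definition norm_grad :: "'a::euclidean_space set \<Rightarrow> real \<Rightarrow> 'a fun_ae \<Rightarrow> real" where
  "norm_grad \<Omega> r u = Lr_norm \<Omega> r (weak_gradient \<Omega> u)"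

text \<open>\<open>W\<^sub>0\<^sup>1\<^sup>,\<^sup>r(\<Omega>)\<close>: the closure of the test functions in the full Sobolev norm.\<close>

definition W0 :: "'a::euclidean_space set \<Rightarrow> real \<Rightarrow> 'a fun_ae set" where
  "W0 \<Omega> r =
    {u \<in> sobolev_space \<Omega> r. \<exists>\<phi>. (\<forall>n::nat. \<phi> n \<in> test_functions \<Omega>) \<and>
       (\<lambda>n. norm_L \<Omega> r (u - abs_fun_ae (\<phi> n)) + norm_grad \<Omega> r (u - abs_fun_ae (\<phi> n)))
         \<longlonglongrightarrow> 0}"

definition W0_topology :: "'a::euclidean_space set \<Rightarrow> real \<Rightarrow> 'a fun_ae topology" where
  "W0_topology \<Omega> r = Metric_space.mtopology (W0 \<Omega> r) (\<lambda>u v. norm_grad \<Omega> r (u - v))"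

section \<open>Genus and the variational eigenvalues\<close>

definition genus :: "'b::ab_group_add topology \<Rightarrow> 'b set \<Rightarrow> enat" where
  "genus X A = (if A = {} then 0 else
    Inf (enat ` {k. \<exists>h. continuous_map (subtopology X A)
                          (subtopology (Euclidean_space k) (- {\<lambda>_. 0})) h \<and>
                        (\<forall>u\<in>A. h (- u) = (\<lambda>i. - h u i))}))"

definition Sigma_k :: "'a::euclidean_space set \<Rightarrow> nat \<Rightarrow> real \<Rightarrow> 'a fun_ae set set" where
  "Sigma_k \<Omega> k r =
    {A. A \<subseteq> W0 \<Omega> r - {0} \<and> uminus ` A = A \<and> compactin (W0_topology \<Omega> r) A \<and>
        enat k \<le> genus (W0_topology \<Omega> r) A}"

text \<open>For \<open>k \<ge> 1\<close> the sets in \<open>Sigma_k\<close> are nonempty and compact, so the supremum is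
  the maximum.\<close>

definition eigenvalue_k :: "'a::euclidean_space set \<Rightarrow> nat \<Rightarrow> real \<Rightarrow> ereal" where
  "eigenvalue_k \<Omega> k r =
    (INF A\<in>Sigma_k \<Omega> k r. SUP u\<in>A. ereal (norm_grad \<Omega> r u powr r / norm_L \<Omega> r u powr r))"

section \<open>The energy functional\<close>

definition H_fun :: "'a::euclidean_space set \<Rightarrow> real \<Rightarrow> real \<Rightarrow> 'a fun_ae \<Rightarrow> real" where
  "H_fun \<Omega> p \<alpha> u = norm_grad \<Omega> p u powr p - \<alpha> * norm_L \<Omega> p u powr p"

definition G_fun :: "'a::euclidean_space set \<Rightarrow> real \<Rightarrow> real \<Rightarrow> 'a fun_ae \<Rightarrow> real" where
  "G_fun \<Omega> q \<beta> u = norm_grad \<Omega> q u powr q - \<beta> * norm_L \<Omega> q u powr q"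

definition E_fun ::
    "'a::euclidean_space set \<Rightarrow> real \<Rightarrow> real \<Rightarrow> real \<Rightarrow> real \<Rightarrow> 'a fun_ae \<Rightarrow> real" where
  "E_fun \<Omega> p q \<alpha> \<beta> u = 1 / p * H_fun \<Omega> p \<alpha> u + 1 / q * G_fun \<Omega> q \<beta> u"

text \<open>\<open>u\<close> is a critical point of \<open>J\<close> on \<open>W\<^sub>0\<^sup>1\<^sup>,\<^sup>r(\<Omega>)\<close>: the Frechet derivative of
  \<open>J\<close> at \<open>u\<close>, with respect to the norm \<open>norm_grad\<close>, exists and is the zero
  functional. A weak solution of the boundary value problem is by definition a critical
  point of \<open>E_fun\<close> on \<open>W\<^sub>0\<^sup>1\<^sup>,\<^sup>p(\<Omega>)\<close>.\<close>

definition critical_point ::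
    "'a::euclidean_space set \<Rightarrow> real \<Rightarrow> ('a fun_ae \<Rightarrow> real) \<Rightarrow> 'a fun_ae \<Rightarrow> bool" where
  "critical_point \<Omega> r J u \<longleftrightarrow> u \<in> W0 \<Omega> r \<and>
    (\<forall>\<epsilon>>0. \<exists>\<delta>>0. \<forall>v\<in>W0 \<Omega> r. norm_grad \<Omega> r v < \<delta> \<longrightarrow>
       \<bar>J (u + v) - J u\<bar> \<le> \<epsilon> * norm_grad \<Omega> r v)"

definition beta_star :: "'a::euclidean_space set \<Rightarrow> real \<Rightarrow> real \<Rightarrow> real \<Rightarrow> ereal" where
  "beta_star \<Omega> p q \<alpha> =
    (if ereal \<alpha> \<ge> eigenvalue_k \<Omega> 1 p
     then INF u\<in>{u \<in> W0 \<Omega> p - {0}. H_fun \<Omega> p \<alpha> u \<le> 0}.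
            ereal (norm_grad \<Omega> q u powr q / norm_L \<Omega> q u powr q)
     else \<infinity>)"

end

theory Submission
  imports Defs "HOL-Analysis.Analysis" "HOL-Computational_Algebra.Polynomial" "HOL-Library.Diagonal_Subsequence"
begin

text \<open>Write \<open>E = H / p + G / q\<close>. Where \<open>H u < 0 < G u\<close>, the function
\<open>t \<mapsto> E (t u) = t\<^sup>p H u / p + t\<^sup>q G u / q\<close> has exactly one critical point on \<open>t > 0\<close>, its value there is
positive, and the critical points of \<open>E\<close> found in this way are the critical points of the 0-homogeneous
functional \<open>J u = p ln (G u) - q ln (- H u)\<close>. The hypothesis on \<open>\<beta>\<close> says that \<open>G\<close> is at least a positive multiple of the \<open>q\<close>-th power of the \<open>L\<^sup>q\<close>-norm on
\<open>H \<le> 0\<close>; the hypothesis on \<open>\<alpha>\<close> provides a compact symmetric set of genus at least \<open>l\<close> inside \<open>H < 0\<close>.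
So it has to be shown that the even functional \<open>J\<close> has at least \<open>l\<close> pairs of critical points on
\<open>X = {u. norm_L \<Omega> p u = 1 \<and> H u < 0}\<close>.

Descent for \<open>J\<close> is provided by one explicit map instead of a flow. For \<open>u \<in> X\<close>
replace \<open>G\<close> by a convex majorant \<open>Gm u\<close> and \<open>- H\<close> by a concave minorant \<open>h u\<close>, both equal at \<open>u\<close> to what they replace
(tangents of the \<open>L\<^sup>p\<close>- and \<open>L\<^sup>q\<close>-powers that have the wrong sign), and replace \<open>ln\<close> by its tangent in the first term. This
gives a convex functional \<open>F u\<close> on the set \<open>h u > 0\<close>, with \<open>- q ln (h u v)\<close> acting as a barrier, and
\<open>J v \<le> J u + (F u v - F u u)\<close> (lemma \<open>descent_bound\<close>). Let \<open>T u\<close> be the normalised minimiser of \<open>F u\<close>. Uniform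
convexity makes the minimiser unique and continuous in the data (lemma \<open>near_min\<close>), and \<open>F u\<close> depends on \<open>u\<close> only through the
\<open>L\<^sup>p\<close>-class of \<open>u\<close> and the number \<open>1 / G u\<close>; therefore Rellich's theorem makes \<open>T\<close> compact on sublevel sets of \<open>J\<close>.
The map \<open>T\<close> is odd, it lowers \<open>J\<close> strictly unless \<open>T u = u\<close>, and a fixed point minimises its own majorant, hence is critical
(lemmas \<open>minimizer_stationary\<close> and \<open>critical_point_on_ray\<close>).

For such a map the Lusternik-Schnirelmann estimate is elementary (lemma \<open>separated_by_pairs\<close>): iterating \<open>T\<close> on a compact
symmetric set pushes it towards the fixed points of one level, the zero set of an odd function not vanishing on these is a
symmetric subset whose genus is smaller by at most one, and two further applications of \<open>T\<close> move that set strictly below the level. Induction on the number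
of pairs of fixed points below the level bounds the genus by this number.

The function spaces are treated in \<open>L\<^sup>p\<close>-norms throughout. On test functions the estimate
\<open>\<parallel>\<phi>(\<cdot> + z) - \<phi>\<parallel> \<le> |z| \<parallel>\<nabla>\<phi>\<parallel>\<close> yields both the Poincare inequality (translate the support off itself) and compactness
(compare with averages over finitely many small balls), and density carries these facts to \<open>W0\<close>.\<close>

section \<open>Convexity of powers of the norm\<close>

text \<open>The gradient of \<open>a \<mapsto> norm a powr r / r\<close>. For \<open>r < 2\<close> the exponent of the scalar factor is negative, and \<open>0 powr _ = 0\<close> gives the
value 0 at the origin that makes the map continuous for \<open>r > 1\<close>.\<close>

definition pdual :: "real \<Rightarrow> 'b::real_inner \<Rightarrow> 'b" where
  "pdual r a = norm a powr (r - 2) *\<^sub>R a"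

lemma norm_pdual: "norm (pdual r a) = norm a powr (r - 1)"
proof (cases "a = 0")
  case False
  then have "norm a powr (r - 2) * norm a powr 1 = norm a powr (r - 1)"
    by (subst powr_add[symmetric]) simp
  with False show ?thesis by (simp add: pdual_def)
qed (simp add: pdual_def)

lemma pdual_inner_self: "pdual r a \<bullet> a = norm a powr r"
proof (cases "a = 0")
  case False
  then have "norm a powr (r - 2) * norm a powr 2 = norm a powr r"
    by (subst powr_add[symmetric]) simp
  with False show ?thesis by (simp add: pdual_def power2_norm_eq_inner)
qed (simp add: pdual_def)

lemma pdual_scale: "c > 0 \<Longrightarrow> pdual r (c *\<^sub>R a) = c powr (r - 1) *\<^sub>R pdual r a"
proof (cases "a = 0")
  case False
  assume c: "c > 0"
  then have "c powr (r - 2) * c powr 1 = c powr (r - 1)"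
    by (subst powr_add[symmetric]) simp
  with False c show ?thesis by (simp add: pdual_def powr_mult)
qed (simp add: pdual_def)

lemma pdual_minus [simp]: "pdual r (- a) = - pdual r a"
  by (simp add: pdual_def)

lemma pdual_0 [simp]: "pdual r 0 = 0"
  by (simp add: pdual_def)

lemma continuous_pdual:
  assumes "r > 1"
  shows "continuous_on UNIV (pdual r :: 'b::euclidean_space \<Rightarrow> 'b)"
  unfolding continuous_on_eq_continuous_at[OF open_UNIV]
proof
  fix a :: 'b
  show "isCont (pdual r) a"
  proof (cases "a = 0")
    case False
    have "isCont (\<lambda>a. norm a powr (r - 2) *\<^sub>R a) a"
      using False by (auto intro!: continuous_intros)
    then show ?thesis by (simp add: pdual_def[abs_def])
  next
    case True
    have "((\<lambda>x. norm x powr (r - 1)) \<longlongrightarrow> norm (0::'b) powr (r - 1)) (at (0::'b))"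
      using assms by (intro tendsto_powr' tendsto_intros) auto
    then have "((\<lambda>x::'b. norm (pdual r x)) \<longlongrightarrow> 0) (at 0)"
      using assms by (simp add: norm_pdual)
    then have "(pdual r \<longlongrightarrow> (0::'b)) (at 0)"
      by (rule tendsto_norm_zero_cancel)
    with True show ?thesis by (simp add: isCont_def)
  qed
qed

text \<open>Young's inequality, in the form in which it bounds the tangent of \<open>x \<mapsto> x powr r\<close>.\<close>

lemma powr_tangent:
  fixes r x y :: real
  assumes "r > 1" "x \<ge> 0" "y \<ge> 0"
  shows "x powr (r - 1) * y \<le> (1 - 1/r) * x powr r + (1/r) * y powr r"
proof -
  have "(x powr (r - 1)) * y \<le> (x powr (r - 1)) powr (r/(r-1)) / (r/(r-1)) + y powr r / r"
    using assms by (intro Youngs_inequality) (auto simp: field_simps)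
  also have "(x powr (r - 1)) powr (r/(r-1)) = x powr r"
    using assms by (simp add: powr_powr)
  also have "x powr r / (r/(r-1)) = (1 - 1/r) * x powr r"
    using assms by (simp add: field_simps)
  finally show ?thesis by simp
qed

lemma powr_tangent_strict:
  fixes r x y :: real
  assumes "r > 1" "x > 0" "y \<ge> 0" "x \<noteq> y"
  shows "x powr (r - 1) * y < (1 - 1/r) * x powr r + (1/r) * y powr r"
proof -
  have E: "x powr r = x powr (r-1) * x"
  proof -
    have "x powr (r-1) * x powr 1 = x powr r" unfolding powr_add[symmetric] by simp
    with assms show ?thesis by simp
  qed
  define z where "z = (x + y) / 2"
  have z: "z > 0" using assms by (simp add: z_def)
  have "x powr (r - 1) * z \<le> (1 - 1/r) * x powr r + (1/r) * z powr r"
    using assms z by (intro powr_tangent) auto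
  moreover have "z powr (r - 1) * x \<le> (1 - 1/r) * z powr r + (1/r) * x powr r"
    using assms z by (intro powr_tangent) auto
  moreover have "z powr (r - 1) * y \<le> (1 - 1/r) * z powr r + (1/r) * y powr r"
    using assms z by (intro powr_tangent) auto
  moreover have Ez: "z powr r = z powr (r-1) * z"
  proof -
    have "z powr (r-1) * z powr 1 = z powr r" unfolding powr_add[symmetric] by simp
    with z show ?thesis by simp
  qed
  moreover have "(z powr (r-1) - x powr (r-1)) * (y - x) > 0"
  proof (cases "x < y")
    case True
    then have "x < z" by (simp add: z_def)
    then have "x powr (r-1) < z powr (r-1)" using assms by (intro powr_less_mono2) auto
    with True show ?thesis by (intro mult_pos_pos) auto
  next
    case False
    with assms have "z < x" by (simp add: z_def)
    then have "z powr (r-1) < x powr (r-1)" using assms z by (intro powr_less_mono2) auto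
    with False assms show ?thesis by (intro mult_neg_neg) auto
  qed
  ultimately have *: "x powr (r - 1) * z \<le> x powr r - (1/r) * (x powr r - z powr r)"
     "z powr (r - 1) * y - z powr (r-1) * z \<le> (1/r) * (y powr r - z powr r)"
    "(z powr (r-1) - x powr (r-1)) * (y - x) > 0"
    by (auto simp: algebra_simps)
  have yz: "y - z = (y - x)/2" "z - x = (y-x)/2" by (auto simp: z_def field_simps)
  have "x powr (r-1) * (z - x) \<le> (1/r) * (z powr r - x powr r)"
    using *(1) E by (simp add: algebra_simps)
  moreover have "z powr (r-1) * (y - z) \<le> (1/r) * (y powr r - z powr r)"
    using *(2) by (simp add: algebra_simps)
  ultimately have "x powr (r-1) * ((y-x)/2) + z powr (r-1) * ((y-x)/2) \<le> (1/r) * (y powr r - x powr r)"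
    unfolding yz by (simp add: algebra_simps)
  moreover have "x powr (r-1) * ((y-x)/2) + z powr (r-1) * ((y-x)/2) > x powr (r-1) * (y - x)"
  proof -
    have "x powr (r-1) * ((y-x)/2) + z powr (r-1) * ((y-x)/2) - x powr (r-1) * (y - x)
        = ((z powr (r-1) - x powr (r-1)) * (y - x)) / 2"
      by (simp add: field_simps)
    with *(3) show ?thesis by linarith
  qed
  ultimately have "x powr (r-1) * (y - x) < (1/r) * (y powr r - x powr r)" by linarith
  then show ?thesis using E by (simp add: algebra_simps)
qed

text \<open>The graph of a convex function lies above its tangents; the following lemma is the case of equality, which is strict convexity.\<close>

lemma norm_powr_tangent:
  assumes "r > 1"
  shows "norm a powr r + r * (pdual r a \<bullet> (b - a)) \<le> norm (b :: 'b::real_inner) powr r"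
proof -
  have "pdual r a \<bullet> b \<le> norm a powr (r - 1) * norm b"
    using Cauchy_Schwarz_ineq2[of "pdual r a" b] by (simp add: norm_pdual)
  also have "\<dots> \<le> (1 - 1/r) * norm a powr r + (1/r) * norm b powr r"
    using assms by (intro powr_tangent) auto
  finally have "r * (pdual r a \<bullet> b) \<le> r * ((1 - 1/r) * norm a powr r + (1/r) * norm b powr r)"
    using assms by (intro mult_left_mono) auto
  also have "\<dots> = (r - 1) * norm a powr r + norm b powr r"
    using assms by (simp add: field_simps)
  finally show ?thesis by (simp add: inner_diff_right pdual_inner_self algebra_simps)
qed

lemma norm_powr_tangent_eq:
  assumes "r > 1" "norm a powr r + r * (pdual r a \<bullet> (b - a)) = norm (b :: 'b::real_inner) powr r"
  shows "a = b"
proof (cases "a = 0")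
  case True
  with assms show ?thesis by simp
next
  case False
  have le: "pdual r a \<bullet> b \<le> norm a powr (r - 1) * norm b"
    using Cauchy_Schwarz_ineq2[of "pdual r a" b] by (simp add: norm_pdual)
  have e1: "r * (pdual r a \<bullet> b) = (r - 1) * norm a powr r + norm b powr r"
    using assms by (simp add: inner_diff_right pdual_inner_self algebra_simps)
  have "norm a = norm b"
  proof (rule ccontr)
    assume ne: "norm a \<noteq> norm b"
    have "norm a powr (r - 1) * norm b < (1 - 1/r) * norm a powr r + (1/r) * norm b powr r"
      using assms False ne by (intro powr_tangent_strict) auto
    with le have "pdual r a \<bullet> b < (1 - 1/r) * norm a powr r + (1/r) * norm b powr r" by simp
    then have "r * (pdual r a \<bullet> b) < r * ((1 - 1/r) * norm a powr r + (1/r) * norm b powr r)"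
      using assms by (intro mult_strict_left_mono) auto
    also have "\<dots> = (r - 1) * norm a powr r + norm b powr r"
      using assms by (simp add: field_simps)
    finally show False using e1 by simp
  qed
  then have "pdual r a \<bullet> b = norm a powr r" using e1 assms by (simp add: algebra_simps)
  then have "norm a powr (r - 2) * (a \<bullet> b) = norm a powr (r-2) * (a \<bullet> a)"
    using pdual_inner_self[of r a] by (simp add: pdual_def)
  with False have "a \<bullet> b = a \<bullet> a" by simp
  with \<open>norm a = norm b\<close> have "(a - b) \<bullet> (a - b) = 0"
    by (simp add: algebra_simps inner_commute norm_eq_sqrt_inner)
  then show ?thesis by simp
qed

lemma norm_powr_midpoint:
  assumes "r > 1"
  shows "norm ((1/2) *\<^sub>R (a + b)) powr r \<le> (norm a powr r + norm (b::'b::real_inner) powr r) / 2"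
proof -
  define m where "m = (1/2) *\<^sub>R (a + b)"
  have "norm m powr r + r * (pdual r m \<bullet> (a - m)) \<le> norm a powr r"
    "norm m powr r + r * (pdual r m \<bullet> (b - m)) \<le> norm b powr r"
    using norm_powr_tangent assms by blast+
  moreover have "b - m = - (a - m)" by (simp add: m_def algebra_simps flip: scaleR_left_distrib)
  ultimately show ?thesis unfolding m_def[symmetric] by (simp add: algebra_simps del: scaleR_half_double)
qed

lemma norm_powr_midpoint_eq:
  assumes "r > 1" "norm ((1/2) *\<^sub>R (a + b)) powr r = (norm a powr r + norm (b::'b::real_inner) powr r) / 2"
  shows "a = b"
proof -
  define m where "m = (1/2) *\<^sub>R (a + b)"
  have 1: "norm m powr r + r * (pdual r m \<bullet> (a - m)) \<le> norm a powr r"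
    "norm m powr r + r * (pdual r m \<bullet> (b - m)) \<le> norm b powr r"
    using norm_powr_tangent assms by blast+
  have 2: "b - m = - (a - m)" by (simp add: m_def algebra_simps flip: scaleR_left_distrib)
  have 3: "norm m powr r = (norm a powr r + norm b powr r) / 2" using assms by (simp add: m_def)
  have "norm m powr r + r * (pdual r m \<bullet> (a - m)) = norm a powr r"
    using 1(1) 1(2)[unfolded 2] 3 by (simp only: inner_minus_right) argo
  then have "m = a" using assms norm_powr_tangent_eq by blast
  then have "a + b = 2 *\<^sub>R a" unfolding m_def by (metis scaleR_half_double scaleR_scaleR scaleR_2 one_neq_zero
    divide_self_if mult.commute nonzero_mult_div_cancel_left scaleR_one times_divide_eq_right zero_neq_numeral mult_1)
  then show ?thesis by (simp add: scaleR_2)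
qed

text \<open>The source of the quantitative estimates below. On the unit sphere the set \<open>K \<ge> e\<close> is compact and \<open>Z\<close> is positive on it, so a
multiple of \<open>Z\<close> dominates \<open>K\<close> there; elsewhere on the sphere \<open>K < e\<close>. Homogeneity extends the bound to all \<open>z\<close>. Strict
inequalities thus become uniform ones without any computation for special exponents.\<close>

lemma homogeneous_domination:
  fixes K Z :: "'c::euclidean_space \<Rightarrow> real"
  assumes cK: "continuous_on UNIV K" and cZ: "continuous_on UNIV Z" and s: "s > 0"
    and hK: "\<And>t z. t > 0 \<Longrightarrow> K (t *\<^sub>R z) = t powr s * K z"
    and hZ: "\<And>t z. t > 0 \<Longrightarrow> Z (t *\<^sub>R z) = t powr s * Z z"
    and Z0: "\<And>z. Z z \<ge> 0" and KZ: "\<And>z. Z z = 0 \<Longrightarrow> K z \<le> 0" and e: "e > 0"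
  shows "\<exists>C\<ge>0. \<forall>z. K z \<le> e * norm z powr s + C * Z z"
proof -
  define S where "S = {z \<in> sphere 0 1. e \<le> K z}"
  have "S = sphere 0 1 \<inter> {z. e \<le> K z}" by (auto simp: S_def)
  moreover have "closed {z. e \<le> K z}"
    using cK by (intro closed_Collect_le) auto
  ultimately have cS: "compact S" by (simp add: compact_Int_closed)
  have "\<exists>C\<ge>0. \<forall>z\<in>sphere 0 1. K z \<le> e + C * Z z"
  proof (cases "S = {}")
    case True
    then show ?thesis by (intro exI[of _ 0]) (auto simp: S_def not_le intro!: less_imp_le)
  next
    case False
    obtain z1 where z1: "z1 \<in> S" "\<And>z. z \<in> S \<Longrightarrow> Z z1 \<le> Z z"
      using continuous_attains_inf[OF cS False continuous_on_subset[OF cZ]] by auto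
    obtain z2 where z2: "z2 \<in> S" "\<And>z. z \<in> S \<Longrightarrow> K z \<le> K z2"
      using continuous_attains_sup[OF cS False continuous_on_subset[OF cK]] by auto
    have pos: "Z z1 > 0"
      using z1(1) KZ[of z1] Z0[of z1] e by (force simp: S_def order_less_le)
    have K2: "K z2 > 0" using z2(1) e by (auto simp: S_def)
    have "K z \<le> e + (K z2 / Z z1) * Z z" if "z \<in> sphere 0 1" for z
    proof (cases "z \<in> S")
      case True
      have "K z \<le> K z2" using z2 True by auto
      also have "\<dots> = (K z2 / Z z1) * Z z1" using pos by simp
      also have "\<dots> \<le> (K z2 / Z z1) * Z z" using z1(2)[OF True] pos K2 by (intro mult_left_mono) auto
      finally show ?thesis using e by simp
    next
      case False
      with that have "K z < e" by (auto simp: S_def)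
      moreover have "(K z2 / Z z1) * Z z \<ge> 0" using pos K2 Z0 by (intro mult_nonneg_nonneg) auto
      ultimately show ?thesis by linarith
    qed
    then show ?thesis using pos K2 by (intro exI[of _ "K z2 / Z z1"]) auto
  qed
  then obtain C where C: "C \<ge> 0" "\<And>z. z \<in> sphere 0 1 \<Longrightarrow> K z \<le> e + C * Z z" by blast
  have "K z \<le> e * norm z powr s + C * Z z" for z
  proof (cases "z = 0")
    case True
    have "K 0 = 2 powr s * K 0" using hK[of 2 0] by simp
    moreover have "2 powr s \<noteq> (1::real)" using s by (metis gr_one_powr less_irrefl one_less_numeral_iff semiring_norm(76))
    ultimately have "K 0 = 0" by simp
    then show ?thesis using True C(1) Z0 by simp
  next
    case False
    define w where "w = (1 / norm z) *\<^sub>R z"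
    have w: "w \<in> sphere 0 1" "z = norm z *\<^sub>R w" using False by (auto simp: w_def)
    have "K z = norm z powr s * K w" using hK[of "norm z" w] w(2) False by simp
    also have "\<dots> \<le> norm z powr s * (e + C * Z w)"
      using C(2)[OF w(1)] by (intro mult_left_mono) auto
    also have "\<dots> = e * norm z powr s + C * Z z"
      using hZ[of "norm z" w] w(2) False by (simp add: algebra_simps)
    finally show ?thesis .
  qed
  with C(1) show ?thesis by blast
qed

lemma norm_add_powr_le:
  assumes "s > 0"
  shows "norm (a + b :: 'b::real_normed_vector) powr s \<le> 2 powr s * (norm a powr s + norm b powr s)"
proof -
  have "norm (a + b) \<le> 2 * max (norm a) (norm b)"
    using norm_triangle_ineq[of a b] by linarith
  then have "norm (a + b) powr s \<le> (2 * max (norm a) (norm b)) powr s"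
    using assms by (intro powr_mono2) auto
  also have "\<dots> = 2 powr s * max (norm a) (norm b) powr s" by (subst powr_mult) auto
  also have "max (norm a) (norm b) powr s \<le> norm a powr s + norm b powr s"
    by (auto simp: max_def)
  finally show ?thesis by simp
qed

lemma norm_Pair_powr_le:
  assumes "s > 0"
  shows "norm (a :: 'b::euclidean_space, b :: 'b) powr s \<le> 2 powr s * (norm a powr s + norm b powr s)"
proof -
  have "norm (a, b) = norm ((a, 0) + (0, b))" by simp
  also have "\<dots> powr s \<le> 2 powr s * (norm (a, 0::'b) powr s + norm (0::'b, b) powr s)"
    by (rule norm_add_powr_le[OF assms])
  finally show ?thesis by simp
qed

lemma continuous_norm_powr:
  assumes "s > 0" "continuous_on UNIV f"
  shows "continuous_on UNIV (\<lambda>x. norm (f x) powr s)"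
  using assms by (intro continuous_on_powr' continuous_intros) auto

text \<open>Apply domination to \<open>K = norm (a - b) powr r\<close> and to the midpoint defect \<open>Z\<close>, whose zeros are the diagonal by strict convexity.\<close>

lemma uniform_convexity_pointwise:
  assumes r: "r > 1" and e: "e > 0"
  shows "\<exists>C\<ge>0. \<forall>a b :: 'b::euclidean_space. norm (a - b) powr r \<le> e * (norm a powr r + norm b powr r)
      + C * ((norm a powr r + norm b powr r) / 2 - norm ((1/2) *\<^sub>R (a + b)) powr r)"
proof -
  define K where "K = (\<lambda>(a :: 'b, b :: 'b). norm (a - b) powr r)"
  define Z where "Z = (\<lambda>(a :: 'b, b :: 'b). (norm a powr r + norm b powr r) / 2 - norm ((1/2) *\<^sub>R (a + b)) powr r)"
  have "\<exists>C\<ge>0. \<forall>z. K z \<le> (e / 2 powr r) * norm z powr r + C * Z z"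
  proof (rule homogeneous_domination)
    show "continuous_on UNIV K"
      unfolding K_def case_prod_unfold using r by (intro continuous_norm_powr continuous_intros) auto
    show "continuous_on UNIV Z"
      unfolding Z_def case_prod_unfold using r by (intro continuous_intros continuous_norm_powr) auto
    show "r > 0" "e / 2 powr r > 0" using r e by auto
    show "K (t *\<^sub>R z) = t powr r * K z" if "t > 0" for t z
      using that by (auto simp: K_def case_prod_unfold powr_mult simp flip: scaleR_diff_right)
    show "Z (t *\<^sub>R z) = t powr r * Z z" if "t > 0" for t z
    proof -
      have "(1/2) *\<^sub>R (t *\<^sub>R fst z + t *\<^sub>R snd z) = t *\<^sub>R ((1/2) *\<^sub>R (fst z + snd z))"
        by (simp add: scaleR_add_right)
      then have "norm ((1/2) *\<^sub>R (t *\<^sub>R fst z + t *\<^sub>R snd z)) powr r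
          = t powr r * norm ((1/2) *\<^sub>R (fst z + snd z)) powr r"
        using that by (simp only: norm_scaleR powr_mult abs_of_pos)
      then show ?thesis using that unfolding Z_def case_prod_unfold fst_scaleR snd_scaleR
        by (simp add: powr_mult algebra_simps diff_divide_distrib add_divide_distrib del: scaleR_add_right)
    qed
    show "Z z \<ge> 0" for z using norm_powr_midpoint[OF r, of "fst z" "snd z"] by (simp add: Z_def case_prod_unfold)
    show "K z \<le> 0" if "Z z = 0" for z
      using that norm_powr_midpoint_eq[OF r, of "fst z" "snd z"] by (simp add: Z_def K_def case_prod_unfold)
  qed
  then obtain C where C: "C \<ge> 0" "\<And>z. K z \<le> (e / 2 powr r) * norm z powr r + C * Z z" by blast
  have "K (a, b) \<le> e * (norm a powr r + norm b powr r) + C * Z (a, b)" for a b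
  proof -
    have "(e / 2 powr r) * norm (a, b) powr r \<le> (e / 2 powr r) * (2 powr r * (norm a powr r + norm b powr r))"
      using e r by (intro mult_left_mono norm_Pair_powr_le) auto
    with C(2)[of "(a, b)"] show ?thesis by simp
  qed
  with C(1) show ?thesis by (auto simp: K_def Z_def)
qed

text \<open>Apply domination with exponent \<open>r - 1\<close>: where \<open>Z = norm (a - b) powr (r - 1)\<close> vanishes, so does the difference of the duals.\<close>

lemma pdual_continuity_pointwise:
  assumes r: "r > 1" and e: "e > 0"
  shows "\<exists>C\<ge>0. \<forall>a b :: 'b::euclidean_space. norm (pdual r a - pdual r b) \<le>
      e * (norm a powr (r - 1) + norm b powr (r - 1)) + C * norm (a - b) powr (r - 1)"
proof -
  define K where "K = (\<lambda>(a :: 'b, b :: 'b). norm (pdual r a - pdual r b))"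
  define Z where "Z = (\<lambda>(a :: 'b, b :: 'b). norm (a - b) powr (r - 1))"
  have "\<exists>C\<ge>0. \<forall>z. K z \<le> (e / 2 powr (r-1)) * norm z powr (r-1) + C * Z z"
  proof (rule homogeneous_domination)
    show "continuous_on UNIV K"
      unfolding K_def case_prod_unfold
      by (intro continuous_intros continuous_on_compose2[OF continuous_pdual[OF r]]) auto
    show "continuous_on UNIV Z"
      unfolding Z_def case_prod_unfold using r by (intro continuous_norm_powr continuous_intros) auto
    show "r - 1 > 0" "e / 2 powr (r-1) > 0" using r e by auto
    show "K (t *\<^sub>R z) = t powr (r-1) * K z" if "t > 0" for t z
      using that by (auto simp: K_def case_prod_unfold pdual_scale simp flip: scaleR_diff_right)
    show "Z (t *\<^sub>R z) = t powr (r-1) * Z z" if "t > 0" for t z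
      using that by (auto simp: Z_def case_prod_unfold powr_mult simp flip: scaleR_diff_right)
    show "Z z \<ge> 0" for z by (simp add: Z_def case_prod_unfold)
    show "K z \<le> 0" if "Z z = 0" for z
      using that by (simp add: Z_def K_def case_prod_unfold)
  qed
  then obtain C where C: "C \<ge> 0" "\<And>z. K z \<le> (e / 2 powr (r-1)) * norm z powr (r-1) + C * Z z" by blast
  have "K (a, b) \<le> e * (norm a powr (r-1) + norm b powr (r-1)) + C * Z (a, b)" for a b
  proof -
    have "(e / 2 powr (r-1)) * norm (a, b) powr (r-1) \<le> (e / 2 powr (r-1)) * (2 powr (r-1) * (norm a powr (r-1) + norm b powr (r-1)))"
      using e r by (intro mult_left_mono norm_Pair_powr_le) auto
    with C(2)[of "(a, b)"] show ?thesis by simp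
  qed
  with C(1) show ?thesis by (auto simp: K_def Z_def)
qed

section \<open>Lebesgue spaces as sets of functions\<close>

text \<open>Functions are not identified almost everywhere, so that vector-valued and scalar functions, and weak gradients chosen only up to null sets,
can be handled by the same lemmas.\<close>

definition Lp :: "'a measure \<Rightarrow> real \<Rightarrow> ('a \<Rightarrow> 'b::euclidean_space) set" where
  "Lp M r = {f \<in> borel_measurable M. integrable M (\<lambda>x. norm (f x) powr r)}"

definition Lint :: "'a measure \<Rightarrow> real \<Rightarrow> ('a \<Rightarrow> 'b::euclidean_space) \<Rightarrow> real" where
  "Lint M r f = (LINT x|M. norm (f x) powr r)"

definition Lnorm :: "'a measure \<Rightarrow> real \<Rightarrow> ('a \<Rightarrow> 'b::euclidean_space) \<Rightarrow> real" where
  "Lnorm M r f = Lint M r f powr (1 / r)"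

text \<open>The pairing of \<open>g\<close> with the duality map at \<open>f\<close>; \<open>r * Lpair M r f\<close> is the derivative of \<open>Lint M r\<close> at \<open>f\<close>.\<close>

definition Lpair :: "'a measure \<Rightarrow> real \<Rightarrow> ('a \<Rightarrow> 'b::euclidean_space) \<Rightarrow> ('a \<Rightarrow> 'b) \<Rightarrow> real" where
  "Lpair M r f g = (LINT x|M. pdual r (f x) \<bullet> g x)"

lemma LpD: "f \<in> Lp M r \<Longrightarrow> f \<in> borel_measurable M" "f \<in> Lp M r \<Longrightarrow> integrable M (\<lambda>x. norm (f x) powr r)"
  by (auto simp: Lp_def)

lemma LpI: "f \<in> borel_measurable M \<Longrightarrow> integrable M (\<lambda>x. norm (f x) powr r) \<Longrightarrow> f \<in> Lp M r"
  by (auto simp: Lp_def)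

lemma Lp_dominated:
  assumes "f \<in> borel_measurable M" "integrable M g" "AE x in M. norm (f x) powr r \<le> g x"
  shows "f \<in> Lp M r"
proof (rule LpI[OF assms(1)])
  show "integrable M (\<lambda>x. norm (f x) powr r)"
    using assms by (intro Bochner_Integration.integrable_bound[OF assms(2)]) auto
qed

lemma Lp_add:
  assumes "r > 0" "f \<in> Lp M r" "g \<in> Lp M r"
  shows "(\<lambda>x. f x + g x) \<in> Lp M r"
proof (rule Lp_dominated)
  show "(\<lambda>x. f x + g x) \<in> borel_measurable M" using LpD(1)[OF assms(2)] LpD(1)[OF assms(3)] by auto
  show "integrable M (\<lambda>x. 2 powr r * (norm (f x) powr r + norm (g x) powr r))"
    using LpD(2)[OF assms(2)] LpD(2)[OF assms(3)] by auto
qed (use norm_add_powr_le[OF assms(1)] in auto)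

lemma Lp_scaleR:
  assumes "f \<in> Lp M r"
  shows "(\<lambda>x. c *\<^sub>R f x) \<in> Lp M r"
  using LpD[OF assms] by (intro LpI) (auto simp: powr_mult)

lemma Lp_mult: "f \<in> Lp M r \<Longrightarrow> (\<lambda>x. c * f x :: real) \<in> Lp M r"
  using Lp_scaleR[of f M r c] by simp

lemma Lp_uminus: "f \<in> Lp M r \<Longrightarrow> (\<lambda>x. - f x) \<in> Lp M r"
  using LpD[of f M r] by (intro LpI) auto

lemma Lp_diff:
  assumes "r > 0" "f \<in> Lp M r" "g \<in> Lp M r"
  shows "(\<lambda>x. f x - g x) \<in> Lp M r"
  using Lp_add[OF assms(1,2) Lp_uminus[OF assms(3)]] by simp

lemma Lint_nonneg [simp]: "Lint M r f \<ge> 0"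
  by (simp add: Lint_def)

lemma Lnorm_nonneg [simp]: "Lnorm M r f \<ge> 0"
  by (simp add: Lnorm_def)

lemma Lnorm_powr: "r > 0 \<Longrightarrow> Lnorm M r f powr r = Lint M r f"
  by (simp add: Lnorm_def powr_powr)

lemma Lint_cong_AE:
  assumes "f \<in> borel_measurable M" "g \<in> borel_measurable M" "AE x in M. f x = g x"
  shows "Lint M r f = Lint M r g"
  unfolding Lint_def using assms by (intro integral_cong_AE) auto

lemma Lnorm_cong_AE:
  assumes "f \<in> borel_measurable M" "g \<in> borel_measurable M" "AE x in M. f x = g x"
  shows "Lnorm M r f = Lnorm M r g"
  using Lint_cong_AE[OF assms] by (simp add: Lnorm_def)

lemma Lpair_cong_AE:
  assumes "f \<in> borel_measurable M" "g \<in> borel_measurable M" "AE x in M. f x = g x"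
    "h \<in> borel_measurable M" "k \<in> borel_measurable M" "AE x in M. h x = k x"
  shows "Lpair M r f h = Lpair M r g k"
  unfolding Lpair_def using assms by (intro integral_cong_AE) (auto simp: pdual_def)

lemma Lint_eq_0_iff:
  assumes "f \<in> Lp M r"
  shows "Lint M r f = 0 \<longleftrightarrow> (AE x in M. f x = 0)"
  unfolding Lint_def by (subst integral_nonneg_eq_0_iff_AE) (use LpD[OF assms] in auto)

lemma Lnorm_eq_0_iff:
  assumes "f \<in> Lp M r" "r > 0"
  shows "Lnorm M r f = 0 \<longleftrightarrow> (AE x in M. f x = 0)"
  using Lint_eq_0_iff[OF assms(1)] assms(2) by (simp add: Lnorm_def)

lemma Lint_scaleR: "Lint M r (\<lambda>x. c *\<^sub>R f x) = \<bar>c\<bar> powr r * Lint M r f"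
  by (simp add: Lint_def powr_mult)

lemma Lnorm_scaleR: "r > 0 \<Longrightarrow> Lnorm M r (\<lambda>x. c *\<^sub>R f x) = \<bar>c\<bar> * Lnorm M r f"
  by (simp add: Lnorm_def Lint_scaleR powr_mult powr_powr)

lemma Lnorm_uminus: "Lnorm M r (\<lambda>x. - f x) = Lnorm M r f"
  by (simp add: Lnorm_def Lint_def)

lemma Lnorm_diff_commute: "Lnorm M r (\<lambda>x. f x - g x) = Lnorm M r (\<lambda>x. g x - f x)"
  by (simp add: Lnorm_def Lint_def norm_minus_commute)

lemma powr_minus_one_mult:
  assumes "(x::real) \<ge> 0" shows "x powr (r - 1) * x = x powr r"
  using assms by (cases "x = 0") (auto simp: powr_diff)

lemma Lp_holder_integrable:
  assumes r: "r > 1" and f: "f \<in> Lp M r" and g: "g \<in> Lp M r"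
  shows "integrable M (\<lambda>x. norm (f x) powr (r - 1) * norm (g x))"
proof (rule Bochner_Integration.integrable_bound)
  show "integrable M (\<lambda>x. (1 - 1/r) * norm (f x) powr r + (1/r) * norm (g x) powr r)"
    using LpD(2)[OF f] LpD(2)[OF g] by auto
  show "(\<lambda>x. norm (f x) powr (r - 1) * norm (g x)) \<in> borel_measurable M"
    using LpD(1)[OF f] LpD(1)[OF g] by auto
  have "norm (f x) powr (r - 1) * norm (g x) \<le> \<bar>(1 - 1/r) * norm (f x) powr r + (1/r) * norm (g x) powr r\<bar>" for x
    using powr_tangent[OF r, of "norm (f x)" "norm (g x)"] by (intro order_trans[OF _ abs_ge_self]) auto
  then show "AE x in M. norm (norm (f x) powr (r - 1) * norm (g x))
      \<le> norm ((1 - 1/r) * norm (f x) powr r + (1/r) * norm (g x) powr r)"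
    by (auto simp: abs_mult)
qed

lemma Lp_holder:
  assumes r: "r > 1" and f: "f \<in> Lp M r" and g: "g \<in> Lp M r"
  shows "(LINT x|M. norm (f x) powr (r - 1) * norm (g x)) \<le> Lnorm M r f powr (r - 1) * Lnorm M r g"
proof (cases "Lnorm M r f = 0 \<or> Lnorm M r g = 0")
  case True
  then have "AE x in M. norm (f x) powr (r - 1) * norm (g x) = 0"
    using Lnorm_eq_0_iff[OF f] Lnorm_eq_0_iff[OF g] r by auto
  then have "(LINT x|M. norm (f x) powr (r - 1) * norm (g x)) = 0"
    by (rule integral_eq_zero_AE)
  then show ?thesis by simp
next
  case False
  define a where "a = Lnorm M r f"
  define b where "b = Lnorm M r g"
  have ab: "a > 0" "b > 0" using False by (auto simp: a_def b_def order_less_le)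
  have "(LINT x|M. norm (f x) powr (r - 1) * norm (g x))
      \<le> (LINT x|M. a powr (r - 1) * b * ((1 - 1/r) / a powr r * norm (f x) powr r + (1/r) / b powr r * norm (g x) powr r))"
  proof (rule integral_mono)
    show "integrable M (\<lambda>x. norm (f x) powr (r - 1) * norm (g x))" by (rule Lp_holder_integrable[OF r f g])
    show "integrable M (\<lambda>x. a powr (r - 1) * b * ((1 - 1/r) / a powr r * norm (f x) powr r + (1/r) / b powr r * norm (g x) powr r))"
      using LpD(2)[OF f] LpD(2)[OF g] by auto
    fix x
    have "(norm (f x) / a) powr (r - 1) * (norm (g x) / b)
        \<le> (1 - 1/r) * (norm (f x) / a) powr r + (1/r) * (norm (g x) / b) powr r"
      using r ab by (intro powr_tangent) auto
    then have "a powr (r-1) * b * ((norm (f x) / a) powr (r - 1) * (norm (g x) / b))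
        \<le> a powr (r-1) * b * ((1 - 1/r) * (norm (f x) / a) powr r + (1/r) * (norm (g x) / b) powr r)"
      using ab by (intro mult_left_mono) auto
    then show "norm (f x) powr (r - 1) * norm (g x) \<le> a powr (r - 1) * b *
        ((1 - 1/r) / a powr r * norm (f x) powr r + (1/r) / b powr r * norm (g x) powr r)"
      using ab by (simp add: powr_divide)
  qed
  also have "\<dots> = a powr (r - 1) * b * ((1 - 1/r) / a powr r * Lint M r f + (1/r) / b powr r * Lint M r g)"
    using LpD(2)[OF f] LpD(2)[OF g] by (simp add: Lint_def)
  also have "Lint M r f = a powr r" using r by (simp add: a_def Lnorm_powr)
  also have "Lint M r g = b powr r" using r by (simp add: b_def Lnorm_powr)
  also have "(1 - 1/r) / a powr r * a powr r + (1/r) / b powr r * b powr r = 1" using ab by simp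
  finally show ?thesis by (simp add: a_def b_def)
qed

lemma Lp_minkowski:
  assumes r: "r > 1" and f: "f \<in> Lp M r" and g: "g \<in> Lp M r"
  shows "Lnorm M r (\<lambda>x. f x + g x) \<le> Lnorm M r f + Lnorm M r g"
proof -
  define h where "h = (\<lambda>x. f x + g x)"
  have h: "h \<in> Lp M r" unfolding h_def using assms by (intro Lp_add) auto
  define n where "n = Lnorm M r h"
  show ?thesis
  proof (cases "n = 0")
    case True
    then show ?thesis by (simp add: n_def h_def)
  next
    case False
    then have n: "n > 0" by (simp add: n_def order_less_le)
    have "n powr (r - 1) * n = n powr r" using n by (intro powr_minus_one_mult) auto
    also have "\<dots> = Lint M r h" using r by (simp add: n_def Lnorm_powr)
    also have "\<dots> = (LINT x|M. norm (h x) powr (r - 1) * norm (h x))"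
      by (simp add: Lint_def powr_minus_one_mult)
    also have "\<dots> \<le> (LINT x|M. norm (h x) powr (r - 1) * norm (f x) + norm (h x) powr (r - 1) * norm (g x))"
      using Lp_holder_integrable[OF r h f] Lp_holder_integrable[OF r h g] Lp_holder_integrable[OF r h h]
      by (intro integral_mono Bochner_Integration.integrable_add)
         (auto simp: h_def norm_triangle_ineq simp flip: distrib_left intro!: mult_left_mono)
    also have "\<dots> = (LINT x|M. norm (h x) powr (r - 1) * norm (f x)) + (LINT x|M. norm (h x) powr (r - 1) * norm (g x))"
      using Lp_holder_integrable[OF r h f] Lp_holder_integrable[OF r h g] by simp
    also have "\<dots> \<le> n powr (r - 1) * Lnorm M r f + n powr (r - 1) * Lnorm M r g"
      unfolding n_def using Lp_holder[OF r h f] Lp_holder[OF r h g] by (rule add_mono)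
    also have "\<dots> = n powr (r - 1) * (Lnorm M r f + Lnorm M r g)" by (simp add: distrib_left)
    finally have "n \<le> Lnorm M r f + Lnorm M r g" using n by (simp add: mult_le_cancel_left)
    then show ?thesis by (simp add: n_def h_def)
  qed
qed

lemma Lp_minkowski_diff:
  assumes r: "r > 1" and f: "f \<in> Lp M r" and g: "g \<in> Lp M r"
  shows "Lnorm M r (\<lambda>x. f x - g x) \<le> Lnorm M r f + Lnorm M r g"
  using Lp_minkowski[OF r f Lp_uminus[OF g]] by (simp add: Lnorm_uminus)

lemma Lnorm_reverse_triangle:
  assumes r: "r > 1" and f: "f \<in> Lp M r" and g: "g \<in> Lp M r"
  shows "\<bar>Lnorm M r f - Lnorm M r g\<bar> \<le> Lnorm M r (\<lambda>x. f x - g x)"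
proof -
  have fg: "(\<lambda>x. f x - g x) \<in> Lp M r" "(\<lambda>x. g x - f x) \<in> Lp M r" using assms by (auto intro!: Lp_diff)
  show ?thesis
    using Lp_minkowski[OF r fg(1) g] Lp_minkowski[OF r fg(2) f] by (simp add: Lnorm_diff_commute[of M r f g])
qed

lemma Lpair_integrable:
  assumes r: "r > 1" and f: "f \<in> Lp M r" and g: "g \<in> Lp M r"
  shows "integrable M (\<lambda>x. pdual r (f x) \<bullet> g x)"
proof (rule Bochner_Integration.integrable_bound[OF Lp_holder_integrable[OF assms]])
  show "(\<lambda>x. pdual r (f x) \<bullet> g x) \<in> borel_measurable M"
    using LpD(1)[OF f] LpD(1)[OF g] by (simp add: pdual_def)
  have "norm (pdual r (f x) \<bullet> g x) \<le> norm (norm (f x) powr (r - 1) * norm (g x))" for x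
    using Cauchy_Schwarz_ineq2[of "pdual r (f x)" "g x"] by (simp add: norm_pdual abs_mult)
  then show "AE x in M. norm (pdual r (f x) \<bullet> g x) \<le> norm (norm (f x) powr (r - 1) * norm (g x))" by auto
qed

lemma Lpair_bound:
  assumes r: "r > 1" and f: "f \<in> Lp M r" and g: "g \<in> Lp M r"
  shows "\<bar>Lpair M r f g\<bar> \<le> Lnorm M r f powr (r - 1) * Lnorm M r g"
proof -
  have "\<bar>Lpair M r f g\<bar> \<le> (LINT x|M. norm (pdual r (f x) \<bullet> g x))"
    unfolding Lpair_def using integral_norm_bound[of M "\<lambda>x. pdual r (f x) \<bullet> g x"] by simp
  also have "\<dots> \<le> (LINT x|M. norm (f x) powr (r - 1) * norm (g x))"
    using Lpair_integrable[OF assms] Lp_holder_integrable[OF assms]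
    by (intro integral_mono integrable_norm) (auto intro!: Cauchy_Schwarz_ineq2 simp flip: norm_pdual)
  also have "\<dots> \<le> Lnorm M r f powr (r - 1) * Lnorm M r g" by (rule Lp_holder[OF assms])
  finally show ?thesis .
qed

lemma Lpair_add:
  assumes "r > 1" "f \<in> Lp M r" "g \<in> Lp M r" "h \<in> Lp M r"
  shows "Lpair M r f (\<lambda>x. g x + h x) = Lpair M r f g + Lpair M r f h"
  unfolding Lpair_def using Lpair_integrable[OF assms(1,2,3)] Lpair_integrable[OF assms(1,2,4)]
  by (simp add: inner_add_right)

lemma Lpair_diff:
  assumes "r > 1" "f \<in> Lp M r" "g \<in> Lp M r" "h \<in> Lp M r"
  shows "Lpair M r f (\<lambda>x. g x - h x) = Lpair M r f g - Lpair M r f h"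
  unfolding Lpair_def using Lpair_integrable[OF assms(1,2,3)] Lpair_integrable[OF assms(1,2,4)]
  by (simp add: inner_diff_right)

lemma Lpair_scaleR: "Lpair M r f (\<lambda>x. c *\<^sub>R g x) = c * Lpair M r f g"
  unfolding Lpair_def by simp

lemma Lpair_scaleR_left: "c > 0 \<Longrightarrow> Lpair M r (\<lambda>x. c *\<^sub>R f x) g = c powr (r - 1) * Lpair M r f g"
  unfolding Lpair_def by (simp add: pdual_scale)

lemma Lpair_self: "Lpair M r f f = Lint M r f"
  unfolding Lpair_def Lint_def by (simp add: pdual_inner_self)

lemma Lint_tangent:
  assumes r: "r > 1" and f: "f \<in> Lp M r" and g: "g \<in> Lp M r"
  shows "Lint M r f + r * Lpair M r f (\<lambda>x. g x - f x) \<le> Lint M r g"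
proof -
  have d: "(\<lambda>x. g x - f x) \<in> Lp M r" using assms by (intro Lp_diff) auto
  have "Lint M r f + r * Lpair M r f (\<lambda>x. g x - f x)
      = (LINT x|M. norm (f x) powr r + r * (pdual r (f x) \<bullet> (g x - f x)))"
    unfolding Lint_def Lpair_def using LpD(2)[OF f] Lpair_integrable[OF r f d] by simp
  also have "\<dots> \<le> Lint M r g"
    unfolding Lint_def using LpD(2)[OF f] LpD(2)[OF g] Lpair_integrable[OF r f d]
    by (intro integral_mono norm_powr_tangent[OF r]) auto
  finally show ?thesis .
qed

lemma Lint_midpoint:
  assumes r: "r > 1" and f: "f \<in> Lp M r" and g: "g \<in> Lp M r"
  shows "Lint M r (\<lambda>x. (1/2) *\<^sub>R (f x + g x)) \<le> (Lint M r f + Lint M r g) / 2"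
proof -
  have d: "(\<lambda>x. (1/2) *\<^sub>R (f x + g x)) \<in> Lp M r" using assms by (intro Lp_scaleR Lp_add) auto
  have "Lint M r (\<lambda>x. (1/2) *\<^sub>R (f x + g x)) \<le> (LINT x|M. (norm (f x) powr r + norm (g x) powr r) / 2)"
    unfolding Lint_def using LpD(2)[OF f] LpD(2)[OF g] LpD(2)[OF d]
    by (intro integral_mono norm_powr_midpoint[OF r]) auto
  also have "\<dots> = (Lint M r f + Lint M r g) / 2"
    using LpD(2)[OF f] LpD(2)[OF g] by (simp add: Lint_def)
  finally show ?thesis .
qed

text \<open>Integrating the pointwise estimate: a small midpoint defect forces a small distance, uniformly on bounded sets.\<close>

lemma Lint_uniform_convexity:
  assumes r: "r > 1" and e: "e > 0"
  shows "\<exists>C\<ge>0. \<forall>f \<in> Lp M r. \<forall>g \<in> Lp M r. Lint M r (\<lambda>x. f x - g x :: 'b::euclidean_space)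
     \<le> e * (Lint M r f + Lint M r g) + C * ((Lint M r f + Lint M r g) / 2 - Lint M r (\<lambda>x. (1/2) *\<^sub>R (f x + g x)))"
proof -
  obtain C where C: "C \<ge> 0" "\<And>a b :: 'b. norm (a - b) powr r \<le> e * (norm a powr r + norm b powr r)
      + C * ((norm a powr r + norm b powr r) / 2 - norm ((1/2) *\<^sub>R (a + b)) powr r)"
    using uniform_convexity_pointwise[OF assms, where 'b='b] by blast
  have "Lint M r (\<lambda>x. f x - g x)
     \<le> e * (Lint M r f + Lint M r g) + C * ((Lint M r f + Lint M r g) / 2 - Lint M r (\<lambda>x. (1/2) *\<^sub>R (f x + g x)))"
    if f: "f \<in> Lp M r" and g: "g \<in> Lp M r" for f g :: "'a \<Rightarrow> 'b"
  proof -
    have m: "(\<lambda>x. (1/2) *\<^sub>R (f x + g x)) \<in> Lp M r" using r f g by (intro Lp_scaleR Lp_add) auto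
    have d: "(\<lambda>x. f x - g x) \<in> Lp M r" using r f g by (intro Lp_diff) auto
    have "Lint M r (\<lambda>x. f x - g x) \<le> (LINT x|M. e * (norm (f x) powr r + norm (g x) powr r)
      + C * ((norm (f x) powr r + norm (g x) powr r) / 2 - norm ((1/2) *\<^sub>R (f x + g x)) powr r))"
      unfolding Lint_def by (intro integral_mono C(2) Bochner_Integration.integrable_add
        Bochner_Integration.integrable_diff integrable_mult_right integrable_divide_zero
        LpD(2)[OF f] LpD(2)[OF g] LpD(2)[OF d] LpD(2)[OF m])
    also have "\<dots> = e * (Lint M r f + Lint M r g) + C * ((Lint M r f + Lint M r g) / 2 - Lint M r (\<lambda>x. (1/2) *\<^sub>R (f x + g x)))"
      using LpD(2)[OF f] LpD(2)[OF g] LpD(2)[OF d] LpD(2)[OF m] unfolding Lint_def by simp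
    finally show ?thesis .
  qed
  with C(1) show ?thesis by blast
qed

text \<open>Holder's inequality after the pointwise estimate for the duals. As \<open>C\<close> is chosen before the functions, the duality map is
uniformly continuous on bounded sets.\<close>

lemma Lpair_continuity:
  assumes r: "r > 1" and e: "e > 0"
  shows "\<exists>C\<ge>0. \<forall>f \<in> Lp M r. \<forall>g \<in> Lp M r. \<forall>h \<in> Lp M r. \<bar>Lpair M r f h - Lpair M r g (h :: 'a \<Rightarrow> 'b::euclidean_space)\<bar>
     \<le> (e * (Lnorm M r f powr (r-1) + Lnorm M r g powr (r-1)) + C * Lnorm M r (\<lambda>x. f x - g x) powr (r-1)) * Lnorm M r h"
proof -
  obtain C where C: "C \<ge> 0" "\<And>a b :: 'b. norm (pdual r a - pdual r b) \<le>
      e * (norm a powr (r - 1) + norm b powr (r - 1)) + C * norm (a - b) powr (r - 1)"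
    using pdual_continuity_pointwise[OF assms, where 'b='b] by blast
  have "\<bar>Lpair M r f h - Lpair M r g h\<bar>
     \<le> (e * (Lnorm M r f powr (r-1) + Lnorm M r g powr (r-1)) + C * Lnorm M r (\<lambda>x. f x - g x) powr (r-1)) * Lnorm M r h"
    if f: "f \<in> Lp M r" and g: "g \<in> Lp M r" and h: "h \<in> Lp M r" for f g h :: "'a \<Rightarrow> 'b"
  proof -
    have d: "(\<lambda>x. f x - g x) \<in> Lp M r" using r f g by (intro Lp_diff) auto
    note I = Lpair_integrable[OF r f h] Lpair_integrable[OF r g h]
      Lp_holder_integrable[OF r f h] Lp_holder_integrable[OF r g h] Lp_holder_integrable[OF r d h]
    have "\<bar>Lpair M r f h - Lpair M r g h\<bar> = norm (LINT x|M. pdual r (f x) \<bullet> h x - pdual r (g x) \<bullet> h x)"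
      using I by (simp add: Lpair_def)
    also have "\<dots> \<le> (LINT x|M. norm (pdual r (f x) \<bullet> h x - pdual r (g x) \<bullet> h x))"
      by (rule integral_norm_bound)
    also have "\<dots> \<le> (LINT x|M. e * (norm (f x) powr (r-1) * norm (h x) + norm (g x) powr (r-1) * norm (h x))
       + C * (norm (f x - g x) powr (r-1) * norm (h x)))"
    proof (rule integral_mono)
      fix x
      have "norm (pdual r (f x) \<bullet> h x - pdual r (g x) \<bullet> h x) = \<bar>(pdual r (f x) - pdual r (g x)) \<bullet> h x\<bar>"
        by (simp add: inner_diff_left)
      also have "\<dots> \<le> norm (pdual r (f x) - pdual r (g x)) * norm (h x)" by (rule Cauchy_Schwarz_ineq2)
      also have "\<dots> \<le> (e * (norm (f x) powr (r - 1) + norm (g x) powr (r - 1)) + C * norm (f x - g x) powr (r - 1)) * norm (h x)"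
        by (intro mult_right_mono C(2)) auto
      finally show "norm (pdual r (f x) \<bullet> h x - pdual r (g x) \<bullet> h x) \<le>
        e * (norm (f x) powr (r-1) * norm (h x) + norm (g x) powr (r-1) * norm (h x))
       + C * (norm (f x - g x) powr (r-1) * norm (h x))" by (simp add: algebra_simps)
    qed (use I in auto)
    also have "\<dots> = e * ((LINT x|M. norm (f x) powr (r-1) * norm (h x)) + (LINT x|M. norm (g x) powr (r-1) * norm (h x)))
       + C * (LINT x|M. norm (f x - g x) powr (r-1) * norm (h x))"
      using I by simp
    also have "\<dots> \<le> e * (Lnorm M r f powr (r - 1) * Lnorm M r h + Lnorm M r g powr (r - 1) * Lnorm M r h)
       + C * (Lnorm M r (\<lambda>x. f x - g x) powr (r - 1) * Lnorm M r h)"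
      using e C(1) Lp_holder[OF r f h] Lp_holder[OF r g h] Lp_holder[OF r d h]
      by (intro add_mono mult_left_mono) auto
    finally show ?thesis by (simp add: algebra_simps)
  qed
  with C(1) show ?thesis by blast
qed

text \<open>By convexity the remainder lies between \<open>0\<close> and \<open>r\<close> times the difference of the pairings with the duals at \<open>f + h\<close> and at \<open>f\<close>, so uniform continuity of the
duality map gives the estimate, for \<open>r < 2\<close> as well as for \<open>r \<ge> 2\<close>.\<close>

lemma Lint_frechet:
  assumes r: "r > 1" and f: "f \<in> Lp M r" and e: "e > 0"
  shows "\<exists>d>0. \<forall>h \<in> Lp M r. Lnorm M r h < d \<longrightarrow>
    \<bar>Lint M r (\<lambda>x. f x + h x :: 'b::euclidean_space) - Lint M r f - r * Lpair M r f h\<bar> \<le> e * Lnorm M r h"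
proof -
  define B where "B = Lnorm M r f powr (r-1) + (Lnorm M r f + 1) powr (r-1) + 1"
  have B: "B > 0" unfolding B_def by (intro add_nonneg_pos add_nonneg_nonneg) auto
  define e' where "e' = e / (2 * r * B)"
  have e': "e' > 0" using r e B by (simp add: e'_def)
  obtain C where C: "C \<ge> 0" "\<And>f g h :: 'a \<Rightarrow> 'b. f \<in> Lp M r \<Longrightarrow> g \<in> Lp M r \<Longrightarrow> h \<in> Lp M r \<Longrightarrow>
     \<bar>Lpair M r f h - Lpair M r g h\<bar>
     \<le> (e' * (Lnorm M r f powr (r-1) + Lnorm M r g powr (r-1)) + C * Lnorm M r (\<lambda>x. f x - g x) powr (r-1)) * Lnorm M r h"
    using Lpair_continuity[OF r e', of M] by blast
  define d where "d = min 1 ((e / (2 * r * (C + 1))) powr (1 / (r - 1)))"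
  have d: "d > 0" "d \<le> 1" using r e C(1) by (auto simp: d_def)
  have "\<bar>Lint M r (\<lambda>x. f x + h x) - Lint M r f - r * Lpair M r f h\<bar> \<le> e * Lnorm M r h"
    if h: "h \<in> Lp M r" and hd: "Lnorm M r h < d" for h
  proof -
    have fh: "(\<lambda>x. f x + h x) \<in> Lp M r" using r f h by (intro Lp_add) auto
    have 1: "Lint M r f + r * Lpair M r f h \<le> Lint M r (\<lambda>x. f x + h x)"
      using Lint_tangent[OF r f fh] by simp
    have mh: "(\<lambda>x. - h x) \<in> Lp M r" using h by (rule Lp_uminus)
    have "Lpair M r (\<lambda>x. f x + h x) (\<lambda>x. - h x) = - Lpair M r (\<lambda>x. f x + h x) h"
      by (simp add: Lpair_def)
    then have 2: "Lint M r (\<lambda>x. f x + h x) - r * Lpair M r (\<lambda>x. f x + h x) h \<le> Lint M r f"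
      using Lint_tangent[OF r fh f] by simp
    have "\<bar>Lint M r (\<lambda>x. f x + h x) - Lint M r f - r * Lpair M r f h\<bar>
       \<le> r * \<bar>Lpair M r (\<lambda>x. f x + h x) h - Lpair M r f h\<bar>"
    proof -
      have "r * (Lpair M r (\<lambda>x. f x + h x) h - Lpair M r f h) \<le> r * \<bar>Lpair M r (\<lambda>x. f x + h x) h - Lpair M r f h\<bar>"
        using r by (intro mult_left_mono) auto
      with 1 2 show ?thesis by (simp add: right_diff_distrib)
    qed
    also have "\<dots> \<le> r * ((e' * (Lnorm M r (\<lambda>x. f x + h x) powr (r-1) + Lnorm M r f powr (r-1))
         + C * Lnorm M r h powr (r-1)) * Lnorm M r h)"
      using C(2)[OF fh f h] r by (intro mult_left_mono) auto
    also have "\<dots> \<le> r * ((e' * B + e / (2 * r)) * Lnorm M r h)"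
    proof (intro mult_left_mono mult_right_mono add_mono)
      have "Lnorm M r (\<lambda>x. f x + h x) \<le> Lnorm M r f + 1"
        using Lp_minkowski[OF r f h] hd d by linarith
      then have "Lnorm M r (\<lambda>x. f x + h x) powr (r-1) \<le> (Lnorm M r f + 1) powr (r-1)"
        using r by (intro powr_mono2) auto
      then show "Lnorm M r (\<lambda>x. f x + h x) powr (r-1) + Lnorm M r f powr (r-1) \<le> B"
        by (simp add: B_def)
      have "Lnorm M r h powr (r-1) \<le> ((e / (2 * r * (C + 1))) powr (1 / (r - 1))) powr (r - 1)"
        using hd r by (intro powr_mono2) (auto simp: d_def)
      also have "\<dots> = e / (2 * r * (C + 1))" using r e C(1) by (simp add: powr_powr)
      finally have "C * Lnorm M r h powr (r-1) \<le> C * (e / (2 * r * (C + 1)))"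
        using C(1) by (intro mult_left_mono)
      also have "\<dots> \<le> (C + 1) * (e / (2 * r * (C + 1)))" using e r C(1) by (intro mult_right_mono) auto
      also have "\<dots> = e / (2 * r)" using C(1) by simp
      finally show "C * Lnorm M r h powr (r-1) \<le> e / (2 * r)" .
    qed (use e' r in auto)
    also have "\<dots> = e * Lnorm M r h" using r B by (simp add: e'_def field_simps)
    finally show ?thesis .
  qed
  with d(1) show ?thesis by blast
qed

text \<open>The constant is not the sharp one. Normalise \<open>f\<close> in \<open>L\<^sup>p\<close> and integrate \<open>x powr q \<le> 1 + x powr p\<close>.\<close>

lemma Lp_nested:
  assumes "finite_measure M" and qp: "0 < q" "q < p" and f: "f \<in> Lp M p"
  shows "f \<in> Lp M q" and "Lnorm M q f \<le> (measure M (space M) + 1) powr (1/q) * Lnorm M p f"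
proof -
  interpret finite_measure M by fact
  have pw: "x powr q \<le> 1 + x powr p" if "x \<ge> 0" for x :: real
  proof (cases "x \<le> 1")
    case True
    have "x powr q \<le> 1 powr q" using True that qp by (intro powr_mono2) auto
    then show ?thesis by (simp add: add_increasing2)
  next
    case False
    then have "x powr q \<le> x powr p" using qp by (intro powr_mono) auto
    then show ?thesis by simp
  qed
  have I: "integrable M (\<lambda>x. c + k * norm (f x) powr p)" for c k
    using LpD(2)[OF f] by auto
  show fq: "f \<in> Lp M q"
  proof (rule Lp_dominated[OF _ I[of 1 1]])
    show "f \<in> borel_measurable M" using LpD[OF f] by auto
    show "AE x in M. norm (f x) powr q \<le> 1 + 1 * norm (f x) powr p" using pw by auto
  qed
  define a where "a = Lnorm M p f"
  show "Lnorm M q f \<le> (measure M (space M) + 1) powr (1/q) * Lnorm M p f"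
  proof (cases "a = 0")
    case True
    then have "Lnorm M q f = 0"
      using Lnorm_eq_0_iff[OF f] Lnorm_eq_0_iff[OF fq] qp by (auto simp: a_def)
    then show ?thesis by simp
  next
    case False
    then have a: "a > 0" by (simp add: a_def order_less_le)
    have "Lint M q f = (LINT x|M. a powr q * (norm (f x) / a) powr q)"
      unfolding Lint_def using a by (simp add: powr_divide)
    also have "\<dots> \<le> (LINT x|M. a powr q * (1 + (1 / a powr p) * norm (f x) powr p))"
    proof (rule integral_mono)
      show "integrable M (\<lambda>x. a powr q * (norm (f x) / a) powr q)"
        using LpD(2)[OF fq] a by (simp add: powr_divide)
      show "integrable M (\<lambda>x. a powr q * (1 + (1 / a powr p) * norm (f x) powr p))"
        using I[of 1 "1 / a powr p"] by (intro integrable_mult_right)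
      show "a powr q * (norm (f x) / a) powr q \<le> a powr q * (1 + (1 / a powr p) * norm (f x) powr p)" for x
        using pw[of "norm (f x) / a"] a by (intro mult_left_mono) (auto simp: powr_divide)
    qed
    also have "\<dots> = a powr q * (measure M (space M) + (1 / a powr p) * Lint M p f)"
      using LpD(2)[OF f] by (simp add: Lint_def)
    also have "(1 / a powr p) * Lint M p f = 1"
      using a qp by (simp add: a_def flip: Lnorm_powr)
    finally have "Lint M q f powr (1/q) \<le> (a powr q * (measure M (space M) + 1)) powr (1/q)"
      using qp by (intro powr_mono2) auto
    also have "\<dots> = (measure M (space M) + 1) powr (1/q) * a"
      using a qp by (simp add: powr_mult powr_powr)
    finally show ?thesis by (simp add: Lnorm_def a_def)
  qed
qed

text \<open>Riesz-Fischer: along a subsequence with rapidly decreasing increments the telescoping series converges absolutely almost everywhere, and its sum is the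
limit in the norm.\<close>

lemma Lp_complete:
  fixes f :: "nat \<Rightarrow> 'a \<Rightarrow> 'b::euclidean_space"
  assumes r: "r > 1" and f: "\<And>n. f n \<in> Lp M r"
    and cauchy: "\<And>e. e > 0 \<Longrightarrow> \<exists>N. \<forall>m\<ge>N. \<forall>n\<ge>N. Lnorm M r (\<lambda>x. f m x - f n x) < e"
  shows "\<exists>g\<in>Lp M r. (\<lambda>n. Lnorm M r (\<lambda>x. f n x - g x)) \<longlonglongrightarrow> 0"
proof -
  define N where "N e = (SOME N. \<forall>m\<ge>N. \<forall>n\<ge>N. Lnorm M r (\<lambda>x. f m x - f n x) < e)" for e
  have N: "Lnorm M r (\<lambda>x. f m x - f n x) < e" if "e > 0" "m \<ge> N e" "n \<ge> N e" for e m n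
    using someI_ex[OF cauchy[OF that(1)]] that(2,3) unfolding N_def by blast
  define s where "s = rec_nat (N (1/4)) (\<lambda>k m. max (Suc m) (N ((1/4)^(k+2))))"
  have s_Suc: "s (Suc k) = max (Suc (s k)) (N ((1/4)^(k+2)))" for k by (simp add: s_def)
  have sN: "s k \<ge> N ((1/4)^(k+1))" for k by (cases k) (auto simp: s_Suc, simp add: s_def)
  have smono: "strict_mono s" unfolding strict_mono_Suc_iff by (simp add: s_Suc less_max_iff_disj)
  define g where "g k x = f (s (Suc k)) x - f (s k) x" for k x
  have gLp: "g k \<in> Lp M r" for k unfolding g_def[abs_def] using r f by (intro Lp_diff) auto
  have gN: "Lnorm M r (g k) < (1/4)^(k+1)" for k
    unfolding g_def[abs_def] using sN[of k] smono[unfolded strict_mono_Suc_iff, rule_format, of k]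
    by (intro N) auto
  have [measurable]: "f n \<in> borel_measurable M" "g n \<in> borel_measurable M" for n
    using LpD(1)[OF f] LpD(1)[OF gLp] by auto
  \<comment> \<open>Weighting the increments makes their a.e. summability geometric.\<close>
  have "(\<integral>\<^sup>+x. (\<Sum>k. ennreal ((2^k) powr r * norm (g k x) powr r)) \<partial>M)
      = (\<Sum>k. \<integral>\<^sup>+x. ennreal ((2^k) powr r * norm (g k x) powr r) \<partial>M)"
    by (rule nn_integral_suminf) simp
  also have "\<dots> = (\<Sum>k. ennreal ((2^k) powr r * Lint M r (g k)))"
  proof (intro suminf_cong)
    fix k
    have "(\<integral>\<^sup>+x. ennreal ((2^k) powr r * norm (g k x) powr r) \<partial>M) = ennreal (LINT x|M. (2^k) powr r * norm (g k x) powr r)"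
      using LpD(2)[OF gLp[of k]] by (intro nn_integral_eq_integral) auto
    then show "(\<integral>\<^sup>+x. ennreal ((2^k) powr r * norm (g k x) powr r) \<partial>M) = ennreal ((2^k) powr r * Lint M r (g k))"
      by (simp add: Lint_def)
  qed
  also have "\<dots> \<le> (\<Sum>k. ennreal ((1/2)^k))"
  proof (intro suminf_le ennreal_leI)
    fix k
    have "(2^k) powr r * Lint M r (g k) = (2^k * Lnorm M r (g k)) powr r"
      using r by (simp add: powr_mult Lnorm_powr)
    also have "\<dots> \<le> ((1/2)^k) powr r"
    proof (intro powr_mono2)
      have "2^k * Lnorm M r (g k) \<le> 2^k * (1/4)^(k+1)" using gN[of k] by (intro mult_left_mono) auto
      also have "\<dots> = (1/4) * (1/2)^k" by (simp add: power_mult_distrib[symmetric])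
      also have "\<dots> \<le> (1/2)^k" by simp
      finally show "2 ^ k * Lnorm M r (g k) \<le> (1 / 2) ^ k" .
    qed (use r in auto)
    also have "\<dots> \<le> ((1/2)^k) powr 1" using r by (intro powr_mono') (auto simp: power_le_one)
    finally show "(2^k) powr r * Lint M r (g k) \<le> (1/2)^k" by simp
  qed auto
  also have "\<dots> < \<infinity>" by (subst suminf_ennreal2) auto
  finally have "AE x in M. (\<Sum>k. ennreal ((2^k) powr r * norm (g k x) powr r)) \<noteq> \<infinity>"
    by (intro nn_integral_noteq_infinite) auto
  then have conv: "AE x in M. convergent (\<lambda>k. f (s k) x)"
  proof eventually_elim
    fix x assume fin: "(\<Sum>k. ennreal ((2^k) powr r * norm (g k x) powr r)) \<noteq> \<infinity>"
    define B where "B = enn2real (\<Sum>k. ennreal ((2^k) powr r * norm (g k x) powr r))"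
    have B: "ennreal B = (\<Sum>k. ennreal ((2^k) powr r * norm (g k x) powr r))" "B \<ge> 0"
      using fin by (auto simp: B_def less_top)
    have bnd: "norm (g k x) \<le> B powr (1/r) * (1/2)^k" for k
    proof -
      define t where "t = (\<lambda>k. ennreal ((2^k) powr r * norm (g k x) powr r))"
      have "sum t {k} \<le> suminf t" by (rule sum_le_suminf) auto
      then have "ennreal ((2^k) powr r * norm (g k x) powr r) \<le> ennreal B"
        unfolding B(1) by (simp only: t_def sum.insert sum.empty finite.emptyI empty_iff not_False_eq_True add_0_right)
      then have "(2^k * norm (g k x)) powr r \<le> B" using B(2) by (simp add: powr_mult)
      then have "((2^k * norm (g k x)) powr r) powr (1/r) \<le> B powr (1/r)" using r by (intro powr_mono2) auto
      then have "2^k * norm (g k x) \<le> B powr (1/r)" using r by (simp add: powr_powr)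
      then show ?thesis by (simp add: field_simps)
    qed
    have "summable (\<lambda>k. B powr (1/r) * (1/2)^k)"
      by (intro summable_mult summable_geometric) simp
    then have "summable (\<lambda>k. g k x)"
      by (rule summable_comparison_test'[where N = 0]) (rule bnd)
    then have "convergent (\<lambda>n. \<Sum>k<n. g k x)" by (simp add: summable_iff_convergent)
    moreover have "(\<Sum>k<n. g k x) = f (s n) x - f (s 0) x" for n
      unfolding g_def by (rule sum_lessThan_telescope)
    ultimately have "convergent (\<lambda>n. f (s n) x - f (s 0) x)" by simp
    then show "convergent (\<lambda>k. f (s k) x)" by (simp add: convergent_diff_const_right_iff)
  qed
  define h where "h x = lim (\<lambda>k. f (s k) x)" for x
  have [measurable]: "h \<in> borel_measurable M" unfolding h_def[abs_def] by (rule borel_measurable_lim_metric) simp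
  have key: "(\<integral>\<^sup>+x. ennreal (norm (f m x - h x) powr r) \<partial>M) \<le> ennreal (e powr r)" if "e > 0" "m \<ge> N e" for e m
  proof -
    have "(\<integral>\<^sup>+x. ennreal (norm (f m x - h x) powr r) \<partial>M)
        = (\<integral>\<^sup>+x. liminf (\<lambda>k. ennreal (norm (f m x - f (s k) x) powr r)) \<partial>M)"
    proof (intro nn_integral_cong_AE)
      show "AE x in M. ennreal (norm (f m x - h x) powr r) = liminf (\<lambda>k. ennreal (norm (f m x - f (s k) x) powr r))"
        using conv
      proof eventually_elim
        fix x assume "convergent (\<lambda>k. f (s k) x)"
        then have "(\<lambda>k. f (s k) x) \<longlonglongrightarrow> h x" by (simp add: h_def convergent_LIMSEQ_iff)
        then have "(\<lambda>k. ennreal (norm (f m x - f (s k) x) powr r)) \<longlonglongrightarrow> ennreal (norm (f m x - h x) powr r)"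
          using r by (intro tendsto_ennrealI tendsto_powr' tendsto_intros) auto
        then show "ennreal (norm (f m x - h x) powr r) = liminf (\<lambda>k. ennreal (norm (f m x - f (s k) x) powr r))"
          using lim_imp_Liminf[OF trivial_limit_sequentially] by metis
      qed
    qed
    also have "\<dots> \<le> liminf (\<lambda>k. \<integral>\<^sup>+x. ennreal (norm (f m x - f (s k) x) powr r) \<partial>M)"
      by (rule nn_integral_liminf) simp
    also have "\<dots> \<le> ennreal (e powr r)"
    proof -
      have "\<forall>\<^sub>F k in sequentially. (\<integral>\<^sup>+x. ennreal (norm (f m x - f (s k) x) powr r) \<partial>M) \<le> ennreal (e powr r)"
        using eventually_ge_at_top[of "N e"]
      proof eventually_elim
        fix k assume "N e \<le> k"
        then have "s k \<ge> N e" using seq_suble[OF smono, of k] by simp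
        then have "Lnorm M r (\<lambda>x. f m x - f (s k) x) < e" using that by (intro N) auto
        then have "Lnorm M r (\<lambda>x. f m x - f (s k) x) powr r \<le> e powr r" using r by (intro powr_mono2) auto
        then have "Lint M r (\<lambda>x. f m x - f (s k) x) \<le> e powr r" using r by (simp add: Lnorm_powr)
        moreover have "(\<lambda>x. f m x - f (s k) x) \<in> Lp M r" using f r by (intro Lp_diff) auto
        then have "(\<integral>\<^sup>+x. ennreal (norm (f m x - f (s k) x) powr r) \<partial>M) = ennreal (Lint M r (\<lambda>x. f m x - f (s k) x))"
          unfolding Lint_def using LpD(2) by (intro nn_integral_eq_integral) auto
        ultimately show "(\<integral>\<^sup>+x. ennreal (norm (f m x - f (s k) x) powr r) \<partial>M) \<le> ennreal (e powr r)"
          by (simp add: ennreal_leI)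
      qed
      then have "liminf (\<lambda>k. \<integral>\<^sup>+x. ennreal (norm (f m x - f (s k) x) powr r) \<partial>M) \<le> liminf (\<lambda>k::nat. ennreal (e powr r))"
        by (rule Liminf_mono)
      then show ?thesis by (simp add: Liminf_const)
    qed
    finally show ?thesis .
  qed
  have dLp: "(\<lambda>x. f m x - h x) \<in> Lp M r" if "e > 0" "m \<ge> N e" for e m
  proof (rule LpI)
    show "integrable M (\<lambda>x. norm (f m x - h x) powr r)"
      using key[OF that] by (intro integrableI_bounded) (auto intro: le_less_trans)
  qed simp
  have dN: "Lnorm M r (\<lambda>x. f m x - h x) \<le> e" if "e > 0" "m \<ge> N e" for e m
  proof -
    have "ennreal (Lint M r (\<lambda>x. f m x - h x)) \<le> ennreal (e powr r)"
      using key[OF that] LpD(2)[OF dLp[OF that]] unfolding Lint_def by (subst (asm) nn_integral_eq_integral) auto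
    then have "Lint M r (\<lambda>x. f m x - h x) powr (1/r) \<le> (e powr r) powr (1/r)" using r by (intro powr_mono2) auto
    then show ?thesis using r that by (simp add: Lnorm_def powr_powr)
  qed
  have "(\<lambda>x. f (N 1) x - (f (N 1) x - h x)) \<in> Lp M r"
    by (rule Lp_diff[OF _ f dLp[of 1]]) (use r in auto)
  then have "h \<in> Lp M r" by simp
  moreover have "(\<lambda>n. Lnorm M r (\<lambda>x. f n x - h x)) \<longlonglongrightarrow> 0"
  proof (rule LIMSEQ_I)
    fix e :: real assume "e > 0"
    have "norm (Lnorm M r (\<lambda>x. f n x - h x) - 0) < e" if "n \<ge> N (e/2)" for n
      using dN[of "e/2" n] that \<open>e > 0\<close> by simp
    then show "\<exists>n0. \<forall>n\<ge>n0. norm (Lnorm M r (\<lambda>x. f n x - h x) - 0) < e" by blast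
  qed
  ultimately show ?thesis by blast
qed

section \<open>Genus and fixed points of compact odd maps\<close>

text \<open>Existence of an odd continuous map from \<open>A\<close> to \<open>\<real>\<^sup>k\<close> without zeros, given by its components. Compared with the genus this avoids infima, and extending one
component at a time is easier than extending a map into the punctured space.\<close>

definition odd_separated :: "'b::ab_group_add topology \<Rightarrow> 'b set \<Rightarrow> nat \<Rightarrow> bool" where
  "odd_separated X A k \<longleftrightarrow> (\<exists>f :: nat \<Rightarrow> 'b \<Rightarrow> real.
     (\<forall>i<k. continuous_map (subtopology X A) euclideanreal (f i) \<and> (\<forall>u\<in>A. f i (- u) = - f i u)) \<and>
     (\<forall>u\<in>A. \<exists>i<k. f i u \<noteq> 0))"

lemma odd_separated_genus:
  assumes "odd_separated X A k" "enat l \<le> genus X A"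
  shows "l \<le> k"
proof (cases "A = {}")
  case True
  with assms show ?thesis by (simp add: genus_def zero_enat_def)
next
  case False
  obtain f :: "nat \<Rightarrow> 'a \<Rightarrow> real" where f:
     "\<And>i. i < k \<Longrightarrow> continuous_map (subtopology X A) euclideanreal (f i)"
     "\<And>i u. i < k \<Longrightarrow> u \<in> A \<Longrightarrow> f i (- u) = - f i u" "\<And>u. u \<in> A \<Longrightarrow> \<exists>i<k. f i u \<noteq> 0"
    using assms(1) unfolding odd_separated_def by blast
  define h where "h u i = (if i < k then f i u else 0)" for u i
  have "continuous_map (subtopology X A) (subtopology (Euclidean_space k) (- {\<lambda>_. 0})) h"
    unfolding continuous_map_in_subtopology
  proof
    show "continuous_map (subtopology X A) (Euclidean_space k) h"
      unfolding h_def using f(1) by (subst continuous_map_componentwise_Euclidean_space) auto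
    show "h \<in> topspace (subtopology X A) \<rightarrow> - {\<lambda>_. 0}"
    proof
      fix u assume "u \<in> topspace (subtopology X A)"
      then obtain i where "i < k" "f i u \<noteq> 0" using f(3)[of u] by auto
      then have "h u i \<noteq> 0" by (simp add: h_def)
      then show "h u \<in> - {\<lambda>_. 0}" by auto
    qed
  qed
  moreover have "\<forall>u\<in>A. h (- u) = (\<lambda>i. - h u i)" using f(2) by (auto simp: h_def)
  ultimately have "genus X A \<le> enat k"
    unfolding genus_def using False by (auto intro!: Inf_lower)
  with assms(2) show ?thesis by (meson enat_ord_simps(1) order_trans)
qed

lemma odd_separated_empty: "odd_separated X {} k"
  by (simp add: odd_separated_def)

lemma odd_separated_mono: "odd_separated X A k \<Longrightarrow> k \<le> m \<Longrightarrow> odd_separated X A m"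
proof -
  assume "odd_separated X A k" and km: "k \<le> m"
  then obtain f :: "nat \<Rightarrow> 'a \<Rightarrow> real" where f:
     "\<And>i. i < k \<Longrightarrow> continuous_map (subtopology X A) euclideanreal (f i)"
     "\<And>i u. i < k \<Longrightarrow> u \<in> A \<Longrightarrow> f i (- u) = - f i u" "\<And>u. u \<in> A \<Longrightarrow> \<exists>i<k. f i u \<noteq> 0"
    unfolding odd_separated_def by blast
  show ?thesis
    unfolding odd_separated_def
  proof (intro exI[of _ "\<lambda>i. if i < k then f i else (\<lambda>_. 0)"] conjI allI impI ballI)
    fix u assume "u \<in> A"
    then obtain i where "i < k" "f i u \<noteq> 0" using f(3) by blast
    then show "\<exists>i<m. (if i < k then f i else (\<lambda>_. 0)) u \<noteq> 0" using km by (intro exI[of _ i]) auto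
  qed (use f in auto)
qed

text \<open>Odd continuous maps do not lower the genus: compose.\<close>

lemma odd_separated_image:
  fixes X :: "'a::ab_group_add topology" and Y :: "'b::ab_group_add topology"
  assumes "odd_separated Y B k" and f: "continuous_map (subtopology X A) (subtopology Y B) f"
    and A: "A \<subseteq> topspace X" and odd: "\<And>u. u \<in> A \<Longrightarrow> f (- u) = - f u"
  shows "odd_separated X A k"
proof -
  obtain g :: "nat \<Rightarrow> 'b \<Rightarrow> real" where g:
     "\<And>i. i < k \<Longrightarrow> continuous_map (subtopology Y B) euclideanreal (g i)"
     "\<And>i u. i < k \<Longrightarrow> u \<in> B \<Longrightarrow> g i (- u) = - g i u" "\<And>u. u \<in> B \<Longrightarrow> \<exists>i<k. g i u \<noteq> 0"
    using assms(1) unfolding odd_separated_def by blast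
  have fB: "f u \<in> B" if "u \<in> A" for u
    using f A that by (auto simp: continuous_map_in_subtopology Pi_iff)
  show ?thesis
    unfolding odd_separated_def
  proof (intro exI[of _ "\<lambda>i. g i \<circ> f"] conjI allI impI ballI)
    show "continuous_map (subtopology X A) euclideanreal (g i \<circ> f)" if "i < k" for i
      using f g(1)[OF that] by (rule continuous_map_compose)
  qed (use g fB odd in auto)
qed

text \<open>Subadditivity of the genus in the only case required. Extend the separating functions from the closed set \<open>g = 0\<close> to \<open>A\<close> by Tietze's theorem and
take their odd parts; where these may all vanish, \<open>g\<close> does not.\<close>

lemma odd_separated_Suc:
  assumes X: "metrizable_space X" and A: "A \<subseteq> topspace X" "\<And>u. u \<in> A \<Longrightarrow> - u \<in> A"
    and min: "continuous_map (subtopology X A) (subtopology X A) uminus"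
    and g: "continuous_map (subtopology X A) euclideanreal g" "\<And>u. u \<in> A \<Longrightarrow> g (- u) = - g u"
    and sep: "odd_separated X {u \<in> A. g u = 0} k"
  shows "odd_separated X A (Suc k)"
proof -
  define Y where "Y = subtopology X A"
  define A' where "A' = {u \<in> A. g u = 0}"
  have tY: "topspace Y = A" using A by (auto simp: Y_def)
  have nY: "normal_space Y"
    unfolding Y_def using X by (intro metrizable_imp_normal_space metrizable_space_subtopology)
  have cA': "closedin Y A'"
  proof -
    have "closedin Y {u \<in> topspace Y. g u \<in> {0}}"
      using g(1) by (intro closedin_continuous_map_preimage[of _ euclideanreal]) (auto simp: Y_def)
    then show ?thesis by (simp add: tY A'_def)
  qed
  have sY: "subtopology Y A' = subtopology X A'"
    unfolding Y_def subtopology_subtopology by (rule arg_cong[of _ _ "subtopology X"]) (auto simp: A'_def)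
  obtain f :: "nat \<Rightarrow> 'a \<Rightarrow> real" where f:
     "\<And>i. i < k \<Longrightarrow> continuous_map (subtopology X A') euclideanreal (f i)"
     "\<And>i u. i < k \<Longrightarrow> u \<in> A' \<Longrightarrow> f i (- u) = - f i u" "\<And>u. u \<in> A' \<Longrightarrow> \<exists>i<k. f i u \<noteq> 0"
    using sep unfolding odd_separated_def A'_def by blast
  have "\<forall>i. \<exists>F. i < k \<longrightarrow> continuous_map Y euclideanreal F \<and> (\<forall>u\<in>A'. F u = f i u)"
  proof
    fix i
    show "\<exists>F. i < k \<longrightarrow> continuous_map Y euclideanreal F \<and> (\<forall>u\<in>A'. F u = f i u)"
    proof (cases "i < k")
      case True
      then have "continuous_map (subtopology Y A') euclideanreal (f i)" using f(1) sY by simp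
      then obtain F where "continuous_map Y euclideanreal F" "\<And>u. u \<in> A' \<Longrightarrow> F u = f i u"
        using Tietze_extension_realinterval[OF nY cA' is_interval_univ, of "f i"] by auto
      then show ?thesis by blast
    qed simp
  qed
  then obtain F where F: "\<And>i. i < k \<Longrightarrow> continuous_map Y euclideanreal (F i)"
      "\<And>i u. i < k \<Longrightarrow> u \<in> A' \<Longrightarrow> F i u = f i u"
    by metis
  define G where "G i = (if i < k then (\<lambda>u. (F i u - F i (- u)) / 2) else g)" for i
  have minY: "continuous_map Y Y uminus" using min by (simp add: Y_def)
  show ?thesis
    unfolding odd_separated_def
  proof (intro exI[of _ G] conjI allI impI ballI)
    fix i assume "i < Suc k"
    show "continuous_map (subtopology X A) euclideanreal (G i)"
    proof (cases "i < k")
      case True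
      have "continuous_map Y euclideanreal (F i \<circ> uminus)"
        using minY F(1)[OF True] by (rule continuous_map_compose)
      then have "continuous_map Y euclideanreal (\<lambda>u. F i (- u))" by (simp add: o_def)
      then have "continuous_map Y euclideanreal (\<lambda>u. (F i u - F i (- u)) / 2)"
        using F(1)[OF True] by (intro continuous_intros) auto
      with True show ?thesis by (simp add: G_def Y_def)
    qed (use g in \<open>simp add: G_def\<close>)
  next
    fix i u assume "i < Suc k" "u \<in> A"
    then show "G i (- u) = - G i u" using g(2) by (auto simp: G_def diff_divide_distrib)
  next
    fix u assume u: "u \<in> A"
    show "\<exists>i<Suc k. G i u \<noteq> 0"
    proof (cases "g u = 0")
      case False
      then show ?thesis by (intro exI[of _ k]) (simp add: G_def)
    next
      case True
      then have uA': "u \<in> A'" "- u \<in> A'" using u A(2) g(2) by (auto simp: A'_def)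
      obtain i where i: "i < k" "f i u \<noteq> 0" using f(3)[OF uA'(1)] by blast
      then have "G i u = f i u" using F(2) f(2) uA' by (simp add: G_def)
      with i show ?thesis by (intro exI[of _ i]) auto
    qed
  qed
qed

lemma half_of_symmetric_finite:
  fixes K :: "'b::group_add set"
  assumes "finite K" "\<And>u. u \<in> K \<Longrightarrow> - u \<in> K" "\<And>u. u \<in> K \<Longrightarrow> - u \<noteq> u"
  shows "\<exists>F. F \<subseteq> K \<and> (\<forall>u\<in>K. u \<in> F \<or> - u \<in> F) \<and> (\<forall>u\<in>F. - u \<notin> F)"
  using assms
proof (induction K rule: finite_psubset_induct)
  case (psubset K)
  show ?case
  proof (cases "K = {}")
    case False
    then obtain x where x: "x \<in> K" by blast
    define K' where "K' = K - {x, - x}"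
    have "K' \<subset> K" using x by (auto simp: K'_def)
    moreover have "- u \<in> K'" if "u \<in> K'" for u using that psubset.prems(1) by (auto simp: K'_def)
    ultimately have "\<exists>F. F \<subseteq> K' \<and> (\<forall>u\<in>K'. u \<in> F \<or> - u \<in> F) \<and> (\<forall>u\<in>F. - u \<notin> F)"
      using psubset.prems(2) by (intro psubset.IH) (auto simp: K'_def)
    then obtain F where F: "F \<subseteq> K'" "\<And>u. u \<in> K' \<Longrightarrow> u \<in> F \<or> - u \<in> F" "\<And>u. u \<in> F \<Longrightarrow> - u \<notin> F" by blast
    have "x \<noteq> - x" using psubset.prems(2)[OF x] by simp
    have "u \<in> insert x F \<or> - u \<in> insert x F" if "u \<in> K" for u
    proof (cases "u = - x")
      case False
      then show ?thesis using F(2)[of u] that by (auto simp: K'_def)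
    qed simp
    moreover have "- u \<notin> insert x F" if "u \<in> insert x F" for u
      using that F(1) F(3)[of u] \<open>x \<noteq> - x\<close> by (auto simp: K'_def)
    moreover have "insert x F \<subseteq> K" using F(1) x by (auto simp: K'_def)
    ultimately show ?thesis by blast
  qed simp
qed

lemma (in Metric_space) continuous_map_sequential:
  assumes M': "Metric_space M' d'" and f: "f ` M \<subseteq> M'"
    and lim: "\<And>s a. a \<in> M \<Longrightarrow> (\<And>n :: nat. s n \<in> M) \<Longrightarrow> (\<lambda>n. d (s n) a) \<longlonglongrightarrow> 0 \<Longrightarrow>
      (\<lambda>n. d' (f (s n)) (f a)) \<longlonglongrightarrow> 0"
  shows "continuous_map mtopology (Metric_space.mtopology M' d') f"
  unfolding metric_continuous_map[OF M']
proof (intro conjI ballI allI impI f)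
  interpret M': Metric_space M' d' by fact
  fix a and e :: real assume a: "a \<in> M" and e: "e > 0"
  show "\<exists>\<delta>>0. \<forall>x. x \<in> M \<and> d a x < \<delta> \<longrightarrow> d' (f a) (f x) < e"
  proof (rule ccontr)
    assume "\<not> ?thesis"
    then have "\<exists>x. x \<in> M \<and> d a x < inverse (real (Suc n)) \<and> \<not> d' (f a) (f x) < e" for n
      by (metis inverse_positive_iff_positive of_nat_0_less_iff zero_less_Suc)
    then obtain s where s: "\<And>n. s n \<in> M" "\<And>n. d a (s n) < inverse (real (Suc n))"
        "\<And>n. \<not> d' (f a) (f (s n)) < e"
      by metis
    have "(\<lambda>n. d (s n) a) \<longlonglongrightarrow> 0"
    proof (rule tendsto_sandwich[OF _ _ tendsto_const LIMSEQ_inverse_real_of_nat])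
      show "\<forall>\<^sub>F n in sequentially. d (s n) a \<le> inverse (real (Suc n))"
        using s(2) by (auto simp: commute less_imp_le)
    qed simp
    then have "(\<lambda>n. d' (f (s n)) (f a)) \<longlonglongrightarrow> 0" using lim a s(1) by blast
    then obtain n where "d' (f (s n)) (f a) < e"
      using LIMSEQ_D[OF _ e] by fastforce
    with s(3)[of n] show False by (simp add: M'.commute)
  qed
qed

text \<open>The setting of the Lusternik-Schnirelmann argument: an odd map that lowers an even functional strictly except at its fixed points, and that is
compact on sublevel sets. Lowering \<open>J\<close> takes the place of a deformation, compactness that of the Palais-Smale condition.\<close>

locale compact_odd_descent = Metric_space X d for X :: "'b::ab_group_add set" and d +
  fixes T :: "'b \<Rightarrow> 'b" and J :: "'b \<Rightarrow> real"
  assumes sym: "u \<in> X \<Longrightarrow> - u \<in> X" and asym: "u \<in> X \<Longrightarrow> - u \<noteq> u"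
    and d_minus: "u \<in> X \<Longrightarrow> v \<in> X \<Longrightarrow> d (- u) (- v) = d u v"
    and T_cont: "continuous_map mtopology mtopology T"
    and T_odd: "u \<in> X \<Longrightarrow> T (- u) = - T u"
    and J_cont: "continuous_map mtopology euclideanreal J"
    and J_even: "u \<in> X \<Longrightarrow> J (- u) = J u"
    and descent: "u \<in> X \<Longrightarrow> J (T u) \<le> J u"
    and strict: "u \<in> X \<Longrightarrow> J (T u) = J u \<Longrightarrow> T u = u"
    and T_compact: "range s \<subseteq> X \<Longrightarrow> (\<And>n. J (s n) \<le> C) \<Longrightarrow>
      \<exists>w r. strict_mono (r :: nat \<Rightarrow> nat) \<and> limitin mtopology (\<lambda>n. T (s (r n))) w sequentially"
begin

lemma T_in: "u \<in> X \<Longrightarrow> T u \<in> X"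
  using T_cont by (auto simp: continuous_map_def)

lemma limit_T: "limitin mtopology s w sequentially \<Longrightarrow> limitin mtopology (\<lambda>n. T (s n)) (T w) sequentially"
  using continuous_map_limit[OF T_cont] by (auto simp: o_def)

lemma limit_J: "limitin mtopology s w sequentially \<Longrightarrow> (\<lambda>n. J (s n)) \<longlonglongrightarrow> J w"
  using continuous_map_limit[OF J_cont] by (auto simp: o_def)

lemma uminus_cont: "continuous_map mtopology mtopology uminus"
  unfolding continuous_map_to_metric
proof (intro ballI allI impI)
  fix x and e :: real assume "x \<in> topspace mtopology" "e > 0"
  then show "\<exists>U. openin mtopology U \<and> x \<in> U \<and> (\<forall>y\<in>U. - y \<in> mball (- x) e)"
    using sym d_minus by (intro exI[of _ "mball x e"]) (auto simp: in_mball)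
qed

definition fixed where "fixed = {u \<in> X. T u = u}"
text \<open>The pairs of fixed points below the level \<open>c\<close>. Values of \<open>J\<close> on pairs are well defined since \<open>J\<close> is even.\<close>

definition pairs where "pairs c = (\<lambda>u. {u, - u}) ` {u \<in> fixed. J u \<le> c}"

lemma fixed_minus: "u \<in> fixed \<Longrightarrow> - u \<in> fixed"
  using sym T_odd by (auto simp: fixed_def)

text \<open>Induction on the number of pairs below \<open>c\<close>. Let \<open>S n\<close> be the image of \<open>A\<close> under \<open>T\<^sup>n\<close> and \<open>m n\<close> the maximum of \<open>J\<close> on it. The decreasing limit
\<open>c'\<close> of \<open>m n\<close> is the level of a fixed point. Finitely many fixed points lie on that level, so there is an odd function \<open>\<sigma>\<close> without
zeros among them, and for large \<open>n\<close> the set \<open>{u \<in> S n. \<sigma> (T u) = 0}\<close> is mapped by \<open>T \<circ> T\<close> strictly below \<open>c'\<close>: otherwise compactness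
would produce a fixed point at level \<open>c'\<close> with \<open>\<sigma> = 0\<close>. The image has fewer pairs below its maximum, and passing back to \<open>A\<close> costs one function.\<close>

lemma separated_by_pairs:
  assumes fin: "finite fixed" and A: "compactin mtopology A" "\<And>u. u \<in> A \<Longrightarrow> - u \<in> A"
    and c: "\<And>u. u \<in> A \<Longrightarrow> J u \<le> c"
  shows "odd_separated mtopology A (card (pairs c))"
  using A c
proof (induction "card (pairs c)" arbitrary: A c rule: less_induct)
  case less
  show ?case
  proof (cases "A = {}")
    case True
    then show ?thesis by (simp add: odd_separated_empty)
  next
    case False
    have AX: "A \<subseteq> X" using less.prems(1) by (auto simp: compactin_def)
    define S where "S n = (T ^^ n) ` A" for n
    have S0: "S 0 = A" and SSuc: "S (Suc n) = T ` S n" for n by (auto simp: S_def image_image)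
    have Scomp: "compactin mtopology (S n)" for n
      by (induction n) (auto simp: S0 SSuc less.prems(1) intro: image_compactin T_cont)
    have SX: "S n \<subseteq> X" for n using Scomp[of n] by (auto simp: compactin_def)
    have Sne: "S n \<noteq> {}" for n using False by (simp add: S_def)
    have Ssym: "- u \<in> S n" if "u \<in> S n" for u n
      using that
    proof (induction n arbitrary: u)
      case (Suc n)
      then obtain v where v: "v \<in> S n" "u = T v" by (auto simp: SSuc)
      then have "- u = T (- v)" using T_odd[of v] SX[of n] by auto
      with Suc.IH[OF v(1)] show ?case by (auto simp: SSuc)
    qed (use less.prems(2) in \<open>simp add: S0\<close>)
    have "\<exists>y\<in>S n. \<forall>u\<in>S n. J u \<le> J y" for n
    proof -
      have "compact (J ` S n)" using image_compactin[OF Scomp J_cont] by simp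
      then show ?thesis using compact_attains_sup[of "J ` S n"] Sne by auto
    qed
    then obtain y where y: "\<And>n. y n \<in> S n" "\<And>n u. u \<in> S n \<Longrightarrow> J u \<le> J (y n)" by metis
    define m where "m n = J (y n)" for n
    have m_dec: "decseq m"
    proof (rule decseq_SucI)
      fix n
      obtain v where "v \<in> S n" "y (Suc n) = T v" using y(1)[of "Suc n"] by (auto simp: SSuc)
      then show "m (Suc n) \<le> m n" using descent[of v] y(2)[of v n] SX by (fastforce simp: m_def)
    qed
    have mc: "m n \<le> c" for n
      using decseqD[OF m_dec, of 0 n] less.prems(3) y(1)[of 0] by (force simp: S0 m_def)
    have "\<exists>v \<in> S n. y (Suc n) = T v" for n using y(1)[of "Suc n"] by (auto simp: SSuc)
    \<comment> \<open>Two backward steps: compactness is available for \<open>T z\<close>, and both \<open>T z\<close> and \<open>T (T z)\<close> must have values of \<open>J\<close> near the limit level.\<close>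
    then obtain x where x: "\<And>n. x n \<in> S n" "\<And>n. y (Suc n) = T (x n)" by metis
    have "\<exists>v \<in> S n. x (Suc n) = T v" for n using x(1)[of "Suc n"] by (auto simp: SSuc)
    then obtain z where z: "\<And>n. z n \<in> S n" "\<And>n. x (Suc n) = T (z n)" by metis
    have "range z \<subseteq> X" using z(1) SX by auto
    moreover have "J (z n) \<le> c" for n using y(2)[OF z(1)[of n]] mc[of n] by (simp add: m_def)
    ultimately obtain w r where r: "strict_mono (r :: nat \<Rightarrow> nat)"
        and lim: "limitin mtopology (\<lambda>n. T (z (r n))) w sequentially"
      using T_compact by blast
    have wX: "w \<in> X" using lim by (auto simp: limitin_def)
    have l1: "(\<lambda>n. J (x (Suc (r n)))) \<longlonglongrightarrow> J w" using limit_J[OF lim] by (simp add: z(2))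
    have l2: "(\<lambda>n. m (Suc (Suc (r n)))) \<longlonglongrightarrow> J (T w)"
      using limit_J[OF limit_T[OF lim]] by (simp add: z(2) x(2) m_def)
    define c' where "c' = J (T w)"
    have m_ge: "c' \<le> m n" for n
    proof (rule LIMSEQ_le_const2[OF l2[folded c'_def]])
      have "m (Suc (Suc (r k))) \<le> m n" if "k \<ge> n" for k
        using seq_suble[OF r, of k] that by (intro decseqD[OF m_dec]) auto
      then show "\<exists>N. \<forall>k\<ge>N. m (Suc (Suc (r k))) \<le> m n" by blast
    qed
    have "m \<longlonglongrightarrow> c'"
    proof (rule LIMSEQ_I)
      fix e :: real assume "e > 0"
      then obtain k where k: "\<bar>m (Suc (Suc (r k))) - c'\<bar> < e"
        using LIMSEQ_D[OF l2[folded c'_def]] by fastforce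
      have "norm (m n - c') < e" if "n \<ge> Suc (Suc (r k))" for n
        using decseqD[OF m_dec that] m_ge[of n] k by auto
      then show "\<exists>N. \<forall>n\<ge>N. norm (m n - c') < e" by blast
    qed
    then have mlim: "m \<longlonglongrightarrow> c'" .
    have "J w \<le> c'"
    proof (rule LIMSEQ_le[OF l1])
      show "(\<lambda>n. m (Suc (r n))) \<longlonglongrightarrow> c'"
        using LIMSEQ_subseq_LIMSEQ[OF LIMSEQ_Suc[OF mlim] r] by (simp add: o_def)
      show "\<exists>N. \<forall>n\<ge>N. J (x (Suc (r n))) \<le> m (Suc (r n))"
        using y(2)[OF x(1)] by (auto simp: m_def)
    qed
    then have Jw: "J (T w) = J w" using descent[OF wX] by (simp add: c'_def)
    then have wfix: "w \<in> fixed" "J w = c'" using strict wX by (auto simp: fixed_def c'_def)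
    have c'c: "c' \<le> c" using m_ge[of 0] mc[of 0] by simp
    define K where "K = {u \<in> fixed. J u = c'}"
    have KX: "K \<subseteq> X" by (auto simp: K_def fixed_def)
    obtain F where F: "F \<subseteq> K" "\<And>u. u \<in> K \<Longrightarrow> u \<in> F \<or> - u \<in> F" "\<And>u. u \<in> F \<Longrightarrow> - u \<notin> F"
    proof -
      have "finite K" using fin by (simp add: K_def)
      moreover have "- u \<in> K" if "u \<in> K" for u
        using that fixed_minus J_even by (auto simp: K_def fixed_def)
      moreover have "- u \<noteq> u" if "u \<in> K" for u using asym KX that by auto
      ultimately show ?thesis using half_of_symmetric_finite[of K] that by metis
    qed
    have finF: "finite F" using F(1) fin by (auto simp: K_def intro: finite_subset)
    \<comment> \<open>Odd, because \<open>u \<mapsto> - u\<close> is an isometry and exchanges the two products; nonzero on \<open>F\<close>, where only the second product vanishes.\<close>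
    define \<sigma> where "\<sigma> u = (\<Prod>f\<in>F. d u (- f)) - (\<Prod>f\<in>F. d u f)" for u
    have \<sigma>_odd: "\<sigma> (- u) = - \<sigma> u" if "u \<in> X" for u
    proof -
      have "d (- u) (- f) = d u f" "d (- u) f = d u (- f)" if "f \<in> F" for f
        using d_minus[of u f] d_minus[of u "- f"] that \<open>u \<in> X\<close> F(1) KX sym by auto
      then show ?thesis by (simp add: \<sigma>_def)
    qed
    have \<sigma>_cont: "continuous_map mtopology euclideanreal \<sigma>"
    proof -
      have *: "continuous_map mtopology euclideanreal (\<lambda>u. d u a)" if "a \<in> X" for a
      proof -
        have "continuous_map mtopology euclidean (\<lambda>x. mdist (metric (X, d)) (id x) ((\<lambda>_. a) x))"
          using that by (intro continuous_map_mdist) (auto simp: mtopology_of_def)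
        then show ?thesis by simp
      qed
      show ?thesis
        unfolding \<sigma>_def using finF F(1) KX sym by (intro continuous_intros *) auto
    qed
    have \<sigma>_nz: "\<sigma> u \<noteq> 0" if u: "u \<in> K" for u
    proof -
      have *: "\<sigma> f \<noteq> 0" if f: "f \<in> F" for f
      proof -
        have fX: "g \<in> X" "- g \<in> X" if "g \<in> F" for g using that F(1) KX sym by auto
        have "(\<Prod>g\<in>F. d f g) = 0" using finF f fX[OF f] by (intro prod_zero bexI[of _ f]) auto
        moreover have "d f (- g) \<noteq> 0" if "g \<in> F" for g
          using fX[OF f] fX[OF that] F(3)[OF f] F(3)[OF that] f that zero by (metis minus_minus)
        then have "(\<Prod>g\<in>F. d f (- g)) \<noteq> 0" using finF by simp
        ultimately show ?thesis by (simp add: \<sigma>_def)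
      qed
      have "u \<in> X" using u KX by auto
      then show ?thesis using F(2)[OF u] * \<sigma>_odd by force
    qed
    have "\<exists>n. \<forall>u\<in>S n. \<sigma> (T u) = 0 \<longrightarrow> J (T (T u)) < c'"
    proof (rule ccontr)
      assume "\<not> ?thesis"
      then have "\<forall>n. \<exists>u\<in>S n. \<sigma> (T u) = 0 \<and> J (T (T u)) \<ge> c'" by (auto simp: not_less)
      then obtain u where u: "\<And>n. u n \<in> S n" "\<And>n. \<sigma> (T (u n)) = 0" "\<And>n. J (T (T (u n))) \<ge> c'" by metis
      have "range u \<subseteq> X" using u(1) SX by auto
      moreover have "J (u n) \<le> c" for n using y(2)[OF u(1)[of n]] mc[of n] by (simp add: m_def)
      ultimately obtain v r where r: "strict_mono (r :: nat \<Rightarrow> nat)"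
          and lim: "limitin mtopology (\<lambda>n. T (u (r n))) v sequentially"
        using T_compact by blast
      have vX: "v \<in> X" using lim by (auto simp: limitin_def)
      have "(\<lambda>n. \<sigma> (T (u (r n)))) \<longlonglongrightarrow> \<sigma> v"
        using continuous_map_limit[OF \<sigma>_cont lim] by (auto simp: o_def)
      then have "\<sigma> v = 0" using u(2) by (simp add: LIMSEQ_const_iff)
      moreover have "J v \<le> c'"
      proof (rule LIMSEQ_le[OF limit_J[OF lim]])
        show "(\<lambda>n. m (Suc (r n))) \<longlonglongrightarrow> c'"
          using LIMSEQ_subseq_LIMSEQ[OF LIMSEQ_Suc[OF mlim] r] by (simp add: o_def)
        have "T (u (r n)) \<in> S (Suc (r n))" for n using u(1) by (auto simp: SSuc)
        then show "\<exists>N. \<forall>n\<ge>N. J (T (u (r n))) \<le> m (Suc (r n))" using y(2) by (auto simp: m_def)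
      qed
      moreover have "J (T v) \<ge> c'"
        by (rule LIMSEQ_le_const[OF limit_J[OF limit_T[OF lim]]]) (use u(3) in auto)
      ultimately have "v \<in> K" using descent[OF vX] strict[OF vX] vX by (auto simp: K_def fixed_def)
      with \<sigma>_nz \<open>\<sigma> v = 0\<close> show False by blast
    qed
    then obtain n where n: "\<And>u. u \<in> S n \<Longrightarrow> \<sigma> (T u) = 0 \<Longrightarrow> J (T (T u)) < c'" by blast
    define A' where "A' = {u \<in> S n. \<sigma> (T u) = 0}"
    have \<sigma>T: "continuous_map mtopology euclideanreal (\<lambda>u. \<sigma> (T u))"
      using continuous_map_compose[OF T_cont \<sigma>_cont] by (simp add: o_def)
    have A'comp: "compactin mtopology A'"
    proof -
      have "closedin mtopology {u \<in> topspace mtopology. \<sigma> (T u) \<in> {0}}"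
        by (rule closedin_continuous_map_preimage[OF \<sigma>T]) auto
      then have "compactin mtopology (S n \<inter> {u \<in> topspace mtopology. \<sigma> (T u) \<in> {0}})"
        using Scomp by (intro compact_Int_closedin)
      moreover have "S n \<inter> {u \<in> topspace mtopology. \<sigma> (T u) \<in> {0}} = A'"
        using SX by (auto simp: A'_def)
      ultimately show ?thesis by simp
    qed
    have A'X: "A' \<subseteq> X" using SX by (auto simp: A'_def)
    have A'sym: "- u \<in> A'" if "u \<in> A'" for u
      using that Ssym A'X T_odd[of u] \<sigma>_odd[of "T u"] T_in[of u] by (auto simp: A'_def)
    define B where "B = T ` T ` A'"
    have Bcomp: "compactin mtopology B"
      unfolding B_def by (intro image_compactin[OF _ T_cont] A'comp)
    have Bsym: "- u \<in> B" if "u \<in> B" for u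
    proof -
      obtain v where v: "v \<in> A'" "u = T (T v)" using \<open>u \<in> B\<close> by (auto simp: B_def)
      then have "- u = T (T (- v))" using A'X T_odd T_in by auto
      with A'sym[OF v(1)] show ?thesis by (auto simp: B_def)
    qed
    have "\<exists>c''<c'. \<forall>u\<in>B. J u \<le> c''"
    proof (cases "B = {}")
      case True
      then show ?thesis by (intro exI[of _ "c' - 1"]) auto
    next
      case False
      have "compact (J ` B)" using image_compactin[OF Bcomp J_cont] by simp
      then obtain b where "b \<in> B" "\<forall>u\<in>B. J u \<le> J b"
        using compact_attains_sup[of "J ` B"] False by auto
      moreover have "J b < c'" using \<open>b \<in> B\<close> n by (auto simp: B_def A'_def)
      ultimately show ?thesis by blast
    qed
    then obtain c'' where c'': "c'' < c'" "\<And>u. u \<in> B \<Longrightarrow> J u \<le> c''" by blast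
    have finp: "finite (pairs c)" for c using fin by (simp add: pairs_def)
    \<comment> \<open>The pair of the fixed point \<open>w\<close> is lost when the level drops from \<open>c\<close> to \<open>c''\<close>.\<close>
    have psub: "pairs c'' \<subset> pairs c"
    proof
      show "pairs c'' \<subseteq> pairs c" using c''(1) c'c by (auto simp: pairs_def)
      have "{w, - w} \<in> pairs c" using wfix c'c by (auto simp: pairs_def)
      moreover have "{w, - w} \<notin> pairs c''"
      proof
        assume "{w, - w} \<in> pairs c''"
        then obtain u where u: "J u \<le> c''" "{w, - w} = {u, - u}" by (auto simp: pairs_def)
        then have "u = w \<or> u = - w" by (auto simp: doubleton_eq_iff)
        then have "J u = c'" using wfix J_even wX by auto
        with u c'' show False by simp
      qed
      ultimately show "pairs c'' \<noteq> pairs c" by blast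
    qed
    then have lt: "card (pairs c'') < card (pairs c)" using finp by (intro psubset_card_mono)
    have "odd_separated mtopology B (card (pairs c''))"
      by (rule less.hyps[OF lt Bcomp]) (use Bsym c'' in auto)
    then have "odd_separated mtopology A' (card (pairs c''))"
    proof (rule odd_separated_image)
      have "continuous_map mtopology mtopology (\<lambda>u. T (T u))"
        using continuous_map_compose[OF T_cont T_cont] by (simp add: o_def)
      then show "continuous_map (subtopology mtopology A') (subtopology mtopology B) (\<lambda>u. T (T u))"
        by (auto simp: continuous_map_in_subtopology B_def intro: continuous_map_from_subtopology)
    qed (use A'X T_odd T_in in auto)
    then have "odd_separated mtopology (S n) (Suc (card (pairs c'')))"
    proof (intro odd_separated_Suc[where g = "\<lambda>u. \<sigma> (T u)"])
      show "metrizable_space mtopology" by (rule metrizable_space_mtopology)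
      show "continuous_map (subtopology mtopology (S n)) (subtopology mtopology (S n)) uminus"
        using uminus_cont Ssym
        by (auto simp: continuous_map_in_subtopology intro: continuous_map_from_subtopology)
      show "continuous_map (subtopology mtopology (S n)) euclideanreal (\<lambda>u. \<sigma> (T u))"
        by (rule continuous_map_from_subtopology[OF \<sigma>T])
    qed (use SX Ssym T_odd \<sigma>_odd T_in in \<open>auto simp: A'_def subset_iff\<close>)
    then have "odd_separated mtopology A (Suc (card (pairs c'')))"
    proof (rule odd_separated_image)
      have "continuous_map mtopology mtopology (T ^^ n)"
      proof (induction n)
        case (Suc n)
        from continuous_map_compose[OF this T_cont] show ?case by (simp add: o_def)
      qed (simp add: id_def)
      then show "continuous_map (subtopology mtopology A) (subtopology mtopology (S n)) (T ^^ n)"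
        by (auto simp: continuous_map_in_subtopology S_def intro: continuous_map_from_subtopology)
      show "(T ^^ n) (- u) = - (T ^^ n) u" if "u \<in> A" for u
      proof (induction n)
        case (Suc n)
        have "(T ^^ n) u \<in> X" using SX[of n] that by (auto simp: S_def)
        with Suc show ?case by (simp add: T_odd)
      qed simp
    qed (use AX in auto)
    from odd_separated_mono[OF this Suc_leI[OF lt]] show ?thesis .
  qed
qed

text \<open>If there are infinitely many fixed points nothing has to be shown; otherwise the genus of \<open>A\<close> bounds their number from below.\<close>

theorem many_fixed_pairs:
  assumes A: "compactin mtopology A" "\<And>u. u \<in> A \<Longrightarrow> - u \<in> A"
    and l: "\<And>k. odd_separated mtopology A k \<Longrightarrow> l \<le> k"
  shows "\<exists>P \<subseteq> (\<lambda>u. {u, - u}) ` fixed. finite P \<and> card P = l"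
proof (cases "finite ((\<lambda>u. {u, - u}) ` fixed)")
  case False
  then show ?thesis by (rule infinite_arbitrarily_large[THEN exE]) blast
next
  case True
  have "finite (\<Union> ((\<lambda>u. {u, - u}) ` fixed))" by (intro finite_Union True) auto
  then have fin: "finite fixed" by (rule finite_subset[rotated]) auto
  have "\<exists>c. \<forall>u\<in>A. J u \<le> c"
  proof -
    have "compact (J ` A)" using image_compactin[OF A(1) J_cont] by simp
    then have "bdd_above (J ` A)" by (intro bounded_imp_bdd_above compact_imp_bounded)
    then show ?thesis by (auto simp: bdd_above_def)
  qed
  then obtain c where "\<And>u. u \<in> A \<Longrightarrow> J u \<le> c" by blast
  then have "l \<le> card (pairs c)"
    using l[OF separated_by_pairs[OF fin A]] by blast
  then obtain P where "P \<subseteq> pairs c" "card P = l" "finite P"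
    using obtain_subset_with_card_n[of l "pairs c"] by metis
  moreover have "pairs c \<subseteq> (\<lambda>u. {u, - u}) ` fixed" by (auto simp: pairs_def)
  ultimately show ?thesis by blast
qed

end

section \<open>Powers of seminorms induced by linear maps into Lebesgue spaces\<close>

text \<open>A linear subspace \<open>W\<close> with a map into \<open>L\<^sup>r\<close> that is linear almost everywhere. It is instantiated with the weak gradient and with the function itself, each
for the two exponents, so that powers of norms, their derivatives and their convexity are dealt with only once.\<close>

locale linear_Lp =
  fixes M :: "'a measure" and W :: "'v::real_vector set" and L :: "'v \<Rightarrow> 'a \<Rightarrow> 'b::euclidean_space" and r :: real
  assumes r: "r > 1"
    and W0: "0 \<in> W" and W_add: "u \<in> W \<Longrightarrow> v \<in> W \<Longrightarrow> u + v \<in> W" and W_scale: "u \<in> W \<Longrightarrow> c *\<^sub>R u \<in> W"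
    and Lp: "u \<in> W \<Longrightarrow> L u \<in> Lp M r"
    and add: "u \<in> W \<Longrightarrow> v \<in> W \<Longrightarrow> AE x in M. L (u + v) x = L u x + L v x"
    and scale: "u \<in> W \<Longrightarrow> AE x in M. L (c *\<^sub>R u) x = c *\<^sub>R L u x"
begin

definition I where "I u = Lint M r (L u)"
definition n where "n u = Lnorm M r (L u)"
definition P where "P u v = Lpair M r (L u) (L v)"

lemma W_minus: "u \<in> W \<Longrightarrow> - u \<in> W"
  using W_scale[of u "-1"] by simp

lemma W_diff: "u \<in> W \<Longrightarrow> v \<in> W \<Longrightarrow> u - v \<in> W"
  using W_add[OF _ W_minus, of u v] by simp

lemma diff:
  assumes "u \<in> W" "v \<in> W" shows "AE x in M. L (u - v) x = L u x - L v x"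
  using add[OF assms(1) W_minus[OF assms(2)]] scale[OF assms(2), of "-1"] by eventually_elim simp

lemma meas: "u \<in> W \<Longrightarrow> L u \<in> borel_measurable M"
  using Lp LpD(1) by blast

lemma I_nonneg [simp]: "I u \<ge> 0" and n_nonneg [simp]: "n u \<ge> 0"
  by (simp_all add: I_def n_def)

lemma n_powr: "n u powr r = I u"
  using r by (simp add: n_def I_def Lnorm_powr)

lemma n_scale_eq: "u \<in> W \<Longrightarrow> n (c *\<^sub>R u) = Lnorm M r (\<lambda>x. c *\<^sub>R L u x)"
  unfolding n_def by (intro Lnorm_cong_AE scale) (auto intro!: meas W_scale borel_measurable_scaleR)

lemma I_scale_eq: "u \<in> W \<Longrightarrow> I (c *\<^sub>R u) = Lint M r (\<lambda>x. c *\<^sub>R L u x)"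
  unfolding I_def by (intro Lint_cong_AE scale) (auto intro!: meas W_scale borel_measurable_scaleR)

lemma n_scale: "u \<in> W \<Longrightarrow> n (c *\<^sub>R u) = \<bar>c\<bar> * n u"
  using r n_scale_eq[of u c] Lnorm_scaleR[of r M c "L u"] by (simp add: n_def)

lemma I_scale: "u \<in> W \<Longrightarrow> I (c *\<^sub>R u) = \<bar>c\<bar> powr r * I u"
  using I_scale_eq[of u c] Lint_scaleR[of M r c "L u"] by (simp add: I_def)

lemma n_minus: "u \<in> W \<Longrightarrow> n (- u) = n u" and I_minus: "u \<in> W \<Longrightarrow> I (- u) = I u"
  using n_scale[of u "-1"] I_scale[of u "-1"] by simp_all

lemma n_0 [simp]: "n 0 = 0" and I_0 [simp]: "I 0 = 0"
  using n_scale[OF W0, of 0] I_scale[OF W0, of 0] by simp_all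

lemma n_diff_eq: "u \<in> W \<Longrightarrow> v \<in> W \<Longrightarrow> n (u - v) = Lnorm M r (\<lambda>x. L u x - L v x)"
  unfolding n_def by (intro Lnorm_cong_AE diff) (auto intro!: meas W_diff borel_measurable_diff)

lemma n_add_eq: "u \<in> W \<Longrightarrow> v \<in> W \<Longrightarrow> n (u + v) = Lnorm M r (\<lambda>x. L u x + L v x)"
  unfolding n_def by (intro Lnorm_cong_AE add) (auto intro!: meas W_add borel_measurable_add)

lemma I_diff_eq: "u \<in> W \<Longrightarrow> v \<in> W \<Longrightarrow> I (u - v) = Lint M r (\<lambda>x. L u x - L v x)"
  unfolding I_def by (intro Lint_cong_AE diff) (auto intro!: meas W_diff borel_measurable_diff)

lemma I_add_eq: "u \<in> W \<Longrightarrow> v \<in> W \<Longrightarrow> I (u + v) = Lint M r (\<lambda>x. L u x + L v x)"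
  unfolding I_def by (intro Lint_cong_AE add) (auto intro!: meas W_add borel_measurable_add)

lemma n_add: "u \<in> W \<Longrightarrow> v \<in> W \<Longrightarrow> n (u + v) \<le> n u + n v"
  unfolding n_add_eq using Lp_minkowski[OF r Lp Lp] by (simp add: n_def)

lemma n_diff_commute: "u \<in> W \<Longrightarrow> v \<in> W \<Longrightarrow> n (u - v) = n (v - u)"
  using n_minus[OF W_diff, of u v] by simp

lemma n_triangle: "u \<in> W \<Longrightarrow> v \<in> W \<Longrightarrow> w \<in> W \<Longrightarrow> n (u - w) \<le> n (u - v) + n (v - w)"
  using n_add[OF W_diff W_diff, of u v v w] by simp

lemma n_reverse: "u \<in> W \<Longrightarrow> v \<in> W \<Longrightarrow> \<bar>n u - n v\<bar> \<le> n (u - v)"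
  using n_add[OF W_diff, of u v v] n_add[OF W_diff, of v u u] n_diff_commute[of u v] by simp

lemma P_scale: "u \<in> W \<Longrightarrow> v \<in> W \<Longrightarrow> P u (c *\<^sub>R v) = c * P u v"
  unfolding P_def Lpair_scaleR[symmetric] by (intro Lpair_cong_AE scale) (auto intro!: meas W_scale borel_measurable_scaleR)

lemma P_add: "u \<in> W \<Longrightarrow> v \<in> W \<Longrightarrow> w \<in> W \<Longrightarrow> P u (v + w) = P u v + P u w"
  unfolding P_def Lpair_add[OF r Lp Lp Lp, symmetric]
  by (intro Lpair_cong_AE add) (auto intro!: meas W_add borel_measurable_add)

lemma P_diff: "u \<in> W \<Longrightarrow> v \<in> W \<Longrightarrow> w \<in> W \<Longrightarrow> P u (v - w) = P u v - P u w"
  using P_add[of u v "- w"] P_scale[of u w "-1"] W_minus[of w] by simp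

lemma P_scale_left: "u \<in> W \<Longrightarrow> v \<in> W \<Longrightarrow> c > 0 \<Longrightarrow> P (c *\<^sub>R u) v = c powr (r - 1) * P u v"
  unfolding P_def Lpair_scaleR_left[symmetric] by (intro Lpair_cong_AE scale) (auto intro!: meas W_scale borel_measurable_scaleR)

lemma P_minus_left: "u \<in> W \<Longrightarrow> v \<in> W \<Longrightarrow> P (- u) v = - P u v"
proof -
  assume uv: "u \<in> W" "v \<in> W"
  have "AE x in M. L (- u) x = - L u x" using scale[OF uv(1), of "-1"] by simp
  then have "P (- u) v = Lpair M r (\<lambda>x. - L u x) (L v)"
    unfolding P_def using uv by (intro Lpair_cong_AE) (auto intro!: meas W_minus)
  also have "\<dots> = - P u v" by (simp add: P_def Lpair_def)
  finally show ?thesis .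
qed

lemma P_self: "P u u = I u"
  by (simp add: P_def I_def Lpair_self)

lemma P_bound: "u \<in> W \<Longrightarrow> v \<in> W \<Longrightarrow> \<bar>P u v\<bar> \<le> n u powr (r - 1) * n v"
  unfolding P_def n_def using Lpair_bound[OF r Lp Lp] by blast

text \<open>Convexity of \<open>I\<close>; the linear part is written with \<open>P u v - I u\<close> since \<open>P u u = I u\<close>.\<close>

lemma I_tangent: "u \<in> W \<Longrightarrow> v \<in> W \<Longrightarrow> I u + r * (P u v - I u) \<le> I v"
proof -
  assume uv: "u \<in> W" "v \<in> W"
  have "Lpair M r (L u) (\<lambda>x. L v x - L u x) = P u v - I u"
    unfolding Lpair_diff[OF r Lp[OF uv(1)] Lp[OF uv(2)] Lp[OF uv(1)]] by (simp add: P_def I_def Lpair_self)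
  then show ?thesis using Lint_tangent[OF r Lp[OF uv(1)] Lp[OF uv(2)]] by (simp add: I_def)
qed

lemma I_lipschitz:
  assumes "u \<in> W" "v \<in> W" "n u \<le> R" "n v \<le> R"
  shows "\<bar>I u - I v\<bar> \<le> r * (R powr (r - 1) * n (u - v))"
proof -
  have *: "I x - I y \<le> r * (R powr (r - 1) * n (x - y))" if "x \<in> W" "y \<in> W" "n x \<le> R" for x y
  proof -
    have "I x - I y \<le> r * (P x x - P x y)" using I_tangent[OF that(1,2)] by (simp add: P_self algebra_simps)
    also have "P x x - P x y = P x (x - y)" using that by (simp add: P_diff)
    also have "r * P x (x - y) \<le> r * (n x powr (r - 1) * n (x - y))"
      using P_bound[OF that(1) W_diff[OF that(1,2)]] r by (intro mult_left_mono) auto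
    also have "\<dots> \<le> r * (R powr (r - 1) * n (x - y))"
      using that r by (intro mult_left_mono mult_right_mono powr_mono2) auto
    finally show ?thesis .
  qed
  show ?thesis using *[of u v] *[of v u] assms n_diff_commute[of u v] by (auto simp: abs_le_iff)
qed

lemma I_mid_eq: "u \<in> W \<Longrightarrow> v \<in> W \<Longrightarrow> I ((1/2) *\<^sub>R (u + v)) = Lint M r (\<lambda>x. (1/2) *\<^sub>R (L u x + L v x))"
  using I_scale[OF W_add, of u v "1/2"] I_add_eq[of u v] Lint_scaleR[of M r "1/2" "\<lambda>x. L u x + L v x"] by simp

lemma I_midpoint: "u \<in> W \<Longrightarrow> v \<in> W \<Longrightarrow> I ((1/2) *\<^sub>R (u + v)) \<le> (I u + I v) / 2"
  unfolding I_mid_eq using Lint_midpoint[OF r Lp Lp] by (simp add: I_def)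

lemma uniform_convexity:
  assumes e: "e > 0"
  shows "\<exists>\<delta>>0. \<forall>u\<in>W. \<forall>v\<in>W. I u \<le> R \<longrightarrow> I v \<le> R \<longrightarrow>
     (I u + I v) / 2 - I ((1/2) *\<^sub>R (u + v)) < \<delta> \<longrightarrow> n (u - v) < e"
proof -
  define R' where "R' = \<bar>R\<bar> + 1"
  have R': "R' > 0" "R \<le> R'" by (auto simp: R'_def)
  define t where "t = e powr r / (4 * R')"
  have t: "t > 0" using e R' by (simp add: t_def)
  obtain C where C: "C \<ge> 0" "\<And>f g :: 'a \<Rightarrow> 'b. f \<in> Lp M r \<Longrightarrow> g \<in> Lp M r \<Longrightarrow> Lint M r (\<lambda>x. f x - g x)
     \<le> t * (Lint M r f + Lint M r g) + C * ((Lint M r f + Lint M r g) / 2 - Lint M r (\<lambda>x. (1/2) *\<^sub>R (f x + g x)))"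
    using Lint_uniform_convexity[OF r t, of M] by blast
  define \<delta> where "\<delta> = e powr r / (2 * (C + 1))"
  have \<delta>: "\<delta> > 0" using e C(1) by (simp add: \<delta>_def)
  have "n (u - v) < e" if uv: "u \<in> W" "v \<in> W" and le: "I u \<le> R" "I v \<le> R"
    and d: "(I u + I v) / 2 - I ((1/2) *\<^sub>R (u + v)) < \<delta>" for u v
  proof -
    have "I (u - v) \<le> t * (I u + I v) + C * ((I u + I v) / 2 - I ((1/2) *\<^sub>R (u + v)))"
      using C(2)[OF Lp[OF uv(1)] Lp[OF uv(2)]] uv by (simp only: I_diff_eq I_mid_eq) (simp add: I_def)
    also have "\<dots> \<le> t * (2 * R') + C * \<delta>"
      using le R' t C(1) d by (intro add_mono mult_left_mono) auto
    also have "t * (2 * R') = e powr r / 2" using R' by (simp add: t_def field_simps)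
    also have "C * \<delta> < (C + 1) * \<delta>" using \<delta> by (simp add: algebra_simps)
    also have "(C + 1) * \<delta> = e powr r / 2" using C(1) by (simp add: \<delta>_def del: distrib_left_numeral)
    finally have "n (u - v) powr r < e powr r" by (simp add: n_powr)
    then show ?thesis using e r by (meson not_less powr_mono2 less_imp_le order_trans zero_less_one)
  qed
  then show ?thesis using \<delta> by blast
qed

lemma P_continuity:
  assumes e: "e > 0"
  shows "\<exists>\<delta>>0. \<forall>u\<in>W. \<forall>v\<in>W. n u \<le> R \<longrightarrow> n v \<le> R \<longrightarrow> n (u - v) < \<delta> \<longrightarrow>
     (\<forall>w\<in>W. \<bar>P u w - P v w\<bar> \<le> e * n w)"
proof -
  define R' where "R' = \<bar>R\<bar> + 1"
  have R': "R' > 0" "R \<le> R'" by (auto simp: R'_def)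
  define t where "t = e / (4 * R' powr (r - 1))"
  have t: "t > 0" using e R' by (simp add: t_def)
  obtain C where C: "C \<ge> 0" "\<And>f g h :: 'a \<Rightarrow> 'b. f \<in> Lp M r \<Longrightarrow> g \<in> Lp M r \<Longrightarrow> h \<in> Lp M r \<Longrightarrow>
     \<bar>Lpair M r f h - Lpair M r g h\<bar>
     \<le> (t * (Lnorm M r f powr (r-1) + Lnorm M r g powr (r-1)) + C * Lnorm M r (\<lambda>x. f x - g x) powr (r-1)) * Lnorm M r h"
    using Lpair_continuity[OF r t, of M] by blast
  define \<delta> where "\<delta> = (e / (2 * (C + 1))) powr (1 / (r - 1))"
  have \<delta>: "\<delta> > 0" using e C(1) by (simp add: \<delta>_def)
  have "\<bar>P u w - P v w\<bar> \<le> e * n w" if uv: "u \<in> W" "v \<in> W" and le: "n u \<le> R" "n v \<le> R"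
    and d: "n (u - v) < \<delta>" and w: "w \<in> W" for u v w
  proof -
    have "\<bar>P u w - P v w\<bar> \<le> (t * (n u powr (r-1) + n v powr (r-1)) + C * n (u - v) powr (r-1)) * n w"
      using C(2)[OF Lp[OF uv(1)] Lp[OF uv(2)] Lp[OF w]] uv by (simp only: n_diff_eq) (simp add: P_def n_def)
    also have "\<dots> \<le> (t * (R' powr (r-1) + R' powr (r-1)) + (C + 1) * \<delta> powr (r-1)) * n w"
      using t R' le C(1) d r by (intro mult_right_mono add_mono mult_mono mult_left_mono powr_mono2) auto
    also have "t * (R' powr (r-1) + R' powr (r-1)) = e / 2" using R' by (simp add: t_def field_simps)
    also have "\<delta> powr (r-1) = e / (2 * (C + 1))" using e C(1) r by (simp add: \<delta>_def powr_powr)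
    also have "(C + 1) * (e / (2 * (C + 1))) = e / 2" using C(1) by (simp del: distrib_left_numeral)
    finally show ?thesis by simp
  qed
  then show ?thesis using \<delta> by blast
qed

lemma I_frechet:
  assumes u: "u \<in> W" and e: "e > 0"
  shows "\<exists>d>0. \<forall>v\<in>W. n v < d \<longrightarrow> \<bar>I (u + v) - I u - r * P u v\<bar> \<le> e * n v"
proof -
  obtain d where d: "d > 0" "\<And>h. h \<in> Lp M r \<Longrightarrow> Lnorm M r h < d \<Longrightarrow>
      \<bar>Lint M r (\<lambda>x. L u x + h x) - Lint M r (L u) - r * Lpair M r (L u) h\<bar> \<le> e * Lnorm M r h"
    using Lint_frechet[OF r Lp[OF u] e] by blast
  have "\<bar>I (u + v) - I u - r * P u v\<bar> \<le> e * n v" if "v \<in> W" "n v < d" for v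
    using d(2)[OF Lp[OF that(1)]] that(2) unfolding I_add_eq[OF u that(1)] by (simp add: I_def n_def P_def)
  with d(1) show ?thesis by blast
qed

lemma I_deriv:
  assumes u: "u \<in> W" and v: "v \<in> W"
  shows "((\<lambda>t. I (u + t *\<^sub>R v)) has_real_derivative r * P u v) (at 0)"
  unfolding has_field_derivative_def has_derivative_at_alt
proof (intro conjI allI impI)
  show "bounded_linear ((*) (r * P u v))" by (rule bounded_linear_mult_right)
  fix e :: real assume e: "e > 0"
  define e' where "e' = e / (n v + 1)"
  have e': "e' > 0" using e by (auto simp: e'_def intro!: divide_pos_pos add_nonneg_pos)
  obtain d where d: "d > 0" "\<And>v. v \<in> W \<Longrightarrow> n v < d \<Longrightarrow> \<bar>I (u + v) - I u - r * P u v\<bar> \<le> e' * n v"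
    using I_frechet[OF u e'] by blast
  show "\<exists>d>0. \<forall>y. norm (y - 0) < d \<longrightarrow>
      norm (I (u + y *\<^sub>R v) - I (u + 0 *\<^sub>R v) - r * P u v * (y - 0)) \<le> e * norm (y - 0)"
  proof (intro exI[of _ "d / (n v + 1)"] conjI allI impI)
    have nv: "n v + 1 > 0" by (intro add_nonneg_pos) auto
    show "d / (n v + 1) > 0" using d(1) nv by simp
    fix y :: real assume y: "norm (y - 0) < d / (n v + 1)"
    have "n (y *\<^sub>R v) = \<bar>y\<bar> * n v" using v by (rule n_scale)
    also have "\<dots> \<le> \<bar>y\<bar> * (n v + 1)" by (intro mult_left_mono) auto
    also have "\<dots> < d" using y nv by (simp add: field_simps)
    finally have "\<bar>I (u + y *\<^sub>R v) - I u - r * P u (y *\<^sub>R v)\<bar> \<le> e' * n (y *\<^sub>R v)"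
      by (intro d(2) W_scale v)
    also have "\<dots> = e' * n v * \<bar>y\<bar>" using v by (simp add: n_scale)
    also have "e' * n v \<le> e' * (n v + 1)" using e' by (intro mult_left_mono) auto
    also have "e' * (n v + 1) = e" using nv by (simp add: e'_def)
    finally show "norm (I (u + y *\<^sub>R v) - I (u + 0 *\<^sub>R v) - r * P u v * (y - 0)) \<le> e * norm (y - 0)"
      using u v by (simp add: P_scale mult_right_mono algebra_simps)
  qed
qed

lemma n_lim:
  assumes "\<And>k::nat. s k \<in> W" "u \<in> W" "(\<lambda>k. n (s k - u)) \<longlonglongrightarrow> 0"
  shows "(\<lambda>k. n (s k)) \<longlonglongrightarrow> n u"
proof -
  have "(\<lambda>k. n (s k) - n u) \<longlonglongrightarrow> 0"
    by (rule Lim_null_comparison[OF _ assms(3)]) (use n_reverse assms(1,2) in auto)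
  then show ?thesis by (simp add: LIM_zero_iff)
qed

lemma I_lim:
  assumes "\<And>k::nat. s k \<in> W" "u \<in> W" "(\<lambda>k. n (s k - u)) \<longlonglongrightarrow> 0"
  shows "(\<lambda>k. I (s k)) \<longlonglongrightarrow> I u"
proof -
  have "(\<lambda>k. n (s k) powr r) \<longlonglongrightarrow> n u powr r"
    using n_lim[OF assms] r by (intro tendsto_powr') auto
  then show ?thesis by (simp add: n_powr)
qed

lemma P_lim:
  assumes "\<And>k::nat. s k \<in> W" "u \<in> W" "w \<in> W" "(\<lambda>k. n (s k - u)) \<longlonglongrightarrow> 0"
  shows "(\<lambda>k. P w (s k)) \<longlonglongrightarrow> P w u"
proof -
  have "(\<lambda>k. P w (s k) - P w u) \<longlonglongrightarrow> 0"
  proof (rule Lim_null_comparison)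
    show "(\<lambda>k. n w powr (r - 1) * n (s k - u)) \<longlonglongrightarrow> 0" using assms(4) by (intro tendsto_mult_right_zero)
    show "\<forall>\<^sub>F k in sequentially. norm (P w (s k) - P w u) \<le> n w powr (r - 1) * n (s k - u)"
      using P_bound[OF assms(3) W_diff[OF assms(1,2)]] by (simp add: P_diff assms)
  qed
  then show ?thesis by (simp add: LIM_zero_iff)
qed

end

text \<open>The computation behind the stability of minimisers, isolated from function spaces. Indices 1 and 2 stand for two near-minimisers \<open>v\<close>, \<open>v'\<close> of two
nearby functionals of the form \<open>a - q ln (k - I)\<close>, and \<open>w\<close> for their midpoint; \<open>k12\<close> is the value at \<open>v'\<close> of the function belonging to the
first functional, and so on. Compare each near-minimiser with the midpoint and add. The convex terms \<open>a\<close> and the affine terms \<open>k\<close> cancel up to \<open>\<delta>\<close>, and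
concavity of \<open>ln\<close> leaves the midpoint defect of \<open>I\<close>, divided by the bound \<open>K\<close> on the argument of \<open>ln\<close>.\<close>

lemma barrier_gap:
  fixes q c0 K \<delta> k11 k12 k22 k2w I1 I2 Iw a11 a12 a22 a1w a2w :: real
  assumes q: "q > 0" and c0: "c0 > 0" and K: "K > 0" and \<delta>: "0 \<le> \<delta>" "\<delta> \<le> c0 / 2"
    and h: "c0 \<le> k11 - I1" "c0 \<le> k22 - I2"
    and I: "0 \<le> Iw" "Iw \<le> (I1 + I2) / 2" and K': "(k11 + k12) / 2 \<le> K"
    and a: "a1w \<le> (a11 + a12) / 2"
    and k2: "\<bar>k12 - k22\<bar> \<le> \<delta>" and kw: "\<bar>(k11 + k12) / 2 - k2w\<bar> \<le> \<delta>"
    and ad: "\<bar>a12 - a22\<bar> \<le> \<delta>" "\<bar>a1w - a2w\<bar> \<le> \<delta>"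
    and k2w: "k2w - Iw \<ge> c0 / 2"
    and m1: "a11 - q * ln (k11 - I1) \<le> a1w - q * ln ((k11 + k12) / 2 - Iw) + \<delta>"
    and m2: "a22 - q * ln (k22 - I2) \<le> a2w - q * ln (k2w - Iw) + \<delta>"
  shows "(I1 + I2) / 2 - Iw \<le> (K / q) * (2 * \<delta> + 2 * q * \<delta> / c0)"
proof -
  define d where "d = (I1 + I2) / 2 - Iw"
  define h11 where "h11 = k11 - I1"
  define h12 where "h12 = k12 - I2"
  define h1w where "h1w = (k11 + k12) / 2 - Iw"
  have d0: "d \<ge> 0" using I by (simp add: d_def)
  have h12: "h12 \<ge> c0 / 2" using h(2) k2 \<delta> by (simp add: h12_def abs_le_iff)
  have h11: "h11 \<ge> c0" using h by (simp add: h11_def)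
  have h1w: "h1w = (h11 + h12) / 2 + d" by (simp add: h1w_def h11_def h12_def d_def field_simps)
  have h1wK: "h1w \<le> K" using K' I unfolding h1w_def by linarith
  have h1wc: "h1w \<ge> c0 / 2" using h1w h11 h12 d0 c0 by argo
  have ln_lip: "\<bar>ln x - ln y\<bar> \<le> 2 * \<delta> / c0" if "x \<ge> c0 / 2" "y \<ge> c0 / 2" "\<bar>x - y\<bar> \<le> \<delta>" for x y
  proof -
    have *: "ln a - ln b \<le> 2 * \<delta> / c0" if "a \<ge> c0/2" "b \<ge> c0/2" "\<bar>a - b\<bar> \<le> \<delta>" for a b
    proof -
      have "ln a - ln b \<le> (a - b) / b" using that c0 by (intro ln_diff_le) auto
      also have "\<dots> \<le> \<delta> / b" using that c0 by (intro divide_right_mono) auto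
      also have "\<dots> \<le> \<delta> / (c0 / 2)" using that c0 \<delta> by (intro divide_left_mono) auto
      finally show ?thesis by (simp add: mult.commute)
    qed
    show ?thesis using *[of x y] *[of y x] that by (auto simp: abs_le_iff)
  qed
  \<comment> \<open>The argument of \<open>ln\<close> at the midpoint exceeds the mean of the two arguments by exactly the defect \<open>d\<close>.\<close>
  have lnw: "ln h1w \<ge> (ln h11 + ln h12) / 2 + d / K"
  proof -
    define y where "y = (h11 + h12) / 2"
    have y: "y > 0" using h11 h12 c0 by (simp add: y_def)
    have "ln y - ln h1w \<le> (y - h1w) / h1w" using y h1wc c0 by (intro ln_diff_le) auto
    then have "d / h1w \<le> ln h1w - ln y" by (simp add: h1w y_def minus_divide_left[symmetric])
    moreover have "d / K \<le> d / h1w" using d0 h1wK h1wc c0 by (intro divide_left_mono mult_pos_pos) auto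
    moreover have "(ln h11 + ln h12) / 2 \<le> ln y"
    proof -
      have "(1/2) * ln h11 + (1/2) * ln h12 \<le> ln ((1/2) * h11 + (1/2) * h12)"
        using concave_onD[OF ln_concave, of "1/2" h11 h12] h11 h12 c0 by simp
      also have "(1/2) * h11 + (1/2) * h12 = y" by (simp add: y_def)
      finally show ?thesis by simp
    qed
    ultimately show ?thesis by linarith
  qed
  define t where "t = q * (2 * \<delta> / c0)"
  have l2: "\<bar>q * ln h12 - q * ln (k22 - I2)\<bar> \<le> t"
  proof -
    have "\<bar>ln h12 - ln (k22 - I2)\<bar> \<le> 2 * \<delta> / c0"
      using h12 h(2) c0 k2 by (intro ln_lip) (auto simp: h12_def)
    then have "q * \<bar>ln h12 - ln (k22 - I2)\<bar> \<le> t" using q unfolding t_def by (intro mult_left_mono) auto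
    moreover have "q * \<bar>ln h12 - ln (k22 - I2)\<bar> = \<bar>q * ln h12 - q * ln (k22 - I2)\<bar>"
      using q by (simp add: abs_mult flip: right_diff_distrib)
    ultimately show ?thesis by simp
  qed
  have lw: "\<bar>q * ln h1w - q * ln (k2w - Iw)\<bar> \<le> t"
  proof -
    have "\<bar>ln h1w - ln (k2w - Iw)\<bar> \<le> 2 * \<delta> / c0"
      using h1wc k2w kw by (intro ln_lip) (auto simp: h1w_def)
    then have "q * \<bar>ln h1w - ln (k2w - Iw)\<bar> \<le> t" using q unfolding t_def by (intro mult_left_mono) auto
    moreover have "q * \<bar>ln h1w - ln (k2w - Iw)\<bar> = \<bar>q * ln h1w - q * ln (k2w - Iw)\<bar>"
      using q by (simp add: abs_mult flip: right_diff_distrib)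
    ultimately show ?thesis by simp
  qed
  have "q * ((ln h11 + ln h12) / 2 + d / K) \<le> q * ln h1w" using lnw q by (intro mult_left_mono) auto
  then have "(q * ln h11) / 2 + (q * ln h12) / 2 + q * d / K \<le> q * ln h1w"
    by (simp add: algebra_simps add_divide_distrib)
  then have "q * d / K \<le> 2 * \<delta> + t"
    using m1[folded h11_def h1w_def] m2 l2 lw ad a by (simp add: abs_le_iff)
  then have "d \<le> (K / q) * (2 * \<delta> + t)" using q K by (simp add: field_simps)
  then show ?thesis by (simp add: d_def t_def mult_ac)
qed

section \<open>Descent by convex minimisation\<close>

text \<open>The properties of \<open>W0\<close> that the variational argument uses. Subtraction on \<open>'v\<close> is global while \<open>W\<close> is a subspace, and a metric must be symmetric for
all arguments; this is why \<open>n_minus_all\<close> is not restricted to \<open>W\<close>. Completeness concerns the gradient norm, compactness the norm of the function.\<close>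

locale sobolev_like = Dp: linear_Lp M W D p + Up: linear_Lp M W U p
  for M :: "'a measure" and W :: "'v::real_vector set" and D :: "'v \<Rightarrow> 'a \<Rightarrow> 'b::euclidean_space"
    and U :: "'v \<Rightarrow> 'a \<Rightarrow> real" and p q :: real +
  assumes fin: "finite_measure M" and q: "1 < q" "q < p"
    and poincare: "\<exists>C. \<forall>u\<in>W. Up.n u \<le> C * Dp.n u"
    and n_minus_all: "Dp.n (- u) = Dp.n u"
    and definite: "u \<in> W \<Longrightarrow> Up.n u = 0 \<Longrightarrow> u = 0"
    and complete: "(\<And>k::nat. s k \<in> W) \<Longrightarrow>
      (\<And>e. e > 0 \<Longrightarrow> \<exists>N. \<forall>j\<ge>N. \<forall>k\<ge>N. Dp.n (s j - s k) < e) \<Longrightarrow>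
      \<exists>w\<in>W. (\<lambda>k. Dp.n (s k - w)) \<longlonglongrightarrow> 0"
    and rellich: "(\<And>k::nat. s k \<in> W) \<Longrightarrow> (\<And>k. Dp.n (s k) \<le> B) \<Longrightarrow>
      \<exists>r :: nat \<Rightarrow> nat. strict_mono r \<and>
        (\<forall>e>0. \<exists>N. \<forall>j\<ge>N. \<forall>k\<ge>N. Up.n (s (r j) - s (r k)) < e)"
begin

sublocale Dq: linear_Lp M W D q
  using q fin Dp.W_add Dp.W_scale Dp.W0 Dp.add Dp.scale Dp.Lp
  by unfold_locales (auto intro: Lp_nested(1)[of M q p])

sublocale Uq: linear_Lp M W U q
  using q fin Up.W_add Up.W_scale Up.W0 Up.add Up.scale Up.Lp
  by unfold_locales (auto intro: Lp_nested(1)[of M q p])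

text \<open>Constants of the embeddings \<open>L\<^sup>p \<subseteq> L\<^sup>q\<close> and \<open>Up.n \<le> CU * Dp.n\<close>.\<close>

definition Cq where "Cq = (measure M (space M) + 1) powr (1/q)"
definition CU where "CU = (SOME C. C > 0 \<and> (\<forall>u\<in>W. Up.n u \<le> C * Dp.n u))"

lemma Cq_pos: "Cq > 0"
proof -
  have "measure M (space M) + 1 > 0" using measure_nonneg[of M "space M"] by linarith
  then show ?thesis by (simp add: Cq_def)
qed

lemma Uq_le: "u \<in> W \<Longrightarrow> Uq.n u \<le> Cq * Up.n u"
  using Lp_nested(2)[OF fin _ q(2) Up.Lp] q(1) by (simp add: Uq.n_def Up.n_def Cq_def)

lemma Dq_le: "u \<in> W \<Longrightarrow> Dq.n u \<le> Cq * Dp.n u"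
  using Lp_nested(2)[OF fin _ q(2) Dp.Lp] q(1) by (simp add: Dq.n_def Dp.n_def Cq_def)

lemma CU: "CU > 0" "u \<in> W \<Longrightarrow> Up.n u \<le> CU * Dp.n u"
proof -
  obtain C where C: "\<And>u. u \<in> W \<Longrightarrow> Up.n u \<le> C * Dp.n u" using poincare by blast
  have "Up.n u \<le> (\<bar>C\<bar> + 1) * Dp.n u" if "u \<in> W" for u
  proof -
    have "C * Dp.n u \<le> (\<bar>C\<bar> + 1) * Dp.n u" by (intro mult_right_mono) auto
    then show ?thesis using C[OF that] by simp
  qed
  then have "\<exists>C. C > 0 \<and> (\<forall>u\<in>W. Up.n u \<le> C * Dp.n u)" by (intro exI[of _ "\<bar>C\<bar> + 1"]) auto
  from someI_ex[OF this] show "CU > 0" "u \<in> W \<Longrightarrow> Up.n u \<le> CU * Dp.n u"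
    unfolding CU_def by blast+
qed

lemma Dp_zero: "u \<in> W \<Longrightarrow> Dp.n u = 0 \<Longrightarrow> u = 0"
  using CU(2)[of u] Up.n_nonneg[of u] definite[of u] by auto

lemma lim_Up:
  assumes "\<And>k::nat. s k \<in> W" "u \<in> W" "(\<lambda>k. Dp.n (s k - u)) \<longlonglongrightarrow> 0"
  shows "(\<lambda>k. Up.n (s k - u)) \<longlonglongrightarrow> 0"
  by (rule Lim_null_comparison[OF _ tendsto_mult_right_zero[OF assms(3), of CU]])
     (use CU(2) Dp.W_diff assms in auto)

lemma lim_Uq:
  assumes "\<And>k::nat. s k \<in> W" "u \<in> W" "(\<lambda>k. Dp.n (s k - u)) \<longlonglongrightarrow> 0"
  shows "(\<lambda>k. Uq.n (s k - u)) \<longlonglongrightarrow> 0"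
  by (rule Lim_null_comparison[OF _ tendsto_mult_right_zero[OF lim_Up[OF assms], of Cq]])
     (use Uq_le Dp.W_diff assms in auto)

lemma lim_Dq:
  assumes "\<And>k::nat. s k \<in> W" "u \<in> W" "(\<lambda>k. Dp.n (s k - u)) \<longlonglongrightarrow> 0"
  shows "(\<lambda>k. Dq.n (s k - u)) \<longlonglongrightarrow> 0"
  by (rule Lim_null_comparison[OF _ tendsto_mult_right_zero[OF assms(3), of Cq]])
     (use Dq_le Dp.W_diff assms in auto)

lemma metric_W: "Metric_space W (\<lambda>u v. Dp.n (u - v))"
proof
  fix x y z assume W: "x \<in> W" "y \<in> W"
  then show "(Dp.n (x - y) = 0) = (x = y)" using Dp_zero[OF Dp.W_diff, of x y] by auto
  show "Dp.n (x - z) \<le> Dp.n (x - y) + Dp.n (y - z)" if "z \<in> W"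
    using W that by (rule Dp.n_triangle)
qed (use n_minus_all[of "x - y" for x y] in \<open>auto\<close>)

end

text \<open>The condition \<open>gap\<close> expresses \<open>\<beta> < \<beta>\<^sub>*(\<alpha>)\<close> without quotients: any number strictly between the two, minus \<open>\<beta>\<close>, serves as \<open>g\<close>.\<close>

locale two_parameter_problem = sobolev_like M W D U p q
  for M :: "'a measure" and W :: "'v::real_vector set" and D :: "'v \<Rightarrow> 'a \<Rightarrow> 'b::euclidean_space"
    and U :: "'v \<Rightarrow> 'a \<Rightarrow> real" and p q :: real +
  fixes \<alpha> \<beta> :: real
  assumes \<alpha>: "\<alpha> > 0"
    and gap: "\<exists>g>0. \<forall>u\<in>W. Dp.I u \<le> \<alpha> * Up.I u \<longrightarrow> g * Uq.I u \<le> Dq.I u - \<beta> * Uq.I u"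
begin

definition H where "H u = Dp.I u - \<alpha> * Up.I u"
definition G where "G u = Dq.I u - \<beta> * Uq.I u"
definition E where "E u = 1 / p * H u + 1 / q * G u"
text \<open>Normalisation by the \<open>p\<close>-norm of the function, because this norm is compact with respect to the gradient norm.\<close>

definition X where "X = {u \<in> W. Up.n u = 1 \<and> H u < 0}"

definition \<beta>p where "\<beta>p = max 0 \<beta>"
definition \<beta>m where "\<beta>m = max 0 (- \<beta>)"

text \<open>\<open>Gm u\<close> is \<open>G\<close> with the concave part \<open>- \<beta>p * Uq.I\<close> replaced by its tangent at \<open>u\<close>; it is convex and \<open>Gm u v \<ge> G v\<close>. Likewise \<open>h u\<close> is \<open>- H\<close> with
the convex part \<open>\<alpha> * Up.I\<close> replaced by its tangent \<open>k u\<close> at \<open>u\<close>, where \<open>Up.I u = 1\<close>; it is concave and \<open>h u v \<le> - H v\<close>. The functional \<open>F u\<close>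
majorises \<open>J\<close> up to a constant; \<open>A u\<close> is its part without the barrier. The reciprocal \<open>inverse (G u)\<close> enters as a separate parameter, since \<open>G u\<close> is not continuous in the \<open>L\<^sup>p\<close>-norm.\<close>

definition Gm where "Gm u v = Dq.I v + \<beta>m * Uq.I v - \<beta>p * (q * Uq.P u v - (q - 1) * Uq.I u)"
definition k where "k u v = \<alpha> * (p * Up.P u v - (p - 1))"
definition h where "h u v = k u v - Dp.I v"
definition A where "A u v = p * inverse (G u) * Gm u v"
definition F where "F u v = A u v - q * ln (h u v)"

lemma pq: "p > 1" "q > 1" "p > 0" "q > 0" "p > q"
  using q Dp.r by auto

lemma \<beta>_eq: "\<beta> = \<beta>p - \<beta>m" "\<beta>p \<ge> 0" "\<beta>m \<ge> 0" "\<beta>p \<le> \<bar>\<beta>\<bar>" "\<beta>m \<le> \<bar>\<beta>\<bar>"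
  by (auto simp: \<beta>p_def \<beta>m_def)

lemma \<beta>_times: "\<beta> * x = \<beta>p * x - \<beta>m * x"
  using \<beta>_eq(1) by (metis left_diff_distrib)

lemma XW: "u \<in> X \<Longrightarrow> u \<in> W" and X_norm: "u \<in> X \<Longrightarrow> Up.n u = 1"
  and X_neg: "u \<in> X \<Longrightarrow> H u < 0" and X_I: "u \<in> X \<Longrightarrow> Up.I u = 1"
  unfolding X_def by (auto simp flip: Up.n_powr)

lemma Uq_zero: "u \<in> W \<Longrightarrow> Uq.I u = 0 \<Longrightarrow> u = 0"
proof -
  assume u: "u \<in> W" "Uq.I u = 0"
  then have "AE x in M. U u x = 0" using Lint_eq_0_iff[OF Uq.Lp[OF u(1)]] by (simp add: Uq.I_def)
  then have "Up.n u = 0" using Lnorm_eq_0_iff[OF Up.Lp[OF u(1)]] pq by (simp add: Up.n_def)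
  then show ?thesis using definite u by blast
qed

lemma G_nonneg: "u \<in> W \<Longrightarrow> H u \<le> 0 \<Longrightarrow> G u \<ge> 0"
  and G_pos: "u \<in> W \<Longrightarrow> H u < 0 \<Longrightarrow> G u > 0"
proof -
  obtain g where g: "g > 0" "\<And>u. u \<in> W \<Longrightarrow> H u \<le> 0 \<Longrightarrow> g * Uq.I u \<le> G u"
    using gap by (auto simp: H_def G_def)
  show "u \<in> W \<Longrightarrow> H u \<le> 0 \<Longrightarrow> G u \<ge> 0"
    using g(2)[of u] mult_nonneg_nonneg[of g "Uq.I u"] g(1) Uq.I_nonneg[of u] by linarith
  assume u: "u \<in> W" "H u < 0"
  then have "u \<noteq> 0" by (auto simp: H_def)
  then have "Uq.I u > 0" using Uq_zero[OF u(1)] Uq.I_nonneg[of u] by linarith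
  then have "g * Uq.I u > 0" using g(1) by simp
  with g(2)[of u] u show "G u > 0" by simp
qed

lemma X_Dp_bound: "u \<in> X \<Longrightarrow> Dp.n u \<le> \<alpha> powr (1 / p)"
proof -
  assume u: "u \<in> X"
  then have "Dp.n u powr p \<le> \<alpha>" using X_neg[OF u] X_I[OF u] by (simp add: Dp.n_powr H_def)
  then have "(Dp.n u powr p) powr (1 / p) \<le> \<alpha> powr (1 / p)" using pq by (intro powr_mono2) auto
  then show ?thesis using pq by (simp add: powr_powr)
qed

text \<open>The \<open>q\<close>-norm cannot degenerate on \<open>X\<close>: a sequence with \<open>q\<close>-norms tending to 0 would, by compactness, converge in \<open>L\<^sup>p\<close> to a function that is zero and has norm one.\<close>

lemma Uq_lower: "\<exists>c>0. \<forall>u\<in>X. c \<le> Uq.n u"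
proof (rule ccontr)
  assume "\<not> ?thesis"
  then have "\<exists>u\<in>X. Uq.n u < inverse (real (Suc j))" for j
    by (metis inverse_positive_iff_positive not_le of_nat_0_less_iff zero_less_Suc)
  then obtain s where s: "\<And>j. s j \<in> X" "\<And>j. Uq.n (s j) < inverse (real (Suc j))" by metis
  have "\<exists>r :: nat \<Rightarrow> nat. strict_mono r \<and>
        (\<forall>e>0. \<exists>N. \<forall>j\<ge>N. \<forall>k\<ge>N. Up.n (s (r j) - s (r k)) < e)"
    by (rule rellich[where s = s and B = "\<alpha> powr (1 / p)"]) (use XW X_Dp_bound s(1) in auto)
  then obtain r :: "nat \<Rightarrow> nat" where r: "strict_mono r"
      "\<And>e. e > 0 \<Longrightarrow> \<exists>N. \<forall>j\<ge>N. \<forall>k\<ge>N. Up.n (s (r j) - s (r k)) < e"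
    by blast
  have sW: "s j \<in> W" for j using s(1) XW by blast
  obtain g where g: "g \<in> Lp M p" "(\<lambda>j. Lnorm M p (\<lambda>x. U (s (r j)) x - g x)) \<longlonglongrightarrow> 0"
    using Lp_complete[of p "\<lambda>j. U (s (r j))" M] r(2) pq Up.Lp sW
    by (auto simp flip: Up.n_diff_eq[OF sW sW])
  have Lq: "g \<in> Lp M q" "(\<lambda>x. U (s (r j)) x - g x) \<in> Lp M p" for j
    using Lp_nested(1)[OF fin _ q(2) g(1)] pq Lp_diff[OF _ Up.Lp[OF sW] g(1)] by auto
  have "(\<lambda>j. Lnorm M q (\<lambda>x. U (s (r j)) x - g x)) \<longlonglongrightarrow> 0"
    by (rule Lim_null_comparison[OF _ tendsto_mult_right_zero[OF g(2), of Cq]])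
       (use Lp_nested(2)[OF fin _ q(2) Lq(2)] pq in \<open>auto simp: Cq_def\<close>)
  moreover have "(\<lambda>j. Uq.n (s (r j))) \<longlonglongrightarrow> 0"
  proof (rule Lim_null_comparison)
    show "(\<lambda>j. inverse (real (Suc (r j)))) \<longlonglongrightarrow> 0"
      using LIMSEQ_subseq_LIMSEQ[OF LIMSEQ_inverse_real_of_nat r(1)] by (simp add: o_def)
    show "\<forall>\<^sub>F j in sequentially. norm (Uq.n (s (r j))) \<le> inverse (real (Suc (r j)))"
      using less_imp_le[OF s(2)] by (intro always_eventually allI) simp
  qed
  ultimately have l: "(\<lambda>j. Uq.n (s (r j)) + Lnorm M q (\<lambda>x. U (s (r j)) x - g x)) \<longlonglongrightarrow> 0"
    using tendsto_add_zero by blast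
  have "Lnorm M q g \<le> 0"
  proof (rule LIMSEQ_le_const[OF l])
    have "Lnorm M q g \<le> Uq.n (s (r j)) + Lnorm M q (\<lambda>x. U (s (r j)) x - g x)" for j
      using Lp_minkowski_diff[OF pq(2) Uq.Lp[OF sW[of "r j"]] Lp_nested(1)[OF fin _ q(2) Lq(2)[of j]]] pq
      by (simp add: Uq.n_def)
    then show "\<exists>N. \<forall>j\<ge>N. Lnorm M q g \<le> Uq.n (s (r j)) + Lnorm M q (\<lambda>x. U (s (r j)) x - g x)" by blast
  qed
  then have "Lnorm M q g = 0" using Lnorm_nonneg[of M q g] by linarith
  then have "AE x in M. g x = 0" using Lnorm_eq_0_iff[OF Lq(1)] pq by simp
  then have g0: "Lnorm M p g = 0" using Lnorm_eq_0_iff[OF g(1)] pq by simp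
  have "1 \<le> Lnorm M p (\<lambda>x. U (s (r j)) x - g x)" for j
    using Lnorm_reverse_triangle[OF pq(1) Up.Lp[OF sW[of "r j"]] g(1)] g0 X_norm[OF s(1)[of "r j"]]
    by (simp add: Up.n_def)
  moreover obtain j where "Lnorm M p (\<lambda>x. U (s (r j)) x - g x) < 1"
    using LIMSEQ_D[OF g(2), of 1] by fastforce
  ultimately show False by (meson not_less)
qed

definition g0 where "g0 = (SOME g. g > 0 \<and> (\<forall>u\<in>X. g \<le> G u))"

lemma g0: "g0 > 0" "u \<in> X \<Longrightarrow> g0 \<le> G u"
proof -
  obtain c where c: "c > 0" "\<And>u. u \<in> X \<Longrightarrow> c \<le> Uq.n u" using Uq_lower by blast
  obtain g where g: "g > 0" "\<And>u. u \<in> W \<Longrightarrow> H u \<le> 0 \<Longrightarrow> g * Uq.I u \<le> G u"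
    using gap by (auto simp: H_def G_def)
  have "g * c powr q \<le> G u" if "u \<in> X" for u
  proof -
    have "c powr q \<le> Uq.I u" unfolding Uq.n_powr[symmetric] using c that pq by (intro powr_mono2) auto
    then have "g * c powr q \<le> g * Uq.I u" using g(1) by (intro mult_left_mono) auto
    with g(2)[of u] that XW X_neg show ?thesis by (meson less_imp_le order_trans)
  qed
  then have "\<exists>g. g > 0 \<and> (\<forall>u\<in>X. g \<le> G u)" using g(1) c(1) by (intro exI[of _ "g * c powr q"]) auto
  from someI_ex[OF this] show "g0 > 0" "u \<in> X \<Longrightarrow> g0 \<le> G u" unfolding g0_def by blast+
qed

lemma Gm_self: "u \<in> W \<Longrightarrow> Gm u u = G u"
  unfolding Gm_def G_def Uq.P_self using \<beta>_times[of "Uq.I u"] by (simp add: algebra_simps)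

lemma h_self: "u \<in> X \<Longrightarrow> h u u = - H u"
  using X_I[of u] by (simp add: h_def k_def H_def Up.P_self)

lemma Gm_ge: "u \<in> W \<Longrightarrow> v \<in> W \<Longrightarrow> G v \<le> Gm u v"
proof -
  assume uv: "u \<in> W" "v \<in> W"
  have "\<beta>p * (q * Uq.P u v - (q - 1) * Uq.I u) \<le> \<beta>p * Uq.I v"
    using Uq.I_tangent[OF uv] \<beta>_eq by (intro mult_left_mono) (auto simp: algebra_simps)
  then show ?thesis unfolding Gm_def G_def using \<beta>_times[of "Uq.I v"] by simp
qed

lemma h_le: "u \<in> X \<Longrightarrow> v \<in> W \<Longrightarrow> h u v \<le> - H v"
proof -
  assume u: "u \<in> X" and v: "v \<in> W"
  have "p * Up.P u v - (p - 1) \<le> Up.I v"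
    using Up.I_tangent[OF XW[OF u] v] X_I[OF u] by (simp add: algebra_simps)
  then have "\<alpha> * (p * Up.P u v - (p - 1)) \<le> \<alpha> * Up.I v" using \<alpha> by (intro mult_left_mono) auto
  then show ?thesis by (simp add: h_def k_def H_def)
qed

text \<open>On \<open>h u > 0\<close> the gradient norm is at most \<open>R0\<close>, since the affine function \<open>k u\<close> grows linearly and \<open>Dp.I\<close> with the power \<open>p > 1\<close>; correspondingly \<open>k u \<le> K0\<close>
there. The effective domain of \<open>F u\<close> is therefore bounded, uniformly in \<open>u\<close>.\<close>

definition R0 where "R0 = (\<alpha> * p * CU) powr (1 / (p - 1))"
definition K0 where "K0 = \<alpha> * p * CU * R0"

lemma R0: "R0 > 0" "K0 > 0"
  using \<alpha> pq CU(1) by (auto simp: R0_def K0_def)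

lemma k_le: "u \<in> X \<Longrightarrow> v \<in> W \<Longrightarrow> k u v \<le> \<alpha> * p * CU * Dp.n v"
proof -
  assume u: "u \<in> X" and v: "v \<in> W"
  have "Up.P u v \<le> CU * Dp.n v"
    using Up.P_bound[OF XW[OF u] v] X_norm[OF u] CU(2)[OF v] by simp
  then have "\<alpha> * p * Up.P u v \<le> \<alpha> * p * (CU * Dp.n v)" using \<alpha> pq by (intro mult_left_mono) auto
  moreover have "k u v \<le> \<alpha> * p * Up.P u v" using \<alpha> pq by (simp add: k_def algebra_simps)
  ultimately show ?thesis by (simp add: mult.assoc)
qed

lemma Dp_le_R0: "u \<in> X \<Longrightarrow> v \<in> W \<Longrightarrow> h u v > 0 \<Longrightarrow> Dp.n v \<le> R0"
proof (cases "Dp.n v = 0")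
  case True
  then show ?thesis using R0 by simp
next
  case False
  assume u: "u \<in> X" and v: "v \<in> W" and h: "h u v > 0"
  have pos: "Dp.n v > 0" using False Dp.n_nonneg[of v] by linarith
  have "Dp.n v powr (p - 1) * Dp.n v = Dp.I v"
    using pos by (simp add: powr_minus_one_mult Dp.n_powr)
  also have "\<dots> \<le> \<alpha> * p * CU * Dp.n v" using k_le[OF u v] h by (simp add: h_def)
  finally have "Dp.n v powr (p - 1) \<le> \<alpha> * p * CU" using pos by (simp add: mult_le_cancel_right)
  then have "(Dp.n v powr (p - 1)) powr (1 / (p - 1)) \<le> R0"
    unfolding R0_def using pq by (intro powr_mono2) auto
  then show ?thesis using pq pos by (simp add: powr_powr)
qed

lemma k_le_K0: "u \<in> X \<Longrightarrow> v \<in> W \<Longrightarrow> Dp.n v \<le> R0 \<Longrightarrow> k u v \<le> K0"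
proof -
  assume *: "u \<in> X" "v \<in> W" "Dp.n v \<le> R0"
  have "\<alpha> * p * CU * Dp.n v \<le> K0"
    unfolding K0_def using *(3) \<alpha> pq CU(1) by (intro mult_left_mono) auto
  with k_le[OF *(1,2)] show ?thesis by simp
qed

lemma A_nonneg: "u \<in> X \<Longrightarrow> v \<in> W \<Longrightarrow> h u v > 0 \<Longrightarrow> A u v \<ge> 0"
proof -
  assume u: "u \<in> X" and v: "v \<in> W" and h: "h u v > 0"
  have "G v \<ge> 0" using h h_le[OF u v] by (intro G_nonneg v) linarith
  then have "Gm u v \<ge> 0" using Gm_ge[OF XW[OF u] v] by linarith
  then show ?thesis using g0(1) g0(2)[OF u] pq by (auto simp: A_def intro!: mult_nonneg_nonneg)
qed

lemma F_lower: "u \<in> X \<Longrightarrow> v \<in> W \<Longrightarrow> h u v > 0 \<Longrightarrow> F u v \<ge> - q * ln K0"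
proof -
  assume u: "u \<in> X" and v: "v \<in> W" and h: "h u v > 0"
  have "h u v \<le> K0" using k_le_K0[OF u v Dp_le_R0[OF u v h]] by (simp add: h_def)
      (use Dp.I_nonneg[of v] in linarith)
  then have "q * ln (h u v) \<le> q * ln K0" using h R0 pq by (intro mult_left_mono) auto
  then show ?thesis using A_nonneg[OF u v h] by (simp add: F_def)
qed

lemma F_self: "u \<in> X \<Longrightarrow> F u u = p - q * ln (- H u)"
  using Gm_self[OF XW, of u] G_pos[OF XW X_neg, of u] by (simp add: F_def A_def h_self)

text \<open>The barrier keeps near-minimisers away from the boundary of \<open>h u > 0\<close>: as \<open>A u\<close> is nonnegative, \<open>F u v \<le> F u u + 1\<close> bounds \<open>h u v\<close> from below by
this number (\<open>F u u = p - q ln (- H u)\<close>).\<close>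

definition h_floor where "h_floor u = - H u * exp (- ((p + 1) / q))"

lemma h_floor_pos: "u \<in> X \<Longrightarrow> h_floor u > 0"
  unfolding h_floor_def using X_neg[of u] by (intro mult_pos_pos) auto

lemma h_ge: "u \<in> X \<Longrightarrow> v \<in> W \<Longrightarrow> h u v > 0 \<Longrightarrow> F u v \<le> F u u + 1 \<Longrightarrow> h_floor u \<le> h u v"
proof -
  assume u: "u \<in> X" and v: "v \<in> W" and h: "h u v > 0" and F: "F u v \<le> F u u + 1"
  have "- q * ln (h u v) \<le> p + 1 - q * ln (- H u)"
    using F A_nonneg[OF u v h] unfolding F_self[OF u] by (simp add: F_def)
  then have "q * (ln (- H u) - (p + 1) / q) \<le> q * ln (h u v)" using pq by (simp add: right_diff_distrib)
  then have "ln (- H u) - (p + 1) / q \<le> ln (h u v)" using pq by simp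
  then have "exp (ln (- H u) - (p + 1) / q) \<le> h u v" using h by (metis exp_le_cancel_iff exp_ln)
  then show ?thesis using X_neg[OF u] by (simp add: h_floor_def exp_diff exp_minus field_simps)
qed

lemma mid_W: "v \<in> W \<Longrightarrow> w \<in> W \<Longrightarrow> (1/2) *\<^sub>R (v + w) \<in> W"
  by (intro Dp.W_scale Dp.W_add)

lemma k_mid: "u \<in> W \<Longrightarrow> v \<in> W \<Longrightarrow> w \<in> W \<Longrightarrow> k u ((1/2) *\<^sub>R (v + w)) = (k u v + k u w) / 2"
proof -
  assume *: "u \<in> W" "v \<in> W" "w \<in> W"
  have e: "Up.P u ((1/2) *\<^sub>R (v + w)) = (1/2) * (Up.P u v + Up.P u w)"
    using Up.P_scale[OF *(1) Dp.W_add[OF *(2,3)], of "1/2"] Up.P_add[OF *] by simp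
  show ?thesis unfolding k_def e by (simp add: field_simps)
qed

lemma A_mid:
  assumes u: "u \<in> X" and v: "v \<in> W" and w: "w \<in> W"
  shows "A u ((1/2) *\<^sub>R (v + w)) \<le> (A u v + A u w) / 2"
proof -
  have "Gm u ((1/2) *\<^sub>R (v + w)) \<le> (Dq.I v + Dq.I w) / 2 + \<beta>m * ((Uq.I v + Uq.I w) / 2)
     - \<beta>p * (q * ((Uq.P u v + Uq.P u w) / 2) - (q - 1) * Uq.I u)"
    unfolding Gm_def using Uq.P_add[OF XW[OF u] v w] Uq.P_scale[OF XW[OF u] Dp.W_add[OF v w], of "1/2"] \<beta>_eq pq
    by (intro add_mono diff_mono mult_left_mono Dq.I_midpoint Uq.I_midpoint v w) auto
  also have "\<dots> = (Gm u v + Gm u w) / 2" by (simp add: Gm_def field_simps)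
  finally have "p * inverse (G u) * Gm u ((1/2) *\<^sub>R (v + w)) \<le> p * inverse (G u) * ((Gm u v + Gm u w) / 2)"
    using g0(1) g0(2)[OF u] pq by (intro mult_left_mono) auto
  then show ?thesis unfolding A_def by (simp only: distrib_left times_divide_eq_right)
qed

text \<open>On the ball of radius \<open>R0\<close> the data of \<open>F u\<close> depend uniformly continuously on the \<open>L\<^sup>p\<close>-class of \<open>u\<close> and on \<open>1 / G u\<close>; the gradient of \<open>u\<close> enters only through \<open>G u\<close>.
This is what turns compactness in \<open>L\<^sup>p\<close> into compactness of \<open>T\<close>.\<close>

lemma params_close:
  assumes \<delta>: "\<delta> > 0"
  shows "\<exists>\<eta>>0. \<forall>u\<in>X. \<forall>u'\<in>X. Up.n (u - u') < \<eta> \<longrightarrow> \<bar>inverse (G u) - inverse (G u')\<bar> < \<eta> \<longrightarrow>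
    (\<forall>x\<in>W. Dp.n x \<le> R0 \<longrightarrow> \<bar>A u x - A u' x\<bar> \<le> \<delta> \<and> \<bar>k u x - k u' x\<bar> \<le> \<delta>)"
proof -
  define B1 where "B1 = (Cq * R0) powr q + \<bar>\<beta>\<bar> * (Cq * (CU * R0)) powr q
     + \<bar>\<beta>\<bar> * (q * (Cq powr (q - 1) * (Cq * (CU * R0))) + (q - 1) * Cq powr q) + 1"
  have B1: "B1 > 0" using pq Cq_pos CU(1) R0 unfolding B1_def
    by (intro add_nonneg_pos add_nonneg_nonneg mult_nonneg_nonneg) auto
  define e1 where "e1 = \<delta> / (\<alpha> * p * (CU * R0))"
  have e1: "e1 > 0" using \<delta> \<alpha> pq CU(1) R0 by (simp add: e1_def)
  define t where "t = \<delta> * g0 / (2 * p)"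
  have t: "t > 0" using \<delta> g0 pq by (simp add: t_def)
  define e2 where "e2 = t / (2 * (\<bar>\<beta>\<bar> + 1) * q * (Cq * (CU * R0)))"
  have b1: "\<bar>\<beta>\<bar> + 1 > 0" by linarith
  have e2: "e2 > 0" using t pq Cq_pos CU(1) R0 b1 by (simp add: e2_def)
  define L3 where "L3 = q * (Cq powr (q - 1) * Cq)"
  have L3: "L3 > 0" using pq Cq_pos by (simp add: L3_def)
  define e3 where "e3 = t / (2 * (\<bar>\<beta>\<bar> + 1) * q * L3)"
  have e3: "e3 > 0" using t L3 b1 pq by (simp add: e3_def)
  obtain d1 where d1: "d1 > 0" "\<And>u v w. u \<in> W \<Longrightarrow> v \<in> W \<Longrightarrow> Up.n u \<le> 1 \<Longrightarrow> Up.n v \<le> 1 \<Longrightarrow>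
      Up.n (u - v) < d1 \<Longrightarrow> w \<in> W \<Longrightarrow> \<bar>Up.P u w - Up.P v w\<bar> \<le> e1 * Up.n w"
    using Up.P_continuity[OF e1, of 1] by blast
  obtain d2 where d2: "d2 > 0" "\<And>u v w. u \<in> W \<Longrightarrow> v \<in> W \<Longrightarrow> Uq.n u \<le> Cq \<Longrightarrow> Uq.n v \<le> Cq \<Longrightarrow>
      Uq.n (u - v) < d2 \<Longrightarrow> w \<in> W \<Longrightarrow> \<bar>Uq.P u w - Uq.P v w\<bar> \<le> e2 * Uq.n w"
    using Uq.P_continuity[OF e2, of Cq] by blast
  define \<eta> where "\<eta> = min (min d1 (d2 / Cq)) (min e3 (\<delta> / (2 * p * B1)))"
  have \<eta>: "\<eta> > 0" "\<eta> \<le> d1" "\<eta> \<le> d2 / Cq" "\<eta> \<le> e3" "\<eta> \<le> \<delta> / (2 * p * B1)"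
    using d1 d2 Cq_pos e3 \<delta> pq B1 by (auto simp: \<eta>_def)
  have "\<bar>A u x - A u' x\<bar> \<le> \<delta> \<and> \<bar>k u x - k u' x\<bar> \<le> \<delta>"
    if u: "u \<in> X" and u': "u' \<in> X" and close: "Up.n (u - u') < \<eta>" and inv: "\<bar>inverse (G u) - inverse (G u')\<bar> < \<eta>"
      and x: "x \<in> W" "Dp.n x \<le> R0" for u u' x
  proof
    note W = XW[OF u] XW[OF u']
    have Ux: "Up.n x \<le> CU * R0"
      using CU(2)[OF x(1)] mult_left_mono[OF x(2), of CU] CU(1) by linarith
    have Uqx: "Uq.n x \<le> Cq * (CU * R0)"
      using Uq_le[OF x(1)] mult_left_mono[OF Ux, of Cq] Cq_pos by linarith
    have Dqx: "Dq.n x \<le> Cq * R0"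
      using Dq_le[OF x(1)] mult_left_mono[OF x(2), of Cq] Cq_pos by linarith
    have Uqu: "Uq.n u \<le> Cq" "Uq.n u' \<le> Cq" using Uq_le W X_norm u u' by fastforce+
    have Uqd: "Uq.n (u - u') \<le> Cq * Up.n (u - u')" using Uq_le Dp.W_diff W by blast
    have Uqd2: "Uq.n (u - u') < d2"
    proof -
      have "Cq * Up.n (u - u') < Cq * (d2 / Cq)" using close \<eta>(3) Cq_pos by (intro mult_strict_left_mono) auto
      then show ?thesis using Uqd Cq_pos by simp
    qed
    have "\<bar>k u x - k u' x\<bar> = \<alpha> * p * \<bar>Up.P u x - Up.P u' x\<bar>"
    proof -
      have "k u x - k u' x = \<alpha> * p * (Up.P u x - Up.P u' x)" by (simp add: k_def algebra_simps)
      then show ?thesis using \<alpha> pq by (simp add: abs_mult)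
    qed
    also have "\<dots> \<le> \<alpha> * p * (e1 * (CU * R0))"
    proof (rule mult_left_mono)
      have "\<bar>Up.P u x - Up.P u' x\<bar> \<le> e1 * Up.n x"
        using W X_norm[OF u] X_norm[OF u'] close \<eta>(2) x by (intro d1(2)) auto
      also have "\<dots> \<le> e1 * (CU * R0)" using Ux e1 by (intro mult_left_mono) auto
      finally show "\<bar>Up.P u x - Up.P u' x\<bar> \<le> e1 * (CU * R0)" .
    qed (use \<alpha> pq in auto)
    also have "\<dots> = \<delta>" using \<alpha> pq CU(1) R0 by (simp add: e1_def)
    finally show "\<bar>k u x - k u' x\<bar> \<le> \<delta>" .
    have Gmb: "\<bar>Gm u x\<bar> \<le> B1"
    proof -
      have "Dq.I x \<le> (Cq * R0) powr q" unfolding Dq.n_powr[symmetric] using Dqx pq by (intro powr_mono2) auto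
      moreover have "Uq.I x \<le> (Cq * (CU * R0)) powr q" unfolding Uq.n_powr[symmetric] using Uqx pq by (intro powr_mono2) auto
      then have "\<beta>m * Uq.I x \<le> \<bar>\<beta>\<bar> * (Cq * (CU * R0)) powr q" using \<beta>_eq by (intro mult_mono) auto
      moreover have "\<bar>Uq.P u x\<bar> \<le> Cq powr (q - 1) * (Cq * (CU * R0))"
      proof -
        have "Uq.n u powr (q - 1) * Uq.n x \<le> Cq powr (q - 1) * (Cq * (CU * R0))"
          using Uqu Uqx pq by (intro mult_mono powr_mono2) auto
        then show ?thesis using Uq.P_bound[OF W(1) x(1)] by linarith
      qed
      moreover have "Uq.I u \<le> Cq powr q" unfolding Uq.n_powr[symmetric] using Uqu pq by (intro powr_mono2) auto
      ultimately have 1: "Dq.I x \<le> (Cq * R0) powr q" "\<beta>m * Uq.I x \<le> \<bar>\<beta>\<bar> * (Cq * (CU * R0)) powr q"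
        "\<bar>q * Uq.P u x - (q - 1) * Uq.I u\<bar> \<le> q * (Cq powr (q - 1) * (Cq * (CU * R0))) + (q - 1) * Cq powr q"
      proof -
        assume a: "\<bar>Uq.P u x\<bar> \<le> Cq powr (q - 1) * (Cq * (CU * R0))" and b: "Uq.I u \<le> Cq powr q"
        have "\<bar>q * Uq.P u x - (q - 1) * Uq.I u\<bar> \<le> q * \<bar>Uq.P u x\<bar> + (q - 1) * Uq.I u"
          using abs_triangle_ineq4[of "q * Uq.P u x" "(q - 1) * Uq.I u"] pq by (simp add: abs_mult)
        also have "\<dots> \<le> q * (Cq powr (q - 1) * (Cq * (CU * R0))) + (q - 1) * Cq powr q"
          using a b pq by (intro add_mono mult_left_mono) auto
        finally show "\<bar>q * Uq.P u x - (q - 1) * Uq.I u\<bar> \<le> q * (Cq powr (q - 1) * (Cq * (CU * R0))) + (q - 1) * Cq powr q" .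
      qed auto
      have "\<bar>\<beta>p * (q * Uq.P u x - (q - 1) * Uq.I u)\<bar> \<le> \<bar>\<beta>\<bar> * (q * (Cq powr (q - 1) * (Cq * (CU * R0))) + (q - 1) * Cq powr q)"
        unfolding abs_mult using 1(3) \<beta>_eq by (intro mult_mono) auto
      moreover have "Dq.I x \<ge> 0" "\<beta>m * Uq.I x \<ge> 0" using \<beta>_eq by auto
      ultimately show ?thesis unfolding Gm_def B1_def using 1(1,2) by linarith
    qed
    have Gmd: "\<bar>Gm u x - Gm u' x\<bar> \<le> t"
    proof -
      have a: "\<bar>Uq.P u x - Uq.P u' x\<bar> \<le> e2 * (Cq * (CU * R0))"
      proof -
        have "\<bar>Uq.P u x - Uq.P u' x\<bar> \<le> e2 * Uq.n x" using W Uqu Uqd2 x by (intro d2(2)) auto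
        also have "\<dots> \<le> e2 * (Cq * (CU * R0))" using Uqx e2 by (intro mult_left_mono) auto
        finally show ?thesis .
      qed
      have b: "\<bar>Uq.I u - Uq.I u'\<bar> \<le> L3 * e3"
      proof -
        have "\<bar>Uq.I u - Uq.I u'\<bar> \<le> q * (Cq powr (q - 1) * Uq.n (u - u'))"
          by (rule Uq.I_lipschitz[OF W Uqu])
        also have "\<dots> \<le> q * (Cq powr (q - 1) * (Cq * e3))"
        proof (intro mult_left_mono)
          have "Cq * Up.n (u - u') \<le> Cq * e3" using close \<eta>(4) Cq_pos by (intro mult_left_mono) auto
          then show "Uq.n (u - u') \<le> Cq * e3" using Uqd by linarith
        qed (use pq in auto)
        finally show ?thesis by (simp add: L3_def mult.assoc)
      qed
      have "Gm u x - Gm u' x = \<beta>p * ((q - 1) * (Uq.I u - Uq.I u') - q * (Uq.P u x - Uq.P u' x))"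
        by (simp add: Gm_def algebra_simps)
      then have "\<bar>Gm u x - Gm u' x\<bar> = \<beta>p * \<bar>(q - 1) * (Uq.I u - Uq.I u') - q * (Uq.P u x - Uq.P u' x)\<bar>"
        using \<beta>_eq by (simp add: abs_mult)
      also have "\<dots> \<le> (\<bar>\<beta>\<bar> + 1) * (q * (L3 * e3) + q * (e2 * (Cq * (CU * R0))))"
      proof (intro mult_mono)
        have "\<bar>(q - 1) * (Uq.I u - Uq.I u') - q * (Uq.P u x - Uq.P u' x)\<bar>
            \<le> (q - 1) * \<bar>Uq.I u - Uq.I u'\<bar> + q * \<bar>Uq.P u x - Uq.P u' x\<bar>"
          using abs_triangle_ineq4[of "(q - 1) * (Uq.I u - Uq.I u')" "q * (Uq.P u x - Uq.P u' x)"] pq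
          by (simp add: abs_mult)
        also have "\<dots> \<le> q * (L3 * e3) + q * (e2 * (Cq * (CU * R0)))"
          using a b pq by (intro add_mono mult_mono) auto
        finally show "\<bar>(q - 1) * (Uq.I u - Uq.I u') - q * (Uq.P u x - Uq.P u' x)\<bar>
            \<le> q * (L3 * e3) + q * (e2 * (Cq * (CU * R0)))" .
      qed (use \<beta>_eq in auto)
      also have "q * (L3 * e3) = t / (2 * (\<bar>\<beta>\<bar> + 1))" using L3 pq by (simp add: e3_def)
      also have "q * (e2 * (Cq * (CU * R0))) = t / (2 * (\<bar>\<beta>\<bar> + 1))" using pq Cq_pos CU(1) R0 by (simp add: e2_def)
      also have "(\<bar>\<beta>\<bar> + 1) * (t / (2 * (\<bar>\<beta>\<bar> + 1)) + t / (2 * (\<bar>\<beta>\<bar> + 1))) = t"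
      proof -
        have "x * (t / (2 * x) + t / (2 * x)) = t" if "x > 0" for x :: real
          using that by (simp add: field_simps)
        from this[OF b1] show ?thesis .
      qed
      finally show ?thesis .
    qed
    have "A u x - A u' x = p * ((inverse (G u) - inverse (G u')) * Gm u x + inverse (G u') * (Gm u x - Gm u' x))"
      by (simp add: A_def algebra_simps)
    then have "\<bar>A u x - A u' x\<bar> = p * \<bar>(inverse (G u) - inverse (G u')) * Gm u x + inverse (G u') * (Gm u x - Gm u' x)\<bar>"
      using pq by (simp add: abs_mult)
    also have "\<dots> \<le> p * (\<bar>inverse (G u) - inverse (G u')\<bar> * \<bar>Gm u x\<bar> + inverse (G u') * \<bar>Gm u x - Gm u' x\<bar>)"
      using pq g0(1) g0(2)[OF u'] abs_triangle_ineq[of "(inverse (G u) - inverse (G u')) * Gm u x" "inverse (G u') * (Gm u x - Gm u' x)"]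
      by (intro mult_left_mono) (auto simp: abs_mult)
    also have "\<dots> \<le> p * ((\<delta> / (2 * p * B1)) * B1 + inverse g0 * t)"
      using inv \<eta>(5) Gmb Gmd pq g0(1) g0(2)[OF u'] \<delta> B1
      by (intro mult_left_mono add_mono mult_mono le_imp_inverse_le) auto
    also have "\<dots> = \<delta>" using pq B1 g0(1) by (simp add: t_def field_simps)
    finally show "\<bar>A u x - A u' x\<bar> \<le> \<delta>" .
  qed
  then show ?thesis using \<eta>(1) by blast
qed

text \<open>One estimate for existence (\<open>u = u'\<close>, minimising sequences), uniqueness (\<open>u = u'\<close>, two minimisers), continuity and compactness of the minimiser. Since \<open>F u\<close>
contains \<open>Dp.I\<close> only inside the logarithm, the midpoint defect has to be extracted from there by \<open>barrier_gap\<close>; uniform convexity then bounds the distance.\<close>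

lemma near_min:
  assumes e: "e > 0" and c0: "c0 > 0"
  shows "\<exists>\<eta>>0. \<forall>u\<in>X. \<forall>u'\<in>X. \<forall>v\<in>W. \<forall>v'\<in>W.
    Up.n (u - u') < \<eta> \<longrightarrow> \<bar>inverse (G u) - inverse (G u')\<bar> < \<eta> \<longrightarrow> c0 \<le> h u v \<longrightarrow> c0 \<le> h u' v' \<longrightarrow>
    (\<forall>x\<in>W. h u x > 0 \<longrightarrow> F u v \<le> F u x + \<eta>) \<longrightarrow> (\<forall>x\<in>W. h u' x > 0 \<longrightarrow> F u' v' \<le> F u' x + \<eta>) \<longrightarrow>
    Dp.n (v - v') < e"
proof -
  obtain d1 where d1: "d1 > 0" "\<And>u v. u \<in> W \<Longrightarrow> v \<in> W \<Longrightarrow> Dp.I u \<le> R0 powr p \<Longrightarrow> Dp.I v \<le> R0 powr p \<Longrightarrow>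
     (Dp.I u + Dp.I v) / 2 - Dp.I ((1/2) *\<^sub>R (u + v)) < d1 \<Longrightarrow> Dp.n (u - v) < e"
    using Dp.uniform_convexity[OF e, of "R0 powr p"] by blast
  define L where "L = (K0 / q) * (2 + 2 * q / c0)"
  have L: "L > 0" unfolding L_def using R0 pq c0 by (intro mult_pos_pos divide_pos_pos add_pos_pos) auto
  define \<delta> where "\<delta> = min (c0 / 2) (d1 / (2 * L))"
  have \<delta>: "\<delta> > 0" "\<delta> \<le> c0 / 2" "L * \<delta> < d1"
  proof -
    show "\<delta> > 0" "\<delta> \<le> c0 / 2" using c0 d1 L by (auto simp: \<delta>_def)
    have "L * \<delta> \<le> L * (d1 / (2 * L))" using L by (intro mult_left_mono) (auto simp: \<delta>_def)
    also have "\<dots> < d1" using L d1(1) by simp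
    finally show "L * \<delta> < d1" .
  qed
  obtain \<eta>0 where \<eta>0: "\<eta>0 > 0" "\<And>u u' x. u \<in> X \<Longrightarrow> u' \<in> X \<Longrightarrow> Up.n (u - u') < \<eta>0 \<Longrightarrow>
      \<bar>inverse (G u) - inverse (G u')\<bar> < \<eta>0 \<Longrightarrow> x \<in> W \<Longrightarrow> Dp.n x \<le> R0 \<Longrightarrow>
      \<bar>A u x - A u' x\<bar> \<le> \<delta> \<and> \<bar>k u x - k u' x\<bar> \<le> \<delta>"
    using params_close[OF \<delta>(1)] by blast
  define \<eta> where "\<eta> = min \<eta>0 \<delta>"
  have "Dp.n (v - v') < e"
    if u: "u \<in> X" and u': "u' \<in> X" and v: "v \<in> W" and v': "v' \<in> W"
      and close: "Up.n (u - u') < \<eta>" "\<bar>inverse (G u) - inverse (G u')\<bar> < \<eta>"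
      and h: "c0 \<le> h u v" "c0 \<le> h u' v'"
      and m: "\<And>x. x \<in> W \<Longrightarrow> h u x > 0 \<Longrightarrow> F u v \<le> F u x + \<eta>"
      and m': "\<And>x. x \<in> W \<Longrightarrow> h u' x > 0 \<Longrightarrow> F u' v' \<le> F u' x + \<eta>" for u u' v v'
  proof -
    define w where "w = (1/2) *\<^sub>R (v + v')"
    have w: "w \<in> W" unfolding w_def using v v' by (rule mid_W)
    have R: "Dp.n v \<le> R0" "Dp.n v' \<le> R0"
      using Dp_le_R0 u u' v v' h c0 by (meson less_le_trans)+
    have Rw: "Dp.n w \<le> R0"
      using Dp.n_scale[OF Dp.W_add[OF v v'], of "1/2"] Dp.n_add[OF v v'] R by (simp add: w_def)
    have cl: "\<bar>A u x - A u' x\<bar> \<le> \<delta>" "\<bar>k u x - k u' x\<bar> \<le> \<delta>" if "x \<in> W" "Dp.n x \<le> R0" for x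
      using \<eta>0(2)[OF u u' _ _ that] close by (auto simp: \<eta>_def)
    have Iw: "Dp.I w \<le> (Dp.I v + Dp.I v') / 2" unfolding w_def by (rule Dp.I_midpoint[OF v v'])
    have kw: "k u w = (k u v + k u v') / 2" "k u' w = (k u' v + k u' v') / 2"
      unfolding w_def by (rule k_mid[OF XW[OF u] v v'], rule k_mid[OF XW[OF u'] v v'])
    have hw: "c0 / 2 \<le> h u w" "c0 / 2 \<le> k u' w - Dp.I w"
      using cl(2)[OF v R(1)] cl(2)[OF v' R(2)] h Iw kw \<delta>(2) unfolding h_def by (simp_all add: abs_le_iff)
    have Fw: "F u v \<le> F u w + \<delta>" "F u' v' \<le> F u' w + \<delta>"
    proof -
      have "h u w > 0" "h u' w > 0" using hw c0 unfolding h_def by linarith+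
      then show "F u v \<le> F u w + \<delta>" "F u' v' \<le> F u' w + \<delta>"
        using m[OF w] m'[OF w] unfolding \<eta>_def by fastforce+
    qed
    have "(Dp.I v + Dp.I v') / 2 - Dp.I w \<le> (K0 / q) * (2 * \<delta> + 2 * q * \<delta> / c0)"
    proof (rule barrier_gap[where ?k11.0 = "k u v" and ?k12.0 = "k u v'" and ?k22.0 = "k u' v'" and k2w = "k u' w"
          and ?a11.0 = "A u v" and ?a12.0 = "A u v'" and ?a22.0 = "A u' v'" and a1w = "A u w" and a2w = "A u' w"])
      show "(k u v + k u v') / 2 \<le> K0" using k_le_K0[OF u w Rw] kw by simp
      show "A u w \<le> (A u v + A u v') / 2" unfolding w_def by (rule A_mid[OF u v v'])
      show "A u v - q * ln (k u v - Dp.I v) \<le> A u w - q * ln ((k u v + k u v') / 2 - Dp.I w) + \<delta>"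
        using Fw(1) unfolding F_def h_def kw(1) .
      show "A u' v' - q * ln (k u' v' - Dp.I v') \<le> A u' w - q * ln (k u' w - Dp.I w) + \<delta>"
        using Fw(2) unfolding F_def h_def .
      show "\<bar>(k u v + k u v') / 2 - k u' w\<bar> \<le> \<delta>" using cl(2)[OF w Rw] by (simp add: kw)
    qed (use pq c0 R0 \<delta> h cl[OF v' R(2)] cl[OF w Rw] Iw hw in \<open>auto simp: h_def\<close>)
    also have "\<dots> = L * \<delta>" by (simp add: L_def algebra_simps)
    also have "\<dots> < d1" by fact
    finally have "(Dp.I v + Dp.I v') / 2 - Dp.I ((1/2) *\<^sub>R (v + v')) < d1" by (simp add: w_def)
    moreover have "Dp.I v \<le> R0 powr p" "Dp.I v' \<le> R0 powr p"
      unfolding Dp.n_powr[symmetric] using R pq by (auto intro!: powr_mono2)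
    ultimately show ?thesis by (intro d1(2) v v')
  qed
  moreover have "\<eta> > 0" using \<eta>0 \<delta> by (simp add: \<eta>_def)
  ultimately show ?thesis by (intro exI[of _ \<eta>]) blast
qed

lemma h_lim:
  assumes "u \<in> X" "\<And>j::nat. s j \<in> W" "v \<in> W" "(\<lambda>j. Dp.n (s j - v)) \<longlonglongrightarrow> 0"
  shows "(\<lambda>j. h u (s j)) \<longlonglongrightarrow> h u v"
  unfolding h_def k_def
  by (intro tendsto_intros Up.P_lim Dp.I_lim assms XW lim_Up)

lemma A_lim:
  assumes "u \<in> X" "\<And>j::nat. s j \<in> W" "v \<in> W" "(\<lambda>j. Dp.n (s j - v)) \<longlonglongrightarrow> 0"
  shows "(\<lambda>j. A u (s j)) \<longlonglongrightarrow> A u v"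
  unfolding A_def Gm_def
  by (intro tendsto_intros Uq.P_lim Dq.I_lim Uq.I_lim assms XW lim_Uq lim_Dq)

lemma F_lim:
  assumes "u \<in> X" "\<And>j::nat. s j \<in> W" "v \<in> W" "(\<lambda>j. Dp.n (s j - v)) \<longlonglongrightarrow> 0" "h u v > 0"
  shows "(\<lambda>j. F u (s j)) \<longlonglongrightarrow> F u v"
  unfolding F_def using assms(5) by (intro tendsto_intros A_lim h_lim assms) auto

lemma H_lim:
  assumes "\<And>j::nat. s j \<in> W" "v \<in> W" "(\<lambda>j. Dp.n (s j - v)) \<longlonglongrightarrow> 0"
  shows "(\<lambda>j. H (s j)) \<longlonglongrightarrow> H v"
  unfolding H_def by (intro tendsto_intros Up.I_lim Dp.I_lim assms lim_Up)

lemma G_lim: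
  assumes "\<And>j::nat. s j \<in> W" "v \<in> W" "(\<lambda>j. Dp.n (s j - v)) \<longlonglongrightarrow> 0"
  shows "(\<lambda>j. G (s j)) \<longlonglongrightarrow> G v"
  unfolding G_def by (intro tendsto_intros Uq.I_lim Dq.I_lim assms lim_Uq lim_Dq)

definition minimizer where
  "minimizer u v \<longleftrightarrow> v \<in> W \<and> h u v > 0 \<and> (\<forall>x\<in>W. h u x > 0 \<longrightarrow> F u v \<le> F u x)"

lemma minimizerD:
  assumes "minimizer u v"
  shows "v \<in> W" "h u v > 0" "\<And>x. x \<in> W \<Longrightarrow> h u x > 0 \<Longrightarrow> F u v \<le> F u x"
  using assms by (auto simp: minimizer_def)

lemma h_self_pos: "u \<in> X \<Longrightarrow> h u u > 0"
  using X_neg[of u] by (simp add: h_self)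

lemma minimizer_h_floor: "u \<in> X \<Longrightarrow> minimizer u v \<Longrightarrow> h_floor u \<le> h u v"
  using minimizerD[of u v] h_self_pos[of u] XW[of u] by (intro h_ge) fastforce+

text \<open>Minimising sequences are Cauchy by \<open>near_min\<close>, so strong convergence replaces weak lower semicontinuity.\<close>

lemma minimizer_exists:
  assumes u: "u \<in> X"
  shows "\<exists>v. minimizer u v"
proof -
  define V where "V = F u ` {x \<in> W. h u x > 0}"
  have V: "V \<noteq> {}" "bdd_below V"
  proof -
    show "V \<noteq> {}" using XW[OF u] h_self_pos[OF u] by (auto simp: V_def)
    show "bdd_below V" using F_lower[OF u] by (intro bdd_belowI[of _ "- q * ln K0"]) (auto simp: V_def)
  qed
  define m where "m = Inf V"
  have m_le: "m \<le> F u x" if "x \<in> W" "h u x > 0" for x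
    unfolding m_def using that V by (intro cInf_lower) (auto simp: V_def)
  have "\<exists>x\<in>W. h u x > 0 \<and> F u x < m + inverse (real (Suc j))" for j
  proof -
    have "Inf V < m + inverse (real (Suc j))" by (simp add: m_def)
    then obtain y where "y \<in> V" "y < m + inverse (real (Suc j))" using V by (meson cInf_less_iff)
    then show ?thesis by (auto simp: V_def)
  qed
  then obtain s where s: "\<And>j. s j \<in> W" "\<And>j. h u (s j) > 0" "\<And>j. F u (s j) < m + inverse (real (Suc j))"
    by metis
  have c: "h_floor u \<le> h u (s j)" for j
  proof (rule h_ge[OF u s(1,2)])
    have "inverse (real (Suc j)) \<le> 1" by (simp add: inverse_le_1_iff)
    then show "F u (s j) \<le> F u u + 1" using s(3)[of j] m_le[OF XW[OF u] h_self_pos[OF u]] by linarith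
  qed
  have "\<exists>w\<in>W. (\<lambda>j. Dp.n (s j - w)) \<longlonglongrightarrow> 0"
  proof (rule complete[OF s(1)])
    fix e :: real assume e: "e > 0"
    obtain \<eta> where \<eta>: "\<eta> > 0" "\<And>v v'. v \<in> W \<Longrightarrow> v' \<in> W \<Longrightarrow> Up.n (u - u) < \<eta> \<Longrightarrow>
        \<bar>inverse (G u) - inverse (G u)\<bar> < \<eta> \<Longrightarrow> h_floor u \<le> h u v \<Longrightarrow> h_floor u \<le> h u v' \<Longrightarrow>
        (\<forall>x\<in>W. h u x > 0 \<longrightarrow> F u v \<le> F u x + \<eta>) \<Longrightarrow> (\<forall>x\<in>W. h u x > 0 \<longrightarrow> F u v' \<le> F u x + \<eta>) \<Longrightarrow>
        Dp.n (v - v') < e"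
      using near_min[OF e h_floor_pos[OF u]] u by metis
    obtain N where N: "inverse (real (Suc N)) < \<eta>" using reals_Archimedean[OF \<eta>(1)] by blast
    have "F u (s j) \<le> F u x + \<eta>" if "j \<ge> N" "x \<in> W" "h u x > 0" for j x
    proof -
      have "inverse (real (Suc j)) \<le> inverse (real (Suc N))" using that by (intro le_imp_inverse_le) auto
      then show ?thesis using s(3)[of j] m_le[OF that(2,3)] N by linarith
    qed
    then have "Dp.n (s i - s j) < e" if "i \<ge> N" "j \<ge> N" for i j
      using that \<eta>(1) c s(1) by (intro \<eta>(2)) auto
    then show "\<exists>N. \<forall>i\<ge>N. \<forall>j\<ge>N. Dp.n (s i - s j) < e" by blast
  qed
  then obtain v where v: "v \<in> W" "(\<lambda>j. Dp.n (s j - v)) \<longlonglongrightarrow> 0" by blast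
  have hv: "h_floor u \<le> h u v" by (rule LIMSEQ_le_const[OF h_lim[OF u s(1) v]]) (use c in auto)
  then have hv0: "h u v > 0" using h_floor_pos[OF u] by linarith
  have "F u v \<le> m"
  proof (rule LIMSEQ_le[OF F_lim[OF u s(1) v hv0]])
    show "(\<lambda>j. m + inverse (real (Suc j))) \<longlonglongrightarrow> m" using tendsto_add[OF tendsto_const LIMSEQ_inverse_real_of_nat, of m] by simp
    show "\<exists>N. \<forall>n\<ge>N. F u (s n) \<le> m + inverse (real (Suc n))" using less_imp_le[OF s(3)] by blast
  qed
  then have "minimizer u v" unfolding minimizer_def using v(1) hv0 m_le by fastforce
  then show ?thesis by blast
qed

lemma minimizers_close:
  assumes "e > 0" "c0 > 0"
  shows "\<exists>\<eta>>0. \<forall>u\<in>X. \<forall>u'\<in>X. \<forall>v v'. minimizer u v \<longrightarrow> minimizer u' v' \<longrightarrow>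
    Up.n (u - u') < \<eta> \<longrightarrow> \<bar>inverse (G u) - inverse (G u')\<bar> < \<eta> \<longrightarrow> c0 \<le> h_floor u \<longrightarrow> c0 \<le> h_floor u' \<longrightarrow>
    Dp.n (v - v') < e"
proof -
  obtain \<eta> where \<eta>: "\<eta> > 0" "\<And>u u' v v'. u \<in> X \<Longrightarrow> u' \<in> X \<Longrightarrow> v \<in> W \<Longrightarrow> v' \<in> W \<Longrightarrow>
    Up.n (u - u') < \<eta> \<Longrightarrow> \<bar>inverse (G u) - inverse (G u')\<bar> < \<eta> \<Longrightarrow> c0 \<le> h u v \<Longrightarrow> c0 \<le> h u' v' \<Longrightarrow>
    (\<forall>x\<in>W. h u x > 0 \<longrightarrow> F u v \<le> F u x + \<eta>) \<Longrightarrow> (\<forall>x\<in>W. h u' x > 0 \<longrightarrow> F u' v' \<le> F u' x + \<eta>) \<Longrightarrow>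
    Dp.n (v - v') < e"
    using near_min[OF assms] by metis
  have "Dp.n (v - v') < e" if u: "u \<in> X" "u' \<in> X" and v: "minimizer u v" "minimizer u' v'"
    and *: "Up.n (u - u') < \<eta>" "\<bar>inverse (G u) - inverse (G u')\<bar> < \<eta>" "c0 \<le> h_floor u" "c0 \<le> h_floor u'" for u u' v v'
  proof (rule \<eta>(2)[OF u minimizerD(1)[OF v(1)] minimizerD(1)[OF v(2)] *(1,2)])
    show "c0 \<le> h u v" "c0 \<le> h u' v'"
      using minimizer_h_floor[OF u(1) v(1)] minimizer_h_floor[OF u(2) v(2)] *(3,4) by linarith+
    show "\<forall>x\<in>W. h u x > 0 \<longrightarrow> F u v \<le> F u x + \<eta>" using minimizerD(3)[OF v(1)] \<eta>(1) by fastforce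
    show "\<forall>x\<in>W. h u' x > 0 \<longrightarrow> F u' v' \<le> F u' x + \<eta>" using minimizerD(3)[OF v(2)] \<eta>(1) by fastforce
  qed
  then show ?thesis using \<eta>(1) by blast
qed

lemma minimizer_unique:
  assumes "u \<in> X" "minimizer u v" "minimizer u v'"
  shows "v = v'"
proof (rule ccontr)
  assume "v \<noteq> v'"
  have W: "v \<in> W" "v' \<in> W" using assms minimizerD by blast+
  have "Dp.n (v - v') \<noteq> 0" using Dp_zero[OF Dp.W_diff[OF W]] \<open>v \<noteq> v'\<close> by auto
  define D where "D = Dp.n (v - v')"
  have D: "D > 0" using \<open>Dp.n (v - v') \<noteq> 0\<close> Dp.n_nonneg[of "v - v'"] unfolding D_def by linarith
  obtain \<eta> where \<eta>: "\<eta> > 0" "\<And>u1 u2 x x'. u1 \<in> X \<Longrightarrow> u2 \<in> X \<Longrightarrow> minimizer u1 x \<Longrightarrow> minimizer u2 x' \<Longrightarrow>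
    Up.n (u1 - u2) < \<eta> \<Longrightarrow> \<bar>inverse (G u1) - inverse (G u2)\<bar> < \<eta> \<Longrightarrow> h_floor u \<le> h_floor u1 \<Longrightarrow> h_floor u \<le> h_floor u2 \<Longrightarrow>
    Dp.n (x - x') < D"
    using minimizers_close[OF D h_floor_pos[OF assms(1)]] by metis
  have "Dp.n (v - v') < D"
    using \<eta>(1) by (intro \<eta>(2)[OF assms(1) assms(1) assms(2,3)]) auto
  then show False by (simp add: D_def)
qed

section \<open>The descent map\<close>

definition S where "S u = (SOME v. minimizer u v)"

lemma S: "u \<in> X \<Longrightarrow> minimizer u (S u)"
  unfolding S_def using minimizer_exists by (rule someI_ex)

lemma S_eq: "u \<in> X \<Longrightarrow> minimizer u v \<Longrightarrow> S u = v"
  using minimizer_unique S by blast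

lemma S_W: "u \<in> X \<Longrightarrow> S u \<in> W" and S_h: "u \<in> X \<Longrightarrow> h u (S u) > 0"
  using minimizerD S by blast+

lemma H_S: "u \<in> X \<Longrightarrow> H (S u) \<le> - h_floor u"
  using h_le[OF _ S_W, of u u] minimizer_h_floor[OF _ S, of u] by simp

lemma H_S_neg: "u \<in> X \<Longrightarrow> H (S u) < 0"
  using H_S[of u] h_floor_pos[of u] by linarith

lemma Up_pos: "u \<in> W \<Longrightarrow> H u < 0 \<Longrightarrow> Up.n u > 0"
proof -
  assume u: "u \<in> W" "H u < 0"
  have "\<alpha> * Up.I u > 0" using u Dp.I_nonneg[of u] unfolding H_def by linarith
  then have "Up.I u > 0" using \<alpha> by (simp add: zero_less_mult_iff)
  then have "Up.n u \<noteq> 0" using Up.n_powr[of u] by auto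
  then show ?thesis using Up.n_nonneg[of u] by linarith
qed

definition normalize where "normalize v = (1 / Up.n v) *\<^sub>R v"
definition T where "T u = normalize (S u)"
definition J where "J u = p * ln (G u) - q * ln (- H u)"

lemma H_scale: "u \<in> W \<Longrightarrow> c > 0 \<Longrightarrow> H (c *\<^sub>R u) = c powr p * H u"
  by (simp add: H_def Dp.I_scale Up.I_scale algebra_simps)

lemma G_scale: "u \<in> W \<Longrightarrow> c > 0 \<Longrightarrow> G (c *\<^sub>R u) = c powr q * G u"
  by (simp add: G_def Dq.I_scale Uq.I_scale algebra_simps)

lemma J_scale: "u \<in> W \<Longrightarrow> H u < 0 \<Longrightarrow> c > 0 \<Longrightarrow> J (c *\<^sub>R u) = J u"
proof -
  assume u: "u \<in> W" "H u < 0" and c: "c > 0"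
  have "ln (G (c *\<^sub>R u)) = q * ln c + ln (G u)"
    using G_pos[OF u] c by (simp add: G_scale[OF u(1) c] ln_mult_pos ln_powr)
  moreover have "ln (- H (c *\<^sub>R u)) = p * ln c + ln (- H u)"
  proof -
    have "- H (c *\<^sub>R u) = c powr p * (- H u)" by (simp add: H_scale[OF u(1) c])
    then show ?thesis using u(2) c ln_mult_pos[of "c powr p" "- H u"] by (simp add: ln_powr)
  qed
  ultimately show ?thesis by (simp add: J_def algebra_simps)
qed

lemma normalize_X: "v \<in> W \<Longrightarrow> H v < 0 \<Longrightarrow> normalize v \<in> X"
  using Up_pos[of v] by (simp add: X_def normalize_def Dp.W_scale Up.n_scale H_scale mult_pos_neg)

lemma J_normalize: "v \<in> W \<Longrightarrow> H v < 0 \<Longrightarrow> J (normalize v) = J v"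
  unfolding normalize_def using Up_pos[of v] by (intro J_scale) auto

lemma T_X: "u \<in> X \<Longrightarrow> T u \<in> X"
  unfolding T_def by (intro normalize_X S_W H_S_neg)

lemma normalize_lim:
  assumes s: "\<And>j::nat. s j \<in> W" and v: "v \<in> W" and l: "(\<lambda>j. Dp.n (s j - v)) \<longlonglongrightarrow> 0" and H: "H v < 0"
  shows "(\<lambda>j. Dp.n (normalize (s j) - normalize v)) \<longlonglongrightarrow> 0"
proof -
  have pos: "Up.n v > 0" by (rule Up_pos[OF v H])
  have l1: "(\<lambda>j. 1 / Up.n (s j)) \<longlonglongrightarrow> 1 / Up.n v"
    using Up.n_lim[OF s v lim_Up[OF s v l]] pos by (intro tendsto_divide) auto
  have "(\<lambda>j. \<bar>1 / Up.n (s j)\<bar> * Dp.n (s j - v) + \<bar>1 / Up.n (s j) - 1 / Up.n v\<bar> * Dp.n v) \<longlonglongrightarrow>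
     \<bar>1 / Up.n v\<bar> * 0 + \<bar>1 / Up.n v - 1 / Up.n v\<bar> * Dp.n v"
    by (intro tendsto_intros l l1)
  then have l2: "(\<lambda>j. \<bar>1 / Up.n (s j)\<bar> * Dp.n (s j - v) + \<bar>1 / Up.n (s j) - 1 / Up.n v\<bar> * Dp.n v) \<longlonglongrightarrow> 0" by simp
  show ?thesis
  proof (rule Lim_null_comparison[OF _ l2], rule always_eventually, rule allI)
    fix j
    have e: "normalize (s j) - normalize v = (1 / Up.n (s j)) *\<^sub>R (s j - v) + (1 / Up.n (s j) - 1 / Up.n v) *\<^sub>R v"
      by (simp add: normalize_def algebra_simps)
    show "norm (Dp.n (normalize (s j) - normalize v)) \<le>
        \<bar>1 / Up.n (s j)\<bar> * Dp.n (s j - v) + \<bar>1 / Up.n (s j) - 1 / Up.n v\<bar> * Dp.n v"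
      unfolding e
      using Dp.n_add[OF Dp.W_scale[OF Dp.W_diff[OF s v]] Dp.W_scale[OF v], of "1 / Up.n (s j)" j "1 / Up.n (s j) - 1 / Up.n v"]
      by (simp only: Dp.n_scale[OF Dp.W_diff[OF s v]] Dp.n_scale[OF v] real_norm_def abs_of_nonneg[OF Dp.n_nonneg])
  qed
qed

text \<open>Concavity of \<open>ln\<close> for the term with \<open>G\<close>, monotonicity of \<open>ln\<close> for the term with \<open>H\<close>.\<close>

lemma descent_bound:
  assumes u: "u \<in> X" and v: "v \<in> W" and h: "h u v > 0"
  shows "J v \<le> J u + (F u v - F u u)"
proof -
  have Hv: "H v < 0" using h_le[OF u v] h by linarith
  have G: "G v > 0" "G u > 0" using G_pos XW[OF u] X_neg[OF u] v Hv by blast+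
  have "ln (G v) \<le> ln (Gm u v)" using G Gm_ge[OF XW[OF u] v] by simp
  also have "\<dots> \<le> ln (G u) + (Gm u v / G u - 1)"
  proof -
    have "Gm u v > 0" using G Gm_ge[OF XW[OF u] v] by linarith
    then have "ln (Gm u v) - ln (G u) \<le> (Gm u v - G u) / G u" using G by (intro ln_diff_le)
    also have "\<dots> = Gm u v / G u - 1" using G by (simp add: field_simps)
    finally show ?thesis by simp
  qed
  finally have "p * ln (G v) \<le> p * (ln (G u) + (Gm u v / G u - 1))" using pq by (intro mult_left_mono) auto
  then have 1: "p * ln (G v) \<le> p * ln (G u) + A u v - p" by (simp add: A_def algebra_simps divide_inverse)
  have "q * ln (h u v) \<le> q * ln (- H v)" using h h_le[OF u v] pq by (intro mult_left_mono) auto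
  then show ?thesis using 1 by (simp add: J_def F_self[OF u]) (simp add: F_def)
qed

lemma T_descent: "u \<in> X \<Longrightarrow> J (T u) \<le> J u"
  unfolding T_def
  using J_normalize[OF S_W H_S_neg, of u] descent_bound[of u "S u"] S_W[of u] S_h[of u] minimizerD(3)[OF S, of u u]
    XW[of u] h_self_pos[of u] by simp

text \<open>If \<open>J\<close> does not decrease then \<open>u\<close> is itself a minimiser of \<open>F u\<close>, and minimisers are unique.\<close>

lemma S_fixed:
  assumes u: "u \<in> X" and J: "J (T u) = J u"
  shows "S u = u"
proof (rule S_eq[OF u])
  have "J (S u) = J u" using J J_normalize[OF S_W H_S_neg, OF u u] by (simp add: T_def)
  then have "F u u \<le> F u (S u)" using descent_bound[OF u S_W[OF u] S_h[OF u]] by simp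
  then show "minimizer u u"
    unfolding minimizer_def using XW[OF u] h_self_pos[OF u] minimizerD(3)[OF S[OF u]] by (auto intro: order_trans)
qed

lemma T_fixed: "u \<in> X \<Longrightarrow> J (T u) = J u \<Longrightarrow> T u = u"
  using S_fixed[of u] X_norm[of u] by (simp add: T_def normalize_def)

lemma minus_X: "u \<in> X \<Longrightarrow> - u \<in> X"
  by (simp add: X_def Dp.W_minus Up.n_minus H_def Dp.I_minus Up.I_minus)

lemma G_minus: "u \<in> W \<Longrightarrow> G (- u) = G u" and H_minus: "u \<in> W \<Longrightarrow> H (- u) = H u"
  by (simp_all add: G_def H_def Dq.I_minus Uq.I_minus Up.I_minus Dp.I_minus)

lemma J_minus: "u \<in> X \<Longrightarrow> J (- u) = J u"
  by (simp add: J_def G_minus H_minus XW)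

text \<open>The functional for \<open>- u\<close> is the reflection of the functional for \<open>u\<close>; uniqueness of minimisers gives oddness.\<close>

lemma S_minus:
  assumes u: "u \<in> X" shows "S (- u) = - S u"
proof (rule S_eq[OF minus_X[OF u]])
  have W: "u \<in> W" using u by (rule XW)
  have Up: "Up.P (- u) x = Up.P u (- x)" and Uq: "Uq.P (- u) x = Uq.P u (- x)" if "x \<in> W" for x
    using that W Up.P_minus_left[OF W that] Uq.P_minus_left[OF W that]
      Up.P_scale[OF W that, of "-1"] Uq.P_scale[OF W that, of "-1"] by simp_all
  have hh: "h (- u) x = h u (- x)" if "x \<in> W" for x
    using that by (simp add: h_def k_def Up Dp.I_minus)
  have FF: "F (- u) x = F u (- x)" if "x \<in> W" for x
    using that W by (simp add: F_def A_def Gm_def hh Uq Dq.I_minus Uq.I_minus G_minus)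
  show "minimizer (- u) (- S u)"
    unfolding minimizer_def using S[OF u] hh FF Dp.W_minus S_W[OF u] by (auto simp: minimizer_def)
qed

lemma T_minus: "u \<in> X \<Longrightarrow> T (- u) = - T u"
  using Up.n_minus[OF S_W, of u] by (simp add: T_def normalize_def S_minus)

lemma T_lim:
  assumes u: "u \<in> X" and s: "\<And>j::nat. s j \<in> X" and l: "(\<lambda>j. Dp.n (s j - u)) \<longlonglongrightarrow> 0"
  shows "(\<lambda>j. Dp.n (T (s j) - T u)) \<longlonglongrightarrow> 0"
proof -
  note W = XW[OF s] XW[OF u]
  have "(\<lambda>j. Dp.n (S (s j) - S u)) \<longlonglongrightarrow> 0"
  proof (rule LIMSEQ_I)
    fix e :: real assume e: "e > 0"
    define c0 where "c0 = h_floor u / 2"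
    have c0: "c0 > 0" "c0 \<le> h_floor u" "c0 < h_floor u" using h_floor_pos[OF u] by (auto simp: c0_def)
    obtain \<eta> where \<eta>: "\<eta> > 0" "\<And>u u' v v'. u \<in> X \<Longrightarrow> u' \<in> X \<Longrightarrow> minimizer u v \<Longrightarrow> minimizer u' v' \<Longrightarrow>
        Up.n (u - u') < \<eta> \<Longrightarrow> \<bar>inverse (G u) - inverse (G u')\<bar> < \<eta> \<Longrightarrow> c0 \<le> h_floor u \<Longrightarrow> c0 \<le> h_floor u' \<Longrightarrow>
        Dp.n (v - v') < e"
      using minimizers_close[OF e c0(1)] by metis
    have "(\<lambda>j. h_floor (s j)) \<longlonglongrightarrow> h_floor u" unfolding h_floor_def by (intro tendsto_intros H_lim W l)
    then have 1: "\<forall>\<^sub>F j in sequentially. c0 < h_floor (s j)" using c0(3) by (rule order_tendstoD)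
    have "(\<lambda>j. Up.n (s j - u)) \<longlonglongrightarrow> 0" by (rule lim_Up[OF W l])
    then have 2: "\<forall>\<^sub>F j in sequentially. Up.n (s j - u) < \<eta>" using \<eta>(1) by (rule order_tendstoD)
    have "(\<lambda>j. \<bar>inverse (G (s j)) - inverse (G u)\<bar>) \<longlonglongrightarrow> \<bar>inverse (G u) - inverse (G u)\<bar>"
      using g0(1) g0(2)[OF u] by (intro tendsto_intros G_lim W l) auto
    then have 3: "\<forall>\<^sub>F j in sequentially. \<bar>inverse (G (s j)) - inverse (G u)\<bar> < \<eta>"
      using \<eta>(1) by (intro order_tendstoD(2)[of _ "\<bar>inverse (G u) - inverse (G u)\<bar>"]) auto
    from 1 2 3 have "\<forall>\<^sub>F j in sequentially. Dp.n (S (s j) - S u) < e"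
    proof eventually_elim
      case (elim j)
      then show ?case using \<eta>(2)[OF s u S[OF s] S[OF u]] c0(2) by simp
    qed
    then show "\<exists>no. \<forall>n\<ge>no. norm (Dp.n (S (s n) - S u) - 0) < e" by (simp add: eventually_sequentially)
  qed
  then show ?thesis unfolding T_def by (intro normalize_lim S_W s u H_S_neg)
qed

text \<open>Pass to a subsequence along which \<open>s\<close> is Cauchy in \<open>L\<^sup>p\<close> and the numbers \<open>1 / G\<close> converge. The bound on \<open>J\<close>, with \<open>G \<ge> g0\<close>, keeps \<open>- H\<close> and hence the
barriers away from 0, so \<open>near_min\<close> applies uniformly and the minimisers are Cauchy in the gradient norm.\<close>

lemma T_compact:
  assumes s: "\<And>j::nat. s j \<in> X" and C: "\<And>j. J (s j) \<le> C"
  shows "\<exists>w\<in>X. \<exists>r :: nat \<Rightarrow> nat. strict_mono r \<and> (\<lambda>j. Dp.n (T (s (r j)) - w)) \<longlonglongrightarrow> 0"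
proof -
  note W = XW[OF s]
  have "\<exists>r :: nat \<Rightarrow> nat. strict_mono r \<and> (\<forall>e>0. \<exists>N. \<forall>j\<ge>N. \<forall>k\<ge>N. Up.n (s (r j) - s (r k)) < e)"
    by (rule rellich[where s = s and B = "\<alpha> powr (1 / p)"]) (use W X_Dp_bound s in auto)
  then obtain r1 :: "nat \<Rightarrow> nat" where r1: "strict_mono r1"
      "\<And>e. e > 0 \<Longrightarrow> \<exists>N. \<forall>j\<ge>N. \<forall>k\<ge>N. Up.n (s (r1 j) - s (r1 k)) < e"
    by blast
  have "bounded (range (\<lambda>j. inverse (G (s (r1 j)))))"
  proof (rule boundedI)
    fix x assume "x \<in> range (\<lambda>j. inverse (G (s (r1 j))))"
    then obtain j where "x = inverse (G (s (r1 j)))" by blast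
    then show "norm x \<le> inverse g0" using g0(1) g0(2)[OF s[of "r1 j"]] by (auto intro!: le_imp_inverse_le)
  qed
  then obtain l r2 where r2: "strict_mono (r2 :: nat \<Rightarrow> nat)" "((\<lambda>j. inverse (G (s (r1 j)))) \<circ> r2) \<longlonglongrightarrow> l"
    using bounded_imp_convergent_subsequence by blast
  define r where "r = r1 \<circ> r2"
  have r: "strict_mono r" unfolding r_def using r1(1) r2(1) by (rule strict_mono_o)
  have Up_cauchy: "\<exists>N. \<forall>j\<ge>N. \<forall>k\<ge>N. Up.n (s (r j) - s (r k)) < e" if "e > 0" for e
  proof -
    obtain N where N: "\<And>j k. j \<ge> N \<Longrightarrow> k \<ge> N \<Longrightarrow> Up.n (s (r1 j) - s (r1 k)) < e" using r1(2)[OF \<open>e > 0\<close>] by blast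
    have "Up.n (s (r j) - s (r k)) < e" if "j \<ge> N" "k \<ge> N" for j k
      using N[of "r2 j" "r2 k"] seq_suble[OF r2(1), of j] seq_suble[OF r2(1), of k] that by (simp add: r_def)
    then show ?thesis by blast
  qed
  have "Cauchy (\<lambda>j. inverse (G (s (r j))))"
    using LIMSEQ_imp_Cauchy[OF r2(2)] by (simp add: r_def o_def)
  then have G_cauchy: "\<exists>N. \<forall>j\<ge>N. \<forall>k\<ge>N. \<bar>inverse (G (s (r j))) - inverse (G (s (r k)))\<bar> < e" if "e > 0" for e
    using that unfolding Cauchy_def dist_real_def by blast
  define c0 where "c0 = exp ((p * ln g0 - C) / q) * exp (- ((p + 1) / q))"
  have c0: "c0 > 0" by (simp add: c0_def)
  have h_floor: "c0 \<le> h_floor (s j)" for j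
  proof -
    have "p * ln g0 \<le> p * ln (G (s j))" using g0(1) g0(2)[OF s[of j]] pq by (intro mult_left_mono) auto
    then have "p * ln g0 - C \<le> q * ln (- H (s j))" using C[of j] by (simp add: J_def)
    then have "(p * ln g0 - C) / q \<le> ln (- H (s j))" using pq by (simp add: pos_divide_le_eq mult.commute)
    then have "exp ((p * ln g0 - C) / q) \<le> - H (s j)" using X_neg[OF s[of j]] by (metis exp_le_cancel_iff exp_ln neg_0_less_iff_less)
    then show ?thesis unfolding c0_def h_floor_def by (intro mult_right_mono) auto
  qed
  have "\<exists>w\<in>W. (\<lambda>j. Dp.n (S (s (r j)) - w)) \<longlonglongrightarrow> 0"
  proof (rule complete)
    fix e :: real assume e: "e > 0"
    obtain \<eta> where \<eta>: "\<eta> > 0" "\<And>u u' v v'. u \<in> X \<Longrightarrow> u' \<in> X \<Longrightarrow> minimizer u v \<Longrightarrow> minimizer u' v' \<Longrightarrow>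
        Up.n (u - u') < \<eta> \<Longrightarrow> \<bar>inverse (G u) - inverse (G u')\<bar> < \<eta> \<Longrightarrow> c0 \<le> h_floor u \<Longrightarrow> c0 \<le> h_floor u' \<Longrightarrow>
        Dp.n (v - v') < e"
      using minimizers_close[OF e c0] by metis
    obtain N1 where N1: "\<And>j k. j \<ge> N1 \<Longrightarrow> k \<ge> N1 \<Longrightarrow> Up.n (s (r j) - s (r k)) < \<eta>" using Up_cauchy[OF \<eta>(1)] by blast
    obtain N2 where N2: "\<And>j k. j \<ge> N2 \<Longrightarrow> k \<ge> N2 \<Longrightarrow> \<bar>inverse (G (s (r j))) - inverse (G (s (r k)))\<bar> < \<eta>"
      using G_cauchy[OF \<eta>(1)] by blast
    have "Dp.n (S (s (r j)) - S (s (r k))) < e" if "j \<ge> max N1 N2" "k \<ge> max N1 N2" for j k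
      using that by (intro \<eta>(2)[OF s s S[OF s] S[OF s] N1 N2 h_floor h_floor]) auto
    then show "\<exists>N. \<forall>j\<ge>N. \<forall>k\<ge>N. Dp.n (S (s (r j)) - S (s (r k))) < e" by blast
  qed (use S_W s in auto)
  then obtain w where w: "w \<in> W" "(\<lambda>j. Dp.n (S (s (r j)) - w)) \<longlonglongrightarrow> 0" by blast
  have "H w \<le> - c0"
  proof (rule LIMSEQ_le_const2[OF H_lim[OF S_W[OF s] w]])
    have "H (S (s (r j))) \<le> - c0" for j using H_S[OF s[of "r j"]] h_floor[of "r j"] by linarith
    then show "\<exists>N. \<forall>n\<ge>N. H (S (s (r n))) \<le> - c0" by blast
  qed
  then have Hw: "H w < 0" using c0 by linarith
  have lim: "(\<lambda>j. Dp.n (T (s (r j)) - normalize w)) \<longlonglongrightarrow> 0"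
    unfolding T_def by (rule normalize_lim[OF S_W[OF s] w Hw])
  show ?thesis
    by (rule bexI[OF _ normalize_X[OF w(1) Hw]], intro exI[of _ r] conjI r lim)
qed

definition dW where "dW u v = Dp.n (u - v)"

lemma metric_dW: "Metric_space W dW"
  using metric_W unfolding dW_def[abs_def] .

lemma metric_X: "Metric_space X dW"
  using XW by (intro Metric_space.subspace[OF metric_dW]) auto

lemma descent_on_X: "compact_odd_descent X dW T J"
proof -
  interpret X_metric: Metric_space X dW by (rule metric_X)
  show ?thesis
  proof
  show "- u \<noteq> u" if "u \<in> X" for u
  proof
    assume "- u = u"
    then have "u = 0" by (metis add_eq_0_iff scaleR_2 scaleR_eq_0_iff zero_neq_numeral)
    then show False using X_norm[OF that] by simp
  qed
  show "dW (- u) (- v) = dW u v" if "u \<in> X" "v \<in> X" for u v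
    using Dp.n_minus[OF Dp.W_diff, of v u] Dp.n_diff_commute[of u v] XW that by (simp add: dW_def)
  show "continuous_map X_metric.mtopology X_metric.mtopology T"
    by (rule X_metric.continuous_map_sequential[OF X_metric.Metric_space_axioms])
       (use T_X T_lim in \<open>auto simp: dW_def\<close>)
  have "continuous_map X_metric.mtopology Met_TC.mtopology J"
  proof (rule X_metric.continuous_map_sequential[OF Met_TC.Metric_space_axioms])
    fix s u assume u: "u \<in> X" and s: "\<And>j::nat. s j \<in> X" and l: "(\<lambda>j. dW (s j) u) \<longlonglongrightarrow> 0"
    have "(\<lambda>j. J (s j)) \<longlonglongrightarrow> J u"
      unfolding J_def using l[unfolded dW_def] G_pos[OF XW[OF u] X_neg[OF u]] X_neg[OF u]
      by (intro tendsto_intros G_lim H_lim XW s u) auto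
    then show "(\<lambda>j. dist (J (s j)) (J u)) \<longlonglongrightarrow> 0" by (rule tendsto_dist_iff[THEN iffD1])
  qed auto
  then show "continuous_map X_metric.mtopology euclideanreal J" by simp
  fix s :: "nat \<Rightarrow> 'v" and C assume "range s \<subseteq> X" "\<And>n. J (s n) \<le> C"
  then obtain w r where "w \<in> X" "strict_mono (r :: nat \<Rightarrow> nat)" "(\<lambda>j. Dp.n (T (s (r j)) - w)) \<longlonglongrightarrow> 0"
    using T_compact[of s C] by blast
  moreover have "s j \<in> X" for j using \<open>range s \<subseteq> X\<close> by auto
  ultimately show "\<exists>w r. strict_mono (r :: nat \<Rightarrow> nat) \<and> limitin X_metric.mtopology (\<lambda>n. T (s (r n))) w sequentially"
    using T_X by (intro exI[of _ w] exI[of _ r]) (auto simp: X_metric.limitin_metric_dist_null dW_def)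
qed (use minus_X T_minus J_minus T_descent T_fixed in auto)
qed

section \<open>From fixed points to critical points\<close>

text \<open>The derivatives of \<open>H\<close> and \<open>G\<close> are \<open>p * dH u\<close> and \<open>q * dG u\<close>.\<close>

definition dH where "dH u v = Dp.P u v - \<alpha> * Up.P u v"
definition dG where "dG u v = Dq.P u v - \<beta> * Uq.P u v"

text \<open>The derivative of \<open>t \<mapsto> F u (u + t w)\<close> at \<open>0\<close> vanishes, and majorant and functional have the same derivative at the point of contact. The result says
that \<open>u\<close> is a critical point of \<open>J\<close>.\<close>

lemma minimizer_stationary:
  assumes u: "u \<in> X" and m: "minimizer u u" and w: "w \<in> W"
  shows "G u * dH u w = H u * dG u w"
proof -
  note W = XW[OF u]
  have Wt: "u + t *\<^sub>R w \<in> W" for t by (intro Dp.W_add Dp.W_scale W w)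
  have kl: "k u (u + t *\<^sub>R w) = k u u + t * (\<alpha> * p * Up.P u w)" for t
    using Up.P_add[OF W W Dp.W_scale[OF w, of t]] Up.P_scale[OF W w, of t] by (simp add: k_def algebra_simps)
  have hD: "((\<lambda>t. h u (u + t *\<^sub>R w)) has_real_derivative \<alpha> * p * Up.P u w - p * Dp.P u w) (at 0)"
    unfolding h_def kl by (rule derivative_eq_intros Dp.I_deriv[OF W w] refl | simp)+
  have PD: "((\<lambda>t. Uq.P u (u + t *\<^sub>R w)) has_real_derivative Uq.P u w) (at 0)"
  proof -
    have e: "Uq.P u (u + t *\<^sub>R w) = Uq.P u u + t * Uq.P u w" for t
      using Uq.P_add[OF W W Dp.W_scale[OF w, of t]] Uq.P_scale[OF W w, of t] by simp
    show ?thesis unfolding e by (rule derivative_eq_intros refl | simp)+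
  qed
  have AD: "((\<lambda>t. A u (u + t *\<^sub>R w)) has_real_derivative p * inverse (G u) * (q * dG u w)) (at 0)"
  proof -
    have "((\<lambda>t. A u (u + t *\<^sub>R w)) has_real_derivative
        p * inverse (G u) * (q * Dq.P u w + \<beta>m * (q * Uq.P u w) - \<beta>p * (q * Uq.P u w))) (at 0)"
      unfolding A_def Gm_def
      by (rule derivative_eq_intros Dq.I_deriv[OF W w] Uq.I_deriv[OF W w] PD refl | simp)+
    moreover have "q * Dq.P u w + \<beta>m * (q * Uq.P u w) - \<beta>p * (q * Uq.P u w) = q * dG u w"
      using \<beta>_times[of "q * Uq.P u w"] by (simp add: dG_def algebra_simps)
    ultimately show ?thesis by simp
  qed
  have h0: "h u (u + 0 *\<^sub>R w) > 0" using h_self_pos[OF u] by simp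
  have FD: "((\<lambda>t. F u (u + t *\<^sub>R w)) has_real_derivative
      p * inverse (G u) * (q * dG u w) - q * ((\<alpha> * p * Up.P u w - p * Dp.P u w) / h u u)) (at 0)"
    unfolding F_def using h0
    by (auto intro!: derivative_eq_intros AD hD)
  have "\<forall>\<^sub>F t in at 0. h u (u + t *\<^sub>R w) > 0"
    using DERIV_isCont[OF hD] h0 unfolding isCont_def by (intro order_tendstoD(1)) auto
  then obtain d where d: "d > 0" "\<And>t. t \<noteq> 0 \<Longrightarrow> \<bar>t\<bar> < d \<Longrightarrow> h u (u + t *\<^sub>R w) > 0"
    unfolding eventually_at by (auto simp: dist_real_def)
  have D0: "p * inverse (G u) * (q * dG u w) - q * ((\<alpha> * p * Up.P u w - p * Dp.P u w) / h u u) = 0"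
  proof (rule DERIV_local_min[OF FD d(1)], intro allI impI)
    fix t :: real assume "\<bar>0 - t\<bar> < d"
    then have "h u (u + t *\<^sub>R w) > 0" using d(2)[of t] h0 by (cases "t = 0") auto
    then show "F u (u + 0 *\<^sub>R w) \<le> F u (u + t *\<^sub>R w)" using minimizerD(3)[OF m Wt] by simp
  qed
  have c: "\<alpha> * p * Up.P u w - p * Dp.P u w = - p * dH u w" by (simp add: dH_def algebra_simps)
  have "p * q * (dG u w / G u + dH u w / (- H u)) = 0"
    using D0 unfolding c h_self[OF u] by (simp add: divide_inverse algebra_simps)
  then have "dG u w / G u + dH u w / (- H u) = 0" using pq by simp
  then show ?thesis using G_pos[OF W X_neg[OF u]] X_neg[OF u] by (simp add: field_simps)
qed

text \<open>The critical point of \<open>t \<mapsto> E (t u)\<close> on \<open>t > 0\<close>.\<close>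

definition \<tau> where "\<tau> u = (G u / (- H u)) powr (1 / (p - q))"

lemma \<tau>: "u \<in> X \<Longrightarrow> \<tau> u > 0" "u \<in> X \<Longrightarrow> \<tau> u powr (p - q) = G u / (- H u)"
  using G_pos[OF XW X_neg, of u] X_neg[of u] pq by (auto simp: \<tau>_def powr_powr)

lemma \<tau>_E: "u \<in> X \<Longrightarrow> E (\<tau> u *\<^sub>R u) > 0"
proof -
  assume u: "u \<in> X"
  note t = \<tau>[OF u]
  have G: "G u > 0" by (rule G_pos[OF XW[OF u] X_neg[OF u]])
  have "\<tau> u powr p = \<tau> u powr q * \<tau> u powr (p - q)" by (simp flip: powr_add)
  then have "E (\<tau> u *\<^sub>R u) = \<tau> u powr q * (\<tau> u powr (p - q) * H u / p + G u / q)"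
    by (simp add: E_def H_scale[OF XW[OF u] t(1)] G_scale[OF XW[OF u] t(1)] algebra_simps)
  also have "\<tau> u powr (p - q) * H u = - G u" unfolding t(2) using X_neg[OF u] by (simp add: field_simps)
  also have "- G u / p + G u / q = G u * (1 / q - 1 / p)" by (simp add: algebra_simps)
  also have "\<tau> u powr q * (G u * (1 / q - 1 / p)) > 0"
    using t(1) G pq by (intro mult_pos_pos) (auto simp: field_simps)
  finally show ?thesis .
qed

definition critical where
  "critical u \<longleftrightarrow> u \<in> W \<and> (\<forall>\<epsilon>>0. \<exists>\<delta>>0. \<forall>v\<in>W. Dp.n v < \<delta> \<longrightarrow> \<bar>E (u + v) - E u\<bar> \<le> \<epsilon> * Dp.n v)"

text \<open>A remainder that is small relative to a weaker norm is small relative to the gradient norm.\<close>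

lemma remainder_transfer:
  assumes R: "\<And>e. e > 0 \<Longrightarrow> \<exists>d>0. \<forall>v\<in>W. m v < d \<longrightarrow> \<bar>R v\<bar> \<le> e * m v"
    and m: "\<And>v. v \<in> W \<Longrightarrow> m v \<le> C * Dp.n v" and C: "C > 0" and e: "e > 0"
  shows "\<exists>d>0. \<forall>v\<in>W. Dp.n v < d \<longrightarrow> \<bar>R v\<bar> \<le> e * Dp.n v"
proof -
  obtain d where d: "d > 0" "\<And>v. v \<in> W \<Longrightarrow> m v < d \<Longrightarrow> \<bar>R v\<bar> \<le> e / C * m v"
    using R[of "e / C"] e C by auto
  have "\<bar>R v\<bar> \<le> e * Dp.n v" if v: "v \<in> W" "Dp.n v < d / C" for v
  proof -
    have "C * Dp.n v < d" using v(2) C by (simp add: field_simps)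
    then have "\<bar>R v\<bar> \<le> e / C * m v" using m[OF v(1)] by (intro d(2) v(1)) linarith
    also have "\<dots> \<le> e / C * (C * Dp.n v)" using m[OF v(1)] e C by (intro mult_left_mono) auto
    finally show ?thesis using C by simp
  qed
  then show ?thesis using d(1) C by (intro exI[of _ "d / C"]) auto
qed

text \<open>With \<open>\<tau> u powr (p - q) = G u / (- H u)\<close> the two homogeneous derivatives cancel at \<open>\<tau> u\<close> by \<open>minimizer_stationary\<close>, and each of the four powers in \<open>E\<close> is differentiable.\<close>

lemma critical_point_on_ray:
  assumes u: "u \<in> X" and m: "minimizer u u"
  shows "critical (\<tau> u *\<^sub>R u)"
proof -
  define z where "z = \<tau> u *\<^sub>R u"
  note t = \<tau>[OF u] and Wu = XW[OF u]
  have z: "z \<in> W" unfolding z_def by (rule Dp.W_scale[OF Wu])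
  have lin: "dH z v + dG z v = 0" if v: "v \<in> W" for v
  proof -
    have "\<tau> u powr (p - 1) = \<tau> u powr (q - 1) * \<tau> u powr (p - q)" by (simp flip: powr_add)
    then have "dH z v + dG z v = \<tau> u powr (q - 1) * (\<tau> u powr (p - q) * dH u v + dG u v)"
      unfolding dH_def dG_def z_def Dp.P_scale_left[OF Wu v t(1)] Up.P_scale_left[OF Wu v t(1)]
        Dq.P_scale_left[OF Wu v t(1)] Uq.P_scale_left[OF Wu v t(1)] by (simp add: algebra_simps)
    moreover have "\<tau> u powr (p - q) * dH u v + dG u v = 0"
      unfolding t(2) using minimizer_stationary[OF u m v] X_neg[OF u] by (simp add: field_simps)
    ultimately show ?thesis by simp
  qed
  have "\<exists>\<delta>>0. \<forall>v\<in>W. Dp.n v < \<delta> \<longrightarrow> \<bar>E (z + v) - E z\<bar> \<le> \<epsilon> * Dp.n v" if \<epsilon>: "\<epsilon> > 0" for \<epsilon>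
  proof -
    define e where "e = \<epsilon> / (2 + \<alpha> + \<bar>\<beta>\<bar>)"
    have e: "e > 0" using \<epsilon> \<alpha> by (simp add: e_def)
    define R1 where "R1 v = Dp.I (z + v) - Dp.I z - p * Dp.P z v" for v
    define R2 where "R2 v = Up.I (z + v) - Up.I z - p * Up.P z v" for v
    define R3 where "R3 v = Dq.I (z + v) - Dq.I z - q * Dq.P z v" for v
    define R4 where "R4 v = Uq.I (z + v) - Uq.I z - q * Uq.P z v" for v
    have UqC: "Uq.n v \<le> Cq * CU * Dp.n v" if "v \<in> W" for v
    proof -
      have "Cq * Up.n v \<le> Cq * (CU * Dp.n v)" using CU(2)[OF that] Cq_pos by (intro mult_left_mono) auto
      then show ?thesis using Uq_le[OF that] by simp
    qed
    obtain d1 where d1: "d1 > 0" "\<And>v. v \<in> W \<Longrightarrow> Dp.n v < d1 \<Longrightarrow> \<bar>R1 v\<bar> \<le> e * Dp.n v"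
      using Dp.I_frechet[OF z e] unfolding R1_def by blast
    obtain d2 where d2: "d2 > 0" "\<And>v. v \<in> W \<Longrightarrow> Dp.n v < d2 \<Longrightarrow> \<bar>R2 v\<bar> \<le> e * Dp.n v"
      using remainder_transfer[OF Up.I_frechet[OF z] CU(2) CU(1) e] unfolding R2_def by blast
    obtain d3 where d3: "d3 > 0" "\<And>v. v \<in> W \<Longrightarrow> Dp.n v < d3 \<Longrightarrow> \<bar>R3 v\<bar> \<le> e * Dp.n v"
      using remainder_transfer[OF Dq.I_frechet[OF z] Dq_le Cq_pos e] unfolding R3_def by blast
    obtain d4 where d4: "d4 > 0" "\<And>v. v \<in> W \<Longrightarrow> Dp.n v < d4 \<Longrightarrow> \<bar>R4 v\<bar> \<le> e * Dp.n v"
      using remainder_transfer[OF Uq.I_frechet[OF z] UqC mult_pos_pos[OF Cq_pos CU(1)] e] unfolding R4_def by blast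
    have "\<bar>E (z + v) - E z\<bar> \<le> \<epsilon> * Dp.n v" if v: "v \<in> W" "Dp.n v < min (min d1 d2) (min d3 d4)" for v
    proof -
      have "E (z + v) - E z = (1/p) * (R1 v - \<alpha> * R2 v) + (1/q) * (R3 v - \<beta> * R4 v) + (dH z v + dG z v)"
        using pq by (simp add: E_def H_def G_def R1_def R2_def R3_def R4_def dH_def dG_def field_simps)
      then have "\<bar>E (z + v) - E z\<bar> \<le> (1/p) * \<bar>R1 v - \<alpha> * R2 v\<bar> + (1/q) * \<bar>R3 v - \<beta> * R4 v\<bar>"
        unfolding lin[OF v(1)]
        using abs_triangle_ineq[of "(1/p) * (R1 v - \<alpha> * R2 v)" "(1/q) * (R3 v - \<beta> * R4 v)"] pq by (simp add: abs_mult)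
      also have "\<dots> \<le> 1 * \<bar>R1 v - \<alpha> * R2 v\<bar> + 1 * \<bar>R3 v - \<beta> * R4 v\<bar>"
        using pq by (intro add_mono mult_right_mono) auto
      also have "\<dots> \<le> (e * Dp.n v + \<alpha> * (e * Dp.n v)) + (e * Dp.n v + \<bar>\<beta>\<bar> * (e * Dp.n v))"
      proof -
        have "\<bar>R1 v - \<alpha> * R2 v\<bar> \<le> \<bar>R1 v\<bar> + \<alpha> * \<bar>R2 v\<bar>"
          using abs_triangle_ineq4[of "R1 v" "\<alpha> * R2 v"] \<alpha> by (simp add: abs_mult)
        moreover have "\<bar>R3 v - \<beta> * R4 v\<bar> \<le> \<bar>R3 v\<bar> + \<bar>\<beta>\<bar> * \<bar>R4 v\<bar>"
          using abs_triangle_ineq4[of "R3 v" "\<beta> * R4 v"] by (simp add: abs_mult)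
        moreover have "\<alpha> * \<bar>R2 v\<bar> \<le> \<alpha> * (e * Dp.n v)" "\<bar>\<beta>\<bar> * \<bar>R4 v\<bar> \<le> \<bar>\<beta>\<bar> * (e * Dp.n v)"
          using d2(2)[OF v(1)] d4(2)[OF v(1)] v(2) \<alpha> by (auto intro!: mult_left_mono)
        ultimately show ?thesis using d1(2)[OF v(1)] d3(2)[OF v(1)] v(2) by simp
      qed
      also have "\<dots> = e * (2 + \<alpha> + \<bar>\<beta>\<bar>) * Dp.n v" by (simp add: algebra_simps)
      also have "e * (2 + \<alpha> + \<bar>\<beta>\<bar>) = \<epsilon>" using \<alpha> by (simp add: e_def)
      finally show ?thesis .
    qed
    then show ?thesis using d1(1) d2(1) d3(1) d4(1) by (intro exI[of _ "min (min d1 d2) (min d3 d4)"]) auto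
  qed
  then show ?thesis using z by (simp add: critical_def z_def)
qed

text \<open>Normalisation maps \<open>B\<close> oddly and continuously into \<open>X\<close>, so it does not lower the genus. Distinct pairs of fixed points give distinct pairs of critical points because
the fixed point is recovered from the critical point by normalisation.\<close>

theorem many_critical_points:
  assumes B: "compactin (Metric_space.mtopology W dW) B" "\<And>u. u \<in> B \<Longrightarrow> - u \<in> B"
    and neg: "\<And>u. u \<in> B \<Longrightarrow> H u < 0"
    and l: "enat l \<le> genus (Metric_space.mtopology W dW) B"
  shows "\<exists>P \<subseteq> (\<lambda>u. {u, - u}) ` {u. critical u \<and> u \<noteq> 0 \<and> E u > 0}. finite P \<and> card P = l"
proof -
  interpret Wm: Metric_space W dW by (rule metric_dW)
  interpret L: compact_odd_descent X dW T J by (rule descent_on_X)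
  have AW: "B \<subseteq> W" using B(1) by (auto simp: compactin_def)
  have cont: "continuous_map (subtopology Wm.mtopology B) L.mtopology normalize"
  proof -
    have sub: "Submetric W dW B"
      using metric_dW AW by (auto simp: Submetric_def Submetric_axioms_def)
    have mA: "Metric_space B dW" using AW by (rule Wm.subspace)
    have "continuous_map (Metric_space.mtopology B dW) L.mtopology normalize"
    proof (rule Metric_space.continuous_map_sequential[OF mA metric_X])
      show "normalize ` B \<subseteq> X" using AW neg normalize_X by auto
      fix s a assume a: "a \<in> B" and s: "\<And>n::nat. s n \<in> B" and "(\<lambda>n. dW (s n) a) \<longlonglongrightarrow> 0"
      then show "(\<lambda>n. dW (normalize (s n)) (normalize a)) \<longlonglongrightarrow> 0"
        unfolding dW_def using AW by (intro normalize_lim neg) auto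
    qed
    then show ?thesis by (simp only: Submetric.mtopology_submetric[OF sub])
  qed
  define B' where "B' = normalize ` B"
  have "compactin L.mtopology B'"
    unfolding B'_def by (rule image_compactin[OF _ cont]) (use B(1) in \<open>simp add: compactin_subtopology\<close>)
  moreover have nm: "normalize (- u) = - normalize u" if "u \<in> W" for u
    using that by (simp add: normalize_def Up.n_minus)
  have "- u \<in> B'" if u: "u \<in> B'" for u
  proof -
    obtain a where "a \<in> B" "u = normalize a" using u by (auto simp: B'_def)
    then show ?thesis using nm[of a] B(2)[of a] AW unfolding B'_def by (metis image_eqI subsetD)
  qed
  moreover have "l \<le> k" if k: "odd_separated L.mtopology B' k" for k
  proof (rule odd_separated_genus[OF _ l], rule odd_separated_image[OF k])
    show "continuous_map (subtopology Wm.mtopology B) (subtopology L.mtopology B') normalize"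
      using cont by (auto simp: continuous_map_in_subtopology B'_def)
  qed (use AW nm in auto)
  ultimately obtain P where P: "P \<subseteq> (\<lambda>u. {u, - u}) ` L.fixed" "finite P" "card P = l"
    using L.many_fixed_pairs[of B' l] by blast
  define f where "f u = \<tau> u *\<^sub>R u" for u
  have fX: "L.fixed \<subseteq> X" by (auto simp: L.fixed_def)
  have crit: "critical (f u) \<and> f u \<noteq> 0 \<and> E (f u) > 0" if "u \<in> L.fixed" for u
  proof -
    have u: "u \<in> X" "T u = u" using that by (auto simp: L.fixed_def)
    then have "S u = u" by (intro S_fixed) auto
    then have "minimizer u u" using S[OF u(1)] by simp
    then have "critical (f u)" "E (f u) > 0"
      unfolding f_def using critical_point_on_ray[OF u(1)] \<tau>_E[OF u(1)] by auto
    moreover have "f u \<noteq> 0" using \<tau>(1)[OF u(1)] X_norm[OF u(1)] by (auto simp: f_def)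
    ultimately show ?thesis by blast
  qed
  have f_minus: "f (- u) = - f u" if "u \<in> X" for u
    using XW[OF that] by (simp add: f_def \<tau>_def G_minus H_minus)
  have f_inv: "normalize (f u) = u" if "u \<in> X" for u
    using \<tau>(1)[OF that] X_norm[OF that] Up.n_scale[OF XW[OF that], of "\<tau> u"] by (simp add: f_def normalize_def)
  have sub: "Q \<subseteq> X" if "Q \<in> P" for Q
    using that P(1) fX minus_X by fastforce
  have inj: "inj_on ((`) f) P"
  proof (rule inj_on_inverseI)
    fix Q assume "Q \<in> P"
    then show "normalize ` (f ` Q) = Q" using f_inv sub by (force simp: image_image)
  qed
  have "((`) f) ` P \<subseteq> (\<lambda>u. {u, - u}) ` {u. critical u \<and> u \<noteq> 0 \<and> E u > 0}"
  proof
    fix Q assume "Q \<in> ((`) f) ` P"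
    then obtain u where u: "u \<in> L.fixed" "Q = f ` {u, - u}" using P(1) by auto
    then have "Q = {f u, - f u}" using f_minus[of u] fX by auto
    then show "Q \<in> (\<lambda>u. {u, - u}) ` {u. critical u \<and> u \<noteq> 0 \<and> E u > 0}" using crit[OF u(1)] by blast
  qed
  moreover have "card (((`) f) ` P) = l" using card_image[OF inj] P(3) by simp
  ultimately show ?thesis using P(2) by blast
qed

end

section \<open>Smooth bump functions and the fundamental lemma of the calculus of variations\<close>

text \<open>Infinitely often differentiable, stated coinductively: \<open>g\<close> belongs to a set of functions that is closed under differentiation. To prove smoothness it suffices to exhibit such a set.\<close>

definition smooth_fun :: "(real \<Rightarrow> real) \<Rightarrow> bool" where
  "smooth_fun g \<longleftrightarrow> (\<exists>S. g \<in> S \<and> (\<forall>f\<in>S. \<exists>f'\<in>S. \<forall>x. (f has_real_derivative f' x) (at x)))"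

lemma smooth_funD:
  assumes "smooth_fun g"
  shows "\<exists>g'. smooth_fun g' \<and> (\<forall>x. (g has_real_derivative g' x) (at x))"
  using assms unfolding smooth_fun_def by blast

lemma smooth_fun_affine:
  assumes "smooth_fun g" shows "smooth_fun (\<lambda>x. g (m * x + c))"
proof -
  obtain S where S: "g \<in> S" "\<And>f. f \<in> S \<Longrightarrow> \<exists>f'\<in>S. \<forall>x. (f has_real_derivative f' x) (at x)"
    using assms unfolding smooth_fun_def by blast
  define S' where "S' = {\<lambda>x. k * f (m * x + c) | k f. f \<in> S}"
  have "\<exists>h'\<in>S'. \<forall>x. (h has_real_derivative h' x) (at x)" if "h \<in> S'" for h
  proof -
    have "\<exists>k f. h = (\<lambda>x. k * f (m * x + c)) \<and> f \<in> S" using that unfolding S'_def by (rule CollectD)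
    then obtain k f where kf: "h = (\<lambda>x. k * f (m * x + c))" "f \<in> S" by (elim exE conjE)
    obtain f' where f': "f' \<in> S" "\<And>x. (f has_real_derivative f' x) (at x)" using S(2)[OF kf(2)] by blast
    have "(h has_real_derivative (k * m) * f' (m * x + c)) (at x)" for x
      unfolding kf(1) by (rule derivative_eq_intros DERIV_chain2[OF f'(2)] refl | simp)+
    moreover have "(\<lambda>x. (k * m) * f' (m * x + c)) \<in> S'"
      unfolding S'_def using f'(1) by (intro CollectI exI[of _ "k * m"] exI[of _ f'] conjI refl)
    ultimately show ?thesis by (intro bexI[of _ "\<lambda>x. (k * m) * f' (m * x + c)"]) auto
  qed
  moreover have "(\<lambda>x. 1 * g (m * x + c)) \<in> S'"
    unfolding S'_def using S(1) by (intro CollectI exI[of _ 1] exI[of _ g] conjI refl)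
  then have "(\<lambda>x. g (m * x + c)) \<in> S'" by simp
  ultimately show ?thesis unfolding smooth_fun_def by blast
qed

text \<open>By the product rule this set is closed under differentiation if \<open>A\<close> and \<open>B\<close> are.\<close>

inductive_set sums_of_products :: "(real \<Rightarrow> real) set \<Rightarrow> (real \<Rightarrow> real) set \<Rightarrow> (real \<Rightarrow> real) set"
  for A B where
  prod: "a \<in> A \<Longrightarrow> b \<in> B \<Longrightarrow> (\<lambda>x. a x * b x) \<in> sums_of_products A B"
| sum: "f \<in> sums_of_products A B \<Longrightarrow> g \<in> sums_of_products A B \<Longrightarrow> (\<lambda>x. f x + g x) \<in> sums_of_products A B"

lemma smooth_fun_mult:
  assumes "smooth_fun g" "smooth_fun h" shows "smooth_fun (\<lambda>x. g x * h x)"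
proof -
  obtain A where A: "g \<in> A" "\<And>f. f \<in> A \<Longrightarrow> \<exists>f'\<in>A. \<forall>x. (f has_real_derivative f' x) (at x)"
    using assms(1) unfolding smooth_fun_def by blast
  obtain B where B: "h \<in> B" "\<And>f. f \<in> B \<Longrightarrow> \<exists>f'\<in>B. \<forall>x. (f has_real_derivative f' x) (at x)"
    using assms(2) unfolding smooth_fun_def by blast
  have "\<exists>f'\<in>sums_of_products A B. \<forall>x. (f has_real_derivative f' x) (at x)" if "f \<in> sums_of_products A B" for f
    using that
  proof induction
    case (prod a b)
    obtain a' where a': "a' \<in> A" "\<And>x. (a has_real_derivative a' x) (at x)" using A(2)[OF prod(1)] by blast
    obtain b' where b': "b' \<in> B" "\<And>x. (b has_real_derivative b' x) (at x)" using B(2)[OF prod(2)] by blast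
    have "(\<lambda>x. a' x * b x + a x * b' x) \<in> sums_of_products A B"
      using prod a'(1) b'(1) by (intro sums_of_products.intros)
    moreover have "((\<lambda>x. a x * b x) has_real_derivative a' x * b x + a x * b' x) (at x)" for x
      by (rule derivative_eq_intros a'(2) b'(2) refl | simp)+
    ultimately show ?case by (intro bexI[of _ "\<lambda>x. a' x * b x + a x * b' x"]) auto
  next
    case (sum f g)
    obtain f' where f': "f' \<in> sums_of_products A B" "\<And>x. (f has_real_derivative f' x) (at x)" using sum.IH(1) by blast
    obtain g' where g': "g' \<in> sums_of_products A B" "\<And>x. (g has_real_derivative g' x) (at x)" using sum.IH(2) by blast
    have "(\<lambda>x. f' x + g' x) \<in> sums_of_products A B" using f'(1) g'(1) by (rule sums_of_products.sum)
    moreover have "((\<lambda>x. f x + g x) has_real_derivative f' x + g' x) (at x)" for x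
      by (intro DERIV_add f'(2) g'(2))
    ultimately show ?case by (intro bexI[of _ "\<lambda>x. f' x + g' x"]) auto
  qed
  then show ?thesis using sums_of_products.prod[OF A(1) B(1)] unfolding smooth_fun_def by blast
qed

text \<open>The functions \<open>p(1/t) exp(-1/t)\<close>, extended by 0 to \<open>t \<le> 0\<close>. They are closed under differentiation, which acts on the polynomial by \<open>p \<mapsto> X\<^sup>2 (p - p')\<close>, so all
of them are smooth.\<close>

definition flat :: "real poly \<Rightarrow> real \<Rightarrow> real" where
  "flat p t = (if t > 0 then poly p (1 / t) * exp (- (1 / t)) else 0)"

lemma poly_times_exp_tendsto_0: "((\<lambda>s::real. s ^ k * poly p s * exp (- s)) \<longlongrightarrow> 0) at_top"
proof (induction p arbitrary: k)
  case 0
  then show ?case by simp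
next
  case (pCons a p)
  have "((\<lambda>s::real. a * (s ^ k / exp s) + s ^ (Suc k) * poly p s * exp (- s)) \<longlongrightarrow> a * 0 + 0) at_top"
    by (intro tendsto_intros tendsto_power_div_exp_0 pCons.IH)
  then show ?case by (simp add: algebra_simps exp_minus divide_inverse)
qed

lemma flat_has_derivative:
  "(flat p has_real_derivative flat ([:0, 0, 1:] * (p - pderiv p)) t) (at t)"
proof -
  consider "t > 0" | "t < 0" | "t = 0" by linarith
  then show ?thesis
  proof cases
    case 1
    have "((\<lambda>t. poly p (1 / t) * exp (- (1 / t))) has_real_derivative
        flat ([:0, 0, 1:] * (p - pderiv p)) t) (at t)"
      using 1 by (auto intro!: derivative_eq_intros DERIV_chain2[OF poly_DERIV]
        simp: flat_def power2_eq_square field_simps)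
    then show ?thesis
      by (rule has_field_derivative_transform_within_open[of _ _ _ "{0<..}"]) (use 1 in \<open>auto simp: flat_def\<close>)
  next
    case 2
    have "((\<lambda>_. 0) has_real_derivative 0) (at t)" by simp
    then have "(flat p has_real_derivative 0) (at t)"
      by (rule has_field_derivative_transform_within_open[of _ _ _ "{..<0}"]) (use 2 in \<open>auto simp: flat_def\<close>)
    then show ?thesis using 2 by (simp add: flat_def)
  next
    case 3
    have "((\<lambda>h. (flat p (0 + h) - flat p 0) / h) \<longlongrightarrow> 0) (at 0)"
      unfolding filterlim_split_at[of _ _ 0] filterlim_at_split
    proof
      show "((\<lambda>h. (flat p (0 + h) - flat p 0) / h) \<longlongrightarrow> 0) (at_left 0)"
        by (rule tendsto_eventually) (auto simp: flat_def eventually_at_filter)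
      have "((\<lambda>h. inverse h ^ 1 * poly p (inverse h) * exp (- inverse h)) \<longlongrightarrow> 0) (at_right (0::real))"
        by (rule filterlim_compose[OF poly_times_exp_tendsto_0 filterlim_inverse_at_top_right])
      then show "((\<lambda>h. (flat p (0 + h) - flat p 0) / h) \<longlongrightarrow> 0) (at_right 0)"
        by (rule Lim_transform_eventually) (auto simp: flat_def eventually_at_filter field_simps)
    qed
    then show ?thesis using 3 by (simp add: DERIV_def flat_def)
  qed
qed

lemma smooth_fun_flat: "smooth_fun (flat p)"
  unfolding smooth_fun_def by (intro exI[of _ "range flat"]) (auto intro: flat_has_derivative)

text \<open>Each partial derivative of such a product is again such a product, with one factor differentiated.\<close>

lemma Ck_prod:
  assumes "\<And>j. j \<in> (Basis :: 'a::euclidean_space set) \<Longrightarrow> smooth_fun (g j)"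
  shows "Ck k (\<lambda>x::'a. \<Prod>j\<in>Basis. g j (x \<bullet> j))"
  using assms
proof (induction k arbitrary: g)
  case 0
  have c: "continuous_on UNIV (g j)" if "j \<in> Basis" for j
    using smooth_funD[OF 0[OF that]] by (meson DERIV_isCont continuous_at_imp_continuous_on)
  have "continuous_on UNIV (\<lambda>x::'a. g j (x \<bullet> j))" if "j \<in> Basis" for j
    by (rule continuous_on_compose2[OF c[OF that] continuous_on_inner[OF continuous_on_id continuous_on_const]]) simp
  then show ?case unfolding Ck.simps by (rule continuous_on_prod)
next
  case (Suc k)
  define g' where "g' j = (SOME h. smooth_fun h \<and> (\<forall>x. (g j has_real_derivative h x) (at x)))" for j
  have g': "smooth_fun (g' j)" "(g j has_real_derivative g' j x) (at x)" if "j \<in> Basis" for j x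
    using someI_ex[OF smooth_funD[OF Suc.prems[OF that]]] unfolding g'_def by blast+
  have D: "((\<lambda>x::'a. \<Prod>j\<in>Basis. g j (x \<bullet> j)) has_derivative
      (\<lambda>y. \<Sum>i\<in>Basis. (g' i (x \<bullet> i) * (y \<bullet> i)) * (\<Prod>j\<in>Basis - {i}. g j (x \<bullet> j)))) (at x)" for x
  proof (rule has_derivative_prod)
    fix i :: 'a assume i: "i \<in> Basis"
    have "((\<lambda>x. x \<bullet> i) has_derivative (\<lambda>y. y \<bullet> i)) (at x)"
      by (rule bounded_linear_imp_has_derivative[OF bounded_linear_inner_left])
    from has_derivative_compose[OF this g'(2)[OF i, of "x \<bullet> i", unfolded has_field_derivative_def]]
    show "((\<lambda>x. g i (x \<bullet> i)) has_derivative (\<lambda>y. g' i (x \<bullet> i) * (y \<bullet> i))) (at x)" by (simp add: o_def)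
  qed
  have FD: "frechet_derivative (\<lambda>x::'a. \<Prod>j\<in>Basis. g j (x \<bullet> j)) (at x) i = (\<Prod>j\<in>Basis. (g(i := g' i)) j (x \<bullet> j))"
    if i: "i \<in> Basis" for x i
  proof -
    have "frechet_derivative (\<lambda>x::'a. \<Prod>j\<in>Basis. g j (x \<bullet> j)) (at x) i =
       (\<Sum>l\<in>Basis. (g' l (x \<bullet> l) * (i \<bullet> l)) * (\<Prod>j\<in>Basis - {l}. g j (x \<bullet> j)))"
      by (rule fun_cong[OF frechet_derivative_at[OF D], symmetric])
    also have "\<dots> = (\<Sum>l\<in>Basis. if l = i then g' i (x \<bullet> i) * (\<Prod>j\<in>Basis - {i}. g j (x \<bullet> j)) else 0)"
      using i by (intro sum.cong) (auto simp: inner_Basis)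
    also have "\<dots> = g' i (x \<bullet> i) * (\<Prod>j\<in>Basis - {i}. g j (x \<bullet> j))" using i by simp
    also have "\<dots> = (\<Prod>j\<in>Basis. (g(i := g' i)) j (x \<bullet> j))"
    proof -
      have "(\<Prod>j\<in>Basis. (g(i := g' i)) j (x \<bullet> j))
          = (g(i := g' i)) i (x \<bullet> i) * (\<Prod>j\<in>Basis - {i}. (g(i := g' i)) j (x \<bullet> j))"
        by (rule prod.remove[OF finite_Basis i])
      moreover have "(\<Prod>j\<in>Basis - {i}. (g(i := g' i)) j (x \<bullet> j)) = (\<Prod>j\<in>Basis - {i}. g j (x \<bullet> j))"
        by (rule prod.cong) auto
      ultimately show ?thesis by simp
    qed
    finally show ?thesis .
  qed
  have "Ck k (\<lambda>x. frechet_derivative (\<lambda>x::'a. \<Prod>j\<in>Basis. g j (x \<bullet> j)) (at x) i)" if i: "i \<in> Basis" for i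
    unfolding FD[OF i] using Suc.prems g'(1) i by (intro Suc.IH) auto
  moreover have "(\<lambda>x::'a. \<Prod>j\<in>Basis. g j (x \<bullet> j)) differentiable (at x)" for x
    using D unfolding differentiable_def by blast
  ultimately show ?case by simp
qed

text \<open>Positive exactly on \<open>box a b\<close>; the scaling by \<open>n + 1\<close> makes the functions increase to its indicator, as \<open>flat 1 t = exp (- 1 / t)\<close> tends to 1 for large \<open>t\<close>.\<close>

definition bump :: "'a::euclidean_space \<Rightarrow> 'a \<Rightarrow> nat \<Rightarrow> 'a \<Rightarrow> real" where
  "bump a b n x = (\<Prod>j\<in>Basis. flat 1 (real (Suc n) * (x \<bullet> j - a \<bullet> j)) * flat 1 (real (Suc n) * (b \<bullet> j - x \<bullet> j)))"

lemma flat_1: "0 \<le> flat 1 t" "flat 1 t \<le> 1" "flat 1 t = 0 \<longleftrightarrow> t \<le> 0"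
  by (auto simp: flat_def)

lemma bump_bounds: "0 \<le> bump a b n x" "bump a b n x \<le> 1"
  unfolding bump_def by (auto intro!: prod_nonneg prod_le_1 mult_nonneg_nonneg mult_le_one flat_1)

lemma bump_support: "bump a b n x \<noteq> 0 \<longleftrightarrow> x \<in> box a b"
  unfolding bump_def by (auto simp: mem_box flat_1(3) mult_le_0_iff not_le)

lemma bump_tendsto: "(\<lambda>n. bump a b n x) \<longlonglongrightarrow> indicator (box a b) x"
proof (cases "x \<in> box a b")
  case False
  then show ?thesis using bump_support[of a b _ x] by simp
next
  case True
  have *: "(\<lambda>n. flat 1 (real (Suc n) * t)) \<longlonglongrightarrow> 1" if "t > 0" for t
  proof -
    have "(\<lambda>n. exp (- (inverse (real (Suc n)) * inverse t))) \<longlonglongrightarrow> exp (- (0 * inverse t))"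
      by (intro tendsto_intros LIMSEQ_inverse_real_of_nat)
    then show ?thesis using that by (simp add: flat_def divide_inverse)
  qed
  have "(\<lambda>n. bump a b n x) \<longlonglongrightarrow> (\<Prod>j\<in>(Basis::'a set). 1 * 1)"
    unfolding bump_def using True by (intro tendsto_intros *) (auto simp: mem_box)
  with True show ?thesis by simp
qed

lemma bump_test_function:
  assumes "cbox a b \<subseteq> \<Omega>"
  shows "bump a b n \<in> test_functions \<Omega>"
proof -
  have "Ck k (bump a b n)" for k
  proof -
    have eq: "bump a b n = (\<lambda>x. \<Prod>j\<in>Basis. (\<lambda>j t. flat 1 (real (Suc n) * t + (- real (Suc n) * (a \<bullet> j)))
        * flat 1 (- real (Suc n) * t + real (Suc n) * (b \<bullet> j))) j (x \<bullet> j))"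
      by (auto simp: bump_def fun_eq_iff algebra_simps)
    show ?thesis
      unfolding eq by (intro Ck_prod smooth_fun_mult smooth_fun_affine smooth_fun_flat)
  qed
  moreover have "closure {x. bump a b n x \<noteq> 0} \<subseteq> cbox a b"
    unfolding bump_support by (rule closure_minimal) (auto simp: box_subset_cbox)
  moreover have "compact (closure {x. bump a b n x \<noteq> 0})"
    using calculation(2) by (meson bounded_cbox bounded_subset closed_closure compact_eq_bounded_closed)
  ultimately show ?thesis using assms unfolding test_functions_def by auto
qed

text \<open>Boxes generate the Borel sets and are stable under intersection, so all integrals over Borel sets vanish.\<close>

lemma zero_box_integrals_imp_zero:
  fixes f :: "'a::euclidean_space \<Rightarrow> real"
  assumes f: "integrable lebesgue f" and supp: "\<And>x. x \<notin> box c d \<Longrightarrow> f x = 0"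
    and z: "\<And>a b. (LINT x:box a b|lebesgue. f x) = 0"
  shows "AE x in lebesgue. f x = 0"
proof -
  obtain g where g: "g \<in> borel_measurable lborel" "AE x in lborel. f x = g x"
    using completion_ex_borel_measurable_real[OF borel_measurable_integrable[OF f]] by blast
  have gl: "g \<in> borel_measurable lebesgue" using g(1) by (rule measurable_completion)
  have fg: "AE x in lebesgue. f x = g x" using g(2) by (rule AE_completion)
  have "integrable lebesgue g" using f gl fg by (subst integrable_cong_AE[symmetric, of f]) auto
  then have gi: "integrable lborel g" using g(1) by (simp add: integrable_completion)
  have conv: "(LINT x:A|lborel. g x) = (LINT x:A|lebesgue. f x)" if A: "A \<in> sets borel" for A
  proof -
    have "(LINT x:A|lborel. g x) = (LINT x:A|lebesgue. g x)"
      unfolding set_lebesgue_integral_def using A g(1) by (subst integral_completion) auto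
    also have "\<dots> = (LINT x:A|lebesgue. f x)"
      unfolding set_lebesgue_integral_def
    proof (rule integral_cong_AE)
      have "A \<in> sets lebesgue" using A by auto
      then have m: "(\<lambda>x. indicat_real A x *\<^sub>R u x) \<in> borel_measurable lebesgue"
        if "u \<in> borel_measurable lebesgue" for u :: "'a \<Rightarrow> real"
        using that by (intro borel_measurable_scaleR borel_measurable_indicator)
      show "(\<lambda>x. indicat_real A x *\<^sub>R g x) \<in> borel_measurable lebesgue" by (rule m[OF gl])
      show "(\<lambda>x. indicat_real A x *\<^sub>R f x) \<in> borel_measurable lebesgue"
        by (rule m[OF borel_measurable_integrable[OF f]])
      show "AE x in lebesgue. indicat_real A x *\<^sub>R g x = indicat_real A x *\<^sub>R f x"
        using fg by eventually_elim simp
    qed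
    finally show ?thesis .
  qed
  have tot: "(LINT x:UNIV|lborel. g x) = 0"
  proof -
    have "(LINT x:UNIV|lborel. g x) = (LINT x:UNIV|lebesgue. f x)" by (rule conv) auto
    also have "\<dots> = (LINT x:box c d|lebesgue. f x)"
      unfolding set_lebesgue_integral_def using supp by (intro Bochner_Integration.integral_cong) (auto simp: indicator_def)
    finally show ?thesis using z by simp
  qed
  have gset: "set_integrable lborel A g" if "A \<in> sets borel" for A
    unfolding set_integrable_def using gi that by (intro integrable_mult_indicator) auto
  have "AE x in lborel. g x = 0"
  proof (rule density_unique_real[OF gi])
    fix A :: "'a set" assume "A \<in> sets lborel"
    then have A: "A \<in> sigma_sets UNIV (range (\<lambda>(a, b). box a b))" by (simp add: borel_eq_box)
    have "Int_stable (range (\<lambda>(a, b). box a b :: 'a set))"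
      by (auto simp: Int_stable_def box_Int_box)
    moreover have "range (\<lambda>(a, b). box a b :: 'a set) \<subseteq> Pow UNIV" by auto
    ultimately have "(LINT x:A|lborel. g x) = 0"
      using A
    proof (induction rule: sigma_sets_induct_disjoint)
      case (basic A)
      then show ?case using z by (auto simp: conv)
    next
      case (compl A)
      then have A: "A \<in> sets borel" by (simp add: borel_eq_box)
      have "(LINT x:(UNIV - A) \<union> A|lborel. g x) = (LINT x:UNIV - A|lborel. g x) + (LINT x:A|lborel. g x)"
        using A gset by (intro set_integral_Un) auto
      moreover have "(UNIV - A) \<union> A = UNIV" by auto
      ultimately show ?case using compl tot by simp
    next
      case (union F)
      then have F: "F i \<in> sets borel" for i by (auto simp: borel_eq_box)
      have "(LINT x:(\<Union>i. F i)|lborel. g x) = (\<Sum>i. (LINT x:F i|lborel. g x))"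
        using F union.hyps by (intro lebesgue_integral_countable_add gset) (auto simp: disjoint_family_on_def)
      then show ?case using union by simp
    qed (auto simp: set_lebesgue_integral_def)
    then show "(LINT x:A|lborel. g x) = (LINT x:A|lborel. 0)" by (simp add: set_lebesgue_integral_def)
  qed simp
  then have "AE x in lebesgue. g x = 0" by (rule AE_completion)
  with fg show ?thesis by eventually_elim simp
qed

text \<open>Testing with bump functions and dominated convergence give integral 0 over every box whose closure lies in \<open>\<Omega>\<close>, hence \<open>f = 0\<close> almost everywhere in such boxes; countably many of
them cover \<open>\<Omega>\<close>.\<close>

lemma fundamental_lemma:
  fixes f :: "'a::euclidean_space \<Rightarrow> real"
  assumes \<Omega>: "open \<Omega>" and loc: "\<And>K. compact K \<Longrightarrow> K \<subseteq> \<Omega> \<Longrightarrow> set_integrable lebesgue K f"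
    and test: "\<And>\<phi>. \<phi> \<in> test_functions \<Omega> \<Longrightarrow> (LINT x:\<Omega>|lebesgue. f x * \<phi> x) = 0"
  shows "AE x in lebesgue. x \<in> \<Omega> \<longrightarrow> f x = 0"
proof -
  have box0: "(LINT x:box a b|lebesgue. f x) = 0" if ab: "cbox a b \<subseteq> \<Omega>" for a b
  proof -
    have fi: "set_integrable lebesgue (cbox a b) f" using ab by (intro loc) auto
    have fm: "(\<lambda>x. indicator (cbox a b) x * f x) \<in> borel_measurable lebesgue"
      using fi unfolding set_integrable_def by (auto dest: borel_measurable_integrable)
    have bm: "bump a b n \<in> borel_measurable lebesgue" for n
    proof -
      have "Ck 0 (bump a b n)" using bump_test_function[OF ab] unfolding test_functions_def by blast
      then have "bump a b n \<in> borel_measurable borel" by (intro borel_measurable_continuous_onI) simp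
      then show ?thesis by (intro measurable_completion) simp
    qed
    have "(\<lambda>n. LINT x|lebesgue. indicator (cbox a b) x * f x * bump a b n x) \<longlonglongrightarrow>
        (LINT x|lebesgue. indicator (cbox a b) x * f x * indicator (box a b) x)"
    proof (rule integral_dominated_convergence)
      show "integrable lebesgue (\<lambda>x. norm (indicator (cbox a b) x * f x))"
        using fi unfolding set_integrable_def by simp
      show "AE x in lebesgue. (\<lambda>n. indicator (cbox a b) x * f x * bump a b n x)
          \<longlonglongrightarrow> indicator (cbox a b) x * f x * indicator (box a b) x"
        by (intro always_eventually allI tendsto_intros bump_tendsto)
      show "AE x in lebesgue. norm (indicator (cbox a b) x * f x * bump a b n x) \<le> norm (indicator (cbox a b) x * f x)" for n
        using bump_bounds[of a b n] by (auto simp: abs_mult mult_left_le)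
    qed (use fm bm in \<open>auto intro!: borel_measurable_times borel_measurable_indicator\<close>)
    moreover have "(LINT x|lebesgue. indicator (cbox a b) x * f x * bump a b n x) = 0" for n
    proof -
      have "(LINT x|lebesgue. indicator (cbox a b) x * f x * bump a b n x) = (LINT x:\<Omega>|lebesgue. f x * bump a b n x)"
        unfolding set_lebesgue_integral_def using ab bump_support[of a b n] box_subset_cbox[of a b]
        by (intro Bochner_Integration.integral_cong) (auto simp: indicator_def)
      then show ?thesis using test[OF bump_test_function[OF ab]] by simp
    qed
    ultimately have "(LINT x|lebesgue. indicator (cbox a b) x * f x * indicator (box a b) x) = 0"
      by (simp add: LIMSEQ_const_iff)
    moreover have "(LINT x|lebesgue. indicator (cbox a b) x * f x * indicator (box a b) x) = (LINT x:box a b|lebesgue. f x)"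
      unfolding set_lebesgue_integral_def using box_subset_cbox[of a b]
      by (intro Bochner_Integration.integral_cong) (auto simp: indicator_def)
    ultimately show ?thesis by simp
  qed
  have cb: "AE x in lebesgue. x \<in> cbox c d \<longrightarrow> f x = 0" if cd: "cbox c d \<subseteq> \<Omega>" for c d
  proof -
    have "AE x in lebesgue. indicator (box c d) x * f x = 0"
    proof (rule zero_box_integrals_imp_zero[where c = c and d = d])
      have "set_integrable lebesgue (box c d) f"
        by (rule set_integrable_subset[OF loc[OF compact_cbox cd]]) (auto simp: box_subset_cbox)
      then show "integrable lebesgue (\<lambda>x. indicator (box c d) x * f x)" by (simp add: set_integrable_def)
      fix a b :: 'a
      define a' where "a' = (\<Sum>i\<in>Basis. max (a\<bullet>i) (c\<bullet>i) *\<^sub>R i)"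
      define b' where "b' = (\<Sum>i\<in>Basis. min (b\<bullet>i) (d\<bullet>i) *\<^sub>R i)"
      have ab: "box a b \<inter> box c d = box a' b'" unfolding a'_def b'_def by (rule box_Int_box)
      have "cbox a' b' \<subseteq> cbox c d" by (auto simp: mem_box a'_def b'_def)
      then have "(LINT x:box a' b'|lebesgue. f x) = 0" using cd by (intro box0) auto
      moreover have "(LINT x:box a b|lebesgue. indicator (box c d) x * f x) = (LINT x:box a' b'|lebesgue. f x)"
        unfolding ab[symmetric] set_lebesgue_integral_def
        by (intro Bochner_Integration.integral_cong) (auto simp: indicator_def)
      ultimately show "(LINT x:box a b|lebesgue. indicator (box c d) x * f x) = 0" by simp
    qed auto
    moreover have "AE x in lebesgue. x \<notin> cbox c d - box c d"
      using negligible_frontier_interval[of c d] by (intro AE_not_in) (simp add: negligible_iff_null_sets)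
    ultimately show ?thesis by eventually_elim (auto simp: indicator_def)
  qed
  obtain \<D> where \<D>: "countable \<D>" "\<D> \<subseteq> Pow \<Omega>" "\<And>X. X \<in> \<D> \<Longrightarrow> \<exists>a b. X = cbox a b" "\<Union>\<D> = \<Omega>"
    using open_countable_Union_open_cbox[OF \<Omega>] by blast
  have "AE x in lebesgue. \<forall>X\<in>\<D>. x \<in> X \<longrightarrow> f x = 0"
    unfolding AE_ball_countable[OF \<D>(1)]
  proof
    fix X assume X: "X \<in> \<D>"
    then obtain a b where ab: "X = cbox a b" using \<D>(3) by blast
    moreover have "X \<subseteq> \<Omega>" using X \<D>(2) by blast
    ultimately show "AE x in lebesgue. x \<in> X \<longrightarrow> f x = 0" using cb[of a b] by simp
  qed
  then show ?thesis
  proof eventually_elim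
    case (elim x)
    then show ?case using \<D>(4) by blast
  qed
qed

section \<open>Continuously differentiable functions of compact support\<close>

text \<open>The estimates hold for all \<open>C\<^sup>1\<close> functions of compact support. Carrying the gradient \<open>G\<close> as an argument avoids derivative operators.\<close>

definition C1c :: "('a::euclidean_space \<Rightarrow> real) \<Rightarrow> ('a \<Rightarrow> 'a) \<Rightarrow> bool" where
  "C1c \<phi> G \<longleftrightarrow> (\<forall>x. (\<phi> has_derivative (\<lambda>v. G x \<bullet> v)) (at x)) \<and> continuous_on UNIV G \<and>
     (\<exists>R. \<forall>x. R < norm x \<longrightarrow> \<phi> x = 0)"

lemma C1cD:
  assumes "C1c \<phi> G"
  shows "(\<phi> has_derivative (\<lambda>v. G x \<bullet> v)) (at x)" "continuous_on UNIV G" "continuous_on UNIV \<phi>"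
  using assms unfolding C1c_def
  by (auto intro!: continuous_at_imp_continuous_on has_derivative_continuous)

lemma C1c_grad_zero:
  fixes \<phi> :: "'a::euclidean_space \<Rightarrow> real"
  assumes "C1c \<phi> G" "\<And>x. R < norm x \<Longrightarrow> \<phi> x = 0" "R < norm x"
  shows "G x = 0"
proof -
  have "open {x::'a. R < norm x}" by (intro open_Collect_less continuous_intros)
  then have "(\<phi> has_derivative (\<lambda>_. 0)) (at x)"
    by (rule has_derivative_transform_within_open[OF has_derivative_const]) (use assms in auto)
  then have "(\<lambda>v. G x \<bullet> v) = (\<lambda>_. 0)" using C1cD(1)[OF assms(1)] has_derivative_unique by blast
  from fun_cong[OF this, of "G x"] show ?thesis by simp
qed

lemma C1c_support:
  fixes \<phi> :: "'a::euclidean_space \<Rightarrow> real"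
  assumes "C1c \<phi> G"
  obtains R where "R > 0" "\<And>x. R < norm x \<Longrightarrow> \<phi> x = 0" "\<And>x. R < norm x \<Longrightarrow> G x = 0"
proof -
  obtain R where R: "\<And>x. R < norm x \<Longrightarrow> \<phi> x = 0" using assms unfolding C1c_def by blast
  show thesis
  proof (rule that[of "\<bar>R\<bar> + 1"])
    fix x :: 'a assume "\<bar>R\<bar> + 1 < norm x"
    then have "R < norm x" by linarith
    then show "\<phi> x = 0" "G x = 0" using R C1c_grad_zero[OF assms R] by simp_all
  qed simp
qed

lemma compact_support_bounded:
  fixes f :: "'a::euclidean_space \<Rightarrow> 'b::euclidean_space"
  assumes "continuous_on UNIV f" "\<And>x. R < norm x \<Longrightarrow> f x = 0"
  obtains B where "B > 0" "\<And>x. norm (f x) \<le> B"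
proof -
  have "compact (f ` cball 0 R)"
    by (intro compact_continuous_image continuous_on_subset[OF assms(1)] compact_cball) simp
  then have "\<exists>B>0. \<forall>y\<in>f ` cball 0 R. norm y \<le> B"
    using compact_imp_bounded unfolding bounded_pos[symmetric] by auto
  then obtain B where "B > 0" "\<forall>y\<in>f ` cball 0 R. norm y \<le> B" by (elim exE conjE)
  then have B: "B > 0" "\<And>y. y \<in> f ` cball 0 R \<Longrightarrow> norm y \<le> B" by auto
  have "norm (f x) \<le> B" for x
  proof (cases "R < norm x")
    case True
    then show ?thesis using assms(2)[of x] B(1) by simp
  next
    case False
    then show ?thesis using B(2)[of "f x"] by simp
  qed
  with B(1) show thesis by (rule that)
qed

lemma compact_support_Lp:
  fixes f :: "'a::euclidean_space \<Rightarrow> 'b::euclidean_space"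
  assumes f: "continuous_on UNIV f" "\<And>x. R < norm x \<Longrightarrow> f x = 0" and p: "p > 0"
  shows "f \<in> Lp lborel p"
proof -
  obtain B where B: "B > 0" "\<And>x. norm (f x) \<le> B" using compact_support_bounded[OF f] by blast
  show ?thesis
  proof (rule Lp_dominated)
    show "f \<in> borel_measurable lborel" using f(1) borel_measurable_continuous_onI by simp
    have "integrable lborel (indicator (cball 0 R :: 'a set) :: 'a \<Rightarrow> real)"
      by (rule integrable_real_indicator) (auto intro: emeasure_bounded_finite[unfolded infinity_ennreal_def])
    then show "integrable lborel (\<lambda>x. B powr p * indicator (cball (0::'a) R) x)" by simp
    have "norm (f x) powr p \<le> B powr p * indicator (cball 0 R) x" for x
    proof (cases "R < norm x")
      case True
      then show ?thesis using f(2)[of x] by simp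
    next
      case False
      then have "indicator (cball 0 R) x = (1::real)" by simp
      moreover have "norm (f x) powr p \<le> B powr p" using B(2)[of x] p by (intro powr_mono2) auto
      ultimately show ?thesis by simp
    qed
    then show "AE x in lborel. norm (f x) powr p \<le> B powr p * indicator (cball 0 R) x" by simp
  qed
qed

lemma compact_support_integrable:
  fixes f :: "'a::euclidean_space \<Rightarrow> real"
  assumes f: "continuous_on UNIV f" "\<And>x. R < norm x \<Longrightarrow> f x = 0"
  shows "integrable lborel f"
proof -
  have "integrable lborel (\<lambda>x. norm (f x) powr 1)" by (rule LpD(2)[OF compact_support_Lp[OF f]]) simp_all
  then have "integrable lborel (\<lambda>x. norm (f x))" by simp
  moreover have "f \<in> borel_measurable lborel" using borel_measurable_continuous_onI[OF f(1)] by simp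
  ultimately show ?thesis by (rule integrable_norm_cancel)
qed

lemma C1c_Lp:
  assumes "C1c \<phi> G" "p > 0"
  shows "\<phi> \<in> Lp lborel p" "G \<in> Lp lborel p"
proof -
  obtain R where "\<And>x. R < norm x \<Longrightarrow> \<phi> x = 0" "\<And>x. R < norm x \<Longrightarrow> G x = 0" using C1c_support[OF assms(1)] by metis
  then show "\<phi> \<in> Lp lborel p" "G \<in> Lp lborel p"
    using compact_support_Lp[OF C1cD(3)[OF assms(1)] _ assms(2)] compact_support_Lp[OF C1cD(2)[OF assms(1)] _ assms(2)] by blast+
qed

lemma C1c_lipschitz:
  assumes "C1c \<phi> G" "\<And>x. norm (G x) \<le> B"
  shows "\<bar>\<phi> x - \<phi> y\<bar> \<le> B * norm (x - y)"
proof -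
  have B: "B \<ge> 0" using assms(2)[of 0] norm_ge_zero[of "G 0"] by linarith
  have "norm (\<phi> x - \<phi> y) \<le> B * norm (x - y)"
  proof (rule differentiable_bound[of UNIV \<phi> "\<lambda>x v. G x \<bullet> v" B])
    show "(\<phi> has_derivative (\<lambda>v. G x \<bullet> v)) (at x within UNIV)" for x using C1cD(1)[OF assms(1)] by simp
    show "onorm (\<lambda>v. G x \<bullet> v) \<le> B" for x
    proof (rule onorm_bound[OF B])
      fix v
      have "norm (G x \<bullet> v) \<le> norm (G x) * norm v" using Cauchy_Schwarz_ineq2 by simp
      also have "\<dots> \<le> B * norm v" using assms(2) by (intro mult_right_mono) auto
      finally show "norm (G x \<bullet> v) \<le> B * norm v" .
    qed
  qed auto
  then show ?thesis by simp
qed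

lemma C1c_add: "C1c \<phi> G \<Longrightarrow> C1c \<psi> K \<Longrightarrow> C1c (\<lambda>x. \<phi> x + \<psi> x) (\<lambda>x. G x + K x)"
proof -
  assume *: "C1c \<phi> G" "C1c \<psi> K"
  obtain R1 where R1: "\<And>x. R1 < norm x \<Longrightarrow> \<phi> x = 0" using C1c_support[OF *(1)] by metis
  obtain R2 where R2: "\<And>x. R2 < norm x \<Longrightarrow> \<psi> x = 0" using C1c_support[OF *(2)] by metis
  show ?thesis unfolding C1c_def
  proof (intro conjI allI)
    show "((\<lambda>x. \<phi> x + \<psi> x) has_derivative (\<lambda>v. (G x + K x) \<bullet> v)) (at x)" for x
      unfolding inner_add_left by (rule has_derivative_add[OF C1cD(1)[OF *(1)] C1cD(1)[OF *(2)]])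
    show "\<exists>R. \<forall>x. R < norm x \<longrightarrow> \<phi> x + \<psi> x = 0" using R1 R2 by (intro exI[of _ "max R1 R2"]) auto
  qed (intro continuous_intros C1cD(2,3)[OF *(1)] C1cD(2,3)[OF *(2)])
qed

lemma C1c_scale: "C1c \<phi> G \<Longrightarrow> C1c (\<lambda>x. c * \<phi> x) (\<lambda>x. c *\<^sub>R G x)"
proof -
  assume *: "C1c \<phi> G"
  obtain R1 where R1: "\<And>x. R1 < norm x \<Longrightarrow> \<phi> x = 0" using C1c_support[OF *(1)] by metis
  show ?thesis unfolding C1c_def
  proof (intro conjI allI)
    show "((\<lambda>x. c * \<phi> x) has_derivative (\<lambda>v. (c *\<^sub>R G x) \<bullet> v)) (at x)" for x
      unfolding inner_scaleR_left by (rule has_derivative_mult_right[OF C1cD(1)[OF *]])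
    show "\<exists>R. \<forall>x. R < norm x \<longrightarrow> c * \<phi> x = 0" using R1 by (intro exI[of _ "R1"]) auto
  qed (intro continuous_intros C1cD(2,3)[OF *])
qed

lemma C1c_diff: "C1c \<phi> G \<Longrightarrow> C1c \<psi> K \<Longrightarrow> C1c (\<lambda>x. \<phi> x - \<psi> x) (\<lambda>x. G x - K x)"
  using C1c_add[OF _ C1c_scale[of \<psi> K "-1"], of \<phi> G] by simp

lemma C1c_mult: "C1c \<phi> G \<Longrightarrow> C1c \<psi> K \<Longrightarrow> C1c (\<lambda>x. \<phi> x * \<psi> x) (\<lambda>x. \<phi> x *\<^sub>R K x + \<psi> x *\<^sub>R G x)"
proof -
  assume *: "C1c \<phi> G" "C1c \<psi> K"
  obtain R1 where R1: "\<And>x. R1 < norm x \<Longrightarrow> \<phi> x = 0" using C1c_support[OF *(1)] by metis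
  show ?thesis unfolding C1c_def
  proof (intro conjI allI)
    show "((\<lambda>x. \<phi> x * \<psi> x) has_derivative (\<lambda>v. (\<phi> x *\<^sub>R K x + \<psi> x *\<^sub>R G x) \<bullet> v)) (at x)" for x
      using has_derivative_mult[OF C1cD(1)[OF *(1)] C1cD(1)[OF *(2)], of x] by (simp add: inner_add_left mult.commute)
    show "\<exists>R. \<forall>x. R < norm x \<longrightarrow> \<phi> x * \<psi> x = 0" using R1 by (intro exI[of _ "R1"]) auto
  qed (intro continuous_intros C1cD(2,3)[OF *(1)] C1cD(2,3)[OF *(2)])
qed

lemma difference_quotient_limit:
  assumes "C1c \<phi> G"
  shows "(\<lambda>n. real (Suc n) * (\<phi> (x + (1 / real (Suc n)) *\<^sub>R z) - \<phi> x)) \<longlonglongrightarrow> G x \<bullet> z"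
proof -
  have "((\<lambda>t. x + t *\<^sub>R z) has_derivative (\<lambda>t. t *\<^sub>R z)) (at 0)"
    by (auto intro!: derivative_eq_intros)
  from has_derivative_compose[OF this, of \<phi> "\<lambda>v. G x \<bullet> v"] C1cD(1)[OF assms, of x]
  have "((\<lambda>t. \<phi> (x + t *\<^sub>R z)) has_derivative (\<lambda>t. G x \<bullet> (t *\<^sub>R z))) (at 0)" by simp
  then have "((\<lambda>t. \<phi> (x + t *\<^sub>R z)) has_real_derivative (G x \<bullet> z)) (at 0)"
    unfolding has_field_derivative_def by (simp add: mult.commute[of _ "G x \<bullet> z"])
  then have "((\<lambda>h. (\<phi> (x + (0 + h) *\<^sub>R z) - \<phi> (x + 0 *\<^sub>R z)) / h) \<longlongrightarrow> G x \<bullet> z) (at 0)" by (simp add: DERIV_def)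
  moreover have "filterlim (\<lambda>n. 1 / real (Suc n)) (at 0) sequentially"
    using LIMSEQ_inverse_real_of_nat by (simp add: filterlim_at inverse_eq_divide)
  ultimately have "(\<lambda>n. (\<phi> (x + (0 + 1 / real (Suc n)) *\<^sub>R z) - \<phi> (x + 0 *\<^sub>R z)) / (1 / real (Suc n))) \<longlonglongrightarrow> G x \<bullet> z"
    by (rule filterlim_compose)
  then show ?thesis by (simp add: mult.commute)
qed

lemma lborel_translate:
  fixes f :: "'a::euclidean_space \<Rightarrow> real"
  assumes "f \<in> borel_measurable borel"
  shows "(LINT x|lborel. f (x + z)) = (LINT x|lborel. f x)"
proof -
  have "(LINT x|lborel. f x) = (LINT x|distr lborel borel ((+) z). f x)" by (simp add: lborel_distr_plus)
  also have "\<dots> = (LINT x|lborel. f (z + x))" using assms by (subst integral_distr) auto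
  finally show ?thesis by (simp add: add.commute)
qed

lemma Lint_translate:
  fixes f :: "'a::euclidean_space \<Rightarrow> 'b::euclidean_space"
  assumes "f \<in> borel_measurable borel"
  shows "Lint lborel p (\<lambda>x. f (x + z)) = Lint lborel p f"
  unfolding Lint_def by (rule lborel_translate[of "\<lambda>x. norm (f x) powr p"]) (use assms in auto)

lemma continuous_translate:
  fixes f :: "'a::euclidean_space \<Rightarrow> 'b::euclidean_space"
  assumes "continuous_on UNIV f" shows "continuous_on UNIV (\<lambda>x. f (x + z))"
  by (rule continuous_on_compose2[OF assms continuous_on_add[OF continuous_on_id continuous_on_const]]) simp

lemma continuous_borel:
  fixes f :: "'a::euclidean_space \<Rightarrow> 'b::euclidean_space"
  shows "continuous_on UNIV f \<Longrightarrow> f \<in> borel_measurable borel"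
  by (rule borel_measurable_continuous_onI)

lemma Lp_translate_diff:
  fixes \<phi> :: "'a::euclidean_space \<Rightarrow> real"
  assumes "C1c \<phi> G" "p > 0"
  shows "(\<lambda>x. \<phi> (x + a) - \<phi> (x + b)) \<in> Lp lborel p"
proof -
  obtain R where R: "\<And>x. R < norm x \<Longrightarrow> \<phi> x = 0" using C1c_support[OF assms(1)] by metis
  show ?thesis
  proof (rule compact_support_Lp[where R = "R + norm a + norm b"])
    show "continuous_on UNIV (\<lambda>x. \<phi> (x + a) - \<phi> (x + b))"
      by (intro continuous_intros continuous_translate C1cD(3)[OF assms(1)])
    fix x :: 'a assume x: "R + norm a + norm b < norm x"
    have "norm x \<le> norm (x + a) + norm a" "norm x \<le> norm (x + b) + norm b"
      using norm_triangle_ineq4[of "x + a" a] norm_triangle_ineq4[of "x + b" b] by simp_all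
    then have "R < norm (x + a)" "R < norm (x + b)" using x norm_ge_zero[of a] norm_ge_zero[of b] by linarith+
    then show "\<phi> (x + a) - \<phi> (x + b) = 0" using R by simp
  qed (use assms in auto)
qed

lemma dominated_difference_quotient:
  fixes \<phi> :: "'a::euclidean_space \<Rightarrow> real"
  assumes c: "C1c \<phi> G"
  obtains B R where "B > 0" "\<And>n x. \<bar>real (Suc n) * (\<phi> (x + (1 / real (Suc n)) *\<^sub>R z) - \<phi> x)\<bar> \<le> B * indicator (cball 0 R) x"
proof -
  obtain R where R: "\<And>x. R < norm x \<Longrightarrow> \<phi> x = 0" "\<And>x. R < norm x \<Longrightarrow> G x = 0" using C1c_support[OF c] by metis
  obtain B where B: "B > 0" "\<And>x. norm (G x) \<le> B" using compact_support_bounded[OF C1cD(2)[OF c] R(2)] by blast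
  show thesis
  proof (rule that[of "B * (norm z + 1)" "R + norm z"])
    show "B * (norm z + 1) > 0" using B(1) by (intro mult_pos_pos add_nonneg_pos) auto
    fix n and x :: 'a
    define y where "y = (1 / real (Suc n)) *\<^sub>R z"
    have y: "norm y = norm z / real (Suc n)" by (simp add: y_def)
    have "norm z / real (Suc n) \<le> norm z / 1" by (intro divide_left_mono) auto
    then have yz: "norm y \<le> norm z" by (simp add: y)
    show "\<bar>real (Suc n) * (\<phi> (x + (1 / real (Suc n)) *\<^sub>R z) - \<phi> x)\<bar> \<le> B * (norm z + 1) * indicator (cball 0 (R + norm z)) x"
    proof (cases "R + norm z < norm x")
      case True
      have "norm x \<le> norm (x + y) + norm y" using norm_triangle_ineq4[of "x + y" y] by simp
      then have "R < norm (x + y)" "R < norm x" using True yz norm_ge_zero[of z] by linarith+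
      then have "\<phi> (x + y) = 0" "\<phi> x = 0" by (auto intro: R)
      then show ?thesis using True by (simp add: y_def)
    next
      case False
      have "\<bar>real (Suc n) * (\<phi> (x + y) - \<phi> x)\<bar> = real (Suc n) * \<bar>\<phi> (x + y) - \<phi> x\<bar>" by (simp add: abs_mult)
      also have "\<dots> \<le> real (Suc n) * (B * norm (x + y - x))"
        by (intro mult_left_mono C1c_lipschitz[OF c B(2)]) auto
      also have "\<dots> = B * norm z" by (simp add: y)
      also have "\<dots> \<le> B * (norm z + 1)" using B(1) by (intro mult_left_mono) auto
      finally show ?thesis using False by (simp add: y_def)
    qed
  qed
qed

lemma indicator_cball_integrable: "integrable lborel (\<lambda>x. c * indicator (cball (a::'a::euclidean_space) R) x :: real)"
  by (intro integrable_mult_right integrable_real_indicator) (auto intro: emeasure_bounded_finite[unfolded infinity_ennreal_def])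

text \<open>Integration by parts: the difference quotients have integral 0 by translation invariance, and they converge dominatedly. Applied to a product it gives the
weak gradient of a test function.\<close>

lemma integral_directional_derivative:
  fixes \<phi> :: "'a::euclidean_space \<Rightarrow> real"
  assumes c: "C1c \<phi> G"
  shows "(LINT x|lborel. G x \<bullet> z) = 0"
proof -
  obtain B R where BR: "\<And>n x. \<bar>real (Suc n) * (\<phi> (x + (1 / real (Suc n)) *\<^sub>R z) - \<phi> x)\<bar> \<le> B * indicator (cball 0 R) x"
    using dominated_difference_quotient[OF c, of z] by metis
  have "(\<lambda>n. LINT x|lborel. real (Suc n) * (\<phi> (x + (1 / real (Suc n)) *\<^sub>R z) - \<phi> x)) \<longlonglongrightarrow> (LINT x|lborel. G x \<bullet> z)"
  proof (rule integral_dominated_convergence)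
    show "integrable lborel (\<lambda>x. B * indicator (cball 0 R) x)" by (rule indicator_cball_integrable)
    show "(\<lambda>x. G x \<bullet> z) \<in> borel_measurable lborel" using continuous_borel[OF C1cD(2)[OF c]] by simp
    show "(\<lambda>x. real (Suc n) * (\<phi> (x + (1 / real (Suc n)) *\<^sub>R z) - \<phi> x)) \<in> borel_measurable lborel" for n
      using continuous_borel[OF C1cD(3)[OF c]] continuous_borel[OF continuous_translate[OF C1cD(3)[OF c]]] by simp
  qed (use BR difference_quotient_limit[OF c] in auto)
  moreover have "(LINT x|lborel. real (Suc n) * (\<phi> (x + (1 / real (Suc n)) *\<^sub>R z) - \<phi> x)) = 0" for n
  proof -
    obtain R where R: "\<And>x. R < norm x \<Longrightarrow> \<phi> x = 0" using C1c_support[OF c] by metis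
    have i1: "integrable lborel \<phi>" by (rule compact_support_integrable[OF C1cD(3)[OF c] R])
    define y where "y = (1 / real (Suc n)) *\<^sub>R z"
    have "integrable lborel (\<lambda>x. \<phi> (x + y))"
    proof (rule compact_support_integrable[where R = "R + norm y"])
      fix x :: 'a assume "R + norm y < norm x"
      moreover have "norm x \<le> norm (x + y) + norm y" using norm_triangle_ineq4[of "x + y" y] by simp
      ultimately show "\<phi> (x + y) = 0" by (intro R) linarith
    qed (rule continuous_translate[OF C1cD(3)[OF c]])
    then have "(LINT x|lborel. real (Suc n) * (\<phi> (x + y) - \<phi> x)) = real (Suc n) * ((LINT x|lborel. \<phi> (x + y)) - (LINT x|lborel. \<phi> x))"
      using i1 by simp
    also have "\<dots> = 0" using lborel_translate[OF continuous_borel[OF C1cD(3)[OF c]]] by simp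
    finally show ?thesis by (simp add: y_def)
  qed
  ultimately show ?thesis by (simp add: LIMSEQ_const_iff)
qed

text \<open>Divide the translation by \<open>z\<close> into \<open>n + 1\<close> equal steps. By Minkowski's inequality and translation invariance the norm of the difference is at most that of the difference
quotient with step \<open>z / (n + 1)\<close>, which tends to the norm of the directional derivative.\<close>

lemma translation_estimate:
  fixes \<phi> :: "'a::euclidean_space \<Rightarrow> real"
  assumes c: "C1c \<phi> G" and p: "p > 1"
  shows "Lnorm lborel p (\<lambda>x. \<phi> (x + z) - \<phi> x) \<le> norm z * Lnorm lborel p G"
proof -
  have \<phi>b: "\<phi> \<in> borel_measurable borel" by (rule continuous_borel[OF C1cD(3)[OF c]])
  have \<phi>t: "(\<lambda>x. \<phi> (x + y)) \<in> borel_measurable borel" for y by (rule continuous_borel[OF continuous_translate[OF C1cD(3)[OF c]]])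
  have Gb: "G \<in> borel_measurable borel" by (rule continuous_borel[OF C1cD(2)[OF c]])
  define f where "f n x = real (Suc n) * (\<phi> (x + (1 / real (Suc n)) *\<^sub>R z) - \<phi> x)" for n x
  obtain B R where BR: "B > 0" "\<And>n x. \<bar>f n x\<bar> \<le> B * indicator (cball 0 R) x"
    unfolding f_def using dominated_difference_quotient[OF c, of z] by metis
  have "(\<lambda>n. Lint lborel p (f n)) \<longlonglongrightarrow> Lint lborel p (\<lambda>x. G x \<bullet> z)"
    unfolding Lint_def
  proof (rule integral_dominated_convergence)
    show "integrable lborel (\<lambda>x. B powr p * indicator (cball 0 R) x)" by (rule indicator_cball_integrable)
    show "(\<lambda>x. norm (G x \<bullet> z) powr p) \<in> borel_measurable lborel" using Gb by simp
    show "(\<lambda>x. norm (f n x) powr p) \<in> borel_measurable lborel" for n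
      unfolding f_def using \<phi>b \<phi>t by simp
    have "norm (norm (f n x) powr p) \<le> B powr p * indicator (cball 0 R) x" for n x
    proof (cases "x \<in> cball 0 R")
      case True
      then have "norm (f n x) powr p \<le> B powr p" using BR(2)[of n x] p by (intro powr_mono2) auto
      then show ?thesis using True by simp
    next
      case False
      then show ?thesis using BR(2)[of n x] p by auto
    qed
    then show "AE x in lborel. norm (norm (f n x) powr p) \<le> B powr p * indicator (cball 0 R) x" for n by simp
    show "AE x in lborel. (\<lambda>n. norm (f n x) powr p) \<longlonglongrightarrow> norm (G x \<bullet> z) powr p"
      unfolding f_def using difference_quotient_limit[OF c] p
      by (intro always_eventually allI tendsto_powr' tendsto_norm) auto
  qed
  then have lim: "(\<lambda>n. Lnorm lborel p (f n)) \<longlonglongrightarrow> Lnorm lborel p (\<lambda>x. G x \<bullet> z)"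
    unfolding Lnorm_def using p by (intro tendsto_powr') auto
  have le: "Lnorm lborel p (\<lambda>x. \<phi> (x + z) - \<phi> x) \<le> Lnorm lborel p (f n)" for n
  proof -
    define y where "y = (1 / real (Suc n)) *\<^sub>R z"
    define t where "t = Lnorm lborel p (\<lambda>x. \<phi> (x + y) - \<phi> x)"
    have step: "Lnorm lborel p (\<lambda>x. \<phi> (x + real k *\<^sub>R y) - \<phi> x) \<le> real k * t" for k
    proof (induction k)
      case 0
      have "Lnorm lborel p (\<lambda>x::'a. 0::real) = 0" using p by (simp add: Lnorm_def Lint_def)
      then show ?case by simp
    next
      case (Suc k)
      have "Lnorm lborel p (\<lambda>x. \<phi> (x + real (Suc k) *\<^sub>R y) - \<phi> x)
          = Lnorm lborel p (\<lambda>x. (\<phi> (x + real (Suc k) *\<^sub>R y) - \<phi> (x + real k *\<^sub>R y)) + (\<phi> (x + real k *\<^sub>R y) - \<phi> x))"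
        by simp
      also have "\<dots> \<le> Lnorm lborel p (\<lambda>x. \<phi> (x + real (Suc k) *\<^sub>R y) - \<phi> (x + real k *\<^sub>R y))
          + Lnorm lborel p (\<lambda>x. \<phi> (x + real k *\<^sub>R y) - \<phi> x)"
        using Lp_translate_diff[OF c, of p "real (Suc k) *\<^sub>R y" "real k *\<^sub>R y"] Lp_translate_diff[OF c, of p "real k *\<^sub>R y" 0] p
        by (intro Lp_minkowski) auto
      also have "Lnorm lborel p (\<lambda>x. \<phi> (x + real (Suc k) *\<^sub>R y) - \<phi> (x + real k *\<^sub>R y)) = t"
      proof -
        have "Lint lborel p (\<lambda>x. (\<lambda>x. \<phi> (x + y) - \<phi> x) (x + real k *\<^sub>R y)) = Lint lborel p (\<lambda>x. \<phi> (x + y) - \<phi> x)"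
          using \<phi>b \<phi>t by (intro Lint_translate) auto
        moreover have "x + real k *\<^sub>R y + y = x + real (Suc k) *\<^sub>R y" for x by (simp add: algebra_simps)
        ultimately show ?thesis by (simp add: t_def Lnorm_def)
      qed
      finally show ?case using Suc by (simp add: algebra_simps)
    qed
    have "Lnorm lborel p (f n) = Lnorm lborel p (\<lambda>x. real (Suc n) *\<^sub>R (\<phi> (x + y) - \<phi> x))"
      by (simp add: f_def[abs_def] y_def)
    also have "\<dots> = real (Suc n) * t" using p by (simp only: Lnorm_scaleR t_def)
    finally have "Lnorm lborel p (f n) = real (Suc n) * t" .
    moreover have "real (Suc n) *\<^sub>R y = z" by (simp add: y_def)
    ultimately show ?thesis using step[of "Suc n"] by simp
  qed
  have "Lnorm lborel p (\<lambda>x. \<phi> (x + z) - \<phi> x) \<le> Lnorm lborel p (\<lambda>x. G x \<bullet> z)"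
    by (rule LIMSEQ_le_const[OF lim]) (use le in auto)
  also have "\<dots> \<le> Lnorm lborel p (\<lambda>x. norm z *\<^sub>R G x)"
  proof -
    have "Lint lborel p (\<lambda>x. G x \<bullet> z) \<le> Lint lborel p (\<lambda>x. norm z *\<^sub>R G x)"
      unfolding Lint_def
    proof (rule integral_mono)
      have zG: "(\<lambda>x. norm z *\<^sub>R G x) \<in> Lp lborel p" using C1c_Lp[OF c] p by (intro Lp_scaleR) auto
      then show "integrable lborel (\<lambda>x. norm (norm z *\<^sub>R G x) powr p)" by (rule LpD)
      have b: "norm (G x \<bullet> z) powr p \<le> norm (norm z *\<^sub>R G x) powr p" for x
        using Cauchy_Schwarz_ineq2[of "G x" z] p by (intro powr_mono2) (auto simp: mult.commute)
      then show "norm (G x \<bullet> z) powr p \<le> norm (norm z *\<^sub>R G x) powr p" for x .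
      show "integrable lborel (\<lambda>x. norm (G x \<bullet> z) powr p)"
        by (rule LpD(2)[OF Lp_dominated[OF _ LpD(2)[OF zG]]]) (use b Gb in auto)
    qed
    then show ?thesis unfolding Lnorm_def using p by (intro powr_mono2) auto
  qed
  also have "\<dots> = norm z * Lnorm lborel p G" using p by (simp add: Lnorm_scaleR)
  finally show ?thesis .
qed

text \<open>A translation by more than the diameter of the ball makes the supports of \<open>\<phi>\<close> and its translate disjoint, so \<open>\<parallel>\<phi>\<parallel>\<close> is at most the norm of the difference.\<close>

lemma poincare_C1c:
  fixes \<phi> :: "'a::euclidean_space \<Rightarrow> real"
  assumes c: "C1c \<phi> G" and p: "p > 1" and R: "R > 0" "\<And>x. R < norm x \<Longrightarrow> \<phi> x = 0"
  shows "Lnorm lborel p \<phi> \<le> (2 * R + 1) * Lnorm lborel p G"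
proof -
  obtain b :: 'a where b: "b \<in> Basis" by (meson nonempty_Basis ex_in_conv)
  define z where "z = (2 * R + 1) *\<^sub>R b"
  have nz: "norm z = 2 * R + 1" using b R by (simp add: z_def)
  have \<phi>b: "\<phi> \<in> borel_measurable borel" by (rule continuous_borel[OF C1cD(3)[OF c]])
  have L: "\<phi> \<in> Lp lborel p" using C1c_Lp[OF c] p by auto
  \<comment> \<open>At every point at least one of the two terms is 0.\<close>
  have pw: "norm (\<phi> (x + z) - \<phi> x) powr p = norm (\<phi> (x + z)) powr p + norm (\<phi> x) powr p" for x
  proof (cases "R < norm x")
    case True
    then show ?thesis using R by simp
  next
    case False
    have "norm z \<le> norm (x + z) + norm x" using norm_triangle_ineq4[of "x + z" x] by simp
    then have "R < norm (x + z)" using False nz R by linarith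
    then show ?thesis using R by simp
  qed
  have "integrable lborel (\<lambda>x. norm (\<phi> (x + z)) powr p)"
    using Lp_add[OF _ Lp_translate_diff[OF c, of p z 0] L] p by (auto dest: LpD(2))
  then have "Lint lborel p (\<lambda>x. \<phi> (x + z) - \<phi> x) = Lint lborel p (\<lambda>x. \<phi> (x + z)) + Lint lborel p \<phi>"
    unfolding Lint_def pw using LpD(2)[OF L] by simp
  also have "\<dots> = 2 * Lint lborel p \<phi>" using Lint_translate[OF \<phi>b] by simp
  finally have "Lint lborel p \<phi> \<le> Lint lborel p (\<lambda>x. \<phi> (x + z) - \<phi> x)"
    using Lint_nonneg[of lborel p \<phi>] by linarith
  then have "Lnorm lborel p \<phi> \<le> Lnorm lborel p (\<lambda>x. \<phi> (x + z) - \<phi> x)"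
    unfolding Lnorm_def using p by (intro powr_mono2) auto
  also have "\<dots> \<le> norm z * Lnorm lborel p G" by (rule translation_estimate[OF c p])
  finally show ?thesis by (simp add: nz)
qed

section \<open>An inequality of Ehrling type\<close>

lemma norm_add3_powr_le:
  fixes a b c :: real
  assumes "s > 0"
  shows "\<bar>a + b + c\<bar> powr s \<le> 3 powr s * (\<bar>a\<bar> powr s + \<bar>b\<bar> powr s + \<bar>c\<bar> powr s)"
proof -
  have "\<bar>a + b + c\<bar> \<le> 3 * max \<bar>a\<bar> (max \<bar>b\<bar> \<bar>c\<bar>)" by linarith
  then have "\<bar>a + b + c\<bar> powr s \<le> (3 * max \<bar>a\<bar> (max \<bar>b\<bar> \<bar>c\<bar>)) powr s"
    using assms by (intro powr_mono2) auto
  also have "\<dots> = 3 powr s * max \<bar>a\<bar> (max \<bar>b\<bar> \<bar>c\<bar>) powr s" by (rule powr_mult)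
  also have "max \<bar>a\<bar> (max \<bar>b\<bar> \<bar>c\<bar>) powr s \<le> \<bar>a\<bar> powr s + \<bar>b\<bar> powr s + \<bar>c\<bar> powr s"
    by (auto simp: max_def)
  finally show ?thesis by simp
qed

lemma mean_power_le:
  fixes f :: "'a::euclidean_space \<Rightarrow> real"
  assumes f: "continuous_on UNIV f" and p: "p > 1"
  shows "\<bar>LINT z:cball 0 h|lborel. f z\<bar> powr p
     \<le> measure lborel (cball (0::'a) h) powr (p - 1) * (LINT z:cball 0 h|lborel. \<bar>f z\<bar> powr p)"
proof -
  define m where "m = measure lborel (cball (0::'a) h)"
  define i where "i = (indicator (cball (0::'a) h) :: 'a \<Rightarrow> real)"
  define g where "g x = i x * f x" for x
  obtain B where B: "\<And>x. x \<in> cball 0 h \<Longrightarrow> \<bar>f x\<bar> \<le> B"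
  proof -
    have "bounded (f ` cball 0 h)"
      by (intro compact_imp_bounded compact_continuous_image continuous_on_subset[OF f] compact_cball) simp
    then obtain a where "\<forall>y\<in>f ` cball 0 h. norm y \<le> a" unfolding bounded_iff by (elim exE)
    then show thesis by (intro that[of a]) auto
  qed
  have ii: "integrable lborel i" unfolding i_def using indicator_cball_integrable[of 1 "0::'a" h] by simp
  have ip: "norm (i x) powr t = i x" for x t by (simp add: i_def indicator_def)
  have iL: "i \<in> Lp lborel p" by (rule LpI) (simp_all only: ip ii borel_measurable_integrable[OF ii])
  have fb: "f \<in> borel_measurable borel" by (rule continuous_borel[OF f])
  have gL: "g \<in> Lp lborel p"
  proof (rule Lp_dominated[OF _ indicator_cball_integrable])
    show "g \<in> borel_measurable lborel"
      unfolding g_def i_def measurable_lborel2 by (intro borel_measurable_times borel_measurable_indicator fb) auto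
    have "norm (g x) powr p \<le> \<bar>B\<bar> powr p * indicator (cball 0 h) x" for x
    proof (cases "x \<in> cball 0 h")
      case True
      then have "norm (g x) \<le> \<bar>B\<bar>" using B[OF True] by (simp add: g_def i_def)
      then have "norm (g x) powr p \<le> \<bar>B\<bar> powr p" using p by (intro powr_mono2) auto
      then show ?thesis using True by simp
    qed (simp add: g_def i_def)
    then show "AE x in lborel. norm (g x) powr p \<le> \<bar>B\<bar> powr p * indicator (cball 0 h) x" by simp
  qed
  have gp: "norm (g x) powr p = i x * (\<bar>f x\<bar> powr p)" for x by (simp add: g_def i_def indicator_def)
  have ig: "norm (i x) powr (p - 1) * norm (g x) = norm (g x)" for x by (simp add: g_def i_def indicator_def)
  have "\<bar>LINT z:cball 0 h|lborel. f z\<bar> = norm (LINT x|lborel. g x)"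
    by (simp add: set_lebesgue_integral_def g_def i_def)
  also have "\<dots> \<le> (LINT x|lborel. norm (g x))" by (rule integral_norm_bound)
  also have "\<dots> \<le> Lnorm lborel p i powr (p - 1) * Lnorm lborel p g"
    using Lp_holder[OF p iL gL] unfolding ig .
  finally have "\<bar>LINT z:cball 0 h|lborel. f z\<bar> powr p \<le> (Lnorm lborel p i powr (p - 1) * Lnorm lborel p g) powr p"
    using p by (intro powr_mono2) auto
  also have "\<dots> = (Lnorm lborel p i powr p) powr (p - 1) * Lnorm lborel p g powr p"
    by (simp add: powr_mult powr_powr mult.commute)
  also have "Lnorm lborel p i powr p = m"
  proof -
    have "Lnorm lborel p i powr p = Lint lborel p i" using p by (intro Lnorm_powr) simp
    also have "\<dots> = (LINT x|lborel. i x)" unfolding Lint_def ip ..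
    finally show ?thesis by (simp add: i_def m_def)
  qed
  also have "Lnorm lborel p g powr p = (LINT z:cball 0 h|lborel. \<bar>f z\<bar> powr p)"
  proof -
    have "Lnorm lborel p g powr p = Lint lborel p g" using p by (intro Lnorm_powr) simp
    also have "\<dots> = (LINT x|lborel. i x * (\<bar>f x\<bar> powr p))" unfolding Lint_def gp ..
    finally show ?thesis by (simp add: i_def set_lebesgue_integral_def)
  qed
  finally show ?thesis by (simp add: m_def)
qed

text \<open>Fubini and \<open>translation_estimate\<close>; the translations occurring have length at most \<open>h\<close>.\<close>

lemma averaged_translation:
  fixes \<phi> :: "'a::euclidean_space \<Rightarrow> real"
  assumes c: "C1c \<phi> G" and p: "p > 1" and h: "h > 0"
  defines "A \<equiv> \<lambda>x. LINT z:cball 0 h|lborel. \<bar>\<phi> x - \<phi> (x + z)\<bar> powr p"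
  shows "integrable lborel A"
    and "(LINT x|lborel. A x) \<le> measure lborel (cball (0::'a) h) * (h powr p * Lint lborel p G)"
proof -
  obtain R where R: "\<And>x. R < norm x \<Longrightarrow> \<phi> x = 0" using C1c_support[OF c] by metis
  have \<phi>c: "continuous_on UNIV \<phi>" by (rule C1cD(3)[OF c])
  obtain B where B: "B > 0" "\<And>x. norm (\<phi> x) \<le> B" using compact_support_bounded[OF \<phi>c R] by blast
  define F where "F x z = indicator (cball (0::'a) h) z * \<bar>\<phi> x - \<phi> (x + z)\<bar> powr p" for x z :: 'a
  have cont2: "continuous_on UNIV (\<lambda>xz::'a \<times> 'a. \<bar>\<phi> (fst xz) - \<phi> (fst xz + snd xz)\<bar> powr p)"
  proof (rule continuous_norm_powr[of p "\<lambda>xz::'a \<times> 'a. \<phi> (fst xz) - \<phi> (fst xz + snd xz)", simplified real_norm_def])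
    show "continuous_on UNIV (\<lambda>xz::'a \<times> 'a. \<phi> (fst xz) - \<phi> (fst xz + snd xz))"
      by (intro continuous_on_diff continuous_on_compose2[OF \<phi>c] continuous_on_fst continuous_on_snd
        continuous_on_add continuous_on_id) auto
  qed (use p in simp)
  have meas: "(\<lambda>xz. F (fst xz) (snd xz)) \<in> borel_measurable (lborel \<Otimes>\<^sub>M lborel)"
  proof -
    have 1: "(\<lambda>xz::'a \<times> 'a. \<bar>\<phi> (fst xz) - \<phi> (fst xz + snd xz)\<bar> powr p) \<in> borel_measurable borel"
      by (rule borel_measurable_continuous_onI[OF cont2])
    have "(\<lambda>xz::'a \<times> 'a. indicator (cball (0::'a) h) (snd xz) :: real) = indicator (UNIV \<times> cball 0 h)"
      by (auto simp: indicator_def fun_eq_iff)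
    moreover have "closed ((UNIV::'a set) \<times> cball (0::'a) h)" by (intro closed_Times) auto
    ultimately have "(\<lambda>xz::'a \<times> 'a. indicator (cball (0::'a) h) (snd xz) :: real) \<in> borel_measurable borel"
      by simp
    with 1 have "(\<lambda>xz. F (fst xz) (snd xz)) \<in> borel_measurable borel"
      unfolding F_def by (intro borel_measurable_times)
    then show ?thesis by (simp add: lborel_prod)
  qed
  have bound: "norm (F x z) \<le> (2 * B) powr p * indicator (cball 0 (R + h) \<times> cball 0 h) (x, z)" for x z
  proof (cases "z \<in> cball 0 h")
    case True
    then have z: "norm z \<le> h" by simp
    show ?thesis
    proof (cases "R + h < norm x")
      case True
      have "norm x \<le> norm (x + z) + norm z" using norm_triangle_ineq4[of "x + z" z] by simp
      then have "R < norm (x + z)" "R < norm x" using True z norm_ge_zero[of z] h by linarith+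
      then have "\<phi> x = 0" "\<phi> (x + z) = 0" using R by auto
      then show ?thesis by (simp add: F_def)
    next
      case False
      have "\<bar>\<phi> x - \<phi> (x + z)\<bar> \<le> 2 * B" using B(2)[of x] B(2)[of "x + z"] by simp
      then have "\<bar>\<phi> x - \<phi> (x + z)\<bar> powr p \<le> (2 * B) powr p" using p by (intro powr_mono2) auto
      then show ?thesis using False z by (simp add: F_def indicator_def)
    qed
  qed (simp add: F_def)
  have int: "integrable (lborel \<Otimes>\<^sub>M lborel) (\<lambda>xz. F (fst xz) (snd xz))"
  proof (rule Bochner_Integration.integrable_bound[OF _ meas])
    have "emeasure (lborel \<Otimes>\<^sub>M lborel) (cball (0::'a) (R + h) \<times> cball (0::'a) h) < \<infinity>"
      unfolding lborel_prod by (intro emeasure_bounded_finite bounded_Times) auto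
    moreover have "cball (0::'a) (R + h) \<times> cball (0::'a) h \<in> sets (lborel \<Otimes>\<^sub>M lborel)" by simp
    ultimately show "integrable (lborel \<Otimes>\<^sub>M lborel) (\<lambda>xz. (2 * B) powr p * indicator (cball (0::'a) (R + h) \<times> cball (0::'a) h) xz)"
      by (intro integrable_mult_right integrable_real_indicator) auto
    show "AE xz in lborel \<Otimes>\<^sub>M lborel. norm (F (fst xz) (snd xz))
        \<le> norm ((2 * B) powr p * indicator (cball (0::'a) (R + h) \<times> cball (0::'a) h) xz)"
      using bound by (auto simp: order_trans[OF bound abs_ge_self])
  qed
  have AF: "A x = (LINT z|lborel. F x z)" for x
    by (simp add: A_def F_def set_lebesgue_integral_def)
  have int': "integrable (lborel \<Otimes>\<^sub>M lborel) (\<lambda>(x, z). F x z)"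
    using int by (simp add: case_prod_unfold)
  show "integrable lborel A"
    using lborel_pair.integrable_fst'[OF int'] by (simp add: AF[abs_def])
  have "(LINT x|lborel. A x) = (LINT z|lborel. (LINT x|lborel. F x z))"
    unfolding AF by (rule lborel_pair.Fubini_integral[OF int', symmetric])
  also have "\<dots> \<le> (LINT z|lborel. (h powr p * Lint lborel p G) * indicator (cball (0::'a) h) z)"
  proof (rule integral_mono)
    show "integrable lborel (\<lambda>z. LINT x|lborel. F x z)"
      using lborel_pair.integrable_snd[OF int'] by simp
    show "integrable lborel (\<lambda>z::'a. (h powr p * Lint lborel p G) * indicator (cball 0 h) z)"
      by (rule indicator_cball_integrable)
    fix z :: 'a
    show "(LINT x|lborel. F x z) \<le> h powr p * Lint lborel p G * indicator (cball 0 h) z"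
    proof (cases "z \<in> cball 0 h")
      case True
      have "(LINT x|lborel. F x z) = Lint lborel p (\<lambda>x. \<phi> (x + z) - \<phi> x)"
        using True by (simp add: F_def Lint_def abs_minus_commute)
      also have "\<dots> = Lnorm lborel p (\<lambda>x. \<phi> (x + z) - \<phi> x) powr p" using p by (simp add: Lnorm_powr)
      also have "\<dots> \<le> (h * Lnorm lborel p G) powr p"
      proof (rule powr_mono2)
        have "norm z * Lnorm lborel p G \<le> h * Lnorm lborel p G" using True by (intro mult_right_mono) auto
        then show "Lnorm lborel p (\<lambda>x. \<phi> (x + z) - \<phi> x) \<le> h * Lnorm lborel p G"
          using translation_estimate[OF c p, of z] by linarith
      qed (use p in auto)
      also have "\<dots> = h powr p * Lint lborel p G" using p h by (simp add: powr_mult Lnorm_powr)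
      finally show ?thesis using True by simp
    qed (simp add: F_def)
  qed
  also have "\<dots> = measure lborel (cball (0::'a) h) * (h powr p * Lint lborel p G)" by simp
  finally show "(LINT x|lborel. A x) \<le> measure lborel (cball (0::'a) h) * (h powr p * Lint lborel p G)" .
qed

definition ball_integral :: "real \<Rightarrow> 'a::euclidean_space \<Rightarrow> ('a \<Rightarrow> real) \<Rightarrow> real" where
  "ball_integral h y \<phi> = (LINT z:cball 0 h|lborel. \<phi> (y + z))"

lemma cball_set_integrable:
  fixes f :: "'a::euclidean_space \<Rightarrow> real"
  assumes "continuous_on UNIV f" shows "set_integrable lborel (cball 0 h) f"
  unfolding set_integrable_def by (rule borel_integrable_compact) (auto intro: continuous_on_subset[OF assms])

lemma continuous_translate_left:
  fixes f :: "'a::euclidean_space \<Rightarrow> 'b::euclidean_space"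
  assumes "continuous_on UNIV f" shows "continuous_on UNIV (\<lambda>x. f (z + x))"
  using continuous_translate[OF assms, of z] by (simp add: add.commute)

text \<open>On a ball of small radius \<open>h\<close> replace \<open>\<phi> x\<close> by its mean, and the mean at \<open>x\<close> by that at a point \<open>y\<close> of a finite \<open>\<delta>\<close>-net. Both errors are controlled by
\<open>translation_estimate\<close>, and only finitely many continuous linear functionals of \<open>\<phi>\<close> remain.\<close>

lemma ehrling:
  assumes p: "p > 1" and R: "R > 0" and e: "e > 0"
  shows "\<exists>X h C. finite X \<and> h > 0 \<and> C \<ge> 0 \<and> (\<forall>(\<phi> :: 'a::euclidean_space \<Rightarrow> real) G. C1c \<phi> G \<longrightarrow> (\<forall>x. R < norm x \<longrightarrow> \<phi> x = 0) \<longrightarrow>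
     Lint lborel p \<phi> \<le> e * Lint lborel p G + C * (\<Sum>y\<in>X. \<bar>ball_integral h y \<phi>\<bar> powr p))"
proof -
  \<comment> \<open>The factors 3 come from splitting the power of a sum of three terms; each error receives half of \<open>e\<close>.\<close>
  define h where "h = (e / 2) powr (1 / p) / 3"
  have h: "h > 0" using e by (simp add: h_def)
  have h3: "3 powr p * h powr p = e / 2"
  proof -
    have "3 powr p * h powr p = (3 * h) powr p" by (simp add: powr_mult)
    also have "3 * h = (e / 2) powr (1 / p)" by (simp add: h_def)
    finally show ?thesis using p e by (simp add: powr_powr)
  qed
  define m where "m = measure lborel (cball (0::'a) h)"
  define V where "V = measure lborel (cball (0::'a) R)"
  have mpos: "m > 0" "V > 0" unfolding m_def V_def using h R content_cball_pos by auto
  define \<delta> where "\<delta> = (e * m / (2 * V)) powr (1 / p) / 3"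
  have \<delta>: "\<delta> > 0" using e mpos by (simp add: \<delta>_def)
  have \<delta>3: "3 powr p * V * \<delta> powr p / m = e / 2"
  proof -
    have "3 powr p * \<delta> powr p = (3 * \<delta>) powr p" by (simp add: powr_mult)
    also have "3 * \<delta> = (e * m / (2 * V)) powr (1 / p)" by (simp add: \<delta>_def)
    also have "\<dots> powr p = e * m / (2 * V)" using p e mpos by (simp add: powr_powr)
    finally have "3 powr p * \<delta> powr p = e * m / (2 * V)" .
    then have "(3 powr p * \<delta> powr p) * V / m = e / 2" using mpos by simp
    then show ?thesis by (simp add: mult_ac)
  qed
  obtain X where X: "finite X" "cball (0::'a) R \<subseteq> (\<Union>x\<in>X. ball x \<delta>)"
    using compact_cball[of "0::'a" R] \<delta> unfolding compact_eq_totally_bounded by blast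
  define C where "C = 3 powr p * V / m powr p"
  have C: "C \<ge> 0" using mpos by (simp add: C_def)
  have "Lint lborel p \<phi> \<le> e * Lint lborel p G + C * (\<Sum>y\<in>X. \<bar>ball_integral h y \<phi>\<bar> powr p)"
    if c: "C1c \<phi> G" and supp: "\<And>x. R < norm x \<Longrightarrow> \<phi> x = 0" for \<phi> :: "'a \<Rightarrow> real" and G
  proof -
    note \<phi>c = C1cD(3)[OF c]
    define \<Sigma> where "\<Sigma> = (\<Sum>y\<in>X. \<bar>ball_integral h y \<phi>\<bar> powr p)"
    define A where "A x = (LINT z:cball 0 h|lborel. \<bar>\<phi> x - \<phi> (x + z)\<bar> powr p)" for x
    define g where "g = Lint lborel p G"
    have g: "g \<ge> 0" by (simp add: g_def)
    have Aint: "integrable lborel A" and Ale: "(LINT x|lborel. A x) \<le> m * (h powr p * g)"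
      using averaged_translation[OF c p h] by (simp_all add: A_def[abs_def] m_def g_def)
    have A0: "A x \<ge> 0" for x unfolding A_def set_lebesgue_integral_def by (intro integral_nonneg_AE) auto
    have pw: "m powr p * \<bar>\<phi> x\<bar> powr p \<le> 3 powr p * (m powr (p - 1) * A x + m powr (p - 1) * (\<delta> powr p * g) + \<Sigma>)"
      if x: "norm x \<le> R" for x
    proof -
      obtain y where y: "y \<in> X" "dist y x < \<delta>" using X(2) x by (auto simp: subset_iff)
      have ct: "continuous_on UNIV (\<lambda>z. \<phi> (x + z))" "continuous_on UNIV (\<lambda>z. \<phi> (y + z))"
        by (rule continuous_translate_left[OF \<phi>c])+
      define I1 where "I1 = (LINT z:cball 0 h|lborel. \<phi> x - \<phi> (x + z))"
      define I2 where "I2 = (LINT z:cball 0 h|lborel. \<phi> (x + z) - \<phi> (y + z))"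
      have "m * \<phi> x = I1 + I2 + ball_integral h y \<phi>"
      proof -
        have sx: "set_integrable lborel (cball 0 h) (\<lambda>z. \<phi> (x + z))" "set_integrable lborel (cball 0 h) (\<lambda>z. \<phi> (y + z))"
          "set_integrable lborel (cball 0 h) (\<lambda>z::'a. \<phi> x)"
          by (intro cball_set_integrable ct continuous_on_const)+
        have "I1 = (LINT z:cball (0::'a) h|lborel. \<phi> x) - (LINT z:cball 0 h|lborel. \<phi> (x + z))"
          unfolding I1_def by (rule set_integral_diff(2)[OF sx(3,1)])
        moreover have "I2 = (LINT z:cball 0 h|lborel. \<phi> (x + z)) - (LINT z:cball 0 h|lborel. \<phi> (y + z))"
          unfolding I2_def by (rule set_integral_diff(2)[OF sx(1,2)])
        moreover have "(LINT z:cball (0::'a) h|lborel. \<phi> x) = m * \<phi> x" by (simp add: set_lebesgue_integral_def m_def)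
        ultimately show ?thesis by (simp add: ball_integral_def)
      qed
      then have "m powr p * \<bar>\<phi> x\<bar> powr p = \<bar>I1 + I2 + ball_integral h y \<phi>\<bar> powr p"
        using mpos by (simp add: powr_mult[symmetric] flip: abs_mult_pos') 
          (metis abs_mult abs_of_pos)
      also have "\<dots> \<le> 3 powr p * (\<bar>I1\<bar> powr p + \<bar>I2\<bar> powr p + \<bar>ball_integral h y \<phi>\<bar> powr p)"
        using p by (intro norm_add3_powr_le) auto
      also have "\<dots> \<le> 3 powr p * (m powr (p - 1) * A x + m powr (p - 1) * (\<delta> powr p * g) + \<Sigma>)"
      proof (intro mult_left_mono add_mono)
        show "\<bar>I1\<bar> powr p \<le> m powr (p - 1) * A x"
          unfolding I1_def A_def m_def
          by (rule mean_power_le[OF continuous_on_diff[OF continuous_on_const ct(1)] p])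
        have "\<bar>I2\<bar> powr p \<le> m powr (p - 1) * (LINT z:cball 0 h|lborel. \<bar>\<phi> (x + z) - \<phi> (y + z)\<bar> powr p)"
          unfolding I2_def m_def by (rule mean_power_le[OF continuous_on_diff[OF ct] p])
        also have "(LINT z:cball 0 h|lborel. \<bar>\<phi> (x + z) - \<phi> (y + z)\<bar> powr p) \<le> \<delta> powr p * g"
        proof -
          have L: "(\<lambda>z. \<phi> (z + x) - \<phi> (z + y)) \<in> Lp lborel p" using p by (intro Lp_translate_diff[OF c]) auto
          have "(LINT z:cball 0 h|lborel. \<bar>\<phi> (x + z) - \<phi> (y + z)\<bar> powr p) \<le> (LINT z|lborel. \<bar>\<phi> (z + x) - \<phi> (z + y)\<bar> powr p)"
            unfolding set_lebesgue_integral_def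
          proof (rule integral_mono)
            show i2: "integrable lborel (\<lambda>z. \<bar>\<phi> (z + x) - \<phi> (z + y)\<bar> powr p)" using LpD(2)[OF L] by simp
            show "integrable lborel (\<lambda>z. indicat_real (cball 0 h) z *\<^sub>R \<bar>\<phi> (x + z) - \<phi> (y + z)\<bar> powr p)"
              using integrable_mult_indicator[OF _ i2, of "cball 0 h"] by (simp add: add.commute)
          qed (auto simp: indicator_def add.commute)
          also have "\<dots> = Lint lborel p (\<lambda>z. \<phi> (z + (x - y)) - \<phi> z)"
          proof -
            have "Lint lborel p (\<lambda>z. (\<lambda>z. \<phi> (z + (x - y)) - \<phi> z) (z + y)) = Lint lborel p (\<lambda>z. \<phi> (z + (x - y)) - \<phi> z)"
              by (rule Lint_translate, intro borel_measurable_diff continuous_borel continuous_translate \<phi>c)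
            then show ?thesis by (simp add: Lint_def algebra_simps)
          qed
          also have "\<dots> = Lnorm lborel p (\<lambda>z. \<phi> (z + (x - y)) - \<phi> z) powr p" using p by (simp add: Lnorm_powr)
          also have "\<dots> \<le> (\<delta> * Lnorm lborel p G) powr p"
          proof (rule powr_mono2)
            have "norm (x - y) * Lnorm lborel p G \<le> \<delta> * Lnorm lborel p G"
              using y(2) by (intro mult_right_mono) (auto simp: dist_norm norm_minus_commute)
            then show "Lnorm lborel p (\<lambda>z. \<phi> (z + (x - y)) - \<phi> z) \<le> \<delta> * Lnorm lborel p G"
              using translation_estimate[OF c p, of "x - y"] by linarith
          qed (use p in auto)
          also have "\<dots> = \<delta> powr p * g" using p by (simp add: powr_mult Lnorm_powr g_def)
          finally show ?thesis .
        qed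
        finally show "\<bar>I2\<bar> powr p \<le> m powr (p - 1) * (\<delta> powr p * g)" by (simp add: mult_left_mono)
        show "\<bar>ball_integral h y \<phi>\<bar> powr p \<le> \<Sigma>"
          unfolding \<Sigma>_def using X(1) y(1) by (intro member_le_sum) auto
      qed auto
      finally show ?thesis .
    qed
    define K where "K = m powr (p - 1) * (\<delta> powr p * g) + \<Sigma>"
    have K: "K \<ge> 0" unfolding K_def \<Sigma>_def using g by (intro add_nonneg_nonneg mult_nonneg_nonneg sum_nonneg) auto
    have "m powr p * Lint lborel p \<phi> = (LINT x|lborel. m powr p * \<bar>\<phi> x\<bar> powr p)" by (simp add: Lint_def)
    also have "\<dots> \<le> (LINT x|lborel. 3 powr p * (m powr (p - 1) * A x + K * indicator (cball 0 R) x))"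
    proof (rule integral_mono)
      show "integrable lborel (\<lambda>x. m powr p * \<bar>\<phi> x\<bar> powr p)" using LpD(2)[OF C1c_Lp(1)[OF c, of p]] p by simp
      show "integrable lborel (\<lambda>x. 3 powr p * (m powr (p - 1) * A x + K * indicator (cball 0 R) x))"
        by (intro integrable_mult_right Bochner_Integration.integrable_add Aint indicator_cball_integrable)
      show "m powr p * \<bar>\<phi> x\<bar> powr p \<le> 3 powr p * (m powr (p - 1) * A x + K * indicator (cball 0 R) x)" for x
      proof (cases "R < norm x")
        case True
        then show ?thesis using supp A0 by (auto intro!: mult_nonneg_nonneg)
      next
        case False
        then show ?thesis using pw[of x] by (simp add: K_def add.assoc)
      qed
    qed
    also have "\<dots> = 3 powr p * (m powr (p - 1) * (LINT x|lborel. A x) + K * V)"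
      using Aint indicator_cball_integrable[of K "0::'a" R] by (simp add: V_def)
    also have "\<dots> \<le> 3 powr p * (m powr (p - 1) * (m * (h powr p * g)) + K * V)"
      using Ale K mpos by (intro mult_left_mono add_mono) auto
    finally have "m powr p * Lint lborel p \<phi> \<le> 3 powr p * (m powr (p - 1) * (m * (h powr p * g)) + K * V)" .
    moreover have mp: "m powr p = m powr (p - 1) * m" using mpos by (simp add: powr_diff)
    have "3 powr p * (m powr (p - 1) * (m * (h powr p * g)) + K * V) =
        m powr p * ((3 powr p * h powr p) * g + (3 powr p * V * \<delta> powr p / m) * g + C * \<Sigma>)"
      using mpos unfolding K_def C_def by (simp add: mp field_simps)
    then have "3 powr p * (m powr (p - 1) * (m * (h powr p * g)) + K * V) = m powr p * (e * g + C * \<Sigma>)"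
      unfolding h3 \<delta>3 by (simp add: field_simps)
    ultimately have "m powr p * Lint lborel p \<phi> \<le> m powr p * (e * g + C * \<Sigma>)" by simp
    then show ?thesis using mpos by (simp add: g_def \<Sigma>_def)
  qed
  then show ?thesis using X(1) h C by blast
qed

section \<open>Weak gradients\<close>

text \<open>Test functions are defined by partial derivatives; this is the gradient assembled from them.\<close>

definition test_gradient :: "('a::euclidean_space \<Rightarrow> real) \<Rightarrow> 'a \<Rightarrow> 'a" where
  "test_gradient \<phi> x = (\<Sum>i\<in>Basis. frechet_derivative \<phi> (at x) i *\<^sub>R i)"

lemma test_gradient_inner: "i \<in> Basis \<Longrightarrow> test_gradient \<phi> x \<bullet> i = frechet_derivative \<phi> (at x) i"
  by (simp add: test_gradient_def)

lemma has_derivative_test_gradient: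
  assumes "\<phi> differentiable (at x)"
  shows "(\<phi> has_derivative (\<lambda>v. test_gradient \<phi> x \<bullet> v)) (at x)"
proof -
  have d: "(\<phi> has_derivative frechet_derivative \<phi> (at x)) (at x)"
    using assms frechet_derivative_works by blast
  have "frechet_derivative \<phi> (at x) v = test_gradient \<phi> x \<bullet> v" for v
  proof -
    have "frechet_derivative \<phi> (at x) v = frechet_derivative \<phi> (at x) (\<Sum>i\<in>Basis. (v \<bullet> i) *\<^sub>R i)"
      by (simp add: euclidean_representation)
    also have "\<dots> = (\<Sum>i\<in>Basis. (v \<bullet> i) * frechet_derivative \<phi> (at x) i)"
      using has_derivative_linear[OF d] by (simp add: linear_sum linear_cmul)
    also have "\<dots> = test_gradient \<phi> x \<bullet> v"
      unfolding test_gradient_def inner_sum_left inner_scaleR_left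
      by (intro sum.cong refl) (simp add: inner_commute mult.commute)
    finally show ?thesis .
  qed
  then have "frechet_derivative \<phi> (at x) = (\<lambda>v. test_gradient \<phi> x \<bullet> v)" by (rule ext)
  with d show ?thesis by simp
qed

lemma test_gradient_unique:
  assumes "(\<phi> has_derivative (\<lambda>v. g \<bullet> v)) (at x)"
  shows "test_gradient \<phi> x = g"
proof -
  have "\<phi> differentiable (at x)" using assms unfolding differentiable_def by blast
  then have "(\<lambda>v. test_gradient \<phi> x \<bullet> v) = (\<lambda>v. g \<bullet> v)"
    using has_derivative_unique has_derivative_test_gradient assms by blast
  then have "test_gradient \<phi> x \<bullet> i = g \<bullet> i" for i by (rule fun_cong)
  then show ?thesis by (rule euclidean_eqI)
qed

lemma Ck_add: "Ck k f \<Longrightarrow> Ck k g \<Longrightarrow> Ck k (\<lambda>x. f x + g x)"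
proof (induction k arbitrary: f g)
  case 0
  then show ?case by (auto intro: continuous_on_add)
next
  case (Suc k)
  have D: "((\<lambda>x. f x + g x) has_derivative (\<lambda>v. frechet_derivative f (at x) v + frechet_derivative g (at x) v)) (at x)" for x
    using Suc.prems by (intro has_derivative_add) (simp_all add: frechet_derivative_works[symmetric])
  have "frechet_derivative (\<lambda>x. f x + g x) (at x) i = frechet_derivative f (at x) i + frechet_derivative g (at x) i" for x i
    by (rule fun_cong[OF frechet_derivative_at[OF D], symmetric])
  moreover have "(\<lambda>x. f x + g x) differentiable (at x)" for x using D unfolding differentiable_def by blast
  ultimately show ?case using Suc by simp
qed

lemma Ck_scale: "Ck k f \<Longrightarrow> Ck k (\<lambda>x. c * f x)"
proof (induction k arbitrary: f)
  case 0
  then show ?case by (auto intro: continuous_on_mult_left)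
next
  case (Suc k)
  have D: "((\<lambda>x. c * f x) has_derivative (\<lambda>v. c * frechet_derivative f (at x) v)) (at x)" for x
    using Suc.prems by (intro has_derivative_mult_right) (simp add: frechet_derivative_works[symmetric])
  have "frechet_derivative (\<lambda>x. c * f x) (at x) i = c * frechet_derivative f (at x) i" for x i
    by (rule fun_cong[OF frechet_derivative_at[OF D], symmetric])
  moreover have "(\<lambda>x. c * f x) differentiable (at x)" for x using D unfolding differentiable_def by blast
  ultimately show ?case using Suc by simp
qed

lemma test_functions_add:
  assumes "\<phi> \<in> test_functions \<Omega>" "\<psi> \<in> test_functions \<Omega>"
  shows "(\<lambda>x. \<phi> x + \<psi> x) \<in> test_functions \<Omega>"
proof -
  define A where "A = closure {x. \<phi> x \<noteq> 0}"
  define B where "B = closure {x. \<psi> x \<noteq> 0}"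
  have AB: "compact A" "compact B" "A \<subseteq> \<Omega>" "B \<subseteq> \<Omega>"
    using assms by (auto simp: test_functions_def A_def B_def)
  have "\<phi> x = 0" if "x \<notin> A" for x
    using that closure_subset[of "{x. \<phi> x \<noteq> 0}"] unfolding A_def by blast
  moreover have "\<psi> x = 0" if "x \<notin> B" for x
    using that closure_subset[of "{x. \<psi> x \<noteq> 0}"] unfolding B_def by blast
  ultimately have "{x. \<phi> x + \<psi> x \<noteq> 0} \<subseteq> A \<union> B" by force
  then have sub: "closure {x. \<phi> x + \<psi> x \<noteq> 0} \<subseteq> A \<union> B"
    by (rule closure_minimal) (simp only: A_def B_def closed_Un closed_closure)
  moreover have "compact (A \<union> B)" using AB by (intro compact_Un)
  ultimately have "compact (closure {x. \<phi> x + \<psi> x \<noteq> 0})"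
    by (meson bounded_subset closed_closure compact_eq_bounded_closed)
  moreover have "Ck k (\<lambda>x. \<phi> x + \<psi> x)" for k
    using assms unfolding test_functions_def mem_Collect_eq by (intro Ck_add) blast+
  moreover have "closure {x. \<phi> x + \<psi> x \<noteq> 0} \<subseteq> \<Omega>" using sub AB by blast
  ultimately show ?thesis unfolding test_functions_def mem_Collect_eq by blast
qed

lemma test_functions_scale:
  assumes "\<phi> \<in> test_functions \<Omega>"
  shows "(\<lambda>x. c * \<phi> x) \<in> test_functions \<Omega>"
proof -
  have sub: "closure {x. c * \<phi> x \<noteq> 0} \<subseteq> closure {x. \<phi> x \<noteq> 0}" by (rule closure_mono) auto
  then have "compact (closure {x. c * \<phi> x \<noteq> 0})"
    using assms unfolding test_functions_def mem_Collect_eq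
    by (meson bounded_subset closed_closure compact_eq_bounded_closed)
  moreover have "Ck k (\<lambda>x. c * \<phi> x)" for k
    using assms unfolding test_functions_def mem_Collect_eq by (intro Ck_scale) blast
  moreover have "closure {x. c * \<phi> x \<noteq> 0} \<subseteq> \<Omega>"
    using sub assms unfolding test_functions_def mem_Collect_eq by blast
  ultimately show ?thesis unfolding test_functions_def mem_Collect_eq by blast
qed

lemma test_functions_zero: "(\<lambda>_. 0) \<in> test_functions \<Omega>"
proof -
  have "Ck k (\<lambda>_::'a. 0)" for k
    by (induction k) (auto simp: frechet_derivative_const)
  then show ?thesis by (simp add: test_functions_def)
qed

lemma test_function_C1c:
  assumes "\<phi> \<in> test_functions \<Omega>"
  shows "C1c \<phi> (test_gradient \<phi>)"
proof -
  have Ck: "Ck (Suc 0) \<phi>" using assms by (simp add: test_functions_def)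
  have "bounded (closure {x. \<phi> x \<noteq> 0})" using assms by (auto simp: test_functions_def intro: compact_imp_bounded)
  then obtain R where R: "\<And>x. x \<in> closure {x. \<phi> x \<noteq> 0} \<Longrightarrow> norm x \<le> R" unfolding bounded_iff by blast
  have z: "\<phi> x = 0" if "R < norm x" for x
  proof (rule ccontr)
    assume "\<phi> x \<noteq> 0"
    then have "x \<in> {x. \<phi> x \<noteq> 0}" by simp
    then have "x \<in> closure {x. \<phi> x \<noteq> 0}" using closure_subset by (rule rev_subsetD)
    then show False using R[of x] that by simp
  qed
  have "continuous_on UNIV (test_gradient \<phi>)"
  proof -
    have "continuous_on UNIV (\<lambda>x. frechet_derivative \<phi> (at x) i)" if "i \<in> Basis" for i
      using Ck that by simp
    then have "continuous_on UNIV (\<lambda>x. \<Sum>i\<in>Basis. frechet_derivative \<phi> (at x) i *\<^sub>R i)"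
      by (intro continuous_on_sum continuous_on_scaleR continuous_on_const)
    then show ?thesis unfolding test_gradient_def[abs_def] .
  qed
  moreover have "(\<phi> has_derivative (\<lambda>v. test_gradient \<phi> x \<bullet> v)) (at x)" for x
    using Ck by (intro has_derivative_test_gradient) simp
  moreover have "\<exists>R. \<forall>x. R < norm x \<longrightarrow> \<phi> x = 0" using z by (intro exI[of _ R]) simp
  ultimately show ?thesis unfolding C1c_def by (intro conjI allI)
qed

lemma test_function_support:
  assumes "\<phi> \<in> test_functions \<Omega>"
  obtains K where "compact K" "K \<subseteq> \<Omega>" "\<And>x. x \<notin> K \<Longrightarrow> \<phi> x = 0" "\<And>x. x \<notin> K \<Longrightarrow> test_gradient \<phi> x = 0"
proof (rule that[of "closure {x. \<phi> x \<noteq> 0}"])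
  show "compact (closure {x. \<phi> x \<noteq> 0})" "closure {x. \<phi> x \<noteq> 0} \<subseteq> \<Omega>"
    using assms by (auto simp: test_functions_def)
  show z: "\<phi> x = 0" if "x \<notin> closure {x. \<phi> x \<noteq> 0}" for x
    using that closure_subset[of "{x. \<phi> x \<noteq> 0}"] by auto
  show "test_gradient \<phi> x = 0" if "x \<notin> closure {x. \<phi> x \<noteq> 0}" for x
  proof (rule test_gradient_unique)
    have "open (- closure {x. \<phi> x \<noteq> 0})" by (rule open_Compl[OF closed_closure])
    then have "(\<phi> has_derivative (\<lambda>_. 0)) (at x)"
    proof (rule has_derivative_transform_within_open[OF has_derivative_const])
      show "x \<in> - closure {x. \<phi> x \<noteq> 0}" using that by simp
      show "0 = \<phi> y" if "y \<in> - closure {x. \<phi> x \<noteq> 0}" for y using z[of y] that by simp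
    qed
    then show "(\<phi> has_derivative (\<lambda>v. 0 \<bullet> v)) (at x)" by simp
  qed
qed

lemma test_gradient_add:
  assumes "\<phi> \<in> test_functions \<Omega>" "\<psi> \<in> test_functions \<Omega>"
  shows "test_gradient (\<lambda>x. \<phi> x + \<psi> x) = (\<lambda>x. test_gradient \<phi> x + test_gradient \<psi> x)"
proof
  fix x
  have "C1c (\<lambda>x. \<phi> x + \<psi> x) (\<lambda>x. test_gradient \<phi> x + test_gradient \<psi> x)"
    by (rule C1c_add[OF test_function_C1c[OF assms(1)] test_function_C1c[OF assms(2)]])
  from C1cD(1)[OF this, of x]
  show "test_gradient (\<lambda>x. \<phi> x + \<psi> x) x = test_gradient \<phi> x + test_gradient \<psi> x"
    by (rule test_gradient_unique)
qed

lemma test_gradient_scale: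
  assumes "\<phi> \<in> test_functions \<Omega>"
  shows "test_gradient (\<lambda>x. c * \<phi> x) = (\<lambda>x. c *\<^sub>R test_gradient \<phi> x)"
proof
  fix x
  from C1cD(1)[OF C1c_scale[OF test_function_C1c[OF assms]], of c x]
  show "test_gradient (\<lambda>x. c * \<phi> x) x = c *\<^sub>R test_gradient \<phi> x"
    by (rule test_gradient_unique)
qed

lemma rep_abs_fun_ae: "AE x in lebesgue. rep_fun_ae (abs_fun_ae f) x = f x"
proof -
  have "AE x in lebesgue. f x = rep_fun_ae (abs_fun_ae f) x"
    using Quotient3_fun_ae[THEN rep_abs_rsp, of f f] by simp
  then show ?thesis by eventually_elim simp
qed

lemma abs_rep_fun_ae [simp]: "abs_fun_ae (rep_fun_ae u) = u"
  by (rule Quotient3_abs_rep[OF Quotient3_fun_ae])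

lemma rep_fun_ae_add: "AE x in lebesgue. rep_fun_ae (u + v) x = rep_fun_ae u x + rep_fun_ae v x"
  using rep_abs_fun_ae[of "\<lambda>x. rep_fun_ae u x + rep_fun_ae v x"]
  by (simp flip: plus_fun_ae.abs_eq)

lemma rep_fun_ae_scale: "AE x in lebesgue. rep_fun_ae (c *\<^sub>R u) x = c * rep_fun_ae u x"
  using rep_abs_fun_ae[of "\<lambda>x. c * rep_fun_ae u x"]
  by (simp flip: scaleR_fun_ae.abs_eq)

lemma fun_ae_eqI: "AE x in lebesgue. rep_fun_ae u x = f x \<Longrightarrow> u = abs_fun_ae f"
  using fun_ae.abs_eq_iff[of "rep_fun_ae u" f] by simp

text \<open>Integrals over \<open>\<Omega>\<close> are taken with respect to the finite measure \<open>lebesgue_on \<Omega>\<close>, so that the results on Lebesgue spaces apply as they are.\<close>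

locale bounded_domain =
  fixes \<Omega> :: "'a::euclidean_space set"
  assumes open_\<Omega>: "open \<Omega>" and bounded_\<Omega>: "bounded \<Omega>"
begin

abbreviation "\<mu> \<equiv> lebesgue_on \<Omega>"

lemma \<Omega>_sets [simp]: "\<Omega> \<in> sets lebesgue" "\<Omega> \<inter> space lebesgue \<in> sets lebesgue"
  using open_\<Omega> by auto

lemma finite_mu: "finite_measure \<mu>"
  using open_\<Omega> bounded_\<Omega> by (intro finite_measure_lebesgue_on lmeasurable_open)

lemma set_integrable_mu: "set_integrable lebesgue \<Omega> f \<longleftrightarrow> integrable \<mu> f"
  for f :: "'a \<Rightarrow> 'c::{banach, second_countable_topology}"
  by (simp add: set_integrable_def integrable_restrict_space)

lemma set_integral_mu: "(LINT x:\<Omega>|lebesgue. f x) = (LINT x|\<mu>. f x)"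
  for f :: "'a \<Rightarrow> 'c::{banach, second_countable_topology}"
  by (simp add: set_lebesgue_integral_def integral_restrict_space)

lemma AE_mu: "(AE x in \<mu>. P x) \<longleftrightarrow> (AE x in lebesgue. x \<in> \<Omega> \<longrightarrow> P x)"
  by (rule AE_restrict_space_iff) simp

lemma AE_mu_I: "AE x in lebesgue. P x \<Longrightarrow> AE x in \<mu>. P x"
  unfolding AE_mu by (erule eventually_mono) simp

lemma norm_L_eq: "norm_L \<Omega> r u = Lnorm \<mu> r (rep_fun_ae u)"
  and norm_grad_eq: "norm_grad \<Omega> r u = Lnorm \<mu> r (weak_gradient \<Omega> u)"
  by (simp_all add: norm_L_def norm_grad_def Lr_norm_def Lnorm_def Lint_def set_integral_mu)

lemma integral_mu_continuous:
  fixes f :: "'a \<Rightarrow> real"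
  assumes "continuous_on UNIV f" "\<And>x. x \<notin> \<Omega> \<Longrightarrow> f x = 0"
  shows "(LINT x|\<mu>. f x) = (LINT x|lborel. f x)"
proof -
  have "(LINT x|\<mu>. f x) = (LINT x|lebesgue. indicator \<Omega> x *\<^sub>R f x)" by (rule integral_restrict_space) simp
  also have "(\<lambda>x. indicator \<Omega> x *\<^sub>R f x) = f" using assms(2) by (auto simp: indicator_def fun_eq_iff)
  also have "(LINT x|lebesgue. f x) = (LINT x|lborel. f x)"
    using continuous_borel[OF assms(1)] by (intro integral_completion) simp
  finally show ?thesis .
qed

lemma integrable_mu_continuous:
  fixes f :: "'a \<Rightarrow> real"
  assumes "continuous_on UNIV f" "\<And>x. x \<notin> \<Omega> \<Longrightarrow> f x = 0"
  shows "integrable \<mu> f"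
proof -
  obtain R where R: "\<And>x. x \<in> \<Omega> \<Longrightarrow> norm x \<le> R" using bounded_\<Omega> unfolding bounded_iff by blast
  have "f x = 0" if "R < norm x" for x using R[of x] assms(2)[of x] that by (cases "x \<in> \<Omega>") auto
  from compact_support_integrable[OF assms(1) this]
  have "integrable lebesgue f" using continuous_borel[OF assms(1)] by (subst integrable_completion) auto
  moreover have "(\<lambda>x. indicator \<Omega> x *\<^sub>R f x) = f" using assms(2) by (auto simp: indicator_def fun_eq_iff)
  ultimately show ?thesis by (simp add: integrable_restrict_space)
qed

lemma measurable_mu_borel: "f \<in> borel_measurable borel \<Longrightarrow> f \<in> borel_measurable \<mu>"
  by (rule measurable_restrict_space1, rule measurable_completion) simp

lemma Lint_mu_continuous:
  fixes f :: "'a \<Rightarrow> 'c::euclidean_space"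
  assumes "continuous_on UNIV f" "\<And>x. x \<notin> \<Omega> \<Longrightarrow> f x = 0" "r > 0"
  shows "Lint \<mu> r f = Lint lborel r f" "Lnorm \<mu> r f = Lnorm lborel r f" "f \<in> Lp \<mu> r"
proof -
  have c: "continuous_on UNIV (\<lambda>x. norm (f x) powr r)" using assms by (intro continuous_norm_powr)
  show 1: "Lint \<mu> r f = Lint lborel r f"
    unfolding Lint_def by (rule integral_mu_continuous[OF c]) (use assms in auto)
  then show "Lnorm \<mu> r f = Lnorm lborel r f" by (simp add: Lnorm_def)
  show "f \<in> Lp \<mu> r"
    by (rule LpI[OF measurable_mu_borel[OF continuous_borel[OF assms(1)]] integrable_mu_continuous[OF c]])
       (use assms in auto)
qed

lemma test_function_Lp:
  assumes "\<phi> \<in> test_functions \<Omega>" "r > 0"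
  shows "\<phi> \<in> Lp \<mu> r" "test_gradient \<phi> \<in> Lp \<mu> r"
    "Lnorm \<mu> r \<phi> = Lnorm lborel r \<phi>" "Lnorm \<mu> r (test_gradient \<phi>) = Lnorm lborel r (test_gradient \<phi>)"
    "Lint \<mu> r \<phi> = Lint lborel r \<phi>" "Lint \<mu> r (test_gradient \<phi>) = Lint lborel r (test_gradient \<phi>)"
proof -
  obtain K where K: "K \<subseteq> \<Omega>" "\<And>x. x \<notin> K \<Longrightarrow> \<phi> x = 0" "\<And>x. x \<notin> K \<Longrightarrow> test_gradient \<phi> x = 0"
    using test_function_support[OF assms(1)] by metis
  have z: "\<phi> x = 0" "test_gradient \<phi> x = 0" if "x \<notin> \<Omega>" for x using K that by blast+
  note C = C1cD(2,3)[OF test_function_C1c[OF assms(1)]]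
  show "\<phi> \<in> Lp \<mu> r" "test_gradient \<phi> \<in> Lp \<mu> r"
    "Lnorm \<mu> r \<phi> = Lnorm lborel r \<phi>" "Lnorm \<mu> r (test_gradient \<phi>) = Lnorm lborel r (test_gradient \<phi>)"
    "Lint \<mu> r \<phi> = Lint lborel r \<phi>" "Lint \<mu> r (test_gradient \<phi>) = Lint lborel r (test_gradient \<phi>)"
    using Lint_mu_continuous[OF C(2) z(1) assms(2)] Lint_mu_continuous[OF C(1) z(2) assms(2)] by simp_all
qed

text \<open>The condition that the definition of a weak gradient imposes on both functions; the formulation as a predicate makes it reusable.\<close>

definition locally_integrable :: "('a \<Rightarrow> 'c::euclidean_space) \<Rightarrow> bool" where
  "locally_integrable f \<longleftrightarrow> (\<forall>K. compact K \<longrightarrow> K \<subseteq> \<Omega> \<longrightarrow> set_integrable lebesgue K f)"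

text \<open>Exhaust \<open>\<Omega>\<close> by compact sets.\<close>

lemma locally_integrable_measurable:
  fixes f :: "'a \<Rightarrow> 'c::euclidean_space"
  assumes "locally_integrable f" shows "f \<in> borel_measurable \<mu>"
proof -
  obtain C :: "nat \<Rightarrow> 'a set" where C: "\<And>n. compact (C n)" "\<And>n. C n \<subseteq> \<Omega>" "\<And>n. C n \<subseteq> interior (C (Suc n))" "\<Union>(range C) = \<Omega>"
    using open_Union_compact_subsets[OF open_\<Omega>] by metis
  have "(\<lambda>x. indicator \<Omega> x *\<^sub>R f x) \<in> borel_measurable lebesgue"
  proof (rule borel_measurable_LIMSEQ_metric)
    show "(\<lambda>x. indicator (C n) x *\<^sub>R f x) \<in> borel_measurable lebesgue" for n
      using assms C(1,2) unfolding locally_integrable_def set_integrable_def by (intro borel_measurable_integrable) blast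
    have inc: "C m \<subseteq> C n" if "m \<le> n" for m n
      using that by (rule lift_Suc_mono_le[rotated]) (use C(3) interior_subset in blast)
    show "(\<lambda>n. indicator (C n) x *\<^sub>R f x) \<longlonglongrightarrow> indicator \<Omega> x *\<^sub>R f x" for x
    proof (cases "x \<in> \<Omega>")
      case True
      then obtain m where m: "x \<in> C m" using C(4) by blast
      have "\<forall>\<^sub>F n in sequentially. indicator (C n) x *\<^sub>R f x = indicator \<Omega> x *\<^sub>R f x"
        using eventually_ge_at_top[of m]
      proof eventually_elim
        case (elim n)
        then have "x \<in> C n" using inc m by blast
        then show ?case using True by simp
      qed
      then show ?thesis by (rule tendsto_eventually)
    next
      case False
      then have "x \<notin> C n" for n using C(2) by blast
      with False show ?thesis by simp
    qed
  qed
  then show ?thesis by (subst borel_measurable_restrict_space_iff) auto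
qed

lemma locally_integrable_add: "locally_integrable f \<Longrightarrow> locally_integrable g \<Longrightarrow> locally_integrable (\<lambda>x. f x + g x)"
  unfolding locally_integrable_def by (auto intro: set_integral_add(1))

lemma locally_integrable_scale: "locally_integrable f \<Longrightarrow> locally_integrable (\<lambda>x. c *\<^sub>R f x)"
  unfolding locally_integrable_def set_integrable_def
proof (intro allI impI)
  fix K assume "\<forall>K. compact K \<longrightarrow> K \<subseteq> \<Omega> \<longrightarrow> integrable lebesgue (\<lambda>x. indicat_real K x *\<^sub>R f x)"
    and "compact K" "K \<subseteq> \<Omega>"
  then have "integrable lebesgue (\<lambda>x. c *\<^sub>R (indicat_real K x *\<^sub>R f x))" by (intro integrable_scaleR_right) blast
  then show "integrable lebesgue (\<lambda>x. indicat_real K x *\<^sub>R c *\<^sub>R f x)" by (simp add: mult.commute)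
qed

lemma locally_integrable_inner: "locally_integrable f \<Longrightarrow> locally_integrable (\<lambda>x. f x \<bullet> i)"
  unfolding locally_integrable_def set_integrable_def
  by (auto intro: integrable_inner_left simp flip: inner_scaleR_left)

lemma locally_integrable_AE:
  assumes "locally_integrable f" "AE x in lebesgue. f x = g x"
  shows "locally_integrable g"
  unfolding locally_integrable_def
proof (intro allI impI)
  fix K :: "'a set" assume K: "compact K" "K \<subseteq> \<Omega>"
  have i: "integrable lebesgue (\<lambda>x. indicator K x *\<^sub>R f x)" using assms(1) K unfolding locally_integrable_def set_integrable_def by blast
  have ae: "AE x in lebesgue. indicator K x *\<^sub>R f x = indicator K x *\<^sub>R g x" using assms(2) by eventually_elim simp
  have "(\<lambda>x. indicator K x *\<^sub>R g x) \<in> borel_measurable lebesgue"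
    by (rule borel_measurable_AE[OF borel_measurable_integrable[OF i] ae])
  then show "set_integrable lebesgue K g"
    unfolding set_integrable_def using i ae borel_measurable_integrable[OF i] by (subst integrable_cong_AE[symmetric]) auto
qed

lemma Lp_imp_integrable:
  fixes f :: "'a \<Rightarrow> 'c::euclidean_space"
  assumes "f \<in> Lp \<mu> r" "r > 1"
  shows "integrable \<mu> f"
proof -
  have "f \<in> Lp \<mu> 1" by (rule Lp_nested(1)[OF finite_mu _ assms(2) assms(1)]) simp
  then have "integrable \<mu> (\<lambda>x. norm (f x))" "f \<in> borel_measurable \<mu>" using LpD[of f \<mu> 1] by simp_all
  then show ?thesis by (rule integrable_norm_cancel)
qed

lemma Lp_imp_locally_integrable:
  fixes f :: "'a \<Rightarrow> 'c::euclidean_space"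
  assumes "f \<in> Lp \<mu> r" "r > 1"
  shows "locally_integrable f"
  unfolding locally_integrable_def
proof (intro allI impI)
  fix K :: "'a set" assume K: "compact K" "K \<subseteq> \<Omega>"
  have "set_integrable lebesgue \<Omega> f" using Lp_imp_integrable[OF assms] by (simp add: set_integrable_mu)
  then show "set_integrable lebesgue K f"
    by (rule set_integrable_subset) (use K in \<open>auto intro: lmeasurable_compact fmeasurableD\<close>)
qed

lemma integrable_times_continuous:
  fixes f \<psi> :: "'a \<Rightarrow> real"
  assumes f: "locally_integrable f" and \<psi>: "continuous_on UNIV \<psi>" and K: "compact K" "K \<subseteq> \<Omega>" "\<And>x. x \<notin> K \<Longrightarrow> \<psi> x = 0"
  shows "integrable \<mu> (\<lambda>x. f x * \<psi> x)"
proof -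
  have Kf: "integrable lebesgue (\<lambda>x. indicator K x *\<^sub>R f x)"
    using f K unfolding locally_integrable_def set_integrable_def by blast
  have "bounded (\<psi> ` K)" by (intro compact_imp_bounded compact_continuous_image K continuous_on_subset[OF \<psi>]) simp
  then obtain B where "\<forall>y\<in>\<psi> ` K. norm y \<le> B" unfolding bounded_iff by (elim exE)
  then have B: "\<And>x. x \<in> K \<Longrightarrow> \<bar>\<psi> x\<bar> \<le> B" by auto
  have "integrable lebesgue (\<lambda>x. (indicator K x *\<^sub>R f x) * \<psi> x)"
  proof (rule Bochner_Integration.integrable_bound)
    show "integrable lebesgue (\<lambda>x. B * (indicator K x *\<^sub>R f x))" using Kf by (rule integrable_mult_right)
    have "\<psi> \<in> borel_measurable lebesgue" using continuous_borel[OF \<psi>] by (intro measurable_completion) simp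
    then show "(\<lambda>x. (indicator K x *\<^sub>R f x) * \<psi> x) \<in> borel_measurable lebesgue"
      using borel_measurable_integrable[OF Kf] by (intro borel_measurable_times)
    have "norm ((indicator K x *\<^sub>R f x) * \<psi> x) \<le> norm (B * (indicator K x *\<^sub>R f x))" for x
    proof (cases "x \<in> K")
      case True
      have "\<bar>f x\<bar> * \<bar>\<psi> x\<bar> \<le> \<bar>f x\<bar> * \<bar>B\<bar>" using B[OF True] by (intro mult_left_mono) auto
      then show ?thesis using True by (simp add: abs_mult mult.commute)
    qed simp
    then show "AE x in lebesgue. norm ((indicator K x *\<^sub>R f x) * \<psi> x) \<le> norm (B * (indicator K x *\<^sub>R f x))" by simp
  qed
  moreover have "(\<lambda>x. (indicator K x *\<^sub>R f x) * \<psi> x) = (\<lambda>x. indicator \<Omega> x *\<^sub>R (f x * \<psi> x))"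
    using K(2,3) by (auto simp: indicator_def fun_eq_iff)
  ultimately show ?thesis by (simp add: integrable_restrict_space)
qed

lemma integrable_times_test:
  fixes f :: "'a \<Rightarrow> real"
  assumes f: "locally_integrable f" and \<phi>: "\<phi> \<in> test_functions \<Omega>"
  shows "integrable \<mu> (\<lambda>x. f x * \<phi> x)" and "integrable \<mu> (\<lambda>x. f x * (test_gradient \<phi> x \<bullet> i))"
proof -
  obtain K where K: "compact K" "K \<subseteq> \<Omega>" "\<And>x. x \<notin> K \<Longrightarrow> \<phi> x = 0" "\<And>x. x \<notin> K \<Longrightarrow> test_gradient \<phi> x = 0"
    using test_function_support[OF \<phi>] by metis
  note C = C1cD(2,3)[OF test_function_C1c[OF \<phi>]]
  show "integrable \<mu> (\<lambda>x. f x * \<phi> x)" by (rule integrable_times_continuous[OF f C(2) K(1,2,3)])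
  show "integrable \<mu> (\<lambda>x. f x * (test_gradient \<phi> x \<bullet> i))"
    by (rule integrable_times_continuous[OF f continuous_on_inner[OF C(1) continuous_on_const] K(1,2)]) (simp add: K(4))
qed

lemma weak_gradient_iff:
  "has_weak_gradient \<Omega> f g \<longleftrightarrow> locally_integrable f \<and> locally_integrable g \<and>
    (\<forall>\<phi>\<in>test_functions \<Omega>. \<forall>i\<in>Basis.
       (LINT x|\<mu>. f x * (test_gradient \<phi> x \<bullet> i)) = - (LINT x|\<mu>. (g x \<bullet> i) * \<phi> x))"
  unfolding has_weak_gradient_def locally_integrable_def set_integral_mu
  by (auto simp: test_gradient_inner)

lemma weak_gradient_locally_integrable:
  assumes "has_weak_gradient \<Omega> f g"
  shows "locally_integrable f" "locally_integrable g"
  using assms by (auto simp: weak_gradient_iff)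

lemma weak_gradient_measurable:
  assumes "has_weak_gradient \<Omega> f g"
  shows "f \<in> borel_measurable \<mu>" "g \<in> borel_measurable \<mu>"
  using weak_gradient_locally_integrable[OF assms] locally_integrable_measurable by blast+

lemma weak_gradient_add:
  assumes "has_weak_gradient \<Omega> f g" "has_weak_gradient \<Omega> f' g'"
  shows "has_weak_gradient \<Omega> (\<lambda>x. f x + f' x) (\<lambda>x. g x + g' x)"
  unfolding weak_gradient_iff
proof (intro conjI ballI)
  note L = weak_gradient_locally_integrable[OF assms(1)] weak_gradient_locally_integrable[OF assms(2)]
  show "locally_integrable (\<lambda>x. f x + f' x)" "locally_integrable (\<lambda>x. g x + g' x)"
    using L by (auto intro: locally_integrable_add)
  fix \<phi> i assume \<phi>: "\<phi> \<in> test_functions \<Omega>" and i: "i \<in> (Basis::'a set)"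
  show "(LINT x|\<mu>. (f x + f' x) * (test_gradient \<phi> x \<bullet> i)) = - (LINT x|\<mu>. (g x + g' x) \<bullet> i * \<phi> x)"
    using assms \<phi> i integrable_times_test[OF L(1) \<phi>] integrable_times_test[OF L(3) \<phi>]
      integrable_times_test[OF locally_integrable_inner[OF L(2)] \<phi>] integrable_times_test[OF locally_integrable_inner[OF L(4)] \<phi>]
    by (simp add: distrib_right inner_add_left weak_gradient_iff)
qed

lemma weak_gradient_scale:
  assumes "has_weak_gradient \<Omega> f g"
  shows "has_weak_gradient \<Omega> (\<lambda>x. c * f x) (\<lambda>x. c *\<^sub>R g x)"
  unfolding weak_gradient_iff
proof (intro conjI ballI)
  note L = weak_gradient_locally_integrable[OF assms(1)]
  show "locally_integrable (\<lambda>x. c * f x)" "locally_integrable (\<lambda>x. c *\<^sub>R g x)"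
    using L locally_integrable_scale[of f c] locally_integrable_scale[of g c] by simp_all
  fix \<phi> i assume "\<phi> \<in> test_functions \<Omega>" "i \<in> (Basis::'a set)"
  then show "(LINT x|\<mu>. c * f x * (test_gradient \<phi> x \<bullet> i)) = - (LINT x|\<mu>. c *\<^sub>R g x \<bullet> i * \<phi> x)"
    using assms by (simp add: weak_gradient_iff mult.assoc)
qed

lemma weak_gradient_AE:
  assumes "has_weak_gradient \<Omega> f g" "AE x in lebesgue. f x = f' x"
  shows "has_weak_gradient \<Omega> f' g"
  unfolding weak_gradient_iff
proof (intro conjI ballI)
  note L = weak_gradient_locally_integrable[OF assms(1)]
  show l': "locally_integrable f'" by (rule locally_integrable_AE[OF L(1) assms(2)])
  show "locally_integrable g" by (rule L)
  fix \<phi> i assume \<phi>: "\<phi> \<in> test_functions \<Omega>" and i: "i \<in> (Basis::'a set)"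
  have "(LINT x|\<mu>. f' x * (test_gradient \<phi> x \<bullet> i)) = (LINT x|\<mu>. f x * (test_gradient \<phi> x \<bullet> i))"
  proof (rule integral_cong_AE)
    show "AE x in \<mu>. f' x * (test_gradient \<phi> x \<bullet> i) = f x * (test_gradient \<phi> x \<bullet> i)"
      using AE_mu_I[OF assms(2)] by eventually_elim simp
  qed (use integrable_times_test(2)[OF l' \<phi>] integrable_times_test(2)[OF L(1) \<phi>] in \<open>auto intro: borel_measurable_integrable\<close>)
  then show "(LINT x|\<mu>. f' x * (test_gradient \<phi> x \<bullet> i)) = - (LINT x|\<mu>. g x \<bullet> i * \<phi> x)"
    using assms(1) \<phi> i by (simp add: weak_gradient_iff)
qed

text \<open>The fundamental lemma for each component of the difference.\<close>

lemma weak_gradient_unique: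
  assumes "has_weak_gradient \<Omega> f g" "has_weak_gradient \<Omega> f g'"
  shows "AE x in \<mu>. g x = g' x"
proof -
  note L = weak_gradient_locally_integrable[OF assms(1)] weak_gradient_locally_integrable[OF assms(2)]
  have "AE x in lebesgue. x \<in> \<Omega> \<longrightarrow> (g x \<bullet> i + (- 1) *\<^sub>R (g' x \<bullet> i)) = 0" if i: "i \<in> Basis" for i
  proof (rule fundamental_lemma[OF open_\<Omega>])
    have "locally_integrable (\<lambda>x. g x \<bullet> i + (- 1) *\<^sub>R (g' x \<bullet> i))"
      by (intro locally_integrable_add locally_integrable_scale locally_integrable_inner L)
    then show "set_integrable lebesgue K (\<lambda>x. g x \<bullet> i + (- 1) *\<^sub>R (g' x \<bullet> i))" if "compact K" "K \<subseteq> \<Omega>" for K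
      using that unfolding locally_integrable_def by blast
    fix \<phi> assume \<phi>: "\<phi> \<in> test_functions \<Omega>"
    have "(LINT x|\<mu>. (g x \<bullet> i) * \<phi> x) = (LINT x|\<mu>. (g' x \<bullet> i) * \<phi> x)"
      using assms \<phi> i by (fastforce simp: weak_gradient_iff)
    then show "(LINT x:\<Omega>|lebesgue. (g x \<bullet> i + (- 1) *\<^sub>R (g' x \<bullet> i)) * \<phi> x) = 0"
      unfolding set_integral_mu
      using integrable_times_test(1)[OF locally_integrable_inner[OF L(2)] \<phi>, of i] integrable_times_test(1)[OF locally_integrable_inner[OF L(4)] \<phi>, of i]
      by (simp add: left_diff_distrib)
  qed
  then have "AE x in lebesgue. \<forall>i\<in>Basis. x \<in> \<Omega> \<longrightarrow> (g x \<bullet> i + (- 1) *\<^sub>R (g' x \<bullet> i)) = 0"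
    by (subst AE_ball_countable) (auto intro: countable_finite)
  then show ?thesis
    unfolding AE_mu
  proof eventually_elim
    case (elim x)
    show ?case
    proof
      assume "x \<in> \<Omega>"
      then show "g x = g' x" using elim by (subst euclidean_eq_iff) simp
    qed
  qed
qed

text \<open>Integration by parts for the product of two test functions.\<close>

lemma weak_gradient_test:
  assumes "\<phi> \<in> test_functions \<Omega>"
  shows "has_weak_gradient \<Omega> \<phi> (test_gradient \<phi>)"
  unfolding weak_gradient_iff
proof (intro conjI ballI)
  show L: "locally_integrable \<phi>" "locally_integrable (test_gradient \<phi>)"
    using Lp_imp_locally_integrable[of _ 2] test_function_Lp[OF assms, of 2] by simp_all
  fix \<psi> i assume \<psi>: "\<psi> \<in> test_functions \<Omega>" and i: "i \<in> (Basis::'a set)"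
  note C = test_function_C1c[OF assms] and C' = test_function_C1c[OF \<psi>]
  obtain K where K: "K \<subseteq> \<Omega>" "\<And>x. x \<notin> K \<Longrightarrow> \<phi> x = 0" "\<And>x. x \<notin> K \<Longrightarrow> test_gradient \<phi> x = 0"
    using test_function_support[OF assms] by metis
  have "0 = (LINT x|lborel. (\<phi> x *\<^sub>R test_gradient \<psi> x + \<psi> x *\<^sub>R test_gradient \<phi> x) \<bullet> i)"
    by (rule integral_directional_derivative[OF C1c_mult[OF C C'], symmetric])
  also have "\<dots> = (LINT x|\<mu>. (\<phi> x *\<^sub>R test_gradient \<psi> x + \<psi> x *\<^sub>R test_gradient \<phi> x) \<bullet> i)"
  proof (rule integral_mu_continuous[symmetric])
    show "continuous_on UNIV (\<lambda>x. (\<phi> x *\<^sub>R test_gradient \<psi> x + \<psi> x *\<^sub>R test_gradient \<phi> x) \<bullet> i)"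
      by (intro continuous_intros C1cD(2,3)[OF C] C1cD(2,3)[OF C'])
    show "(\<phi> x *\<^sub>R test_gradient \<psi> x + \<psi> x *\<^sub>R test_gradient \<phi> x) \<bullet> i = 0" if "x \<notin> \<Omega>" for x
    proof -
      have "x \<notin> K" using that K(1) by blast
      then show ?thesis by (simp add: K)
    qed
  qed
  also have "\<dots> = (LINT x|\<mu>. \<phi> x * (test_gradient \<psi> x \<bullet> i) + (test_gradient \<phi> x \<bullet> i) * \<psi> x)"
    by (intro Bochner_Integration.integral_cong) (auto simp: inner_add_left)
  also have "\<dots> = (LINT x|\<mu>. \<phi> x * (test_gradient \<psi> x \<bullet> i)) + (LINT x|\<mu>. (test_gradient \<phi> x \<bullet> i) * \<psi> x)"
    using integrable_times_test(2)[OF L(1) \<psi>, of i] integrable_times_test(1)[OF locally_integrable_inner[OF L(2)] \<psi>, of i]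
    by (rule Bochner_Integration.integral_add)
  finally show "(LINT x|\<mu>. \<phi> x * (test_gradient \<psi> x \<bullet> i)) = - (LINT x|\<mu>. test_gradient \<phi> x \<bullet> i * \<psi> x)" by simp
qed

section \<open>The Sobolev space\<close>

abbreviation rep :: "'a fun_ae \<Rightarrow> 'a \<Rightarrow> real" where "rep \<equiv> rep_fun_ae"
abbreviation grad where "grad \<equiv> weak_gradient \<Omega>"

text \<open>The weak gradient is chosen by \<open>SOME\<close>; every weak gradient of any representative of \<open>u\<close> agrees with it almost everywhere.\<close>

lemma grad_eq:
  assumes "has_weak_gradient \<Omega> f g" "AE x in lebesgue. rep u x = f x"
  shows "has_weak_gradient \<Omega> (rep u) (grad u)" "AE x in \<mu>. grad u x = g x"
proof -
  have "AE x in lebesgue. f x = rep u x" using assms(2) by eventually_elim simp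
  then have g: "has_weak_gradient \<Omega> (rep u) g" by (rule weak_gradient_AE[OF assms(1)])
  show w: "has_weak_gradient \<Omega> (rep u) (grad u)"
    unfolding weak_gradient_def by (rule someI[of "has_weak_gradient \<Omega> (rep u)", OF g])
  show "AE x in \<mu>. grad u x = g x" by (rule weak_gradient_unique[OF w g])
qed

lemma Lp_cong_AE:
  fixes f g :: "'a \<Rightarrow> 'c::euclidean_space"
  assumes "f \<in> Lp \<mu> r" "g \<in> borel_measurable \<mu>" "AE x in \<mu>. f x = g x"
  shows "g \<in> Lp \<mu> r"
proof (rule Lp_dominated[OF assms(2) LpD(2)[OF assms(1)]])
  show "AE x in \<mu>. norm (g x) powr r \<le> norm (f x) powr r" using assms(3) by eventually_elim simp
qed

lemma sobolev_iff:
  "u \<in> sobolev_space \<Omega> r \<longleftrightarrow> (AE x in lebesgue. x \<notin> \<Omega> \<longrightarrow> rep u x = 0) \<and>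
     has_weak_gradient \<Omega> (rep u) (grad u) \<and> rep u \<in> Lp \<mu> r \<and> grad u \<in> Lp \<mu> r"
proof
  assume u: "u \<in> sobolev_space \<Omega> r"
  then obtain g where g: "has_weak_gradient \<Omega> (rep u) g" "integrable \<mu> (\<lambda>x. norm (g x) powr r)"
    and i: "integrable \<mu> (\<lambda>x. norm (rep u x) powr r)" "AE x in lebesgue. x \<notin> \<Omega> \<longrightarrow> rep u x = 0"
    unfolding sobolev_space_def set_integrable_mu by blast
  have e: "has_weak_gradient \<Omega> (rep u) (grad u)" "AE x in \<mu>. grad u x = g x" using grad_eq[OF g(1)] by simp_all
  have L: "g \<in> Lp \<mu> r" using weak_gradient_measurable(2)[OF g(1)] g(2) by (rule LpI)
  have "AE x in \<mu>. g x = grad u x" using e(2) by eventually_elim simp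
  then have "grad u \<in> Lp \<mu> r" by (rule Lp_cong_AE[OF L weak_gradient_measurable(2)[OF e(1)]])
  moreover have "rep u \<in> Lp \<mu> r" using weak_gradient_measurable(1)[OF e(1)] i(1) by (rule LpI)
  ultimately show "(AE x in lebesgue. x \<notin> \<Omega> \<longrightarrow> rep u x = 0) \<and>
     has_weak_gradient \<Omega> (rep u) (grad u) \<and> rep u \<in> Lp \<mu> r \<and> grad u \<in> Lp \<mu> r" using e i by blast
next
  assume "(AE x in lebesgue. x \<notin> \<Omega> \<longrightarrow> rep u x = 0) \<and>
     has_weak_gradient \<Omega> (rep u) (grad u) \<and> rep u \<in> Lp \<mu> r \<and> grad u \<in> Lp \<mu> r"
  then show "u \<in> sobolev_space \<Omega> r"
    unfolding sobolev_space_def set_integrable_mu mem_Collect_eq using LpD(2)[of "rep u" \<mu> r] LpD(2)[of "grad u" \<mu> r] by blast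
qed

lemma grad_add:
  assumes "has_weak_gradient \<Omega> (rep u) (grad u)" "has_weak_gradient \<Omega> (rep v) (grad v)"
  shows "has_weak_gradient \<Omega> (rep (u + v)) (grad (u + v))" "AE x in \<mu>. grad (u + v) x = grad u x + grad v x"
  by (rule grad_eq[OF weak_gradient_add[OF assms] rep_fun_ae_add])+

lemma grad_scale:
  assumes "has_weak_gradient \<Omega> (rep u) (grad u)"
  shows "has_weak_gradient \<Omega> (rep (c *\<^sub>R u)) (grad (c *\<^sub>R u))" "AE x in \<mu>. grad (c *\<^sub>R u) x = c *\<^sub>R grad u x"
  by (rule grad_eq[OF weak_gradient_scale[OF assms] rep_fun_ae_scale])+

lemma grad_test:
  assumes "\<phi> \<in> test_functions \<Omega>"
  shows "has_weak_gradient \<Omega> (rep (abs_fun_ae \<phi>)) (grad (abs_fun_ae \<phi>))"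
    "AE x in \<mu>. grad (abs_fun_ae \<phi>) x = test_gradient \<phi> x"
  by (rule grad_eq[OF weak_gradient_test[OF assms] rep_abs_fun_ae])+

lemma sobolev_I:
  assumes "AE x in lebesgue. x \<notin> \<Omega> \<longrightarrow> rep w x = 0" "has_weak_gradient \<Omega> (rep w) (grad w)"
    and "f \<in> Lp \<mu> r" "AE x in \<mu>. rep w x = f x" "g \<in> Lp \<mu> r" "AE x in \<mu>. grad w x = g x"
  shows "w \<in> sobolev_space \<Omega> r"
proof -
  have "AE x in \<mu>. f x = rep w x" using assms(4) by eventually_elim simp
  then have 1: "rep w \<in> Lp \<mu> r" by (rule Lp_cong_AE[OF assms(3) weak_gradient_measurable(1)[OF assms(2)]])
  have "AE x in \<mu>. g x = grad w x" using assms(6) by eventually_elim simp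
  then have 2: "grad w \<in> Lp \<mu> r" by (rule Lp_cong_AE[OF assms(5) weak_gradient_measurable(2)[OF assms(2)]])
  show ?thesis using assms(1,2) 1 2 by (simp add: sobolev_iff)
qed

lemma sobolev_D:
  assumes "u \<in> sobolev_space \<Omega> r"
  shows "AE x in lebesgue. x \<notin> \<Omega> \<longrightarrow> rep u x = 0" "has_weak_gradient \<Omega> (rep u) (grad u)" "rep u \<in> Lp \<mu> r" "grad u \<in> Lp \<mu> r"
  using assms by (simp_all add: sobolev_iff)

lemma sobolev_add:
  assumes "r > 0" "u \<in> sobolev_space \<Omega> r" "v \<in> sobolev_space \<Omega> r"
  shows "u + v \<in> sobolev_space \<Omega> r"
proof (rule sobolev_I)
  note U = sobolev_D[OF assms(2)] and V = sobolev_D[OF assms(3)]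
  show "AE x in lebesgue. x \<notin> \<Omega> \<longrightarrow> rep (u + v) x = 0"
    using rep_fun_ae_add[of u v] U(1) V(1) by eventually_elim simp
  show "has_weak_gradient \<Omega> (rep (u + v)) (grad (u + v))" by (rule grad_add(1)[OF U(2) V(2)])
  show "AE x in \<mu>. rep (u + v) x = rep u x + rep v x" by (rule AE_mu_I[OF rep_fun_ae_add])
  show "AE x in \<mu>. grad (u + v) x = grad u x + grad v x" by (rule grad_add(2)[OF U(2) V(2)])
  show "(\<lambda>x. rep u x + rep v x) \<in> Lp \<mu> r" by (rule Lp_add[OF assms(1) U(3) V(3)])
  show "(\<lambda>x. grad u x + grad v x) \<in> Lp \<mu> r" by (rule Lp_add[OF assms(1) U(4) V(4)])
qed

lemma sobolev_scale:
  assumes "u \<in> sobolev_space \<Omega> r"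
  shows "c *\<^sub>R u \<in> sobolev_space \<Omega> r"
proof (rule sobolev_I)
  note U = sobolev_D[OF assms]
  show "AE x in lebesgue. x \<notin> \<Omega> \<longrightarrow> rep (c *\<^sub>R u) x = 0"
    using rep_fun_ae_scale[of c u] U(1) by eventually_elim simp
  show "has_weak_gradient \<Omega> (rep (c *\<^sub>R u)) (grad (c *\<^sub>R u))" by (rule grad_scale(1)[OF U(2)])
  show "AE x in \<mu>. rep (c *\<^sub>R u) x = c * rep u x" by (rule AE_mu_I[OF rep_fun_ae_scale])
  show "AE x in \<mu>. grad (c *\<^sub>R u) x = c *\<^sub>R grad u x" by (rule grad_scale(2)[OF U(2)])
  show "(\<lambda>x. c * rep u x) \<in> Lp \<mu> r" by (rule Lp_mult[OF U(3)])
  show "(\<lambda>x. c *\<^sub>R grad u x) \<in> Lp \<mu> r" by (rule Lp_scaleR[OF U(4)])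
qed

lemma norms_diff_test:
  assumes u: "u \<in> sobolev_space \<Omega> r" and \<phi>: "\<phi> \<in> test_functions \<Omega>" and r: "r > 0"
  shows "norm_L \<Omega> r (u - abs_fun_ae \<phi>) = Lnorm \<mu> r (\<lambda>x. rep u x - \<phi> x)"
    "norm_grad \<Omega> r (u - abs_fun_ae \<phi>) = Lnorm \<mu> r (\<lambda>x. grad u x - test_gradient \<phi> x)"
proof -
  note U = u[unfolded sobolev_iff]
  define v where "v = (-1) *\<^sub>R abs_fun_ae \<phi>"
  have v: "u - abs_fun_ae \<phi> = u + v" by (simp add: v_def)
  note T = grad_test[OF \<phi>]
  have gv1: "has_weak_gradient \<Omega> (rep v) (grad v)" unfolding v_def by (rule grad_scale(1)[OF T(1)])
  have "AE x in \<mu>. grad v x = - test_gradient \<phi> x"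
    using grad_scale(2)[OF T(1), of "-1"] T(2) unfolding v_def by eventually_elim simp
  note gv = gv1 this
  have rv: "AE x in \<mu>. rep v x = - \<phi> x"
    using AE_mu_I[OF rep_fun_ae_scale[of "-1" "abs_fun_ae \<phi>"]] AE_mu_I[OF rep_abs_fun_ae[of \<phi>]]
    unfolding v_def by eventually_elim simp
  have Ug: "has_weak_gradient \<Omega> (rep u) (grad u)" using U by blast
  note guv = grad_add[OF Ug gv(1)]
  have m: "\<phi> \<in> borel_measurable \<mu>" "test_gradient \<phi> \<in> borel_measurable \<mu>"
    using LpD(1)[OF test_function_Lp(1)[OF \<phi> r]] LpD(1)[OF test_function_Lp(2)[OF \<phi> r]] by simp_all
  show "norm_L \<Omega> r (u - abs_fun_ae \<phi>) = Lnorm \<mu> r (\<lambda>x. rep u x - \<phi> x)"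
    unfolding norm_L_eq v
  proof (rule Lnorm_cong_AE)
    show "AE x in \<mu>. rep (u + v) x = rep u x - \<phi> x"
      using AE_mu_I[OF rep_fun_ae_add[of u v]] rv by eventually_elim simp
    show "rep (u + v) \<in> borel_measurable \<mu>" by (rule weak_gradient_measurable(1)[OF guv(1)])
    show "(\<lambda>x. rep u x - \<phi> x) \<in> borel_measurable \<mu>" using weak_gradient_measurable(1)[OF Ug] m by simp
  qed
  show "norm_grad \<Omega> r (u - abs_fun_ae \<phi>) = Lnorm \<mu> r (\<lambda>x. grad u x - test_gradient \<phi> x)"
    unfolding norm_grad_eq v
  proof (rule Lnorm_cong_AE)
    show "AE x in \<mu>. grad (u + v) x = grad u x - test_gradient \<phi> x"
      using guv(2) gv(2) by eventually_elim simp
    show "grad (u + v) \<in> borel_measurable \<mu>" by (rule weak_gradient_measurable(2)[OF guv(1)])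
    show "(\<lambda>x. grad u x - test_gradient \<phi> x) \<in> borel_measurable \<mu>" using weak_gradient_measurable(2)[OF Ug] m by simp
  qed
qed

text \<open>Approximation in terms of representatives, where linear combinations are pointwise, instead of differences of classes.\<close>

definition approximated where
  "approximated r f g \<phi> \<longleftrightarrow> (\<forall>n::nat. \<phi> n \<in> test_functions \<Omega>) \<and>
     (\<lambda>n. Lnorm \<mu> r (\<lambda>x. f x - \<phi> n x)) \<longlonglongrightarrow> 0 \<and> (\<lambda>n. Lnorm \<mu> r (\<lambda>x. g x - test_gradient (\<phi> n) x)) \<longlonglongrightarrow> 0"

lemma W0_iff:
  assumes r: "r > 0"
  shows "u \<in> W0 \<Omega> r \<longleftrightarrow> u \<in> sobolev_space \<Omega> r \<and> (\<exists>\<phi>. approximated r (rep u) (grad u) \<phi>)"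
proof -
  have "(\<lambda>n. norm_L \<Omega> r (u - abs_fun_ae (\<phi> n)) + norm_grad \<Omega> r (u - abs_fun_ae (\<phi> n))) \<longlonglongrightarrow> 0 \<longleftrightarrow>
     (\<lambda>n. Lnorm \<mu> r (\<lambda>x. rep u x - \<phi> n x)) \<longlonglongrightarrow> 0 \<and> (\<lambda>n. Lnorm \<mu> r (\<lambda>x. grad u x - test_gradient (\<phi> n) x)) \<longlonglongrightarrow> 0"
    if u: "u \<in> sobolev_space \<Omega> r" and \<phi>: "\<forall>n::nat. \<phi> n \<in> test_functions \<Omega>" for \<phi>
  proof -
    define a where "a n = Lnorm \<mu> r (\<lambda>x. rep u x - \<phi> n x)" for n
    define b where "b n = Lnorm \<mu> r (\<lambda>x. grad u x - test_gradient (\<phi> n) x)" for n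
    have nn: "0 \<le> a n" "0 \<le> b n" for n by (simp_all add: a_def b_def)
    have eq: "norm_L \<Omega> r (u - abs_fun_ae (\<phi> n)) + norm_grad \<Omega> r (u - abs_fun_ae (\<phi> n)) = a n + b n" for n
      using norms_diff_test[OF u \<phi>[rule_format] r, of n] by (simp add: a_def b_def)
    have "(\<lambda>n. a n + b n) \<longlonglongrightarrow> 0 \<longleftrightarrow> a \<longlonglongrightarrow> 0 \<and> b \<longlonglongrightarrow> 0"
    proof (intro iffI conjI)
      assume ab: "(\<lambda>n. a n + b n) \<longlonglongrightarrow> 0"
      show "a \<longlonglongrightarrow> 0" by (rule Lim_null_comparison[OF _ ab]) (use nn in auto)
      show "b \<longlonglongrightarrow> 0" by (rule Lim_null_comparison[OF _ ab]) (use nn in auto)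
    next
      assume "a \<longlonglongrightarrow> 0 \<and> b \<longlonglongrightarrow> 0"
      then show "(\<lambda>n. a n + b n) \<longlonglongrightarrow> 0" using tendsto_add[of a 0 sequentially b 0] by simp
    qed
    then show ?thesis unfolding eq a_def[abs_def] b_def[abs_def] .
  qed
  then show ?thesis unfolding W0_def approximated_def mem_Collect_eq by blast
qed

lemma W0D:
  assumes "u \<in> W0 \<Omega> r"
  shows "u \<in> sobolev_space \<Omega> r" "has_weak_gradient \<Omega> (rep u) (grad u)" "rep u \<in> Lp \<mu> r" "grad u \<in> Lp \<mu> r"
    "AE x in lebesgue. x \<notin> \<Omega> \<longrightarrow> rep u x = 0"
proof -
  show s: "u \<in> sobolev_space \<Omega> r" using assms by (simp add: W0_def)
  show "has_weak_gradient \<Omega> (rep u) (grad u)" "rep u \<in> Lp \<mu> r" "grad u \<in> Lp \<mu> r"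
    "AE x in lebesgue. x \<notin> \<Omega> \<longrightarrow> rep u x = 0"
    using s unfolding sobolev_iff by blast+
qed

lemma Lnorm_add_lim:
  fixes f g :: "'a \<Rightarrow> 'c::euclidean_space" and \<phi> \<psi> :: "nat \<Rightarrow> 'a \<Rightarrow> 'c"
  assumes r: "r > 1" and L: "f \<in> Lp \<mu> r" "g \<in> Lp \<mu> r" "\<And>n. \<phi> n \<in> Lp \<mu> r" "\<And>n. \<psi> n \<in> Lp \<mu> r"
    and l: "(\<lambda>n. Lnorm \<mu> r (\<lambda>x. f x - \<phi> n x)) \<longlonglongrightarrow> 0" "(\<lambda>n. Lnorm \<mu> r (\<lambda>x. g x - \<psi> n x)) \<longlonglongrightarrow> 0"
    and h: "h \<in> borel_measurable \<mu>" "AE x in \<mu>. h x = f x + g x"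
  shows "(\<lambda>n. Lnorm \<mu> r (\<lambda>x. h x - (\<phi> n x + \<psi> n x))) \<longlonglongrightarrow> 0"
proof (rule Lim_null_comparison[OF _ tendsto_add_zero[OF l]], rule always_eventually, rule allI)
  fix n
  have D: "(\<lambda>x. f x - \<phi> n x) \<in> Lp \<mu> r" "(\<lambda>x. g x - \<psi> n x) \<in> Lp \<mu> r" using L r by (intro Lp_diff; simp)+
  have "Lnorm \<mu> r (\<lambda>x. h x - (\<phi> n x + \<psi> n x)) = Lnorm \<mu> r (\<lambda>x. (f x - \<phi> n x) + (g x - \<psi> n x))"
  proof (rule Lnorm_cong_AE)
    show "AE x in \<mu>. h x - (\<phi> n x + \<psi> n x) = (f x - \<phi> n x) + (g x - \<psi> n x)"
      using h(2) by eventually_elim simp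
    show "(\<lambda>x. h x - (\<phi> n x + \<psi> n x)) \<in> borel_measurable \<mu>"
      by (intro borel_measurable_diff borel_measurable_add h LpD(1)[OF L(3)] LpD(1)[OF L(4)])
    show "(\<lambda>x. (f x - \<phi> n x) + (g x - \<psi> n x)) \<in> borel_measurable \<mu>"
      by (intro borel_measurable_add LpD(1)[OF D(1)] LpD(1)[OF D(2)])
  qed
  also have "\<dots> \<le> Lnorm \<mu> r (\<lambda>x. f x - \<phi> n x) + Lnorm \<mu> r (\<lambda>x. g x - \<psi> n x)"
    by (rule Lp_minkowski[OF r D])
  finally show "norm (Lnorm \<mu> r (\<lambda>x. h x - (\<phi> n x + \<psi> n x)))
      \<le> Lnorm \<mu> r (\<lambda>x. f x - \<phi> n x) + Lnorm \<mu> r (\<lambda>x. g x - \<psi> n x)" by simp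
qed

lemma W0_add:
  assumes r: "r > 1" and u: "u \<in> W0 \<Omega> r" and v: "v \<in> W0 \<Omega> r"
  shows "u + v \<in> W0 \<Omega> r"
proof -
  have r0: "r > 0" using r by simp
  note U = W0D[OF u] and V = W0D[OF v]
  obtain \<phi> where \<phi>: "approximated r (rep u) (grad u) \<phi>" using u unfolding W0_iff[OF r0] by blast
  obtain \<psi> where \<psi>: "approximated r (rep v) (grad v) \<psi>" using v unfolding W0_iff[OF r0] by blast
  note A = \<phi>[unfolded approximated_def] \<psi>[unfolded approximated_def]
  have t: "\<phi> n \<in> test_functions \<Omega>" "\<psi> n \<in> test_functions \<Omega>" for n using A by blast+
  have s: "u + v \<in> sobolev_space \<Omega> r" by (rule sobolev_add[OF r0 U(1) V(1)])
  have m: "rep (u + v) \<in> borel_measurable \<mu>" "grad (u + v) \<in> borel_measurable \<mu>"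
    using s[unfolded sobolev_iff] LpD(1) by blast+
  have "approximated r (rep (u + v)) (grad (u + v)) (\<lambda>n x. \<phi> n x + \<psi> n x)"
    unfolding approximated_def
  proof (intro conjI allI)
    show "(\<lambda>x. \<phi> n x + \<psi> n x) \<in> test_functions \<Omega>" for n by (rule test_functions_add[OF t])
    show "(\<lambda>n. Lnorm \<mu> r (\<lambda>x. rep (u + v) x - (\<phi> n x + \<psi> n x))) \<longlonglongrightarrow> 0"
      by (rule Lnorm_add_lim[OF r U(3) V(3) test_function_Lp(1)[OF t(1) r0] test_function_Lp(1)[OF t(2) r0] _ _ m(1) AE_mu_I[OF rep_fun_ae_add]])
         (use A in blast)+
    show "(\<lambda>n. Lnorm \<mu> r (\<lambda>x. grad (u + v) x - test_gradient (\<lambda>x. \<phi> n x + \<psi> n x) x)) \<longlonglongrightarrow> 0"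
      unfolding test_gradient_add[OF t]
      by (rule Lnorm_add_lim[OF r U(4) V(4) test_function_Lp(2)[OF t(1) r0] test_function_Lp(2)[OF t(2) r0] _ _ m(2) grad_add(2)[OF U(2) V(2)]])
         (use A in blast)+
  qed
  with s show ?thesis unfolding W0_iff[OF r0] by blast
qed

lemma Lnorm_scale_lim:
  fixes f :: "'a \<Rightarrow> 'c::euclidean_space" and \<phi> :: "nat \<Rightarrow> 'a \<Rightarrow> 'c"
  assumes r: "r > 0" and L: "f \<in> Lp \<mu> r" "\<And>n. \<phi> n \<in> Lp \<mu> r"
    and l: "(\<lambda>n. Lnorm \<mu> r (\<lambda>x. f x - \<phi> n x)) \<longlonglongrightarrow> 0"
    and h: "h \<in> borel_measurable \<mu>" "AE x in \<mu>. h x = c *\<^sub>R f x"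
  shows "(\<lambda>n. Lnorm \<mu> r (\<lambda>x. h x - c *\<^sub>R \<phi> n x)) \<longlonglongrightarrow> 0"
proof -
  have "Lnorm \<mu> r (\<lambda>x. h x - c *\<^sub>R \<phi> n x) = \<bar>c\<bar> * Lnorm \<mu> r (\<lambda>x. f x - \<phi> n x)" for n
  proof -
    have "Lnorm \<mu> r (\<lambda>x. h x - c *\<^sub>R \<phi> n x) = Lnorm \<mu> r (\<lambda>x. c *\<^sub>R (f x - \<phi> n x))"
    proof (rule Lnorm_cong_AE)
      show "AE x in \<mu>. h x - c *\<^sub>R \<phi> n x = c *\<^sub>R (f x - \<phi> n x)"
        using h(2) by eventually_elim (simp add: scaleR_diff_right)
      show "(\<lambda>x. h x - c *\<^sub>R \<phi> n x) \<in> borel_measurable \<mu>"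
        by (intro borel_measurable_diff borel_measurable_scaleR borel_measurable_const h LpD(1)[OF L(2)])
      show "(\<lambda>x. c *\<^sub>R (f x - \<phi> n x)) \<in> borel_measurable \<mu>"
        by (intro borel_measurable_diff borel_measurable_scaleR borel_measurable_const LpD(1)[OF L(1)] LpD(1)[OF L(2)])
    qed
    then show ?thesis using r by (simp add: Lnorm_scaleR)
  qed
  then show ?thesis using tendsto_mult_right_zero[OF l, of "\<bar>c\<bar>"] by simp
qed

lemma W0_scale:
  assumes r0: "r > 0" and u: "u \<in> W0 \<Omega> r"
  shows "c *\<^sub>R u \<in> W0 \<Omega> r"
proof -
  note U = W0D[OF u]
  obtain \<phi> where \<phi>: "approximated r (rep u) (grad u) \<phi>" using u unfolding W0_iff[OF r0] by blast
  note A = \<phi>[unfolded approximated_def]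
  have t: "\<phi> n \<in> test_functions \<Omega>" for n using A by blast+
  have s: "c *\<^sub>R u \<in> sobolev_space \<Omega> r" by (rule sobolev_scale[OF U(1)])
  have m: "rep (c *\<^sub>R u) \<in> borel_measurable \<mu>" "grad (c *\<^sub>R u) \<in> borel_measurable \<mu>"
    using s[unfolded sobolev_iff] LpD(1) by blast+
  have "approximated r (rep (c *\<^sub>R u)) (grad (c *\<^sub>R u)) (\<lambda>n x. c * \<phi> n x)"
    unfolding approximated_def
  proof (intro conjI allI)
    show "(\<lambda>x. c * \<phi> n x) \<in> test_functions \<Omega>" for n by (rule test_functions_scale[OF t])
    have "(\<lambda>n. Lnorm \<mu> r (\<lambda>x. rep (c *\<^sub>R u) x - c *\<^sub>R \<phi> n x)) \<longlonglongrightarrow> 0"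
    proof (rule Lnorm_scale_lim[OF r0 U(3) test_function_Lp(1)[OF t r0] _ m(1)])
      show "AE x in \<mu>. rep (c *\<^sub>R u) x = c *\<^sub>R rep u x"
        using AE_mu_I[OF rep_fun_ae_scale[of c u]] by eventually_elim simp
    qed (use A in blast)
    then show "(\<lambda>n. Lnorm \<mu> r (\<lambda>x. rep (c *\<^sub>R u) x - c * \<phi> n x)) \<longlonglongrightarrow> 0" by simp
    show "(\<lambda>n. Lnorm \<mu> r (\<lambda>x. grad (c *\<^sub>R u) x - test_gradient (\<lambda>x. c * \<phi> n x) x)) \<longlonglongrightarrow> 0"
      unfolding test_gradient_scale[OF t]
      by (rule Lnorm_scale_lim[OF r0 U(4) test_function_Lp(2)[OF t r0] _ m(2) grad_scale(2)[OF U(2)]])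
         (use A in blast)
  qed
  with s show ?thesis unfolding W0_iff[OF r0] by blast
qed

lemma W0_zero: "r > 0 \<Longrightarrow> 0 \<in> W0 \<Omega> r"
proof -
  assume r: "r > 0"
  note z = test_functions_zero[of \<Omega>]
  note L = test_function_Lp[OF z r]
  have r0: "AE x in lebesgue. rep 0 x = 0"
    using rep_abs_fun_ae[of "\<lambda>_::'a. 0"] by (simp add: zero_fun_ae.abs_eq)
  have tg: "test_gradient (\<lambda>_::'a. 0) = (\<lambda>_. 0)" by (simp add: test_gradient_def fun_eq_iff)
  have g: "has_weak_gradient \<Omega> (rep 0) (grad 0)" "AE x in \<mu>. grad 0 x = 0"
    using grad_eq[OF weak_gradient_test[OF z], of 0] r0 by (simp_all add: tg)
  note m = weak_gradient_measurable[OF g(1)]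
  have R: "rep 0 \<in> Lp \<mu> r"
  proof (rule Lp_cong_AE[OF L(1) m(1)])
    show "AE x in \<mu>. 0 = rep 0 x" using AE_mu_I[OF r0] by eventually_elim simp
  qed
  have Gr: "grad 0 \<in> Lp \<mu> r"
  proof (rule Lp_cong_AE[OF L(2)[unfolded tg] m(2)])
    show "AE x in \<mu>. 0 = grad 0 x" using g(2) by eventually_elim simp
  qed
  have "0 \<in> sobolev_space \<Omega> r"
    unfolding sobolev_iff
  proof (intro conjI R Gr g(1))
    show "AE x in lebesgue. x \<notin> \<Omega> \<longrightarrow> rep 0 x = 0" using r0 by eventually_elim simp
  qed
  moreover have "approximated r (rep 0) (grad 0) (\<lambda>_ _. 0)"
    unfolding approximated_def tg
    using z Lnorm_eq_0_iff[OF R r] Lnorm_eq_0_iff[OF Gr r] AE_mu_I[OF r0] g(2) by simp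
  ultimately show ?thesis unfolding W0_iff[OF r] by blast
qed

lemma approximatedD:
  assumes "approximated r f g \<phi>"
  shows "\<phi> n \<in> test_functions \<Omega>" "(\<lambda>n. Lnorm \<mu> r (\<lambda>x. f x - \<phi> n x)) \<longlonglongrightarrow> 0"
    "(\<lambda>n. Lnorm \<mu> r (\<lambda>x. g x - test_gradient (\<phi> n) x)) \<longlonglongrightarrow> 0"
  using assms unfolding approximated_def by blast+

lemma W0_approx:
  assumes r: "r > 0" and u: "u \<in> W0 \<Omega> r" and e: "e > 0"
  obtains \<phi> where "\<phi> \<in> test_functions \<Omega>" "Lnorm \<mu> r (\<lambda>x. rep u x - \<phi> x) < e"
    "Lnorm \<mu> r (\<lambda>x. grad u x - test_gradient \<phi> x) < e"
proof -
  obtain \<phi> where "approximated r (rep u) (grad u) \<phi>" using u unfolding W0_iff[OF r] by blast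
  note \<phi> = approximatedD[OF this]
  have "eventually (\<lambda>n. Lnorm \<mu> r (\<lambda>x. rep u x - \<phi> n x) < e) sequentially"
    "eventually (\<lambda>n. Lnorm \<mu> r (\<lambda>x. grad u x - test_gradient (\<phi> n) x) < e) sequentially"
    using order_tendstoD(2)[OF \<phi>(2) e] order_tendstoD(2)[OF \<phi>(3) e] by simp_all
  then have "eventually (\<lambda>n. Lnorm \<mu> r (\<lambda>x. rep u x - \<phi> n x) < e \<and>
      Lnorm \<mu> r (\<lambda>x. grad u x - test_gradient (\<phi> n) x) < e) sequentially" by (rule eventually_conj)
  then obtain n where "Lnorm \<mu> r (\<lambda>x. rep u x - \<phi> n x) < e \<and>
      Lnorm \<mu> r (\<lambda>x. grad u x - test_gradient (\<phi> n) x) < e"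
    unfolding eventually_sequentially by blast
  with that[OF \<phi>(1)[of n]] show thesis by simp
qed

lemma W0_I:
  assumes r: "r > 0" and u: "u \<in> sobolev_space \<Omega> r"
    and a: "\<And>e. e > 0 \<Longrightarrow> \<exists>\<phi>\<in>test_functions \<Omega>. Lnorm \<mu> r (\<lambda>x. rep u x - \<phi> x) < e \<and>
      Lnorm \<mu> r (\<lambda>x. grad u x - test_gradient \<phi> x) < e"
  shows "u \<in> W0 \<Omega> r"
proof -
  have "\<exists>\<phi>. \<phi> \<in> test_functions \<Omega> \<and> Lnorm \<mu> r (\<lambda>x. rep u x - \<phi> x) < inverse (real (Suc n)) \<and>
      Lnorm \<mu> r (\<lambda>x. grad u x - test_gradient \<phi> x) < inverse (real (Suc n))" for n
    using a[of "inverse (real (Suc n))"] by (simp add: Bex_def)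
  then obtain \<phi> where \<phi>: "\<And>n. \<phi> n \<in> test_functions \<Omega>"
    "\<And>n. Lnorm \<mu> r (\<lambda>x. rep u x - \<phi> n x) < inverse (real (Suc n))"
    "\<And>n. Lnorm \<mu> r (\<lambda>x. grad u x - test_gradient (\<phi> n) x) < inverse (real (Suc n))"
    by metis
  have "approximated r (rep u) (grad u) \<phi>"
    unfolding approximated_def
  proof (intro conjI allI \<phi>(1))
    show "(\<lambda>n. Lnorm \<mu> r (\<lambda>x. rep u x - \<phi> n x)) \<longlonglongrightarrow> 0"
      by (rule Lim_null_comparison[OF _ LIMSEQ_inverse_real_of_nat], rule always_eventually)
         (use less_imp_le[OF \<phi>(2)] in simp)
    show "(\<lambda>n. Lnorm \<mu> r (\<lambda>x. grad u x - test_gradient (\<phi> n) x)) \<longlonglongrightarrow> 0"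
      by (rule Lim_null_comparison[OF _ LIMSEQ_inverse_real_of_nat], rule always_eventually)
         (use less_imp_le[OF \<phi>(3)] in simp)
  qed
  with u show ?thesis unfolding W0_iff[OF r] by blast
qed

lemma linear_grad: "r > 1 \<Longrightarrow> linear_Lp \<mu> (W0 \<Omega> r) grad r"
  using W0_zero[of r] W0_add[of r] W0_scale[of r] W0D(4)[of _ r] grad_add(2)[OF W0D(2) W0D(2)] grad_scale(2)[OF W0D(2)]
  by unfold_locales simp_all

lemma linear_rep: "r > 1 \<Longrightarrow> linear_Lp \<mu> (W0 \<Omega> r) rep r"
  using W0_zero[of r] W0_add[of r] W0_scale[of r] W0D(3)[of _ r] AE_mu_I[OF rep_fun_ae_add] AE_mu_I[OF rep_fun_ae_scale]
  by unfold_locales simp_all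

text \<open>If \<open>u\<close> has no weak gradient then neither does \<open>- u\<close>, and the two choices among the empty set of weak gradients coincide.\<close>

lemma norm_grad_minus: "Lnorm \<mu> r (grad (- u)) = Lnorm \<mu> r (grad u)"
proof (cases "\<exists>g. has_weak_gradient \<Omega> (rep u) g")
  case True
  then have w: "has_weak_gradient \<Omega> (rep u) (grad u)" unfolding weak_gradient_def by (rule someI_ex)
  have w': "has_weak_gradient \<Omega> (rep (- u)) (grad (- u))" "AE x in \<mu>. grad (- u) x = - grad u x"
    using grad_scale[OF w, of "-1"] by simp_all
  have m: "(\<lambda>x. - grad u x) \<in> borel_measurable \<mu>" using weak_gradient_measurable(2)[OF w] by simp
  show ?thesis using Lnorm_cong_AE[OF weak_gradient_measurable(2)[OF w'(1)] m w'(2)] by (simp add: Lnorm_uminus)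
next
  case False
  have "\<not> has_weak_gradient \<Omega> (rep (- u)) g" for g
  proof
    assume "has_weak_gradient \<Omega> (rep (- u)) g"
    then have g: "has_weak_gradient \<Omega> (\<lambda>x. (-1) * rep (- u) x) (\<lambda>x. (-1) *\<^sub>R g x)" by (rule weak_gradient_scale)
    have "AE x in lebesgue. (-1) * rep (- u) x = rep u x"
      using rep_fun_ae_scale[of "-1" u] by eventually_elim simp
    then show False using weak_gradient_AE[OF g] False by blast
  qed
  then have "has_weak_gradient \<Omega> (rep (- u)) = (\<lambda>g. False)" "has_weak_gradient \<Omega> (rep u) = (\<lambda>g. False)"
    using False by (auto simp: fun_eq_iff)
  then have "grad (- u) = grad u" unfolding weak_gradient_def by simp
  then show ?thesis by simp
qed

text \<open>Vanishing in \<open>\<Omega>\<close> is vanishing as a class because elements of the Sobolev space are zero outside \<open>\<Omega>\<close>.\<close>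

lemma definite_rep:
  assumes "r > 0" "u \<in> W0 \<Omega> r" "Lnorm \<mu> r (rep u) = 0"
  shows "u = 0"
proof -
  have "AE x in \<mu>. rep u x = 0" using Lnorm_eq_0_iff[OF W0D(3)[OF assms(2)] assms(1)] assms(3) by simp
  then have "AE x in lebesgue. x \<in> \<Omega> \<longrightarrow> rep u x = 0" by (simp add: AE_mu)
  with W0D(5)[OF assms(2)] have "AE x in lebesgue. rep u x = 0" by eventually_elim blast
  then show ?thesis using fun_ae_eqI[of u "\<lambda>_. 0"] by (simp add: zero_fun_ae.abs_eq)
qed

lemma domain_radius:
  obtains R where "R > 0" "\<And>\<phi> (x::'a). \<phi> \<in> test_functions \<Omega> \<Longrightarrow> R < norm x \<Longrightarrow> \<phi> x = 0"
proof -
  obtain R where R: "R > 0" "\<And>x. x \<in> \<Omega> \<Longrightarrow> norm x \<le> R" using bounded_\<Omega> unfolding bounded_pos by metis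
  show thesis
  proof (rule that[OF R(1)])
    fix \<phi> and x :: 'a assume \<phi>: "\<phi> \<in> test_functions \<Omega>" "R < norm x"
    obtain K where K: "compact K" "K \<subseteq> \<Omega>" "\<And>x. x \<notin> K \<Longrightarrow> \<phi> x = 0" using test_function_support[OF \<phi>(1)] by metis
    show "\<phi> x = 0" using K(2,3) R(2)[of x] \<phi>(2) by fastforce
  qed
qed

lemma norm_limit:
  fixes f :: "'a \<Rightarrow> 'c::euclidean_space" and \<phi> :: "nat \<Rightarrow> 'a \<Rightarrow> 'c"
  assumes "r > 1" "f \<in> Lp \<mu> r" "\<And>n. \<phi> n \<in> Lp \<mu> r" "(\<lambda>n. Lnorm \<mu> r (\<lambda>x. f x - \<phi> n x)) \<longlonglongrightarrow> 0"
  shows "(\<lambda>n. Lnorm \<mu> r (\<phi> n)) \<longlonglongrightarrow> Lnorm \<mu> r f"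
proof -
  have "(\<lambda>n. Lnorm \<mu> r f - Lnorm \<mu> r (\<phi> n)) \<longlonglongrightarrow> 0"
    by (rule Lim_null_comparison[OF _ assms(4)], rule always_eventually)
       (use Lnorm_reverse_triangle[OF assms(1,2,3)] in simp)
  from tendsto_diff[OF tendsto_const[of "Lnorm \<mu> r f"] this] show ?thesis by simp
qed

lemma poincare_W0:
  assumes r: "r > 1"
  shows "\<exists>C\<ge>0. \<forall>u\<in>W0 \<Omega> r. Lnorm \<mu> r (rep u) \<le> C * Lnorm \<mu> r (grad u)"
proof -
  have r0: "r > 0" using r by simp
  obtain R where R: "R > 0" "\<And>\<phi> (x::'a). \<phi> \<in> test_functions \<Omega> \<Longrightarrow> R < norm x \<Longrightarrow> \<phi> x = 0" using domain_radius by metis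
  have "Lnorm \<mu> r (rep u) \<le> (2 * R + 1) * Lnorm \<mu> r (grad u)" if u: "u \<in> W0 \<Omega> r" for u
  proof -
    obtain \<phi> where "approximated r (rep u) (grad u) \<phi>" using u unfolding W0_iff[OF r0] by blast
    note \<phi> = approximatedD[OF this]
    have l: "Lnorm \<mu> r (\<phi> n) \<le> (2 * R + 1) * Lnorm \<mu> r (test_gradient (\<phi> n))" for n
      using poincare_C1c[OF test_function_C1c[OF \<phi>(1)] r R(1) R(2)[OF \<phi>(1)], of n] test_function_Lp(3,4)[OF \<phi>(1) r0, of n] by simp
    show ?thesis
      by (rule LIMSEQ_le[OF norm_limit[OF r W0D(3)[OF u] test_function_Lp(1)[OF \<phi>(1) r0] \<phi>(2)]
            tendsto_mult_left[OF norm_limit[OF r W0D(4)[OF u] test_function_Lp(2)[OF \<phi>(1) r0] \<phi>(3)]]])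
         (use l in blast)
  qed
  then show ?thesis using R(1) by (intro exI[of _ "2 * R + 1"]) simp
qed

text \<open>Convergence in \<open>L\<^sup>r\<close> implies convergence in \<open>L\<^sup>1\<close> on a set of finite measure.\<close>

lemma Lp_integral_limit:
  fixes F :: "'a \<Rightarrow> 'c::euclidean_space" and f :: "nat \<Rightarrow> 'a \<Rightarrow> 'c"
  assumes r: "r > 1" and L: "\<And>k. f k \<in> Lp \<mu> r" "F \<in> Lp \<mu> r" and l: "(\<lambda>k. Lnorm \<mu> r (\<lambda>x. f k x - F x)) \<longlonglongrightarrow> 0"
    and B: "\<And>x. norm (\<psi> x) \<le> B" and i: "\<And>k. integrable \<mu> (\<lambda>x. f k x \<bullet> \<psi> x)" "integrable \<mu> (\<lambda>x. F x \<bullet> \<psi> x)"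
  shows "(\<lambda>k. LINT x|\<mu>. f k x \<bullet> \<psi> x) \<longlonglongrightarrow> (LINT x|\<mu>. F x \<bullet> \<psi> x)"
proof -
  have B0: "B \<ge> 0" using B[of undefined] norm_ge_zero[of "\<psi> undefined"] by linarith
  define K where "K = (measure \<mu> (space \<mu>) + 1) powr (1 / 1)"
  have b: "\<bar>(LINT x|\<mu>. f k x \<bullet> \<psi> x) - (LINT x|\<mu>. F x \<bullet> \<psi> x)\<bar> \<le> B * K * Lnorm \<mu> r (\<lambda>x. f k x - F x)" for k
  proof -
    have D: "(\<lambda>x. f k x - F x) \<in> Lp \<mu> r" using L r by (intro Lp_diff) simp_all
    note D1 = Lp_nested[OF finite_mu _ r D]
    have i1: "integrable \<mu> (\<lambda>x. norm (f k x - F x))" using LpD(2)[OF D1(1)] by simp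
    have "(LINT x|\<mu>. f k x \<bullet> \<psi> x) - (LINT x|\<mu>. F x \<bullet> \<psi> x) = (LINT x|\<mu>. f k x \<bullet> \<psi> x - F x \<bullet> \<psi> x)"
      using i by simp
    also have "\<bar>\<dots>\<bar> \<le> (LINT x|\<mu>. \<bar>f k x \<bullet> \<psi> x - F x \<bullet> \<psi> x\<bar>)" by (rule integral_abs_bound)
    also have "\<dots> \<le> (LINT x|\<mu>. B * norm (f k x - F x))"
    proof (rule integral_mono)
      show "integrable \<mu> (\<lambda>x. \<bar>f k x \<bullet> \<psi> x - F x \<bullet> \<psi> x\<bar>)" using i by (intro integrable_abs Bochner_Integration.integrable_diff)
      show "integrable \<mu> (\<lambda>x. B * norm (f k x - F x))" using i1 by simp
      fix x
      have "\<bar>f k x \<bullet> \<psi> x - F x \<bullet> \<psi> x\<bar> = \<bar>(f k x - F x) \<bullet> \<psi> x\<bar>" by (simp add: inner_diff_left)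
      also have "\<dots> \<le> norm (f k x - F x) * norm (\<psi> x)" by (rule Cauchy_Schwarz_ineq2)
      also have "\<dots> \<le> norm (f k x - F x) * B" by (rule mult_left_mono[OF B norm_ge_zero])
      finally show "\<bar>f k x \<bullet> \<psi> x - F x \<bullet> \<psi> x\<bar> \<le> B * norm (f k x - F x)" by (simp add: mult.commute)
    qed
    also have "\<dots> = B * Lnorm \<mu> 1 (\<lambda>x. f k x - F x)" by (simp add: Lnorm_def Lint_def)
    also have "\<dots> \<le> B * (K * Lnorm \<mu> r (\<lambda>x. f k x - F x))"
      using D1(2) B0 unfolding K_def by (intro mult_left_mono) simp_all
    finally show ?thesis by (simp add: mult.assoc)
  qed
  have "(\<lambda>k. (LINT x|\<mu>. f k x \<bullet> \<psi> x) - (LINT x|\<mu>. F x \<bullet> \<psi> x)) \<longlonglongrightarrow> 0"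
    by (rule Lim_null_comparison[OF _ tendsto_mult_right_zero[OF l, of "B * K"]], rule always_eventually)
       (use b in simp)
  then show ?thesis by (simp add: LIM_zero_iff)
qed

lemma test_function_bounded:
  assumes "\<phi> \<in> test_functions \<Omega>"
  obtains B where "\<And>x. \<bar>\<phi> x\<bar> \<le> B" "\<And>x. norm (test_gradient \<phi> x) \<le> B"
proof -
  obtain K where K: "compact K" "\<And>x. x \<notin> K \<Longrightarrow> \<phi> x = 0" "\<And>x. x \<notin> K \<Longrightarrow> test_gradient \<phi> x = 0"
    using test_function_support[OF assms] by metis
  note C = C1cD(2,3)[OF test_function_C1c[OF assms]]
  have "bounded (test_gradient \<phi> ` K)" "bounded (\<phi> ` K)"
    using K(1) C by (auto intro!: compact_imp_bounded compact_continuous_image intro: continuous_on_subset)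
  then obtain B1 B2 where B: "\<And>x. x \<in> K \<Longrightarrow> norm (test_gradient \<phi> x) \<le> B1" "\<And>x. x \<in> K \<Longrightarrow> norm (\<phi> x) \<le> B2"
    unfolding bounded_iff by auto
  show thesis
  proof (rule that[of "\<bar>B1\<bar> + \<bar>B2\<bar>"])
    show "\<bar>\<phi> x\<bar> \<le> \<bar>B1\<bar> + \<bar>B2\<bar>" for x using B(2)[of x] K(2)[of x] by (cases "x \<in> K") auto
    show "norm (test_gradient \<phi> x) \<le> \<bar>B1\<bar> + \<bar>B2\<bar>" for x using B(1)[of x] K(3)[of x] by (cases "x \<in> K") auto
  qed
qed

lemma weak_gradient_limit:
  assumes r: "r > 1" and w: "\<And>k. has_weak_gradient \<Omega> (f k) (g k)"
    and L: "\<And>k. f k \<in> Lp \<mu> r" "F \<in> Lp \<mu> r" "\<And>k. g k \<in> Lp \<mu> r" "G \<in> Lp \<mu> r"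
    and l: "(\<lambda>k. Lnorm \<mu> r (\<lambda>x. f k x - F x)) \<longlonglongrightarrow> 0" "(\<lambda>k. Lnorm \<mu> r (\<lambda>x. g k x - G x)) \<longlonglongrightarrow> 0"
  shows "has_weak_gradient \<Omega> F G"
  unfolding weak_gradient_iff
proof (intro conjI ballI)
  show lF: "locally_integrable F" and lG: "locally_integrable G"
    using Lp_imp_locally_integrable[OF L(2) r] Lp_imp_locally_integrable[OF L(4) r] by simp_all
  note lf = weak_gradient_locally_integrable[OF w]
  fix \<phi> i assume \<phi>: "\<phi> \<in> test_functions \<Omega>" and i: "(i::'a) \<in> Basis"
  obtain B where B: "\<And>x. \<bar>\<phi> x\<bar> \<le> B" "\<And>x. norm (test_gradient \<phi> x) \<le> B" using test_function_bounded[OF \<phi>] by metis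
  have 1: "(\<lambda>k. LINT x|\<mu>. f k x \<bullet> (test_gradient \<phi> x \<bullet> i)) \<longlonglongrightarrow> (LINT x|\<mu>. F x \<bullet> (test_gradient \<phi> x \<bullet> i))"
  proof (rule Lp_integral_limit[OF r L(1,2) l(1)])
    show "norm (test_gradient \<phi> x \<bullet> i) \<le> B" for x using Basis_le_norm[OF i, of "test_gradient \<phi> x"] B(2)[of x] by simp
    show "integrable \<mu> (\<lambda>x. f k x \<bullet> (test_gradient \<phi> x \<bullet> i))" for k using integrable_times_test(2)[OF lf(1) \<phi>] by simp
    show "integrable \<mu> (\<lambda>x. F x \<bullet> (test_gradient \<phi> x \<bullet> i))" using integrable_times_test(2)[OF lF \<phi>] by simp
  qed
  have 2: "(\<lambda>k. LINT x|\<mu>. g k x \<bullet> (\<phi> x *\<^sub>R i)) \<longlonglongrightarrow> (LINT x|\<mu>. G x \<bullet> (\<phi> x *\<^sub>R i))"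
  proof (rule Lp_integral_limit[OF r L(3,4) l(2)])
    show "norm (\<phi> x *\<^sub>R i) \<le> B" for x using B(1)[of x] i by simp
    show "integrable \<mu> (\<lambda>x. g k x \<bullet> (\<phi> x *\<^sub>R i))" for k
      using integrable_times_test(1)[OF locally_integrable_inner[OF lf(2)] \<phi>] by (simp add: mult.commute)
    show "integrable \<mu> (\<lambda>x. G x \<bullet> (\<phi> x *\<^sub>R i))"
      using integrable_times_test(1)[OF locally_integrable_inner[OF lG] \<phi>] by (simp add: mult.commute)
  qed
  have "(LINT x|\<mu>. f k x \<bullet> (test_gradient \<phi> x \<bullet> i)) = - (LINT x|\<mu>. g k x \<bullet> (\<phi> x *\<^sub>R i))" for k
    using w[of k] \<phi> i unfolding weak_gradient_iff by (simp add: mult.commute)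
  then have "(LINT x|\<mu>. F x \<bullet> (test_gradient \<phi> x \<bullet> i)) = - (LINT x|\<mu>. G x \<bullet> (\<phi> x *\<^sub>R i))"
    using LIMSEQ_unique[OF 1] tendsto_minus[OF 2] by simp
  then show "(LINT x|\<mu>. F x * (test_gradient \<phi> x \<bullet> i)) = - (LINT x|\<mu>. (G x \<bullet> i) * \<phi> x)"
    by (simp add: mult.commute)
qed

text \<open>The gradients converge by completeness of \<open>L\<^sup>r\<close>, the functions by the Poincare inequality. The weak gradient passes to the limit, and test functions close to
the members of the sequence are close to the limit.\<close>

lemma W0_complete:
  assumes r: "r > 1" and s: "\<And>k::nat. s k \<in> W0 \<Omega> r"
    and cauchy: "\<And>e. e > 0 \<Longrightarrow> \<exists>N. \<forall>j\<ge>N. \<forall>k\<ge>N. Lnorm \<mu> r (grad (s j - s k)) < e"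
  shows "\<exists>w\<in>W0 \<Omega> r. (\<lambda>k. Lnorm \<mu> r (grad (s k - w))) \<longlonglongrightarrow> 0"
proof -
  have r0: "r > 0" using r by simp
  interpret G: linear_Lp \<mu> "W0 \<Omega> r" grad r by (rule linear_grad[OF r])
  interpret R: linear_Lp \<mu> "W0 \<Omega> r" rep r by (rule linear_rep[OF r])
  obtain C where C: "C \<ge> 0" "\<And>u. u \<in> W0 \<Omega> r \<Longrightarrow> Lnorm \<mu> r (rep u) \<le> C * Lnorm \<mu> r (grad u)"
    using poincare_W0[OF r] by blast
  note S = W0D[OF s]
  have dg: "Lnorm \<mu> r (grad (s j - s k)) = Lnorm \<mu> r (\<lambda>x. grad (s j) x - grad (s k) x)" for j k
    using G.n_diff_eq[OF s s] by (simp add: G.n_def)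
  have dr: "Lnorm \<mu> r (rep (s j - s k)) = Lnorm \<mu> r (\<lambda>x. rep (s j) x - rep (s k) x)" for j k
    using R.n_diff_eq[OF s s] by (simp add: R.n_def)
  obtain g where g: "g \<in> Lp \<mu> r" "(\<lambda>k. Lnorm \<mu> r (\<lambda>x. grad (s k) x - g x)) \<longlonglongrightarrow> 0"
    using Lp_complete[of r "\<lambda>k. grad (s k)", OF r S(4)] cauchy unfolding dg by blast
  have "\<exists>N. \<forall>j\<ge>N. \<forall>k\<ge>N. Lnorm \<mu> r (\<lambda>x. rep (s j) x - rep (s k) x) < e" if e: "e > 0" for e
  proof -
    have "e / (C + 1) > 0" using e C(1) by simp
    then obtain N where N: "\<And>j k. j \<ge> N \<Longrightarrow> k \<ge> N \<Longrightarrow> Lnorm \<mu> r (grad (s j - s k)) < e / (C + 1)" using cauchy by meson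
    have "Lnorm \<mu> r (rep (s j - s k)) < e" if "j \<ge> N" "k \<ge> N" for j k
    proof -
      have "Lnorm \<mu> r (rep (s j - s k)) \<le> C * Lnorm \<mu> r (grad (s j - s k))" by (rule C(2)[OF G.W_diff[OF s s]])
      also have "\<dots> \<le> (C + 1) * Lnorm \<mu> r (grad (s j - s k))" by (intro mult_right_mono) simp_all
      also have "\<dots> < e" using N[OF that] C(1) by (simp add: pos_less_divide_eq mult.commute)
      finally show ?thesis .
    qed
    then show ?thesis unfolding dr by blast
  qed
  then obtain F where F: "F \<in> Lp \<mu> r" "(\<lambda>k. Lnorm \<mu> r (\<lambda>x. rep (s k) x - F x)) \<longlonglongrightarrow> 0"
    using Lp_complete[of r "\<lambda>k. rep (s k)", OF r S(3)] by blast
  \<comment> \<open>The limit in \<open>L\<^sup>r(\<Omega>)\<close> is arbitrary outside \<open>\<Omega>\<close>; the class requires the extension by 0.\<close>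
  define f where "f = (\<lambda>x. if x \<in> \<Omega> then F x else 0)"
  have Ff: "AE x in \<mu>. F x = f x" unfolding AE_mu f_def by simp
  have fm: "f \<in> borel_measurable \<mu>"
    using LpD(1)[OF F(1)] by (subst measurable_cong[of \<mu> f F]) (simp_all add: f_def)
  have f: "f \<in> Lp \<mu> r" by (rule Lp_cong_AE[OF F(1) fm Ff])
  have "Lnorm \<mu> r (\<lambda>x. rep (s k) x - f x) = Lnorm \<mu> r (\<lambda>x. rep (s k) x - F x)" for k
  proof (rule Lnorm_cong_AE)
    show "AE x in \<mu>. rep (s k) x - f x = rep (s k) x - F x" using Ff by eventually_elim simp
  qed (intro borel_measurable_diff LpD(1)[OF S(3)] fm LpD(1)[OF F(1)])+
  then have fl: "(\<lambda>k. Lnorm \<mu> r (\<lambda>x. rep (s k) x - f x)) \<longlonglongrightarrow> 0" using F(2) by simp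
  define w where "w = abs_fun_ae f"
  have wf: "AE x in lebesgue. rep w x = f x" unfolding w_def by (rule rep_abs_fun_ae)
  note wg = grad_eq[OF weak_gradient_limit[OF r S(2) S(3) f S(4) g(1) fl g(2)] wf]
  have ws: "w \<in> sobolev_space \<Omega> r"
  proof (rule sobolev_I[OF _ wg(1) f AE_mu_I[OF wf] g(1) wg(2)])
    show "AE x in lebesgue. x \<notin> \<Omega> \<longrightarrow> rep w x = 0" using wf by eventually_elim (simp add: f_def)
  qed
  note WL = sobolev_D[OF ws]
  have lr: "Lnorm \<mu> r (\<lambda>x. rep (s k) x - rep w x) = Lnorm \<mu> r (\<lambda>x. rep (s k) x - f x)" for k
  proof (rule Lnorm_cong_AE)
    show "AE x in \<mu>. rep (s k) x - rep w x = rep (s k) x - f x" using AE_mu_I[OF wf] by eventually_elim simp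
  qed (intro borel_measurable_diff LpD(1)[OF S(3)] fm LpD(1)[OF WL(3)])+
  have lg: "Lnorm \<mu> r (\<lambda>x. grad (s k) x - grad w x) = Lnorm \<mu> r (\<lambda>x. grad (s k) x - g x)" for k
  proof (rule Lnorm_cong_AE)
    show "AE x in \<mu>. grad (s k) x - grad w x = grad (s k) x - g x" using wg(2) by eventually_elim simp
  qed (intro borel_measurable_diff LpD(1)[OF S(4)] LpD(1)[OF g(1)] LpD(1)[OF WL(4)])+
  have sum: "Lnorm \<mu> r (\<lambda>x. a x - c x) < e"
    if "a \<in> Lp \<mu> r" "b \<in> Lp \<mu> r" "c \<in> Lp \<mu> r" "Lnorm \<mu> r (\<lambda>x. b x - a x) < e / 2" "Lnorm \<mu> r (\<lambda>x. b x - c x) < e / 2"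
    for a b c :: "'a \<Rightarrow> 'd::euclidean_space" and e
    using Lp_minkowski_diff[OF r Lp_diff[OF r0 that(2,3)] Lp_diff[OF r0 that(2,1)]] that(4,5) by simp
  have "w \<in> W0 \<Omega> r"
  proof (rule W0_I[OF r0 ws])
    fix e :: real assume e: "e > 0"
    then have e2: "e / 2 > 0" by simp
    have "eventually (\<lambda>k. Lnorm \<mu> r (\<lambda>x. rep (s k) x - rep w x) < e / 2 \<and> Lnorm \<mu> r (\<lambda>x. grad (s k) x - grad w x) < e / 2) sequentially"
      unfolding lr lg by (rule eventually_conj[OF order_tendstoD(2)[OF fl e2] order_tendstoD(2)[OF g(2) e2]])
    then obtain k where k: "Lnorm \<mu> r (\<lambda>x. rep (s k) x - rep w x) < e / 2" "Lnorm \<mu> r (\<lambda>x. grad (s k) x - grad w x) < e / 2"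
      unfolding eventually_sequentially by blast
    obtain \<phi> where \<phi>: "\<phi> \<in> test_functions \<Omega>" "Lnorm \<mu> r (\<lambda>x. rep (s k) x - \<phi> x) < e / 2"
      "Lnorm \<mu> r (\<lambda>x. grad (s k) x - test_gradient \<phi> x) < e / 2" using W0_approx[OF r0 s e2] by metis
    note T = test_function_Lp(1,2)[OF \<phi>(1) r0]
    show "\<exists>\<phi>\<in>test_functions \<Omega>. Lnorm \<mu> r (\<lambda>x. rep w x - \<phi> x) < e \<and> Lnorm \<mu> r (\<lambda>x. grad w x - test_gradient \<phi> x) < e"
      using sum[OF WL(3) S(3) T(1) k(1) \<phi>(2)] sum[OF WL(4) S(4) T(2) k(2) \<phi>(3)] \<phi>(1) by blast
  qed
  moreover have "Lnorm \<mu> r (grad (s k - w)) = Lnorm \<mu> r (\<lambda>x. grad (s k) x - g x)" for k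
    using G.n_diff_eq[OF s \<open>w \<in> W0 \<Omega> r\<close>] lg[of k] by (simp add: G.n_def)
  ultimately show ?thesis using g(2) by (intro bexI[of _ w]) simp_all
qed

end

section \<open>Rellich compactness\<close>

lemma finitely_many_convergent_subsequences:
  fixes a :: "'b \<Rightarrow> nat \<Rightarrow> real"
  assumes "finite X" and "\<And>y. y \<in> X \<Longrightarrow> bounded (range (a y))"
  shows "\<exists>r :: nat \<Rightarrow> nat. strict_mono r \<and> (\<forall>y\<in>X. convergent (\<lambda>k. a y (r k)))"
  using assms
proof (induction X rule: finite_induct)
  case empty
  show ?case by (intro exI[of _ id]) (simp add: strict_mono_def)
next
  case (insert x X)
  obtain r where r: "strict_mono r" "\<And>y. y \<in> X \<Longrightarrow> convergent (\<lambda>k. a y (r k))" using insert by auto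
  have "bounded (range (\<lambda>k. a x (r k)))" by (rule bounded_subset[OF insert.prems[of x]]) auto
  then obtain l r' where r': "strict_mono r'" "((\<lambda>k. a x (r k)) \<circ> r') \<longlonglongrightarrow> l"
    using bounded_imp_convergent_subsequence[of "\<lambda>k. a x (r k)"] by blast
  have "convergent (\<lambda>k. a y ((r \<circ> r') k))" if "y \<in> insert x X" for y
  proof (cases "y = x")
    case True
    then show ?thesis using r'(2) by (auto simp: convergent_def o_def)
  next
    case False
    then show ?thesis using convergent_subseq_convergent[OF r(2)[of y] r'(1)] that by (simp add: o_def)
  qed
  then show ?case using strict_mono_o[OF r(1) r'(1)] by blast
qed

lemma ball_integral_diff:
  fixes \<phi> \<psi> :: "'a::euclidean_space \<Rightarrow> real"
  assumes "continuous_on UNIV \<phi>" "continuous_on UNIV \<psi>"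
  shows "ball_integral h y (\<lambda>x. \<phi> x - \<psi> x) = ball_integral h y \<phi> - ball_integral h y \<psi>"
  unfolding ball_integral_def
  by (rule set_integral_diff(2)[OF cball_set_integrable cball_set_integrable]) (intro continuous_translate_left assms)+

lemma ball_integral_bound:
  fixes \<phi> :: "'a::euclidean_space \<Rightarrow> real"
  assumes c: "C1c \<phi> G" and p: "p > 1"
  shows "\<bar>ball_integral h y \<phi>\<bar> powr p \<le> measure lborel (cball (0::'a) h) powr (p - 1) * Lint lborel p \<phi>"
proof -
  have cont: "continuous_on UNIV (\<lambda>z. \<phi> (y + z))" by (rule continuous_translate_left[OF C1cD(3)[OF c]])
  obtain R where R: "\<And>x. R < norm x \<Longrightarrow> \<phi> x = 0" using C1c_support[OF c] by metis
  have "(\<lambda>z. \<phi> (y + z)) \<in> Lp lborel p"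
  proof (rule compact_support_Lp[OF cont, where R = "R + norm y"])
    fix z :: 'a assume "R + norm y < norm z"
    then show "\<phi> (y + z) = 0" using norm_diff_triangle_ineq[of "y + z" 0 y 0] norm_triangle_ineq4[of "y + z" y] by (intro R) simp
  qed (use p in simp)
  then have i': "integrable lborel (\<lambda>z. \<bar>\<phi> (y + z)\<bar> powr p)" using LpD(2) by force
  have "(LINT z:cball 0 h|lborel. \<bar>\<phi> (y + z)\<bar> powr p) \<le> (LINT z|lborel. \<bar>\<phi> (y + z)\<bar> powr p)"
    unfolding set_lebesgue_integral_def
  proof (rule integral_mono[OF _ i'])
    show "integrable lborel (\<lambda>z. indicator (cball 0 h) z *\<^sub>R \<bar>\<phi> (y + z)\<bar> powr p)"
      by (rule integrable_mult_indicator[OF _ i']) simp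
  qed (simp add: indicator_def)
  also have "\<dots> = Lint lborel p \<phi>"
    using Lint_translate[OF continuous_borel[OF C1cD(3)[OF c]], of p y] by (simp add: Lint_def add.commute)
  finally have "(LINT z:cball 0 h|lborel. \<bar>\<phi> (y + z)\<bar> powr p) \<le> Lint lborel p \<phi>" .
  then have "measure lborel (cball (0::'a) h) powr (p - 1) * (LINT z:cball 0 h|lborel. \<bar>\<phi> (y + z)\<bar> powr p)
      \<le> measure lborel (cball (0::'a) h) powr (p - 1) * Lint lborel p \<phi>" by (rule mult_left_mono) simp
  with mean_power_le[OF cont p, of h] show ?thesis unfolding ball_integral_def by linarith
qed

lemma powr_le_imp_le:
  fixes a b p :: real
  assumes "a powr p \<le> b powr p" "p > 0" "a \<ge> 0" "b \<ge> 0"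
  shows "a \<le> b"
  using assms powr_less_mono2[of p b a] by fastforce

text \<open>Choose a subsequence along which the finitely many functionals of \<open>ehrling\<close> converge; the gradient term contributes at most \<open>\<eta> (2 K)\<^sup>p\<close>, which the choice of \<open>\<eta>\<close> makes small.\<close>

lemma ehrling_subsequence:
  fixes \<phi> :: "nat \<Rightarrow> 'a::euclidean_space \<Rightarrow> real"
  assumes p: "p > 1" and R: "R > 0" and c: "\<And>k. C1c (\<phi> k) (G k)" and supp: "\<And>k x. R < norm x \<Longrightarrow> \<phi> k x = 0"
    and b: "\<And>k. Lnorm lborel p (\<phi> k) \<le> K" "\<And>k. Lnorm lborel p (G k) \<le> K" and e: "e > 0"
  shows "\<exists>r :: nat \<Rightarrow> nat. strict_mono r \<and> (\<exists>N. \<forall>j\<ge>N. \<forall>k\<ge>N. Lnorm lborel p (\<lambda>x. \<phi> (r j) x - \<phi> (r k) x) \<le> e)"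
proof -
  have p0: "p > 0" using p by simp
  have K: "K \<ge> 0" using b(1)[of 0] Lnorm_nonneg[of lborel p "\<phi> 0"] by linarith
  define \<eta> where "\<eta> = e powr p / 2 / ((2 * K) powr p + 1)"
  have \<eta>: "\<eta> > 0" "\<eta> * (2 * K) powr p \<le> e powr p / 2"
  proof -
    have d: "(2 * K) powr p + 1 > 0" using powr_ge_zero[of "2 * K" p] by linarith
    then show "\<eta> > 0" using e by (simp add: \<eta>_def)
    then have "\<eta> * (2 * K) powr p \<le> \<eta> * ((2 * K) powr p + 1)" by (intro mult_left_mono) simp_all
    also have "\<dots> = e powr p / 2" unfolding \<eta>_def by (rule nonzero_eq_divide_eq[THEN iffD1, OF less_imp_neq[OF d, symmetric] refl])
    finally show "\<eta> * (2 * K) powr p \<le> e powr p / 2" .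
  qed
  obtain X h C where X: "finite X" "C \<ge> 0"
    and eh: "\<And>(\<phi>::'a \<Rightarrow> real) G. C1c \<phi> G \<Longrightarrow> (\<forall>x. R < norm x \<longrightarrow> \<phi> x = 0) \<Longrightarrow>
      Lint lborel p \<phi> \<le> \<eta> * Lint lborel p G + C * (\<Sum>y\<in>X. \<bar>ball_integral h y \<phi>\<bar> powr p)"
    using ehrling[OF p R \<eta>(1)] by metis
  have "bounded (range (\<lambda>k. ball_integral h y (\<phi> k)))" for y
  proof -
    define m where "m = measure lborel (cball (0::'a) h) powr (p - 1)"
    have m: "m \<ge> 0" by (simp add: m_def)
    have "\<bar>ball_integral h y (\<phi> k)\<bar> \<le> m powr (1 / p) * K" for k
    proof -
      have "\<bar>ball_integral h y (\<phi> k)\<bar> powr p \<le> m * Lint lborel p (\<phi> k)"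
        unfolding m_def by (rule ball_integral_bound[OF c p])
      also have "Lint lborel p (\<phi> k) = Lnorm lborel p (\<phi> k) powr p" by (rule Lnorm_powr[OF p0, symmetric])
      also have "m * Lnorm lborel p (\<phi> k) powr p \<le> m * K powr p"
        using b(1)[of k] p0 by (intro mult_left_mono[OF _ m] powr_mono2) simp_all
      also have "\<dots> = (m powr (1 / p) * K) powr p"
      proof -
        have "(m powr (1 / p)) powr p = m" using p0 m by (simp add: powr_powr)
        then show ?thesis by (simp only: powr_mult)
      qed
      finally show ?thesis by (rule powr_le_imp_le[OF _ p0]) (use K in simp_all)
    qed
    then show ?thesis unfolding bounded_iff by (intro exI[of _ "m powr (1 / p) * K"]) auto
  qed
  then obtain r where r: "strict_mono r" "\<And>y. y \<in> X \<Longrightarrow> convergent (\<lambda>k. ball_integral h y (\<phi> (r k)))"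
    using finitely_many_convergent_subsequences[OF X(1), of "\<lambda>y k. ball_integral h y (\<phi> k)"] by blast
  define S where "S j k = (\<Sum>y\<in>X. \<bar>ball_integral h y (\<lambda>x. \<phi> (r j) x - \<phi> (r k) x)\<bar> powr p)" for j k
  define d where "d = (e powr p / 2 / (C * real (card X) + 1)) powr (1 / p)"
  have cX: "C * real (card X) + 1 > 0" using X(2) by (intro add_nonneg_pos mult_nonneg_nonneg) simp_all
  have d: "d > 0" "C * (real (card X) * d powr p) \<le> e powr p / 2"
  proof -
    show "d > 0" using e cX by (simp add: d_def)
    have dp: "d powr p = e powr p / 2 / (C * real (card X) + 1)" using p0 e cX by (simp add: d_def powr_powr)
    have "C * (real (card X) * d powr p) \<le> (C * real (card X) + 1) * d powr p" by (simp add: distrib_right mult.assoc)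
    also have "\<dots> = e powr p / 2" unfolding dp by (subst mult.commute, rule nonzero_eq_divide_eq[THEN iffD1, OF less_imp_neq[OF cX, symmetric] refl])
    finally show "C * (real (card X) * d powr p) \<le> e powr p / 2" .
  qed
  have "\<exists>N. \<forall>j\<ge>N. \<forall>k\<ge>N. \<bar>ball_integral h y (\<phi> (r j)) - ball_integral h y (\<phi> (r k))\<bar> < d" if "y \<in> X" for y
    using CauchyD[OF convergent_Cauchy[OF r(2)[OF that]] d(1)] by simp
  then obtain M where M: "\<And>y j k. y \<in> X \<Longrightarrow> j \<ge> M y \<Longrightarrow> k \<ge> M y \<Longrightarrow>
      \<bar>ball_integral h y (\<phi> (r j)) - ball_integral h y (\<phi> (r k))\<bar> < d" by metis
  define N where "N = Max (insert 0 (M ` X))"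
  have N: "M y \<le> N" if "y \<in> X" for y using that X(1) by (simp add: N_def)
  have "Lnorm lborel p (\<lambda>x. \<phi> (r j) x - \<phi> (r k) x) \<le> e" if jk: "j \<ge> N" "k \<ge> N" for j k
  proof -
    have "\<bar>ball_integral h y (\<lambda>x. \<phi> (r j) x - \<phi> (r k) x)\<bar> powr p \<le> d powr p" if y: "y \<in> X" for y
    proof (rule powr_mono2)
      have "\<bar>ball_integral h y (\<phi> (r j)) - ball_integral h y (\<phi> (r k))\<bar> < d"
        by (rule M[OF y]) (use N[OF y] jk in simp_all)
      then show "\<bar>ball_integral h y (\<lambda>x. \<phi> (r j) x - \<phi> (r k) x)\<bar> \<le> d"
        by (simp add: ball_integral_diff[OF C1cD(3)[OF c] C1cD(3)[OF c]])
    qed (use p0 in simp_all)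
    then have "S j k \<le> real (card X) * d powr p" unfolding S_def by (rule sum_bounded_above)
    then have "C * S j k \<le> C * (real (card X) * d powr p)" using X(2) by (rule mult_left_mono)
    also note d(2)
    finally have 1: "C * S j k \<le> e powr p / 2" .
    have "Lnorm lborel p (\<lambda>x. G (r j) x - G (r k) x) \<le> Lnorm lborel p (G (r j)) + Lnorm lborel p (G (r k))"
      by (rule Lp_minkowski_diff[OF p C1c_Lp(2)[OF c p0] C1c_Lp(2)[OF c p0]])
    also have "\<dots> \<le> 2 * K" using b(2)[of "r j"] b(2)[of "r k"] by simp
    finally have "Lnorm lborel p (\<lambda>x. G (r j) x - G (r k) x) powr p \<le> (2 * K) powr p" using p0 by (intro powr_mono2) simp_all
    then have "\<eta> * Lint lborel p (\<lambda>x. G (r j) x - G (r k) x) \<le> \<eta> * (2 * K) powr p"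
      using \<eta>(1) unfolding Lnorm_powr[OF p0] by simp
    also note \<eta>(2)
    finally have 2: "\<eta> * Lint lborel p (\<lambda>x. G (r j) x - G (r k) x) \<le> e powr p / 2" .
    have "Lint lborel p (\<lambda>x. \<phi> (r j) x - \<phi> (r k) x) \<le> \<eta> * Lint lborel p (\<lambda>x. G (r j) x - G (r k) x) + C * S j k"
      unfolding S_def by (rule eh[OF C1c_diff[OF c c]]) (simp add: supp)
    with 1 2 have "Lnorm lborel p (\<lambda>x. \<phi> (r j) x - \<phi> (r k) x) powr p \<le> e powr p"
      unfolding Lnorm_powr[OF p0] by linarith
    then show ?thesis by (rule powr_le_imp_le[OF _ p0]) (use e in simp_all)
  qed
  then show ?thesis using r(1) by blast
qed

text \<open>The previous lemma for the accuracies \<open>1 / (n + 1)\<close> and a diagonal subsequence.\<close>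

lemma rellich_C1c:
  fixes \<phi> :: "nat \<Rightarrow> 'a::euclidean_space \<Rightarrow> real"
  assumes p: "p > 1" and R: "R > 0" and c: "\<And>k. C1c (\<phi> k) (G k)" and supp: "\<And>k x. R < norm x \<Longrightarrow> \<phi> k x = 0"
    and b: "\<And>k. Lnorm lborel p (\<phi> k) \<le> K" "\<And>k. Lnorm lborel p (G k) \<le> K"
  shows "\<exists>r :: nat \<Rightarrow> nat. strict_mono r \<and> (\<forall>e>0. \<exists>N. \<forall>j\<ge>N. \<forall>k\<ge>N. Lnorm lborel p (\<lambda>x. \<phi> (r j) x - \<phi> (r k) x) < e)"
proof -
  define Q where "Q n r \<longleftrightarrow> (\<exists>N. \<forall>j\<ge>N. \<forall>k\<ge>N. Lnorm lborel p (\<lambda>x. \<phi> (r j) x - \<phi> (r k) x) \<le> inverse (real (Suc n)))"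
    for n and r :: "nat \<Rightarrow> nat"
  interpret subseqs Q
  proof
    fix n and s :: "nat \<Rightarrow> nat"
    show "\<exists>r. strict_mono r \<and> Q n (s \<circ> r)"
      unfolding Q_def o_def
      by (rule ehrling_subsequence[of p R "\<lambda>k. \<phi> (s k)" "\<lambda>k. G (s k)" K]) (use p R c supp b in simp_all)
  qed
  have stable: "Q n (s \<circ> r)" if r: "strict_mono r" and "Q n s" for r s :: "nat \<Rightarrow> nat" and n
  proof -
    obtain N where N: "\<And>j k. j \<ge> N \<Longrightarrow> k \<ge> N \<Longrightarrow> Lnorm lborel p (\<lambda>x. \<phi> (s j) x - \<phi> (s k) x) \<le> inverse (real (Suc n))"
      using \<open>Q n s\<close> unfolding Q_def by blast
    have "Lnorm lborel p (\<lambda>x. \<phi> (s (r j)) x - \<phi> (s (r k)) x) \<le> inverse (real (Suc n))" if "j \<ge> N" "k \<ge> N" for j k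
      by (rule N) (use that seq_suble[OF r, of j] seq_suble[OF r, of k] in linarith)+
    then show ?thesis unfolding Q_def o_def by blast
  qed
  have "\<exists>N. \<forall>j\<ge>N. \<forall>k\<ge>N. Lnorm lborel p (\<lambda>x. \<phi> (diagseq j) x - \<phi> (diagseq k) x) < e" if e: "e > 0" for e
  proof -
    obtain n where n: "inverse (real (Suc n)) < e" using reals_Archimedean[OF e] by blast
    obtain N where N: "\<And>j k. j \<ge> N \<Longrightarrow> k \<ge> N \<Longrightarrow>
        Lnorm lborel p (\<lambda>x. \<phi> (diagseq (Suc n + j)) x - \<phi> (diagseq (Suc n + k)) x) \<le> inverse (real (Suc n))"
      using diagseq_holds[of n, OF stable] unfolding Q_def o_def by blast
    have "Lnorm lborel p (\<lambda>x. \<phi> (diagseq j) x - \<phi> (diagseq k) x) < e" if "j \<ge> Suc n + N" "k \<ge> Suc n + N" for j k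
    proof -
      have "Suc n + (j - Suc n) = j" "Suc n + (k - Suc n) = k" "N \<le> j - Suc n" "N \<le> k - Suc n" using that by linarith+
      then show ?thesis using N[of "j - Suc n" "k - Suc n"] n by simp
    qed
    then show ?thesis by blast
  qed
  then show ?thesis using subseq_diagseq by blast
qed

context bounded_domain
begin

text \<open>Replace the \<open>k\<close>-th member of the sequence by a test function at distance less than \<open>1 / (k + 1)\<close>.\<close>

lemma W0_rellich:
  assumes r: "r > 1" and s: "\<And>k::nat. s k \<in> W0 \<Omega> r" and B: "\<And>k. Lnorm \<mu> r (grad (s k)) \<le> B"
  shows "\<exists>\<sigma> :: nat \<Rightarrow> nat. strict_mono \<sigma> \<and>
        (\<forall>e>0. \<exists>N. \<forall>j\<ge>N. \<forall>k\<ge>N. Lnorm \<mu> r (rep (s (\<sigma> j) - s (\<sigma> k))) < e)"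
proof -
  have r0: "r > 0" using r by simp
  interpret Rp: linear_Lp \<mu> "W0 \<Omega> r" rep r by (rule linear_rep[OF r])
  obtain R where R: "R > 0" "\<And>\<phi> (x::'a). \<phi> \<in> test_functions \<Omega> \<Longrightarrow> R < norm x \<Longrightarrow> \<phi> x = 0" using domain_radius by metis
  note S = W0D[OF s]
  have "\<exists>\<phi>. \<phi> \<in> test_functions \<Omega> \<and> Lnorm \<mu> r (\<lambda>x. rep (s k) x - \<phi> x) < inverse (real (Suc k)) \<and>
      Lnorm \<mu> r (\<lambda>x. grad (s k) x - test_gradient \<phi> x) < inverse (real (Suc k))" for k
    using W0_approx[OF r0 s, of "inverse (real (Suc k))" k] by (metis inverse_positive_iff_positive of_nat_0_less_iff zero_less_Suc)
  then obtain \<phi> where \<phi>: "\<And>k. \<phi> k \<in> test_functions \<Omega>"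
    "\<And>k. Lnorm \<mu> r (\<lambda>x. rep (s k) x - \<phi> k x) < inverse (real (Suc k))"
    "\<And>k. Lnorm \<mu> r (\<lambda>x. grad (s k) x - test_gradient (\<phi> k) x) < inverse (real (Suc k))"
    by metis
  note c = test_function_C1c[OF \<phi>(1)] and T = test_function_Lp[OF \<phi>(1) r0]
  have g: "Lnorm lborel r (test_gradient (\<phi> k)) \<le> B + 1" for k
  proof -
    have "\<bar>Lnorm \<mu> r (grad (s k)) - Lnorm \<mu> r (test_gradient (\<phi> k))\<bar> \<le> Lnorm \<mu> r (\<lambda>x. grad (s k) x - test_gradient (\<phi> k) x)"
      by (rule Lnorm_reverse_triangle[OF r S(4) T(2)])
    moreover have "inverse (real (Suc k)) \<le> 1" by (simp add: inverse_le_1_iff)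
    ultimately show ?thesis using B[of k] \<phi>(3)[of k] T(4)[of k] by linarith
  qed
  have B0: "0 \<le> B + 1" using g[of 0] Lnorm_nonneg[of lborel r "test_gradient (\<phi> 0)"] by linarith
  have K: "Lnorm lborel r (\<phi> k) \<le> (2 * R + 1) * (B + 1)" "Lnorm lborel r (test_gradient (\<phi> k)) \<le> (2 * R + 1) * (B + 1)" for k
  proof -
    have "Lnorm lborel r (\<phi> k) \<le> (2 * R + 1) * Lnorm lborel r (test_gradient (\<phi> k))"
      by (rule poincare_C1c[OF c r R(1) R(2)[OF \<phi>(1)]])
    also have "\<dots> \<le> (2 * R + 1) * (B + 1)" using g R(1) by (intro mult_left_mono) simp_all
    finally show "Lnorm lborel r (\<phi> k) \<le> (2 * R + 1) * (B + 1)" .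
    have "1 * (B + 1) \<le> (2 * R + 1) * (B + 1)" using B0 R(1) by (intro mult_right_mono) simp_all
    then show "Lnorm lborel r (test_gradient (\<phi> k)) \<le> (2 * R + 1) * (B + 1)" using g[of k] by simp
  qed
  have supp: "\<phi> k x = 0" if "R < norm x" for k x by (rule R(2)[OF \<phi>(1) that])
  have "\<exists>\<sigma>::nat \<Rightarrow> nat. strict_mono \<sigma> \<and>
      (\<forall>e>0. \<exists>N. \<forall>j\<ge>N. \<forall>k\<ge>N. Lnorm lborel r (\<lambda>x. \<phi> (\<sigma> j) x - \<phi> (\<sigma> k) x) < e)"
    by (rule rellich_C1c[OF r R(1) c _ K]) (rule supp)
  then obtain \<sigma> :: "nat \<Rightarrow> nat" where \<sigma>: "strict_mono \<sigma>"
    "\<And>e. e > 0 \<Longrightarrow> \<exists>N. \<forall>j\<ge>N. \<forall>k\<ge>N. Lnorm lborel r (\<lambda>x. \<phi> (\<sigma> j) x - \<phi> (\<sigma> k) x) < e"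
    by blast
  have "\<exists>N. \<forall>j\<ge>N. \<forall>k\<ge>N. Lnorm \<mu> r (rep (s (\<sigma> j) - s (\<sigma> k))) < e" if e: "e > 0" for e
  proof -
    have e3: "e / 3 > 0" using e by simp
    obtain M where M: "inverse (real (Suc M)) < e / 3" using reals_Archimedean[OF e3] by blast
    obtain N where N: "\<And>j k. j \<ge> N \<Longrightarrow> k \<ge> N \<Longrightarrow> Lnorm lborel r (\<lambda>x. \<phi> (\<sigma> j) x - \<phi> (\<sigma> k) x) < e / 3"
      using \<sigma>(2)[OF e3] by blast
    have close: "Lnorm \<mu> r (\<lambda>x. rep (s (\<sigma> j)) x - \<phi> (\<sigma> j) x) < e / 3" if "j \<ge> M" for j
    proof -
      have "M \<le> \<sigma> j" using that seq_suble[OF \<sigma>(1), of j] by linarith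
      then have "inverse (real (Suc (\<sigma> j))) \<le> inverse (real (Suc M))" by (intro le_imp_inverse_le) simp_all
      then show ?thesis using \<phi>(2)[of "\<sigma> j"] M by linarith
    qed
    have "Lnorm \<mu> r (rep (s (\<sigma> j) - s (\<sigma> k))) < e" if jk: "j \<ge> max M N" "k \<ge> max M N" for j k
    proof -
      define a where "a i = (\<lambda>x. rep (s (\<sigma> i)) x - \<phi> (\<sigma> i) x)" for i
      define b where "b = (\<lambda>x. \<phi> (\<sigma> j) x - \<phi> (\<sigma> k) x)"
      have a: "a i \<in> Lp \<mu> r" for i unfolding a_def by (rule Lp_diff[OF r0 S(3) T(1)])
      have b: "b \<in> Lp \<mu> r" unfolding b_def by (rule Lp_diff[OF r0 T(1) T(1)])
      have t: "b \<in> test_functions \<Omega>"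
        using test_functions_add[OF \<phi>(1) test_functions_scale[OF \<phi>(1), of "-1"], of "\<sigma> j" "\<sigma> k"] by (simp add: b_def)
      have "Lnorm \<mu> r b < e / 3" using N[of j k] jk test_function_Lp(3)[OF t r0] by (simp add: b_def)
      have "Lnorm \<mu> r (rep (s (\<sigma> j) - s (\<sigma> k))) = Lnorm \<mu> r (\<lambda>x. (a j x - a k x) + b x)"
        using Rp.n_diff_eq[OF s s, of "\<sigma> j" "\<sigma> k"] by (simp add: Rp.n_def a_def b_def)
      also have "\<dots> \<le> Lnorm \<mu> r (\<lambda>x. a j x - a k x) + Lnorm \<mu> r b" by (rule Lp_minkowski[OF r Lp_diff[OF r0 a a] b])
      also have "\<dots> \<le> Lnorm \<mu> r (a j) + Lnorm \<mu> r (a k) + Lnorm \<mu> r b" using Lp_minkowski_diff[OF r a a, of j k] by simp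
      also have "\<dots> < e"
        using close[of j] close[of k] \<open>Lnorm \<mu> r b < e / 3\<close> jk unfolding a_def by simp
      finally show ?thesis .
    qed
    then show ?thesis by blast
  qed
  with \<sigma>(1) show ?thesis by blast
qed

lemma sobolev_like_W0:
  assumes "1 < q" "q < p"
  shows "sobolev_like \<mu> (W0 \<Omega> p) grad rep p q"
proof -
  have p: "p > 1" "p > 0" using assms by simp_all
  interpret G: linear_Lp \<mu> "W0 \<Omega> p" grad p by (rule linear_grad[OF p(1)])
  interpret R: linear_Lp \<mu> "W0 \<Omega> p" rep p by (rule linear_rep[OF p(1)])
  show ?thesis
  proof (rule sobolev_like.intro[OF linear_grad[OF p(1)] linear_rep[OF p(1)]], rule sobolev_like_axioms.intro)
    show "finite_measure \<mu>" by (rule finite_mu)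
    show "\<exists>C. \<forall>u\<in>W0 \<Omega> p. R.n u \<le> C * G.n u" using poincare_W0[OF p(1)] unfolding G.n_def R.n_def by blast
    show "G.n (- u) = G.n u" for u unfolding G.n_def by (rule norm_grad_minus)
    show "u = 0" if "u \<in> W0 \<Omega> p" "R.n u = 0" for u
      by (rule definite_rep[OF p(2) that(1) that(2)[unfolded R.n_def]])
    show "\<exists>w\<in>W0 \<Omega> p. (\<lambda>k. G.n (s k - w)) \<longlonglongrightarrow> 0"
      if "\<And>k::nat. s k \<in> W0 \<Omega> p" "\<And>e. e > 0 \<Longrightarrow> \<exists>N. \<forall>j\<ge>N. \<forall>k\<ge>N. G.n (s j - s k) < e" for s
      unfolding G.n_def by (rule W0_complete[OF p(1) that(1) that(2)[unfolded G.n_def]])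
    show "\<exists>\<sigma> :: nat \<Rightarrow> nat. strict_mono \<sigma> \<and> (\<forall>e>0. \<exists>N. \<forall>j\<ge>N. \<forall>k\<ge>N. R.n (s (\<sigma> j) - s (\<sigma> k)) < e)"
      if "\<And>k::nat. s k \<in> W0 \<Omega> p" "\<And>k. G.n (s k) \<le> B" for s B
      unfolding R.n_def by (rule W0_rellich[OF p(1) that(1) that(2)[unfolded G.n_def]])
  qed (use assms in simp_all)
qed

end

section \<open>Multiplicity of critical points\<close>

text \<open>It remains to translate: \<open>\<alpha> > \<lambda>\<^sub>l(p)\<close> yields a set \<open>B\<close> of genus at least \<open>l\<close> on which \<open>H\<close> is negative, \<open>\<beta> < \<beta>\<^sub>*(\<alpha>)\<close> yields \<open>gap\<close>, and
\<open>many_critical_points\<close> applies to \<open>B\<close>.\<close>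

theorem theorem1p7:
  fixes \<Omega> :: "'a::euclidean_space set" and p q \<alpha> \<beta> :: real and l :: nat
  assumes "1 < q" and "q < p"
    and "open \<Omega>" and "connected \<Omega>" and "bounded \<Omega>" and "\<Omega> \<noteq> {}"
    and "DIM('a) \<ge> 2 \<Longrightarrow> \<exists>\<kappa>\<in>{0<..<1}. C1_regular \<kappa> \<Omega>"
    and "1 \<le> l"
    and "eigenvalue_k \<Omega> l p < ereal \<alpha>"
    and "ereal \<beta> < beta_star \<Omega> p q \<alpha>"
  shows "\<exists>P \<subseteq> (\<lambda>u. {u, - u}) `
             {u. critical_point \<Omega> p (E_fun \<Omega> p q \<alpha> \<beta>) u \<and> u \<noteq> 0 \<and> E_fun \<Omega> p q \<alpha> \<beta> u > 0}.
           finite P \<and> card P = l"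
proof -
  have p: "p > 1" using assms(1,2) by simp
  interpret bounded_domain \<Omega> using assms(3,5) by unfold_locales
  interpret S: sobolev_like \<mu> "W0 \<Omega> p" grad rep p q by (rule sobolev_like_W0[OF assms(1,2)])
  have ng: "norm_grad \<Omega> p u = S.Dp.n u" "norm_grad \<Omega> q u = S.Dq.n u" for u
    by (simp_all only: norm_grad_eq S.Dp.n_def S.Dq.n_def)
  have nl: "norm_L \<Omega> p u = S.Up.n u" "norm_L \<Omega> q u = S.Uq.n u" for u
    by (simp_all only: norm_L_eq S.Up.n_def S.Uq.n_def)
  have Hf: "H_fun \<Omega> p \<alpha> u = S.Dp.I u - \<alpha> * S.Up.I u" for u
    unfolding H_fun_def ng nl S.Dp.n_powr S.Up.n_powr ..
  have Gf: "G_fun \<Omega> q \<beta> u = S.Dq.I u - \<beta> * S.Uq.I u" for u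
    unfolding G_fun_def ng nl S.Dq.n_powr S.Uq.n_powr ..
  have Up_pos: "S.Up.I u > 0" if "u \<in> W0 \<Omega> p - {0}" for u
  proof -
    have "S.Up.n u \<noteq> 0" using S.definite[of u] that by blast
    then have "S.Up.n u powr p \<noteq> 0" by simp
    then show ?thesis unfolding S.Up.n_powr using S.Up.I_nonneg[of u] by linarith
  qed
  have Uq_pos: "S.Uq.I u > 0" if u: "u \<in> W0 \<Omega> p - {0}" for u
  proof -
    have "\<not> (AE x in \<mu>. rep u x = 0)"
    proof
      assume "AE x in \<mu>. rep u x = 0"
      then have "S.Up.I u = 0" unfolding S.Up.I_def using Lint_eq_0_iff[OF S.Up.Lp] u by blast
      then show False using Up_pos[OF u] by simp
    qed
    then have "S.Uq.I u \<noteq> 0" unfolding S.Uq.I_def using Lint_eq_0_iff[OF S.Uq.Lp] u by blast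
    then show ?thesis using S.Uq.I_nonneg[of u] by linarith
  qed
  define ray where "ray u = ereal (norm_grad \<Omega> p u powr p / norm_L \<Omega> p u powr p)" for u
  obtain B where B: "B \<in> Sigma_k \<Omega> l p" "(SUP u\<in>B. ray u) < ereal \<alpha>"
    using assms(9) unfolding eigenvalue_k_def INF_less_iff ray_def by blast
  have BW: "u \<in> W0 \<Omega> p - {0}" if "u \<in> B" for u using B(1) that unfolding Sigma_k_def by blast
  have ray: "S.Dp.I u < \<alpha> * S.Up.I u" if u: "u \<in> B" for u
  proof -
    have "ray u < ereal \<alpha>" using B(2) SUP_upper[OF u, of ray] by (rule le_less_trans[rotated])
    then have "S.Dp.I u / S.Up.I u < \<alpha>" unfolding ray_def ng nl S.Dp.n_powr S.Up.n_powr by simp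
    then show ?thesis using Up_pos[OF BW[OF u]] by (simp add: pos_divide_less_eq)
  qed
  have gB: "enat l \<le> genus (W0_topology \<Omega> p) B" using B(1) unfolding Sigma_k_def by blast
  have "B \<noteq> {}"
  proof
    assume "B = {}"
    then have "enat l \<le> 0" using gB unfolding genus_def by simp
    then show False using assms(8) by (simp add: zero_enat_def)
  qed
  then obtain b where b: "b \<in> B" by blast
  \<comment> \<open>\<open>B\<close> is nonempty since the empty set has genus \<open>0 < l\<close>; an element of it has \<open>0 \<le> S.Dp.I b < \<alpha> * S.Up.I b\<close>.\<close>
  have \<alpha>: "\<alpha> > 0"
  proof -
    have "0 < \<alpha> * S.Up.I b" using ray[OF b] S.Dp.I_nonneg[of b] by linarith
    then show ?thesis using Up_pos[OF BW[OF b]] by (simp add: zero_less_mult_iff)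
  qed
  have "Sigma_k \<Omega> l p \<subseteq> Sigma_k \<Omega> 1 p"
  proof
    fix A assume A: "A \<in> Sigma_k \<Omega> l p"
    have "enat 1 \<le> enat l" using assms(8) by simp
    then show "A \<in> Sigma_k \<Omega> 1 p" using A unfolding Sigma_k_def by (blast intro: order_trans)
  qed
  then have "eigenvalue_k \<Omega> 1 p \<le> eigenvalue_k \<Omega> l p"
    unfolding eigenvalue_k_def by (intro INF_superset_mono) simp_all
  then have "eigenvalue_k \<Omega> 1 p \<le> ereal \<alpha>" using assms(9) by (meson less_imp_le order_trans)
  \<comment> \<open>Hence \<open>\<beta>\<^sub>*(\<alpha>)\<close> is given by the infimum and not by the default value \<open>\<infinity>\<close>.\<close>
  then have "ereal \<beta> < (INF u\<in>{u \<in> W0 \<Omega> p - {0}. H_fun \<Omega> p \<alpha> u \<le> 0}. ereal (norm_grad \<Omega> q u powr q / norm_L \<Omega> q u powr q))"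
    using assms(10) unfolding beta_star_def by simp
  then obtain \<gamma> where \<gamma>: "ereal \<beta> < \<gamma>"
    "\<gamma> < (INF u\<in>{u \<in> W0 \<Omega> p - {0}. H_fun \<Omega> p \<alpha> u \<le> 0}. ereal (norm_grad \<Omega> q u powr q / norm_L \<Omega> q u powr q))"
    using dense by blast
  have q\<gamma>: "\<gamma> < ereal (S.Dq.I u / S.Uq.I u)" if "u \<in> W0 \<Omega> p - {0}" "S.Dp.I u \<le> \<alpha> * S.Up.I u" for u
  proof -
    have "(INF u\<in>{u \<in> W0 \<Omega> p - {0}. H_fun \<Omega> p \<alpha> u \<le> 0}. ereal (norm_grad \<Omega> q u powr q / norm_L \<Omega> q u powr q))
        \<le> ereal (norm_grad \<Omega> q u powr q / norm_L \<Omega> q u powr q)"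
      by (rule INF_lower) (use that in \<open>simp add: Hf\<close>)
    with \<gamma>(2) show ?thesis unfolding ng nl S.Dq.n_powr S.Uq.n_powr by (rule less_le_trans)
  qed
  \<comment> \<open>The infimum is over a nonempty set because it contains \<open>B\<close>, so the intermediate value \<open>\<gamma>\<close> is a real number.\<close>
  obtain g where g: "\<gamma> = ereal g"
    using \<gamma>(1) q\<gamma>[OF BW[OF b] less_imp_le[OF ray[OF b]]] by (cases \<gamma>) auto
  interpret T: two_parameter_problem \<mu> "W0 \<Omega> p" grad rep p q \<alpha> \<beta>
  proof
    show "\<alpha> > 0" by (rule \<alpha>)
    have "(g - \<beta>) * S.Uq.I u \<le> S.Dq.I u - \<beta> * S.Uq.I u" if u: "u \<in> W0 \<Omega> p" "S.Dp.I u \<le> \<alpha> * S.Up.I u" for u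
    proof (cases "u = 0")
      case True
      then show ?thesis by simp
    next
      case False
      then have u0: "u \<in> W0 \<Omega> p - {0}" using u(1) by blast
      have "g < S.Dq.I u / S.Uq.I u" using q\<gamma>[OF u0 u(2)] unfolding g by simp
      then have "g * S.Uq.I u < S.Dq.I u" using Uq_pos[OF u0] by (simp add: pos_less_divide_eq)
      then show ?thesis by (simp add: left_diff_distrib)
    qed
    then show "\<exists>g>0. \<forall>u\<in>W0 \<Omega> p. S.Dp.I u \<le> \<alpha> * S.Up.I u \<longrightarrow> g * S.Uq.I u \<le> S.Dq.I u - \<beta> * S.Uq.I u"
      using \<gamma>(1) unfolding g by (intro exI[of _ "g - \<beta>"]) simp
  qed
  have top: "W0_topology \<Omega> p = Metric_space.mtopology (W0 \<Omega> p) T.dW"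
    unfolding W0_topology_def ng T.dW_def[abs_def] ..
  have E: "E_fun \<Omega> p q \<alpha> \<beta> = T.E"
    by (rule ext) (simp only: E_fun_def T.E_def Hf Gf T.H_def T.G_def)
  have crit: "critical_point \<Omega> p T.E u \<longleftrightarrow> T.critical u" for u
    unfolding critical_point_def T.critical_def ng ..
  show ?thesis
    unfolding E crit
  proof (rule T.many_critical_points)
    show "compactin (Metric_space.mtopology (W0 \<Omega> p) T.dW) B" using B(1) unfolding Sigma_k_def top by blast
    show "- u \<in> B" if "u \<in> B" for u using B(1) that unfolding Sigma_k_def by blast
    show "T.H u < 0" if "u \<in> B" for u using ray[OF that] by (simp add: T.H_def)
    show "enat l \<le> genus (Metric_space.mtopology (W0 \<Omega> p) T.dW) B" using gB unfolding top .
  qed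
qed

end
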